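(* Let $G(\lambda)$ be skew-symmetric and let $\mathcal S(\lambda)=\left[\begin{array}{c|c}P(\lambda)&-B^T\\ \hline B&\lambda E-A\end{array}\right]$ be the system matrix of a minimal skew-symmetric realization $G(\lambda)=P(\lambda)+B^T(\lambda E-A)^{-1}B$. Let $0\le h\le m-1$ be even; $\mathbf w$ the simple admissible tuple of $\{0:h\}$ with symmetric complement $\mathbf c_w$; $\mathbf z+m$ any admissible tuple of $\{0:m-h-1\}$ with symmetric complement $\mathbf c_z+m$; and let $\mathbf t_w$, with indices from $\{0:h-1\}$, and $\mathbf t_z+m$, with indices from $\{0:m-h-2\}$, be right index tuples of type-1 relative to $\mathrm{rev}(\mathbf w)$ and $\mathrm{rev}(\mathbf z+m)$, respectively. Consider the GFPR $$\mathbb L(\lambda)=\mathbb M^P_{\mathrm{rev}(\mathbf t_z)}\mathbb M^P_{\mathrm{rev}(\mathbf t_w)}(\lambda\mathbb M^{\mathcal S}_{\mathbf z}-\mathbb M^{\mathcal S}_{\mathbf w})\mathbb M^P_{\mathbf c_w}\mathbb M^P_{\mathbf t_w}\mathbb M^P_{\mathbf c_z}\mathbb M^P_{\mathbf t_z}$$ associated with $\mathcal S(\lambda)$, and $L(\lambda)=M^P_{\mathrm{rev}(\mathbf t_z)}M^P_{\mathrm{rev}(\mathbf t_w)}(\lambda M^P_{\mathbf z}-M^P_{\mathbf w})M^P_{\mathbf c_w}M^P_{\mathbf t_w}M^P_{\mathbf c_z}M^P_{\mathbf t_z}$. Set $\alpha=c_0(\mathbf w,\mathbf c_w,\mathbf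 t_w)$. Then there exists a unique quasi-identity matrix $\mathbb Q=\mathrm{diag}(\mathbf s\,Q,I_r)$ such that $$\mathbb Q\mathbb L(\lambda)=\left[\begin{array}{c|c}\mathbf s\,QL(\lambda)&-e_{m-\alpha}\otimes B^T\\ \hline e^T_{m-\alpha}\otimes B&\lambda E-A\end{array}\right]$$ is skew-symmetric, where $Q$ is the (unique up to multiplication by $-1$) quasi-identity matrix such that $QL(\lambda)$ is skew-symmetric, and $\mathbf s$ is the $(m-\alpha)$-th parameter of $Q$. Assume that $\mathrm{Ind}(\mathbf z+m)=0$ when the leading coefficient $A_m$ of $P(\lambda)$ is singular. Further, suppose that $0\notin\mathbf t_w$ (resp. $-m\notin\mathbf t_z$) when $A_0$ (resp. $A_m$) is singular. Then $\mathbb Q\mathbb L(\lambda)$ is a skew-symmetric Rosenbrock strong linearization of $G(\lambda)$. The transfer function $\mathbb G(\lambda)=\mathbf s\,QL(\lambda)+(e_{m-\alpha}\otimes B^T)(\lambda E-A)^{-1}(e^T_{m-\alpha}\otimes B)$ of $\mathbb Q\mathbb L(\lambda)$ is skew-symmetric.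
   Context: Setting: a rational matrix or pencil $F(\lambda)$ is skew-symmetric if $F(\lambda)^T=-F(\lambda)$. $P(\lambda)=\sum_{i=0}^m\lambda^iA_i$, $A_i\in\mathbb C^{n\times n}$, $A_m\ne0$, $m\ge1$. A skew-symmetric realization $G(\lambda)=P(\lambda)+B^T(\lambda E-A)^{-1}B$ has $P(\lambda)$ and $\lambda E-A$ skew-symmetric, $A,E\in\mathbb C^{r\times r}$, $E$ nonsingular, $B\in\mathbb C^{r\times n}$; minimal means $r$ is smallest possible among all realizations of $G$. $e_j$ is the $j$-th column of $I_m$. Fiedler matrices: $M_0^P=\mathrm{diag}(I_{(m-1)n},-A_0)$, $M_{-m}^P=\mathrm{diag}(A_m,I_{(m-1)n})$, and for $1\le i\le m-1$, $M_i^P=\mathrm{diag}\big(I_{(m-i-1)n},\begin{bmatrix}-A_i&I_n\\ I_n&0\end{bmatrix},I_{(i-1)n}\big)$, $M_{-i}^P=(M_i^P)^{-1}=\mathrm{diag}\big(I_{(m-i-1)n},\begin{bmatrix}0&I_n\\ I_n&A_i\end{bmatrix},I_{(i-1)n}\big)$; $\mathbb M_i^P=\mathrm{diag}(M_i^P,I_r)$ for $-m\le i\le m-1$. The Fiedler matrices associated with this $\mathcal S(\lambda)$ are $\mathbb M_0^{\mathcal S}=\left[\begin{array}{c|c}M_0^P&e_m\otimes B^T\\ \hline -e_m^T\otimes B&A\end{array}\right]$, $\mathbb M_{-m}^{\mathcal S}=\mathrm{diag}(M_{-m}^P,E)$, $\mathbb M_{\pm i}^{\mathcal S}=\mathrm{diag}(M_{\pm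 i}^P,I_r)$ for $1\le i\le m-1$. For a tuple $\mathbf t=(t_1,\dots,t_k)$, $M^P_{\mathbf t},\mathbb M^P_{\mathbf t},\mathbb M^{\mathcal S}_{\mathbf t}$ are the ordered products (empty product $=$ identity). Tuples: $(a:b)=(a,a+1,\dots,b)$ if $a\le b$, empty otherwise; tuples separated by commas are concatenated; $\mathbf t+k$ adds $k$ to each entry; $\mathrm{rev}$ reverses. $c_0(\beta)$ is the largest $p\ge0$ such that $(0,1,\dots,p)$ is a subtuple of $\beta$ (obtained by deleting entries). An admissible tuple of $\{0:k\}$ with index $p=\mathrm{Ind}(\mathbf w)$, $0\le p\le k$, $k-p$ even, is $\mathbf w=(k-1:k,\,k-3:k-2,\dots,p+1:p+2,\,0:p)$; it is simple if $p\in\{0,1\}$ ($p=0$ for $k$ even). Its symmetric complement is $\mathbf c_w=(k-1,k-3,\dots,p+3,p+1,(0:p)_{rev_c})$ if $p\ge1$, where $(0:p)_{rev_c}=(0:p-1,0:p-2,\dots,0:1,0)$; $\mathbf c_w=(k-1,k-3,\dots,1)$ if $p=0,k>0$; $\mathbf c_w=\emptyset$ if $k=0$. Right index tuples of type-1: each permutation $\beta$ of $\{0:k\}$ can be brought, by interchanging adjacent indices that differ by more than $1$, to a unique column standard form $\mathrm{csf}(\beta)=(\mathbf b_d,\mathbf b_{d-1},\dots,\mathbf b_1)$ with strings $\mathbf b_i=(a_{i-1}+1:a_i)$, $-1=a_0<a_1<\dots<a_d=k$. An index $s\in\{0:k-1\}$ is a right index of type-1 relative to $\beta$ if some string of $\mathrm{csf}(\beta)$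 is $(s:t)$ with $s<t$. In that case define $z_r(\beta,s)$: if $s=a_{g-1}+1\ne0$, replace in $\mathrm{csf}(\beta)$ the strings $\mathbf b_g,\mathbf b_{g-1}$ by $(a_{g-1}+2:a_g)$, $(a_{g-2}+1:a_{g-1}+1)$; if $s=0$, replace $\mathbf b_1$ by the two strings $(1:a_1),(0)$. A tuple $(s_1,\dots,s_q)$ with indices from $\{0:k-1\}$ (possibly empty) is a right index tuple of type-1 relative to $\beta$ if for each $i$, $s_i$ is a right index of type-1 relative to $z_r(\beta,(s_1,\dots,s_{i-1}))$, where $z_r(\beta,\emptyset)=\beta$ and $z_r(\beta,(s_1,\dots,s_{i-1}))=z_r(z_r(\beta,(s_1,\dots,s_{i-2})),s_{i-1})$. Quasi-identity: $Q\in\mathbb C^{mn\times mn}$ is a quasi-identity matrix if $Q=\epsilon_1I_n\oplus\cdots\oplus\epsilon_mI_n$ with $\epsilon_i\in\{\pm1\}$; $\epsilon_j$ is its $j$-th parameter. It is a known result that, for $P$ skew-symmetric and tuples as in the claim, there is, up to multiplication by $-1$, a unique quasi-identity $Q$ such that $QL(\lambda)$ is skew-symmetric. A matrix polynomial is unimodular if its determinant is a nonzero constant; a square rational matrix is biproper if its limit at $\infty$ exists and is nonsingular. Rosenbrock strong linearization of $G(\lambda)$: an $(mn+r)\times(mn+r)$ pencil $\mathbb T(\lambda)=\left[\begin{array}{c|c}\mathcal X-\lambda\mathcal Y&\mathcal C\\ \hline\mathcal B&H-\lambda K\end{array}\right]$ with $K\in\mathbb C^{r\times r}$ nonsingular,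 irreducible ($[\mathcal B\ \ H-\lambda K]$ and $\begin{bmatrix}\mathcal C\\ H-\lambda K\end{bmatrix}$ have rank $r$ for all $\lambda\in\mathbb C$), such that (i) $\mathrm{diag}(U(\lambda),U_0)\,\mathbb T(\lambda)\,\mathrm{diag}(V(\lambda),V_0)=\mathrm{diag}(I_{(m-1)n},\mathcal S(\lambda))$ for some $mn\times mn$ unimodular $U,V$ and nonsingular $U_0,V_0\in\mathbb C^{r\times r}$; (ii) $\mathcal O_\ell(\lambda)\lambda^{-1}\mathbb G(\lambda)\mathcal O_r(\lambda)=\mathrm{diag}(I_{(m-1)n},\lambda^{-m}G(\lambda))$ for some $mn\times mn$ biproper $\mathcal O_\ell,\mathcal O_r$, where $\mathbb G(\lambda)=\mathcal X-\lambda\mathcal Y+\mathcal C(\lambda K-H)^{-1}\mathcal B$ is the transfer function.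
   Formalization: Uniqueness of Q up to sign, hence of 𝐐, is proved unless A_0 = 0 and 0 ∈ t_w, where it can fail (e.g. m=3, h=2, t_w=(0), z=(−3)); in that case 𝐐 is shown unique provided Q is unique up to sign. All other claims are unrestricted. *)

theory Defs
  imports
    Complex_Main
    "HOL-Library.Sublist"
    "HOL-Computational_Algebra.Polynomial_Factorial"
    "Jordan_Normal_Form.Determinant"
    "Jordan_Normal_Form.DL_Rank"
begin

section \<open>Matrices over constants, polynomials and rational functions\<close>

text \<open>Matrix polynomials have type \<^typ>\<open>complex poly mat\<close>, rational matrices have type
  \<^typ>\<open>complex poly fract mat\<close>.\<close>

abbreviation lam :: "complex poly"
  where "lam \<equiv> [:0, 1:]"

definition pm :: "complex mat \<Rightarrow> complex poly mat"
  where "pm M = map_mat (\<lambda>c. [:c:]) M"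

definition rm :: "complex poly mat \<Rightarrow> complex poly fract mat"
  where "rm M = map_mat to_fract M"

definition skew_symmetric :: "'a :: uminus mat \<Rightarrow> bool"
  where "skew_symmetric M \<longleftrightarrow> transpose_mat M = - M"

definition nonsingular :: "'a :: comm_ring_1 mat \<Rightarrow> bool"
  where "nonsingular M \<longleftrightarrow> det M \<noteq> 0"

definition minv :: "'a :: field mat \<Rightarrow> 'a mat"
  where "minv M = the (mat_inverse M)"

definition kronecker :: "'a :: times mat \<Rightarrow> 'a mat \<Rightarrow> 'a mat"  (infixl \<open>\<otimes>\<^sub>K\<close> 70)
  where "X \<otimes>\<^sub>K Y = mat (dim_row X * dim_row Y) (dim_col X * dim_col Y)
    (\<lambda>(i, j). X $$ (i div dim_row Y, j div dim_col Y) * Y $$ (i mod dim_row Y, j mod dim_col Y))"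

text \<open>The \<open>j\<close>-th column of the identity of size \<open>m\<close>, counted from \<open>j = 1\<close>.\<close>

definition ecol :: "nat \<Rightarrow> nat \<Rightarrow> 'a :: zero_neq_one mat"
  where "ecol m j = mat_of_cols m [unit_vec m (j - 1)]"

definition matrix_polynomial :: "nat \<Rightarrow> nat \<Rightarrow> (nat \<Rightarrow> complex mat) \<Rightarrow> complex poly mat"
  where "matrix_polynomial n m A = mat n n (\<lambda>(a, b). \<Sum>i\<le>m. monom (A i $$ (a, b)) i)"

section \<open>Realizations and transfer functions\<close>

text \<open>\<open>G = P + C (\<lambda>E - A)\<^sup>-\<^sup>1 B\<close> with state space dimension \<open>r\<close>.\<close>

definition is_realization ::
  "nat \<Rightarrow> nat \<Rightarrow> complex poly mat \<Rightarrow> complex mat \<Rightarrow> complex mat \<Rightarrow> complex mat \<Rightarrow> complex mat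
    \<Rightarrow> complex poly fract mat \<Rightarrow> bool"
  where "is_realization n r P A E B C G \<longleftrightarrow>
    P \<in> carrier_mat n n \<and> A \<in> carrier_mat r r \<and> E \<in> carrier_mat r r \<and> nonsingular E \<and>
    B \<in> carrier_mat r n \<and> C \<in> carrier_mat n r \<and>
    G = rm P + rm (pm C) * minv (rm (lam \<cdot>\<^sub>m pm E - pm A)) * rm (pm B)"

definition skew_realization ::
  "nat \<Rightarrow> nat \<Rightarrow> complex poly mat \<Rightarrow> complex mat \<Rightarrow> complex mat \<Rightarrow> complex mat
    \<Rightarrow> complex poly fract mat \<Rightarrow> bool"
  where "skew_realization n r P A E B G \<longleftrightarrow>
    is_realization n r P A E B (transpose_mat B) G \<and>
    skew_symmetric P \<and> skew_symmetric (lam \<cdot>\<^sub>m pm E - pm A)"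

text \<open>Minimality is over all realizations of \<open>G\<close>, not just the skew-symmetric ones.\<close>

definition minimal_skew_realization ::
  "nat \<Rightarrow> nat \<Rightarrow> complex poly mat \<Rightarrow> complex mat \<Rightarrow> complex mat \<Rightarrow> complex mat
    \<Rightarrow> complex poly fract mat \<Rightarrow> bool"
  where "minimal_skew_realization n r P A E B G \<longleftrightarrow>
    skew_realization n r P A E B G \<and>
    (\<forall>r' P' A' E' B' C'. is_realization n r' P' A' E' B' C' G \<longrightarrow> r \<le> r')"

definition system_matrix ::
  "complex poly mat \<Rightarrow> complex mat \<Rightarrow> complex mat \<Rightarrow> complex mat \<Rightarrow> complex poly mat"
  where "system_matrix P A E B =
    four_block_mat P (- pm (transpose_mat B)) (pm B) (lam \<cdot>\<^sub>m pm E - pm A)"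

text \<open>Transfer function \<open>T11 + T12 (-T22)\<^sup>-\<^sup>1 T21\<close> of a polynomial matrix partitioned after row and
  column \<open>k\<close>. For \<open>T12 = C\<close>, \<open>T21 = B\<close>, \<open>T22 = H - \<lambda>K\<close> this is \<open>T11 + C (\<lambda>K - H)\<^sup>-\<^sup>1 B\<close>.\<close>

definition transfer_function :: "nat \<Rightarrow> complex poly mat \<Rightarrow> complex poly fract mat"
  where "transfer_function k T =
    (case split_block T k k of (T11, T12, T21, T22) \<Rightarrow> rm T11 + rm T12 * minv (rm (- T22)) * rm T21)"

section \<open>Rosenbrock strong linearizations\<close>

definition unimodular :: "complex poly mat \<Rightarrow> bool"
  where "unimodular U \<longleftrightarrow> square_mat U \<and> (\<exists>c. c \<noteq> 0 \<and> det U = [:c:])"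

definition rat_tendsto_at_infinity :: "complex poly fract \<Rightarrow> complex \<Rightarrow> bool"
  where "rat_tendsto_at_infinity f l \<longleftrightarrow>
    (\<exists>p q. q \<noteq> 0 \<and> f = Fraction_Field.Fract p q \<and> ((\<lambda>x. poly p x / poly q x) \<longlongrightarrow> l) at_infinity)"

definition biproper :: "complex poly fract mat \<Rightarrow> bool"
  where "biproper R \<longleftrightarrow> square_mat R \<and>
    (\<exists>N \<in> carrier_mat (dim_row R) (dim_row R). nonsingular N \<and>
      (\<forall>i < dim_row R. \<forall>j < dim_row R. rat_tendsto_at_infinity (R $$ (i, j)) (N $$ (i, j))))"

text \<open>In \<^const>\<open>vec_space.rank\<close> the first argument is the number of rows of the matrix.\<close>

definition rosenbrock_strong_linearization ::
  "nat \<Rightarrow> nat \<Rightarrow> nat \<Rightarrow> complex poly mat \<Rightarrow> complex poly fract mat \<Rightarrow> complex poly mat \<Rightarrow> bool"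
  where "rosenbrock_strong_linearization n m r S G T \<longleftrightarrow>
    (\<exists>X \<in> carrier_mat (m * n) (m * n). \<exists>Y \<in> carrier_mat (m * n) (m * n).
     \<exists>C \<in> carrier_mat (m * n) r. \<exists>B \<in> carrier_mat r (m * n).
     \<exists>H \<in> carrier_mat r r. \<exists>K \<in> carrier_mat r r.
       T = four_block_mat (pm X - lam \<cdot>\<^sub>m pm Y) (pm C) (pm B) (pm H - lam \<cdot>\<^sub>m pm K) \<and>
       nonsingular K \<and>
       (\<forall>x. vec_space.rank r (four_block_mat B (H - x \<cdot>\<^sub>m K) (0\<^sub>m 0 (m * n)) (0\<^sub>m 0 r)) = r) \<and>
       (\<forall>x. vec_space.rank (m * n + r) (C @\<^sub>r (H - x \<cdot>\<^sub>m K)) = r) \<and>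
       (\<exists>U \<in> carrier_mat (m * n) (m * n). \<exists>V \<in> carrier_mat (m * n) (m * n).
        \<exists>U0 \<in> carrier_mat r r. \<exists>V0 \<in> carrier_mat r r.
          unimodular U \<and> unimodular V \<and> nonsingular U0 \<and> nonsingular V0 \<and>
          diag_block_mat [U, pm U0] * T * diag_block_mat [V, pm V0]
            = diag_block_mat [1\<^sub>m ((m - 1) * n), S]) \<and>
       (\<exists>Ol \<in> carrier_mat (m * n) (m * n). \<exists>Or \<in> carrier_mat (m * n) (m * n).
          biproper Ol \<and> biproper Or \<and>
          Ol * (inverse (to_fract lam) \<cdot>\<^sub>m transfer_function (m * n) T) * Or
            = diag_block_mat [1\<^sub>m ((m - 1) * n), (inverse (to_fract lam)) ^ m \<cdot>\<^sub>m G]))"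

section \<open>Index tuples\<close>

definition c0 :: "int list \<Rightarrow> nat"
  where "c0 \<beta> = (GREATEST p. subseq [0..int p] \<beta>)"

definition admissible_tuple :: "nat \<Rightarrow> nat \<Rightarrow> int list \<Rightarrow> bool"
  where "admissible_tuple k p w \<longleftrightarrow> p \<le> k \<and> even (k - p) \<and>
    w = concat (map (\<lambda>j. [int (k - 2 * j) - 1 .. int (k - 2 * j)]) [0..<(k - p) div 2]) @ [0..int p]"

definition simple_admissible_tuple :: "nat \<Rightarrow> nat \<Rightarrow> int list \<Rightarrow> bool"
  where "simple_admissible_tuple k p w \<longleftrightarrow> admissible_tuple k p w \<and> p \<in> {0, 1}"

text \<open>The symmetric complement of the admissible tuple of \<open>{0:k}\<close> with index \<open>p\<close>; the second
  part is \<open>(0:p-1, 0:p-2, \<dots>, 0:1, 0)\<close>, which is empty for \<open>p = 0\<close>.\<close>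

definition symmetric_complement :: "nat \<Rightarrow> nat \<Rightarrow> int list"
  where "symmetric_complement k p =
    map (\<lambda>j. int (k - 2 * j) - 1) [0..<(k - p) div 2] @
    concat (map (\<lambda>j. [0 .. int p - 1 - int j]) [0..<p])"

inductive commuting_swap :: "int list \<Rightarrow> int list \<Rightarrow> bool"
  where "\<bar>i - j\<bar> > 1 \<Longrightarrow> commuting_swap (xs @ [i, j] @ ys) (xs @ [j, i] @ ys)"

text \<open>A column standard form is kept as its list \<open>[b\<^sub>d, \<dots>, b\<^sub>1]\<close> of strings. Nonempty lists whose
  concatenation \<open>b\<^sub>1, \<dots>, b\<^sub>d\<close> is \<open>[0..k]\<close> are exactly the lists \<open>b\<^sub>i = [a\<^sub>i\<^sub>-\<^sub>1 + 1..a\<^sub>i]\<close> with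
  \<open>-1 = a\<^sub>0 < \<dots> < a\<^sub>d = k\<close>.\<close>

definition is_csf :: "nat \<Rightarrow> int list list \<Rightarrow> bool"
  where "is_csf k bs \<longleftrightarrow> [] \<notin> set bs \<and> concat (rev bs) = [0..int k]"

definition csf :: "nat \<Rightarrow> int list \<Rightarrow> int list list"
  where "csf k \<beta> = (THE bs. is_csf k bs \<and> commuting_swap\<^sup>*\<^sup>* \<beta> (concat bs))"

definition right_index_type1 :: "nat \<Rightarrow> int list \<Rightarrow> int \<Rightarrow> bool"
  where "right_index_type1 k \<beta> s \<longleftrightarrow> s \<in> {0..int k - 1} \<and> (\<exists>t. s < t \<and> [s..t] \<in> set (csf k \<beta>))"

text \<open>The string starting with \<open>s\<close> loses its first entry, which is appended to the string on its
  right; the last string (\<open>s = 0\<close>) has no right neighbour, and \<open>(0)\<close> becomes a new string.\<close>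

fun move_first :: "int \<Rightarrow> int list list \<Rightarrow> int list list"
  where
    "move_first s [] = []"
  | "move_first s [b] = (if hd b = s then [tl b, [s]] else [b])"
  | "move_first s (b # b' # bs) =
      (if hd b = s then tl b # (b' @ [s]) # bs else b # move_first s (b' # bs))"

definition z_r :: "nat \<Rightarrow> int list \<Rightarrow> int \<Rightarrow> int list"
  where "z_r k \<beta> s = concat (move_first s (csf k \<beta>))"

primrec right_index_tuple_type1 :: "nat \<Rightarrow> int list \<Rightarrow> int list \<Rightarrow> bool"
  where
    "right_index_tuple_type1 k \<beta> [] \<longleftrightarrow> True"
  | "right_index_tuple_type1 k \<beta> (s # ss) \<longleftrightarrow>
      right_index_type1 k \<beta> s \<and> right_index_tuple_type1 k (z_r k \<beta> s) ss"

section \<open>Fiedler matrices and GFPRs\<close>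

definition fiedler :: "nat \<Rightarrow> nat \<Rightarrow> (nat \<Rightarrow> complex mat) \<Rightarrow> int \<Rightarrow> complex mat"
  where "fiedler n m A i =
    (let j = nat \<bar>i\<bar> in
     if i = 0 then diag_block_mat [1\<^sub>m ((m - 1) * n), - A 0]
     else if i = - int m then diag_block_mat [A m, 1\<^sub>m ((m - 1) * n)]
     else if i > 0 then diag_block_mat
       [1\<^sub>m ((m - j - 1) * n), four_block_mat (- A j) (1\<^sub>m n) (1\<^sub>m n) (0\<^sub>m n n), 1\<^sub>m ((j - 1) * n)]
     else diag_block_mat
       [1\<^sub>m ((m - j - 1) * n), four_block_mat (0\<^sub>m n n) (1\<^sub>m n) (1\<^sub>m n) (A j), 1\<^sub>m ((j - 1) * n)])"

definition fiedler_ext :: "nat \<Rightarrow> nat \<Rightarrow> nat \<Rightarrow> (nat \<Rightarrow> complex mat) \<Rightarrow> int \<Rightarrow> complex mat"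
  where "fiedler_ext n m r A i = diag_block_mat [fiedler n m A i, 1\<^sub>m r]"

definition fiedler_sys ::
  "nat \<Rightarrow> nat \<Rightarrow> nat \<Rightarrow> (nat \<Rightarrow> complex mat) \<Rightarrow> complex mat \<Rightarrow> complex mat \<Rightarrow> complex mat
    \<Rightarrow> int \<Rightarrow> complex mat"
  where "fiedler_sys n m r A As E B i =
    (if i = 0 then four_block_mat (fiedler n m A 0) (ecol m m \<otimes>\<^sub>K transpose_mat B)
       (- (transpose_mat (ecol m m) \<otimes>\<^sub>K B)) As
     else if i = - int m then diag_block_mat [fiedler n m A i, E]
     else diag_block_mat [fiedler n m A i, 1\<^sub>m r])"

text \<open>Ordered product \<open>M\<^sub>t\<^sub>1 M\<^sub>t\<^sub>2 \<dots> M\<^sub>t\<^sub>k\<close> of matrices of size \<open>N\<close>.\<close>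

definition tuple_prod :: "nat \<Rightarrow> (int \<Rightarrow> complex mat) \<Rightarrow> int list \<Rightarrow> complex mat"
  where "tuple_prod N M t = foldr (\<lambda>i X. M i * X) t (1\<^sub>m N)"

definition gfpr ::
  "nat \<Rightarrow> (int \<Rightarrow> complex mat) \<Rightarrow> (int \<Rightarrow> complex mat) \<Rightarrow> int list \<Rightarrow> int list \<Rightarrow> int list \<Rightarrow> int list
    \<Rightarrow> int list \<Rightarrow> int list \<Rightarrow> complex poly mat"
  where "gfpr N M M' w z cw tw cz tz =
    pm (tuple_prod N M (rev tz)) * pm (tuple_prod N M (rev tw)) *
    (lam \<cdot>\<^sub>m pm (tuple_prod N M' z) - pm (tuple_prod N M' w)) *
    pm (tuple_prod N M cw) * pm (tuple_prod N M tw) *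
    pm (tuple_prod N M cz) * pm (tuple_prod N M tz)"

text \<open>\<open>Q\<close> is the quasi-identity matrix with parameters \<open>\<epsilon> 1, \<dots>, \<epsilon> m\<close>.\<close>

definition quasi_identity :: "nat \<Rightarrow> nat \<Rightarrow> (nat \<Rightarrow> complex) \<Rightarrow> complex mat \<Rightarrow> bool"
  where "quasi_identity n m \<epsilon> Q \<longleftrightarrow>
    (\<forall>j \<in> {1..m}. \<epsilon> j \<in> {1, -1}) \<and> Q = diag_block_mat (map (\<lambda>j. \<epsilon> j \<cdot>\<^sub>m 1\<^sub>m n) [1..<Suc m])"

end

theory Submission
  imports Defs
begin

text \<open>Block positions are counted from 0. Every Fiedler matrix is a generator \<open>gen n m p q C\<close>: the
  identity, except for the blocks \<open>C\<close>, \<open>I\<close>, \<open>I\<close>, \<open>0\<close> at \<open>(p, p)\<close>, \<open>(p, q)\<close>, \<open>(q, p)\<close>, \<open>(q, q)\<close>. The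
  matrices of nonnegative index and those of index \<open>-m, \<dots>, -1\<close> form two chains of such generators
  (locale \<open>chain\<close>), which run through the block positions in opposite directions. In \<open>L\<close> the two
  chains interfere only at one block position, so that both coefficients of the pencil factor into
  commuting products, one from each chain (\<open>L0_split\<close>, \<open>L1_split\<close>).

  Words. Up to exchanging letters that differ by more than 1, the tuple \<open>(w, c)\<close> of an admissible
  tuple with its symmetric complement is a palindrome around \<open>evw (Suc k)\<close>, a product of pairwise
  commuting generators, and the complement alone is a palindrome around \<open>evw k\<close>
  (\<open>adm_csym_weq\<close>, \<open>csym_weq\<close>). A column standard form is determined by the set of those \<open>i\<close> for which
  \<open>i\<close> and \<open>i + 1\<close> lie in the same string; these \<open>i\<close> are called marked. A right index of type 1 is a
  marked \<open>s\<close> with \<open>s - 1\<close> unmarked, and \<open>z_r\<close> moves its mark to \<open>s - 1\<close> (or removes it if \<open>s = 0\<close>). Hence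
  right index tuples of type 1 are sequences of legal moves of marks (\<open>right_tuple_adm_mv\<close>), and the
  tuple of index \<open>p\<close> is the simple one conjugated by the further legal moves \<open>exits p\<close>.

  Signs. If all coefficients are skew-symmetric, a palindrome \<open>X\<close> satisfies \<open>X\<^sup>T = D X D'\<close> where the
  diagonal sign matrix \<open>D\<close> is constant on marked and on unmarked positions, with opposite values,
  and \<open>D'\<close> is \<open>D\<close> with the sign changed on the positions of the letters. A legal move exchanges a
  marked and an unmarked position, so conjugation by it preserves this (\<open>palindrome_twisted\<close>).
  Together the two chains change the sign of every position, which gives \<open>(D L)\<^sup>T = - D L\<close>.
  Conversely two such \<open>D\<close> differ by a diagonal sign matrix that commutes with all four palindromes.
  Each marked position is joined to another one by a block \<open>I\<close>, or by the coefficient \<open>C 0\<close> after its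
  mark has been removed, and these links connect all positions (\<open>palindrome_links\<close>,
  \<open>links_connect\<close>), so the two \<open>D\<close> agree up to sign. The number \<open>c\<^sub>0\<close> is found by reading the tuple
  greedily; the same rule describes how a unit block column at an unmarked position travels through
  the word (\<open>track\<close>), and so the coupling blocks of the system pencil end up at \<open>m - \<alpha>\<close>.

  Linearization. With nonsingular constant outer factors removed, \<open>L\<close> becomes \<open>\<lambda>N - M\<^sub>0\<close>, where \<open>N\<close> is
  a product of all generators of negative index in some order. Block elimination reduces such a
  pencil to \<open>diag(I, P)\<close>, and it leaves the last block row and column alone, where the coupling
  blocks sit (\<open>fiedler_elimination\<close>). The elimination is carried out over a ring with a
  distinguished subring that contains all occurring entries: over the polynomials it gives
  unimodular transformations. Over the rational functions with the subring of proper ones, and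
  applied to the reversed pencil in \<open>1/\<lambda>\<close> in which the term \<open>B\<^sup>T(\<lambda>E - A)\<^sup>-\<^sup>1B\<close> has been added to
  \<open>A\<^sub>0\<close>, it gives the biproper transformations at infinity. Irreducibility is the Popov-Belevitch-Hautus
  argument: a left kernel vector would allow a realization of smaller dimension
  (\<open>realization_reducible\<close>).\<close>

section \<open>Block matrices\<close>

definition bcol :: "nat \<Rightarrow> nat \<Rightarrow> nat \<Rightarrow> 'a :: zero_neq_one mat"
  where "bcol n m a = mat (m * n) n (\<lambda>(i, j). if i = a * n + j then 1 else 0)"

text \<open>For \<open>p = q\<close> the first case wins, and \<open>gen n m p p C\<close> is the identity with \<open>C\<close> as diagonal block \<open>p\<close>.
  This covers the two Fiedler matrices of extreme index.\<close>

definition gen :: "nat \<Rightarrow> nat \<Rightarrow> nat \<Rightarrow> nat \<Rightarrow> 'a :: zero_neq_one mat \<Rightarrow> 'a mat"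
  where "gen n m p q C = mat (m * n) (m * n) (\<lambda>(i, j).
    let a = i div n; b = j div n; i' = i mod n; j' = j mod n in
    if a = p \<and> b = p then C $$ (i', j')
    else if a = p \<and> b = q \<or> a = q \<and> b = p then (if i' = j' then 1 else 0)
    else if a = q \<and> b = q then 0
    else if i = j then 1 else 0)"

definition sgnm :: "nat \<Rightarrow> nat \<Rightarrow> (nat \<Rightarrow> 'a :: zero) \<Rightarrow> 'a mat"
  where "sgnm n m d = mat (m * n) (m * n) (\<lambda>(i, j). if i = j then d (i div n) else 0)"

lemma bcol_carrier [simp, intro]: "bcol n m a \<in> carrier_mat (m * n) n"
  by (simp add: bcol_def)

lemma bcol_dim [simp]: "dim_row (bcol n m a) = m * n" "dim_col (bcol n m a) = n"
  by (simp_all add: bcol_def)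

lemma gen_carrier [simp, intro]: "gen n m p q C \<in> carrier_mat (m * n) (m * n)"
  by (simp add: gen_def)

lemma gen_dim [simp]: "dim_row (gen n m p q C) = m * n" "dim_col (gen n m p q C) = m * n"
  by (simp_all add: gen_def)

lemma sgnm_carrier [simp, intro]: "sgnm n m d \<in> carrier_mat (m * n) (m * n)"
  by (simp add: sgnm_def)

lemma sgnm_dim [simp]: "dim_row (sgnm n m d) = m * n" "dim_col (sgnm n m d) = m * n"
  by (simp_all add: sgnm_def)

lemma block_index_less: "a * n + j < m * n" if "a < m" "j < (n :: nat)"
proof -
  have "a * n + j < (a + 1) * n" using that by simp
  also have "\<dots> \<le> m * n" using that by (intro mult_le_mono1) simp
  finally show ?thesis .
qed

lemma block_index_div: "j < n \<Longrightarrow> (a * n + j) div n = (a :: nat)"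
  by (cases "n = 0") (simp_all add: div_mult_self3)

lemma block_index_mod: "j < n \<Longrightarrow> (a * n + j) mod n = (j :: nat)"
  by simp

lemma block_div_less: "i < m * n \<Longrightarrow> i div n < (m :: nat)"
  by (simp add: less_mult_imp_div_less)

lemma block_mod_less: "i < m * n \<Longrightarrow> i mod n < (n :: nat)"
  by (cases "n = 0") simp_all

lemma mult_bcol_index:
  fixes X :: "'a :: semiring_1 mat"
  assumes "X \<in> carrier_mat q (m * n)" "a < m" "i < q" "j < n"
  shows "(X * bcol n m a) $$ (i, j) = X $$ (i, a * n + j)"
proof -
  have "(X * bcol n m a) $$ (i, j) = (\<Sum>k = 0..<m * n. X $$ (i, k) * (if k = a * n + j then 1 else 0))"
    using assms by (auto simp: bcol_def scalar_prod_def intro!: sum.cong)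
  also have "\<dots> = (\<Sum>k\<in>{0..<m * n}. if k = a * n + j then X $$ (i, k) else 0)"
    by (intro sum.cong) auto
  also have "\<dots> = X $$ (i, a * n + j)"
    using block_index_less[OF assms(2,4)] by (simp add: sum.delta)
  finally show ?thesis .
qed

text \<open>All products of generators below are evaluated on block columns: \<open>bcol n m a\<close> is \<open>e\<^sub>a \<otimes> I\<close>, and a
  generator permutes these up to one additional term.\<close>

lemma blockcol_eqI:
  fixes X Y :: "'a :: semiring_1 mat"
  assumes X: "X \<in> carrier_mat q (m * n)" and Y: "Y \<in> carrier_mat q (m * n)"
    and eq: "\<And>a. a < m \<Longrightarrow> X * bcol n m a = Y * bcol n m a"
  shows "X = Y"
proof (rule eq_matI)
  fix i j assume ij: "i < dim_row Y" "j < dim_col Y"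
  hence i: "i < q" and j: "j < m * n" using Y by auto
  have a: "j div n < m" and b: "j mod n < n" using j block_div_less block_mod_less by auto
  have "X $$ (i, j) = (X * bcol n m (j div n)) $$ (i, j mod n)"
    using mult_bcol_index[OF X a i b] by simp
  also have "\<dots> = Y $$ (i, j)"
    using mult_bcol_index[OF Y a i b] eq[OF a] by simp
  finally show "X $$ (i, j) = Y $$ (i, j)" .
qed (use X Y in auto)

lemma bcol_index: "i < m * n \<Longrightarrow> j < n \<Longrightarrow> bcol n m a $$ (i, j) = (if i = a * n + j then 1 else 0)"
  by (simp add: bcol_def)

lemma eq_block_index_iff: "i = a * n + j \<longleftrightarrow> i div n = a \<and> i mod n = j" if "j < n" for i a n j :: nat
proof
  assume "i div n = a \<and> i mod n = j"
  thus "i = a * n + j" using div_mult_mod_eq[of i n] by metis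
qed (use that block_index_div block_index_mod in auto)

lemma bcol_mult_index:
  fixes C :: "'a :: semiring_1 mat"
  assumes "C \<in> carrier_mat n q" "i < m * n" "j < q"
  shows "(bcol n m a * C) $$ (i, j) = (if i div n = a then C $$ (i mod n, j) else 0)"
proof -
  have "(bcol n m a * C) $$ (i, j) = (\<Sum>k = 0..<n. (if i = a * n + k then 1 else 0) * C $$ (k, j))"
    using assms by (auto simp: bcol_def scalar_prod_def intro!: sum.cong)
  also have "\<dots> = (\<Sum>k\<in>{0..<n}. if k = i mod n then (if i div n = a then C $$ (k, j) else 0) else 0)"
    by (intro sum.cong) (auto simp: eq_block_index_iff)
  also have "\<dots> = (if i div n = a then C $$ (i mod n, j) else 0)"
    using block_mod_less[OF assms(2)] by (simp add: sum.delta)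
  finally show ?thesis .
qed

lemma bcol_transpose_mult_bcol:
  assumes "a < m" "b < m"
  shows "transpose_mat (bcol n m a) * bcol n m b = (if a = b then 1\<^sub>m n else 0\<^sub>m n n :: 'a :: semiring_1 mat)"
proof (rule eq_matI)
  fix i j assume "i < dim_row (if a = b then 1\<^sub>m n else 0\<^sub>m n n :: 'a mat)"
    "j < dim_col (if a = b then 1\<^sub>m n else 0\<^sub>m n n :: 'a mat)"
  hence ij: "i < n" "j < n" by (auto split: if_splits)
  have "(transpose_mat (bcol n m a) * bcol n m b) $$ (i, j) = transpose_mat (bcol n m a :: 'a mat) $$ (i, b * n + j)"
    using ij assms by (intro mult_bcol_index) auto
  also have "\<dots> = (if b * n + j = a * n + i then 1 else 0)"
    using ij assms block_index_less[of b m j n] by (simp add: bcol_index)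
  also have "\<dots> = (if a = b \<and> i = j then 1 else 0)"
    using ij block_index_div[of j n b] block_index_mod[of j n b] by (auto simp: eq_block_index_iff)
  finally show "(transpose_mat (bcol n m a) * bcol n m b) $$ (i, j) = (if a = b then 1\<^sub>m n else 0\<^sub>m n n :: 'a mat) $$ (i, j)"
    using ij by auto
qed auto

lemma gen_mult_bcol:
  fixes C :: "'a :: semiring_1 mat"
  assumes C: "C \<in> carrier_mat n n" and ab: "p < m" "q < m" "a < m"
  shows "gen n m p q C * bcol n m a =
    (if a = p then (if p = q then bcol n m p * C else bcol n m q + bcol n m p * C)
     else if a = q then bcol n m p else bcol n m a)"
proof (rule eq_matI)
  let ?R = "if a = p then (if p = q then bcol n m p * C else bcol n m q + bcol n m p * C)
     else if a = q then bcol n m p else bcol n m a"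
  have dims: "dim_row ?R = m * n" "dim_col ?R = n" using C by auto
  fix i j assume "i < dim_row ?R" "j < dim_col ?R"
  hence i: "i < m * n" and j: "j < n" using dims by auto
  have "(gen n m p q C * bcol n m a) $$ (i, j) = gen n m p q C $$ (i, a * n + j)"
    by (rule mult_bcol_index[OF _ ab(3) i j]) auto
  also have "\<dots> = ?R $$ (i, j)"
  proof -
    let ?k = "a * n + j"
    have k: "?k < m * n" "?k div n = a" "?k mod n = j"
      using block_index_less[OF ab(3) j] block_index_div[OF j] block_index_mod[OF j] by auto
    have i': "i mod n < n" using block_mod_less[OF i] .
    have E: "bcol n m b $$ (i, j) = (if i div n = b \<and> i mod n = j then 1 else 0 :: 'a)" for b
      by (simp add: bcol_index[OF i j] eq_block_index_iff[OF j])
    have eq: "i = ?k \<longleftrightarrow> i div n = a \<and> i mod n = j"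
      by (rule eq_block_index_iff[OF j])
    have lhs: "gen n m p q C $$ (i, ?k) = (if i div n = p \<and> a = p then C $$ (i mod n, j)
      else if i div n = p \<and> a = q \<or> i div n = q \<and> a = p then (if i mod n = j then 1 else 0)
      else if i div n = q \<and> a = q then 0 else if i div n = a \<and> i mod n = j then 1 else 0)"
      unfolding gen_def using i k by (simp only: index_mat split Let_def eq)
    show ?thesis
      unfolding lhs using i j C
      by (simp add: E bcol_mult_index[OF C i j])
  qed
  finally show "(gen n m p q C * bcol n m a) $$ (i, j) = ?R $$ (i, j)" .
qed (use C in auto)

lemma gen_index:
  assumes "i < m * n" "j < m * n"
  shows "gen n m p q C $$ (i, j) = (if i div n = p \<and> j div n = p then C $$ (i mod n, j mod n)
    else if i div n = p \<and> j div n = q \<or> i div n = q \<and> j div n = p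
      then (if i mod n = j mod n then 1 else 0)
    else if i div n = q \<and> j div n = q then 0 else if i = j then 1 else 0)"
  using assms unfolding gen_def by (simp only: index_mat split Let_def)

lemma gen_transpose:
  assumes "C \<in> carrier_mat n n"
  shows "transpose_mat (gen n m p q C) = gen n m p q (transpose_mat C)"
proof (rule eq_matI)
  fix i j assume "i < dim_row (gen n m p q (transpose_mat C))" "j < dim_col (gen n m p q (transpose_mat C))"
  hence ij: "i < m * n" "j < m * n" by auto
  hence *: "transpose_mat C $$ (i mod n, j mod n) = C $$ (j mod n, i mod n)"
    using assms block_mod_less[of _ m n] by auto
  have "transpose_mat (gen n m p q C) $$ (i, j) = gen n m p q C $$ (j, i)"
    using ij by simp
  thus "transpose_mat (gen n m p q C) $$ (i, j) = gen n m p q (transpose_mat C) $$ (i, j)"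
    unfolding gen_index[OF ij] gen_index[OF ij(2,1)] * by (simp only: conj_commute disj_commute eq_commute)
qed auto

lemma sgnm_mult_bcol:
  fixes d :: "nat \<Rightarrow> 'a :: semiring_1"
  assumes "a < m"
  shows "sgnm n m d * bcol n m a = d a \<cdot>\<^sub>m bcol n m a"
proof (rule eq_matI)
  fix i j assume "i < dim_row (d a \<cdot>\<^sub>m bcol n m a)" "j < dim_col (d a \<cdot>\<^sub>m bcol n m a)"
  hence i: "i < m * n" and j: "j < n" by auto
  have "(sgnm n m d * bcol n m a) $$ (i, j) = sgnm n m d $$ (i, a * n + j)"
    by (rule mult_bcol_index[OF _ assms i j]) auto
  also have "\<dots> = (if i = a * n + j then d a else 0)"
    using i block_index_less[OF assms j] block_index_div[OF j, of a] by (simp add: sgnm_def)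
  also have "\<dots> = (d a \<cdot>\<^sub>m bcol n m a) $$ (i, j)"
    using i j by (simp add: bcol_index)
  finally show "(sgnm n m d * bcol n m a) $$ (i, j) = (d a \<cdot>\<^sub>m bcol n m a) $$ (i, j)" .
qed auto

lemma sgnm_transpose [simp]: "transpose_mat (sgnm n m d) = sgnm n m d"
  by (intro eq_matI) (auto simp: sgnm_def)

lemma sgnm_mult_sgnm:
  fixes d :: "nat \<Rightarrow> 'a :: comm_semiring_1"
  shows "sgnm n m d * sgnm n m d' = sgnm n m (\<lambda>a. d a * d' a)"
proof (rule blockcol_eqI[of _ "m * n" m n])
  fix a assume a: "a < m"
  have "sgnm n m d * sgnm n m d' * bcol n m a = sgnm n m d * (sgnm n m d' * bcol n m a)"
    by (rule assoc_mult_mat[of _ "m*n" "m*n" _ "m*n" _ n]) auto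
  also have "\<dots> = d' a \<cdot>\<^sub>m (sgnm n m d * bcol n m a)"
    by (subst sgnm_mult_bcol[OF a], rule mult_smult_distrib[of _ "m*n" "m*n"]) auto
  finally show "sgnm n m d * sgnm n m d' * bcol n m a = sgnm n m (\<lambda>a. d a * d' a) * bcol n m a"
    unfolding sgnm_mult_bcol[OF a] by (auto simp: ac_simps)
qed (auto intro: mult_carrier_mat)

lemma sgnm_one: "sgnm n m (\<lambda>a. 1) = 1\<^sub>m (m * n)"
  by (intro eq_matI) (auto simp: sgnm_def)

section \<open>Products along words\<close>

text \<open>\<open>tuple_prod\<close> for an arbitrary index type and coefficient ring; the elimination below needs it over
  polynomials and rational functions.\<close>

definition wprod :: "nat \<Rightarrow> ('i \<Rightarrow> 'a :: semiring_1 mat) \<Rightarrow> 'i list \<Rightarrow> 'a mat"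
  where "wprod N M t = foldr (\<lambda>i X. M i * X) t (1\<^sub>m N)"

lemma wprod_simps [simp]: "wprod N M [] = 1\<^sub>m N" "wprod N M (i # t) = M i * wprod N M t"
  by (simp_all add: wprod_def)

lemma wprod_carrier:
  "(\<And>i. i \<in> set t \<Longrightarrow> M i \<in> carrier_mat N N) \<Longrightarrow> wprod N M t \<in> carrier_mat N N"
  by (induction t) (auto intro!: mult_carrier_mat[of _ N N _ N])

lemma wprod_append:
  assumes "\<And>i. i \<in> set u \<union> set v \<Longrightarrow> M i \<in> carrier_mat N N"
  shows "wprod N M (u @ v) = wprod N M u * wprod N M v"
  using assms
proof (induction u)
  case Nil
  thus ?case using wprod_carrier[of v M N] by simp
next
  case (Cons i u)
  have "M i * (wprod N M u * wprod N M v) = M i * wprod N M u * wprod N M v"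
    by (rule assoc_mult_mat[of _ N N _ N _ N, symmetric]) (use Cons.prems in \<open>auto intro!: wprod_carrier\<close>)
  thus ?case using Cons by simp
qed

lemma tuple_prod_wprod: "tuple_prod N M t = wprod N M t"
  by (simp add: tuple_prod_def wprod_def)

lemma wprod_map: "wprod N M (map f t) = wprod N (\<lambda>i. M (f i)) t"
  by (induction t) auto

lemma wprod_cong: "(\<And>i. i \<in> set t \<Longrightarrow> M i = M' i) \<Longrightarrow> wprod N M t = wprod N M' t"
  by (induction t) auto

lemma wprod_comm:
  assumes c: "\<And>i. i \<in> set u \<union> set v \<Longrightarrow> M i \<in> carrier_mat N N"
    and comm: "\<And>i j. i \<in> set u \<Longrightarrow> j \<in> set v \<Longrightarrow> M i * M j = M j * M i"
  shows "wprod N M u * wprod N M v = wprod N M v * wprod N M u"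
proof -
  have step: "M i * wprod N M v = wprod N M v * M i" if "i \<in> set u" for i
    using c comm[OF that]
  proof (induction v)
    case Nil
    have "M i \<in> carrier_mat N N" using Nil that by auto
    thus ?case by simp
  next
    case (Cons j v)
    have Mi: "M i \<in> carrier_mat N N" and Mj: "M j \<in> carrier_mat N N" using Cons.prems that by auto
    have V: "wprod N M v \<in> carrier_mat N N" using Cons.prems by (intro wprod_carrier) auto
    have "M i * (M j * wprod N M v) = M j * (M i * wprod N M v)"
      using Cons.prems(2)[of j] assoc_mult_mat[OF Mi Mj V] assoc_mult_mat[OF Mj Mi V] by simp
    also have "M i * wprod N M v = wprod N M v * M i" using Cons by auto
    also have "M j * (wprod N M v * M i) = M j * wprod N M v * M i"
      by (rule assoc_mult_mat[symmetric, OF Mj V Mi])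
    finally show ?case by simp
  qed
  show ?thesis using c step
  proof (induction u)
    case Nil
    thus ?case using wprod_carrier[of v M N] by auto
  next
    case (Cons i u)
    have Mi: "M i \<in> carrier_mat N N" using Cons.prems by auto
    have V: "wprod N M v \<in> carrier_mat N N" "wprod N M u \<in> carrier_mat N N"
      using Cons.prems by (auto intro!: wprod_carrier)
    have "M i * wprod N M u * wprod N M v = M i * (wprod N M v * wprod N M u)"
      using Cons assoc_mult_mat[OF Mi V(2,1)] by auto
    also have "\<dots> = wprod N M v * (M i * wprod N M u)"
      using Cons.prems(2)[of i] assoc_mult_mat[OF Mi V] assoc_mult_mat[OF V(1) Mi V(2)] by simp
    finally show ?case by simp
  qed
qed

lemma wprod_transpose:
  fixes M :: "'i \<Rightarrow> 'a :: comm_semiring_1 mat"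
  assumes "\<And>i. i \<in> set t \<Longrightarrow> M i \<in> carrier_mat N N"
  shows "transpose_mat (wprod N M t) = wprod N (\<lambda>i. transpose_mat (M i)) (rev t)"
  using assms
proof (induction t)
  case (Cons i t)
  have "transpose_mat (M i * wprod N M t) = transpose_mat (wprod N M t) * transpose_mat (M i)"
    by (rule transpose_mult[of _ N N _ N]) (use Cons.prems in \<open>auto intro!: wprod_carrier\<close>)
  also have "\<dots> = wprod N (\<lambda>i. transpose_mat (M i)) (rev t @ [i])"
    using Cons by (subst wprod_append)
      (auto simp del: right_mult_one_mat simp: right_mult_one_mat[of _ N N])
  finally show ?case by simp
qed auto

lemma wprod_fixes:
  assumes c: "\<And>i. i \<in> set t \<Longrightarrow> M i \<in> carrier_mat N N" and v: "v \<in> carrier_mat N q"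
    and "\<And>i. i \<in> set t \<Longrightarrow> M i * v = v"
  shows "wprod N M t * v = v"
  using c assms(3)
proof (induction t)
  case (Cons i t)
  have "M i * wprod N M t * v = M i * (wprod N M t * v)"
    by (rule assoc_mult_mat[of _ N N _ N _ q]) (use Cons.prems v in \<open>auto intro!: wprod_carrier\<close>)
  thus ?case using Cons by simp
qed (use v in auto)

text \<open>Generators with disjoint positions act on different block columns.\<close>

lemma gen_comm:
  fixes C C' :: "'a :: semiring_1 mat"
  assumes C: "C \<in> carrier_mat n n" "C' \<in> carrier_mat n n"
    and pq: "p < m" "q < m" "p' < m" "q' < m" and disj: "p \<noteq> p'" "p \<noteq> q'" "q \<noteq> p'" "q \<noteq> q'"
  shows "gen n m p q C * gen n m p' q' C' = gen n m p' q' C' * gen n m p q C"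
proof (rule blockcol_eqI[of _ "m * n" m n])
  fix a assume a: "a < m"
  note act = gen_mult_bcol[OF C(1) pq(1,2)] gen_mult_bcol[OF C(2) pq(3,4)]
  have split: "gen n m p q C * gen n m p' q' C' * bcol n m a = gen n m p q C * (gen n m p' q' C' * bcol n m a)"
    "gen n m p' q' C' * gen n m p q C * bcol n m a = gen n m p' q' C' * (gen n m p q C * bcol n m a)"
    by (rule assoc_mult_mat[of _ "m*n" "m*n" _ "m*n" _ n]; auto)+
  have dist: "X * (bcol n m b + bcol n m c * D) = X * bcol n m b + X * bcol n m c * D"
    "X * (bcol n m c * D) = X * bcol n m c * D"
    if "X \<in> carrier_mat (m*n) (m*n)" "D \<in> carrier_mat n n" for X D :: "'a mat" and b c
  proof -
    show *: "X * (bcol n m c * D) = X * bcol n m c * D"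
      by (rule assoc_mult_mat[symmetric, of _ "m*n" "m*n" _ n _ n]) (use that in auto)
    show "X * (bcol n m b + bcol n m c * D) = X * bcol n m b + X * bcol n m c * D"
      unfolding *[symmetric]
      by (rule mult_add_distrib_mat[of _ "m*n" "m*n" _ n]) (use that in \<open>auto intro!: mult_carrier_mat[of _ _ n]\<close>)
  qed
  have l: "gen n m p q C * bcol n m b = bcol n m b" if "b < m" "b \<noteq> p" "b \<noteq> q" for b
    using that act(1) by simp
  have r: "gen n m p' q' C' * bcol n m b = bcol n m b" if "b < m" "b \<noteq> p'" "b \<noteq> q'" for b
    using that act(2) by simp
  have lD: "gen n m p q C * (bcol n m b * C') = bcol n m b * C'" if "b < m" "b \<noteq> p" "b \<noteq> q" for b
    using dist(2)[OF gen_carrier C(2)] l[OF that] by simp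
  have rD: "gen n m p' q' C' * (bcol n m b * C) = bcol n m b * C" if "b < m" "b \<noteq> p'" "b \<noteq> q'" for b
    using dist(2)[OF gen_carrier C(1)] r[OF that] by simp
  have ld: "gen n m p q C * (bcol n m q' + bcol n m p' * C') = bcol n m q' + bcol n m p' * C'"
    using dist(1)[OF gen_carrier C(2)] l pq disj by simp
  have rd: "gen n m p' q' C' * (bcol n m q + bcol n m p * C) = bcol n m q + bcol n m p * C"
    using dist(1)[OF gen_carrier C(1)] r pq disj by metis
  consider "a = p" | "a \<noteq> p" "a = q" | "a = p'" | "a \<noteq> p'" "a = q'" | "a \<noteq> p" "a \<noteq> q" "a \<noteq> p'" "a \<noteq> q'"
    by blast
  thus "gen n m p q C * gen n m p' q' C' * bcol n m a = gen n m p' q' C' * gen n m p q C * bcol n m a"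
  proof cases
    case 1
    thus ?thesis unfolding split using r[OF a] rD[of p] rD[of q] rd pq disj by (simp add: act(1))
  next
    case 2
    thus ?thesis unfolding split using r[OF a] r[of p] pq disj by (simp add: act(1))
  next
    case 3
    hence "a \<noteq> p" "a \<noteq> q" using disj by auto
    thus ?thesis unfolding split using 3 l[OF a] lD[of p'] lD[of q'] ld pq disj by (simp add: act(2))
  next
    case 4
    hence "a \<noteq> p" "a \<noteq> q" using disj by auto
    thus ?thesis unfolding split using 4 l[OF a] l[of p'] pq disj by (simp add: act(2))
  next
    case 5
    thus ?thesis unfolding split using l[OF a] r[OF a] by simp
  qed
qed (auto intro: mult_carrier_mat)

section \<open>Words up to commuting swaps\<close>

text \<open>The equivalence that defines the column standard form; generators of a chain do not
  distinguish equivalent words.\<close>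

definition weq :: "nat list \<Rightarrow> nat list \<Rightarrow> bool"  (infix \<open>\<approx>\<close> 50)
  where "u \<approx> v \<longleftrightarrow> commuting_swap\<^sup>*\<^sup>* (map int u) (map int v)"

lemma weq_refl [simp]: "u \<approx> u"
  by (simp add: weq_def)

lemma weq_trans [trans]: "u \<approx> v \<Longrightarrow> v \<approx> w \<Longrightarrow> u \<approx> w"
  unfolding weq_def by (rule rtranclp_trans)

lemma commuting_swap_ctx: "commuting_swap u v \<Longrightarrow> commuting_swap (xs @ u @ ys) (xs @ v @ ys)"
proof (induction rule: commuting_swap.induct)
  case (1 i j xs' ys')
  show ?case using commuting_swap.intros[OF 1, of "xs @ xs'" "ys' @ ys"] by simp
qed

lemma weq_ctx: "u \<approx> v \<Longrightarrow> xs @ u @ ys \<approx> xs @ v @ ys"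
proof -
  have "commuting_swap\<^sup>*\<^sup>* (map int xs @ u' @ map int ys) (map int xs @ v' @ map int ys)"
    if "commuting_swap\<^sup>*\<^sup>* u' v'" for u' v'
    using that by (induction rule: rtranclp_induct) (auto intro: rtranclp.rtrancl_into_rtrancl commuting_swap_ctx)
  thus "u \<approx> v \<Longrightarrow> xs @ u @ ys \<approx> xs @ v @ ys" by (simp add: weq_def)
qed

lemma weq_app: "u \<approx> u' \<Longrightarrow> v \<approx> v' \<Longrightarrow> u @ v \<approx> u' @ v'"
  using weq_ctx[of u u' "[]" v] weq_ctx[of v v' u' "[]"] by (auto intro: weq_trans)

definition apart :: "nat \<Rightarrow> nat \<Rightarrow> bool"
  where "apart i j \<longleftrightarrow> i + 1 < j \<or> j + 1 < i"

lemma weq_comm1: "(\<And>j. j \<in> set u \<Longrightarrow> apart i j) \<Longrightarrow> i # u \<approx> u @ [i]"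
proof (induction u)
  case (Cons j u)
  have "i # j # u \<approx> j # i # u"
    using Cons.prems[of j] commuting_swap.intros[of "int i" "int j" "[]" "map int u"]
    by (auto simp: weq_def apart_def)
  also have "j # i # u \<approx> j # (u @ [i])"
    using weq_ctx[OF Cons.IH, of "[j]" "[]"] Cons.prems by auto
  finally show ?case by simp
qed auto

lemma weq_comm: "(\<And>i j. i \<in> set u \<Longrightarrow> j \<in> set v \<Longrightarrow> apart i j) \<Longrightarrow> u @ v \<approx> v @ u"
proof (induction u)
  case (Cons i u)
  have "i # (u @ v) \<approx> (i # v) @ u"
    using weq_ctx[OF Cons.IH, of "[i]" "[]"] Cons.prems by auto
  also have "\<dots> \<approx> (v @ [i]) @ u"
    by (intro weq_app weq_comm1) (use Cons.prems in auto)
  finally show ?case by simp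
qed auto

lemma weq_wprod:
  fixes M :: "nat \<Rightarrow> 'a :: semiring_1 mat"
  assumes "u \<approx> v" and u: "set u \<subseteq> K" and c: "\<And>i. i \<in> K \<Longrightarrow> M i \<in> carrier_mat N N"
    and comm: "\<And>i j. i \<in> K \<Longrightarrow> j \<in> K \<Longrightarrow> apart i j \<Longrightarrow> M i * M j = M j * M i"
  shows "wprod N M u = wprod N M v"
proof -
  have step: "wprod N (\<lambda>i. M (nat i)) u' = wprod N (\<lambda>i. M (nat i)) v' \<and> set v' = set u'"
    if "commuting_swap u' v'" "set u' \<subseteq> int ` K" for u' v'
    using that
  proof (induction rule: commuting_swap.induct)
    case (1 i j xs ys)
    let ?M = "\<lambda>i. M (nat i)"
    have c': "a \<in> set (xs @ [i, j] @ ys) \<Longrightarrow> ?M a \<in> carrier_mat N N" for a using 1 c by auto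
    have "apart (nat i) (nat j)" using 1 by (auto simp: apart_def)
    hence "?M i * ?M j = ?M j * ?M i" using 1 by (intro comm) auto
    moreover have "wprod N ?M ([i, j] @ ys) = ?M i * ?M j * wprod N ?M ys"
      "wprod N ?M ([j, i] @ ys) = ?M j * ?M i * wprod N ?M ys"
      using c' by (auto intro!: assoc_mult_mat[symmetric, of _ N N _ N _ N] wprod_carrier)
    ultimately have "wprod N ?M ([i, j] @ ys) = wprod N ?M ([j, i] @ ys)" by simp
    moreover have "wprod N ?M (xs @ zs) = wprod N ?M xs * wprod N ?M zs"
      if "set zs \<subseteq> set ([i, j] @ ys)" for zs
      using that c' by (intro wprod_append) auto
    ultimately show ?case by (simp add: insert_commute)
  qed
  have "commuting_swap\<^sup>*\<^sup>* u' v' \<Longrightarrow> set u' \<subseteq> int ` K \<Longrightarrow>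
    wprod N (\<lambda>i. M (nat i)) u' = wprod N (\<lambda>i. M (nat i)) v' \<and> set v' = set u'" for u' v'
    by (induction rule: rtranclp_induct) (use step in auto)
  from this[of "map int u" "map int v"] assms(1) u show ?thesis
    by (simp add: weq_def wprod_map image_mono)
qed

text \<open>The letters \<open>K - 1, K - 3, \<dots>\<close>: every second index below \<open>K\<close>, so that they commute pairwise.\<close>

fun evw :: "nat \<Rightarrow> nat list" where
  "evw 0 = []" | "evw (Suc 0) = [0]" | "evw (Suc (Suc K)) = Suc K # evw K"

fun tri :: "nat \<Rightarrow> nat list" where
  "tri 0 = []" | "tri (Suc p) = [0..<Suc p] @ tri p"

text \<open>The admissible tuple of \<open>{0:p + 2j}\<close> with index \<open>p\<close>, built from the inside out; \<open>csym\<close> is its symmetric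
  complement.\<close>

fun adm :: "nat \<Rightarrow> nat \<Rightarrow> nat list" where
  "adm p 0 = [0..<Suc p]" | "adm p (Suc j) = (p + 2 * j + 1) # (p + 2 * j + 2) # adm p j"

fun csym :: "nat \<Rightarrow> nat \<Rightarrow> nat list" where
  "csym p 0 = tri p" | "csym p (Suc j) = (p + 2 * j + 1) # csym p j"

text \<open>Each part \<open>q, q - 1, \<dots>, 0\<close> transports a mark from \<open>q\<close> down to 0 and then removes it. The word turns the
  state of the simple tuple into the state of the tuple of index \<open>p\<close>.\<close>

fun exits :: "nat \<Rightarrow> nat list" where
  "exits 0 = []" | "exits (Suc 0) = []" | "exits (Suc (Suc p)) = exits p @ rev [0..<Suc p]"

lemma evw_letters: "i \<in> set (evw K) \<Longrightarrow> i < K"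
  by (induction K rule: evw.induct) auto

lemma tri_letters: "i \<in> set (tri p) \<Longrightarrow> i < p"
  by (induction p) auto

lemma exits_letters: "i \<in> set (exits p) \<Longrightarrow> i + 1 < p"
  by (induction p rule: exits.induct) (auto simp: less_Suc_eq)

text \<open>Prefixing \<open>(0:q)\<close> to \<open>tri q\<close> gives \<open>tri (q + 1)\<close>. The same word arises by appending the letters in
  descending order, because each of them commutes with all but its neighbours.\<close>

lemma tri_snoc: "tri q @ rev [0..<Suc q] \<approx> tri (Suc q)"
proof (induction q)
  case (Suc q)
  have "tri q @ [Suc q] \<approx> [Suc q] @ tri q"
    by (rule weq_comm) (auto simp: apart_def dest: tri_letters)
  hence "[0..<Suc q] @ (tri q @ [Suc q]) @ rev [0..<Suc q] \<approx> [0..<Suc q] @ ([Suc q] @ tri q) @ rev [0..<Suc q]"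
    by (rule weq_ctx)
  also have "\<dots> = ([0..<Suc q] @ [Suc q]) @ (tri q @ rev [0..<Suc q])" by simp
  also have "\<dots> \<approx> ([0..<Suc q] @ [Suc q]) @ tri (Suc q)"
    by (intro weq_app Suc weq_refl)
  finally show ?case by simp
qed simp

text \<open>For \<open>k \<ge> p\<close> with \<open>k - p\<close> even this is the word of the admissible tuple of index \<open>p\<close> followed by its
  complement: a palindrome around the commuting letters \<open>evw (Suc k)\<close>.\<close>

definition palin :: "nat \<Rightarrow> nat \<Rightarrow> nat list"
  where "palin k p = rev (exits p) @ rev (evw k) @ evw (Suc k) @ evw k @ exits p"

lemma palin_step:
  assumes "p \<le> k"
  shows "palin (Suc (Suc k)) p \<approx> [Suc k, Suc (Suc k)] @ palin k p @ [Suc k]"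
proof -
  let ?a = "rev (exits p) @ rev (evw k)" and ?b = "evw (Suc k)" and ?c = "evw k @ exits p"
  have "palin (Suc (Suc k)) p = (?a @ [Suc k, Suc (Suc k)]) @ ?b @ ([Suc k] @ ?c)"
    by (simp add: palin_def)
  also have "\<dots> \<approx> ([Suc k, Suc (Suc k)] @ ?a) @ ?b @ (?c @ [Suc k])"
  proof -
    have small: "i < k" if "i \<in> set (evw k) \<or> i \<in> set (exits p)" for i
      using that assms evw_letters[of i k] exits_letters[of i p] by auto
    have "?a @ [Suc k, Suc (Suc k)] \<approx> [Suc k, Suc (Suc k)] @ ?a"
    proof (rule weq_comm)
      fix i j show "i \<in> set ?a \<Longrightarrow> j \<in> set [Suc k, Suc (Suc k)] \<Longrightarrow> apart i j"
        using small[of i] by (auto simp: apart_def)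
    qed
    moreover have "[Suc k] @ ?c \<approx> ?c @ [Suc k]"
    proof (rule weq_comm)
      fix i j show "i \<in> set [Suc k] \<Longrightarrow> j \<in> set ?c \<Longrightarrow> apart i j"
        using small[of j] by (auto simp: apart_def)
    qed
    ultimately show ?thesis by (metis weq_app weq_refl)
  qed
  finally show ?thesis by (simp add: palin_def)
qed

lemma palin_tri: "palin p p \<approx> tri (Suc p)"
proof (induction p rule: exits.induct)
  case (3 p)
  have "palin (Suc (Suc p)) (Suc (Suc p)) = [0..<Suc p] @ palin (Suc (Suc p)) p @ rev [0..<Suc p]"
    by (simp add: palin_def)
  also have "\<dots> \<approx> [0..<Suc p] @ ([Suc p, Suc (Suc p)] @ palin p p @ [Suc p]) @ rev [0..<Suc p]"
    by (intro weq_ctx palin_step) simp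
  also have "\<dots> = ([0..<Suc p] @ [Suc p, Suc (Suc p)]) @ palin p p @ (Suc p # rev [0..<Suc p])" by simp
  also have "\<dots> \<approx> ([0..<Suc p] @ [Suc p, Suc (Suc p)]) @ tri (Suc p) @ (Suc p # rev [0..<Suc p])"
    by (rule weq_ctx[OF 3])
  also have "\<dots> = [0..<Suc (Suc (Suc p))] @ (tri (Suc p) @ rev [0..<Suc (Suc p)])" by simp
  also have "\<dots> \<approx> [0..<Suc (Suc (Suc p))] @ tri (Suc (Suc p))"
    by (intro weq_app tri_snoc weq_refl)
  finally show ?case by simp
qed (simp_all add: palin_def)

lemma csym_letters: "i \<in> set (csym p j) \<Longrightarrow> i < p + 2 * j"
  by (induction j) (auto dest: tri_letters)

lemma weq_sym: "u \<approx> v \<Longrightarrow> v \<approx> u"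
proof -
  have s: "commuting_swap a b \<Longrightarrow> commuting_swap b a" for a b
    proof (induction rule: commuting_swap.induct)
    case (1 i j xs ys)
    thus ?case using commuting_swap.intros[of j i xs ys] by (simp add: abs_minus_commute)
  qed
  have "commuting_swap\<^sup>*\<^sup>* b a" if "commuting_swap\<^sup>*\<^sup>* a b" for a b
    using that by (induction rule: rtranclp_induct) (auto intro: s converse_rtranclp_into_rtranclp)
  thus "u \<approx> v \<Longrightarrow> v \<approx> u" by (simp add: weq_def)
qed

text \<open>Both sides obey the same recursion in \<open>j\<close>: passing from \<open>k\<close> to \<open>k + 2\<close> prefixes \<open>k + 1, k + 2\<close> and
  appends \<open>k + 1\<close>.\<close>

lemma adm_csym_weq: "adm p j @ csym p j \<approx> palin (p + 2 * j) p"
proof (induction j)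
  case 0
  show ?case using weq_sym[OF palin_tri[of p]] by simp
next
  case (Suc j)
  let ?k = "p + 2 * j"
  have "adm p (Suc j) @ csym p (Suc j) = [Suc ?k, Suc (Suc ?k)] @ adm p j @ ([Suc ?k] @ csym p j)" by simp
  also have "\<dots> \<approx> [Suc ?k, Suc (Suc ?k)] @ adm p j @ (csym p j @ [Suc ?k])"
    by (intro weq_app[OF weq_refl weq_app[OF weq_refl weq_comm]]) (auto simp: apart_def dest: csym_letters)
  also have "\<dots> = [Suc ?k, Suc (Suc ?k)] @ (adm p j @ csym p j) @ [Suc ?k]" by simp
  also have "\<dots> \<approx> [Suc ?k, Suc (Suc ?k)] @ palin ?k p @ [Suc ?k]"
    by (rule weq_ctx[OF Suc])
  also have "\<dots> \<approx> palin (Suc (Suc ?k)) p"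
    by (rule weq_sym[OF palin_step]) simp
  finally show ?case by simp
qed

text \<open>The analogous form of the complement alone.\<close>

definition palin' :: "nat \<Rightarrow> nat \<Rightarrow> nat list"
  where "palin' k p = rev (exits p) @ evw k @ exits p"

lemma palin'_step:
  assumes "p \<le> k"
  shows "palin' (Suc (Suc k)) p \<approx> [Suc k] @ palin' k p"
proof -
  have "(rev (exits p) @ [Suc k]) @ evw k @ exits p \<approx> ([Suc k] @ rev (exits p)) @ evw k @ exits p"
  proof (rule weq_app[OF weq_comm weq_refl])
    fix i j
    show "i \<in> set (rev (exits p)) \<Longrightarrow> j \<in> set [Suc k] \<Longrightarrow> apart i j"
      using assms exits_letters[of i p] by (auto simp: apart_def)
  qed
  thus ?thesis by (simp add: palin'_def)
qed

lemma palin'_tri: "palin' p p \<approx> tri p"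
proof (induction p rule: exits.induct)
  case (3 p)
  have "palin' (Suc (Suc p)) (Suc (Suc p)) = [0..<Suc p] @ palin' (Suc (Suc p)) p @ rev [0..<Suc p]"
    by (simp add: palin'_def)
  also have "\<dots> \<approx> [0..<Suc p] @ ([Suc p] @ palin' p p) @ rev [0..<Suc p]"
    by (intro weq_ctx palin'_step) simp
  also have "\<dots> = ([0..<Suc p] @ [Suc p]) @ palin' p p @ rev [0..<Suc p]" by simp
  also have "\<dots> \<approx> ([0..<Suc p] @ [Suc p]) @ tri p @ rev [0..<Suc p]"
    by (rule weq_ctx[OF 3])
  also have "\<dots> \<approx> ([0..<Suc p] @ [Suc p]) @ tri (Suc p)"
    by (intro weq_app tri_snoc weq_refl)
  finally show ?case by simp
qed (simp_all add: palin'_def)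

lemma csym_weq: "csym p j \<approx> palin' (p + 2 * j) p"
proof (induction j)
  case 0
  show ?case using weq_sym[OF palin'_tri[of p]] by simp
next
  case (Suc j)
  let ?k = "p + 2 * j"
  have "csym p (Suc j) = [Suc ?k] @ csym p j @ []" by simp
  also have "\<dots> \<approx> [Suc ?k] @ palin' ?k p @ []"
    by (rule weq_ctx[OF Suc])
  also have "\<dots> \<approx> palin' (Suc (Suc ?k)) p"
    using weq_sym[OF palin'_step[of p ?k]] by simp
  finally show ?case by simp
qed

section \<open>States and moves\<close>

text \<open>A state tells which indices are marked, where \<open>i\<close> is marked if \<open>i\<close> and \<open>i + 1\<close> belong to the same
  string of the column standard form. The step at \<open>s\<close> moves the mark of \<open>s\<close> to \<open>s - 1\<close>; at \<open>s = 0\<close> the mark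
  disappears.\<close>

definition stp :: "(nat \<Rightarrow> bool) \<Rightarrow> nat \<Rightarrow> nat \<Rightarrow> bool"
  where "stp c s = (if s = 0 then c(0 := False) else c(s - 1 := True, s := False))"

text \<open>Legality: every letter meets a marked index whose lower neighbour is unmarked.\<close>

primrec mv :: "(nat \<Rightarrow> bool) \<Rightarrow> nat list \<Rightarrow> bool" where
  "mv c [] \<longleftrightarrow> True"
| "mv c (s # ss) \<longleftrightarrow> c s \<and> (s > 0 \<longrightarrow> \<not> c (s - 1)) \<and> mv (stp c s) ss"

abbreviation stl :: "(nat \<Rightarrow> bool) \<Rightarrow> nat list \<Rightarrow> nat \<Rightarrow> bool"
  where "stl \<equiv> foldl stp"

text \<open>The permutation of indices that goes along with a step; \<open>swp 0\<close> is the identity.\<close>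

definition swp :: "nat \<Rightarrow> nat \<Rightarrow> nat"
  where "swp s i = (if i = s then s - 1 else if i = s - 1 then s else i)"

primrec prm :: "nat list \<Rightarrow> nat \<Rightarrow> nat" where
  "prm [] i = i" | "prm (s # ss) i = prm ss (swp s i)"

text \<open>The state of the reversed admissible tuple of \<open>{0:k}\<close> with index \<open>p\<close>.\<close>

definition simple_state :: "nat \<Rightarrow> nat \<Rightarrow> nat \<Rightarrow> bool"
  where "simple_state p k i \<longleftrightarrow> p \<le> i \<and> i < k \<and> even (k - i)"

lemma mv_append: "mv c (u @ v) \<longleftrightarrow> mv c u \<and> mv (stl c u) v"
  by (induction u arbitrary: c) auto

lemma prm_append: "prm (u @ v) i = prm v (prm u i)"
  by (induction u arbitrary: i) auto

lemma mv_letters: "mv c t \<Longrightarrow> (\<And>i. c i \<Longrightarrow> i < k) \<Longrightarrow> s \<in> set t \<Longrightarrow> s < k"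
proof (induction t arbitrary: c)
  case (Cons a t)
  have "i < k" if "stp c a i" for i
    using that Cons.prems(1) Cons.prems(2)[of i] Cons.prems(2)[of a] by (auto simp: stp_def split: if_splits)
  thus ?case using Cons by (auto simp del: One_nat_def)
qed simp

text \<open>A single mark can travel all the way down as long as everything below is unmarked.\<close>

lemma mv_down: "c j \<Longrightarrow> (\<And>i. i < j \<Longrightarrow> \<not> c i) \<Longrightarrow> mv c (rev [0..<Suc j]) \<and> stl c (rev [0..<Suc j]) = c(j := False)"
proof (induction j arbitrary: c)
  case (Suc j)
  have "stp c (Suc j) = c(j := True, Suc j := False)" by (simp add: stp_def)
  hence c': "stp c (Suc j) j" "\<And>i. i < j \<Longrightarrow> \<not> stp c (Suc j) i" "(stp c (Suc j))(j := False) = c(Suc j := False)"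
    using Suc.prems by (auto simp: fun_eq_iff)
  have r: "rev [0..<Suc (Suc j)] = Suc j # rev [0..<Suc j]" by simp
  have "mv (stp c (Suc j)) (rev [0..<Suc j]) \<and> stl (stp c (Suc j)) (rev [0..<Suc j]) = (stp c (Suc j))(j := False)"
    using c'(1,2) by (rule Suc.IH)
  thus ?case unfolding r c'(3) using Suc.prems by (simp only: mv.simps foldl_Cons) auto
qed (simp add: stp_def)

lemma mv_exits:
  "p \<le> k \<Longrightarrow> even (k - p) \<Longrightarrow> mv (simple_state 0 k) (exits p) \<and> stl (simple_state 0 k) (exits p) = simple_state p k"
proof (induction p rule: exits.induct)
  case 2
  have "simple_state 0 k = simple_state 1 k"
  proof
    fix i show "simple_state 0 k i = simple_state 1 k i"
      using 2 by (cases "i = 0") (auto simp: simple_state_def)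
  qed
  thus ?case by simp
next
  case (3 p)
  have k: "p < k" "even (k - p)" "odd (k - Suc p)" using 3 by auto
  have "mv (simple_state p k) (rev [0..<Suc p]) \<and> stl (simple_state p k) (rev [0..<Suc p]) = (simple_state p k)(p := False)"
    using k by (intro mv_down) (auto simp: simple_state_def)
  moreover have "(simple_state p k)(p := False) = simple_state (Suc (Suc p)) k"
  proof
    fix i show "((simple_state p k)(p := False)) i = simple_state (Suc (Suc p)) k i"
      using k by (cases "i = p"; cases "i = Suc p") (auto simp: simple_state_def)
  qed
  ultimately show ?case using 3 k by (auto simp: mv_append simp del: upt_Suc)
qed simp

lemma mv_evw_gen:
  "(\<And>i. i < K \<Longrightarrow> c i = odd (K - i)) \<Longrightarrow>
    mv c (evw K) \<and> stl c (evw K) = (\<lambda>i. if i < K then even (K - i) else c i)"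
proof (induction K arbitrary: c rule: evw.induct)
  case 2
  thus ?case by (auto simp: stp_def fun_eq_iff)
next
  case (3 K)
  have c: "c (Suc K)" "\<not> c K" using 3(2)[of "Suc K"] 3(2)[of K] by auto
  have "stp c (Suc K) = c(K := True, Suc K := False)" by (simp add: stp_def)
  moreover have "mv (c(K := True, Suc K := False)) (evw K) \<and>
      stl (c(K := True, Suc K := False)) (evw K) = (\<lambda>i. if i < K then even (K - i) else (c(K := True, Suc K := False)) i)"
    by (rule 3(1)) (use 3(2) in \<open>auto simp: Suc_diff_le\<close>)
  moreover have "(\<lambda>i. if i < K then even (K - i) else (c(K := True, Suc K := False)) i) =
      (\<lambda>i. if i < Suc (Suc K) then even (Suc (Suc K) - i) else c i)"
    by (auto simp: fun_eq_iff Suc_diff_le less_Suc_eq)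
  ultimately show ?case using c by auto
qed simp

text \<open>Moving every second mark down by one turns the state of \<open>k + 1\<close> into the one of \<open>k\<close>. This is why the
  palindromes around \<open>evw (Suc k)\<close> and around \<open>evw k\<close> can be treated alike.\<close>

lemma mv_evw: "mv (simple_state 0 (Suc k)) (evw k)" "stl (simple_state 0 (Suc k)) (evw k) = simple_state 0 k"
proof -
  have "mv (simple_state 0 (Suc k)) (evw k) \<and> stl (simple_state 0 (Suc k)) (evw k) =
      (\<lambda>i. if i < k then even (k - i) else simple_state 0 (Suc k) i)"
    by (rule mv_evw_gen) (auto simp: simple_state_def Suc_diff_le)
  thus "mv (simple_state 0 (Suc k)) (evw k)" "stl (simple_state 0 (Suc k)) (evw k) = simple_state 0 k"
    by (auto simp: simple_state_def fun_eq_iff less_Suc_eq)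
qed

section \<open>Greedy computation of c0\<close>

lemma subseq_upto_mono: "subseq [0..int q] \<beta> \<Longrightarrow> p \<le> q \<Longrightarrow> subseq [0..int p] \<beta>"
proof -
  assume "subseq [0..int q] \<beta>" "p \<le> q"
  moreover have "[0..int q] = [0..int p] @ [int p + 1..int q]" if "p \<le> q"
    using that upto_split1[of 0 "int p + 1" "int q"] upto_split2[of 0 "int p" "int q"] by auto
  ultimately show ?thesis by (metis prefixI prefix_imp_subseq subseq_order.trans)
qed

lemma subseq_snoc_iff: "subseq (xs @ [x]) (ys @ [y]) \<longleftrightarrow> subseq (xs @ [x]) ys \<or> x = y \<and> subseq xs ys"
proof (cases "x = y")
  case True
  thus ?thesis using subseq_order.trans[of xs "xs @ [x]" ys] by auto
next
  case False
  have "subseq (xs @ [x]) ys" if "subseq (xs @ [x]) (ys @ [y])"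
    using that
  proof (cases rule: subseq_appendE)
    case (append xs1 xs2)
    from append(3) have "xs2 = [] \<or> xs2 = [y]"
      by (cases xs2) (auto split: if_splits)
    thus ?thesis using append False by auto
  qed
  thus ?thesis using False subseq_rev_drop_many by blast
qed

text \<open>The lengths of the initial segments \<open>(0:p)\<close> contained in \<open>\<beta>\<close> are bounded by the length of \<open>\<beta>\<close>, so the
  greatest one exists, and all shorter ones are contained too.\<close>

lemma subseq_upto_c0:
  assumes "0 \<in> set \<beta>"
  shows "subseq [0..int p] \<beta> \<longleftrightarrow> p \<le> c0 \<beta>"
proof -
  have bound: "q \<le> length \<beta>" if "subseq [0..int q] \<beta>" for q
    using list_emb_length[OF that] by simp
  have zero: "subseq [0..int 0] \<beta>"
    using assms by (simp add: subseq_singleton_left)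
  have "subseq [0..int (c0 \<beta>)] \<beta>"
    unfolding c0_def by (rule GreatestI_nat[where P = "\<lambda>p. subseq [0..int p] \<beta>" and k = 0 and b = "length \<beta>"]) (use bound zero in auto)
  moreover have "q \<le> c0 \<beta>" if "subseq [0..int q] \<beta>" for q
    unfolding c0_def by (rule Greatest_le_nat[where P = "\<lambda>p. subseq [0..int p] \<beta>" and b = "length \<beta>"]) (use bound that in auto)
  ultimately show ?thesis using subseq_upto_mono by blast
qed

lemma c0_snoc:
  assumes "0 \<in> set \<beta>"
  shows "c0 (\<beta> @ [int s]) = (if s = Suc (c0 \<beta>) then s else c0 \<beta>)"
proof -
  have iff: "subseq [0..int p] (\<beta> @ [int s]) \<longleftrightarrow> p \<le> c0 \<beta> \<or> p = s \<and> p \<le> Suc (c0 \<beta>)" for p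
  proof (cases p)
    case 0
    thus ?thesis using assms by (auto simp: subseq_singleton_left)
  next
    case (Suc q)
    have u: "[0..int q] @ [int (Suc q)] = [0..int (Suc q)]"
      using upto_rec2[of 0 "int (Suc q)"] by simp
    have "subseq ([0..int q] @ [int (Suc q)]) (\<beta> @ [int s]) \<longleftrightarrow>
        subseq ([0..int q] @ [int (Suc q)]) \<beta> \<or> int (Suc q) = int s \<and> subseq [0..int q] \<beta>"
      by (rule subseq_snoc_iff)
    thus ?thesis unfolding u Suc of_nat_eq_iff subseq_upto_c0[OF assms] by linarith
  qed
  show ?thesis unfolding c0_def[of "\<beta> @ [int s]"]
  proof (rule Greatest_equality)
    show "subseq [0..int (if s = Suc (c0 \<beta>) then s else c0 \<beta>)] (\<beta> @ [int s])"
      unfolding iff by simp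
    fix y assume "subseq [0..int y] (\<beta> @ [int s])"
    thus "y \<le> (if s = Suc (c0 \<beta>) then s else c0 \<beta>)"
      unfolding iff by (auto split: if_splits)
  qed
qed

text \<open>Continues the longest segment \<open>(0:q)\<close> found so far whenever the next index \<open>q + 1\<close> is read.\<close>

primrec greedy :: "nat \<Rightarrow> nat list \<Rightarrow> nat" where
  "greedy q [] = q" | "greedy q (s # ss) = greedy (if s = Suc q then s else q) ss"

lemma c0_greedy: "0 \<in> set \<beta> \<Longrightarrow> c0 (\<beta> @ map int t) = greedy (c0 \<beta>) t"
proof (induction t arbitrary: \<beta>)
  case (Cons s t)
  thus ?case using Cons.IH[of "\<beta> @ [int s]"] c0_snoc[of \<beta> s] by simp
qed simp

lemma c0_last_zero:
  assumes "0 \<notin> set u"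
  shows "c0 (u @ [0]) = 0"
proof -
  have "\<not> subseq [0..int 1] (u @ [0])"
  proof
    assume "subseq [0..int 1] (u @ [0])"
    hence "subseq [0, 1] u" using subseq_snoc_iff[of "[0]" 1 u 0] by (simp add: upto_rec1)
    from list_emb_set[OF this, of 0] show False using assms by auto
  qed
  thus ?thesis using subseq_upto_c0[of "u @ [0]" 1] by simp
qed

lemma greedy_evw: "greedy 0 (evw K) = (if K \<ge> 2 \<and> even K then 1 else 0)"
proof (induction K rule: evw.induct)
  case (3 K)
  show ?case
  proof (cases "K = 0")
    case False
    hence "greedy 0 (evw (Suc (Suc K))) = greedy 0 (evw K)" by simp
    moreover have "K \<ge> 2 \<and> even K \<longleftrightarrow> even K" using False by (cases "K = 1") auto
    ultimately show ?thesis using 3 by simp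
  qed simp
qed simp_all

section \<open>Column standard forms\<close>

definition together :: "int list list \<Rightarrow> nat \<Rightarrow> bool"
  where "together bs i \<longleftrightarrow> (\<exists>b \<in> set bs. int i \<in> set b \<and> int (Suc i) \<in> set b)"

text \<open>Restricting a list of strings to two consecutive indices shows whether a string contains both.\<close>

lemma concat_pair:
  assumes "concat cs = [x, y]" "x \<noteq> y"
  shows "(\<exists>c \<in> set cs. x \<in> set c \<and> y \<in> set c) \<and> concat (rev cs) = [x, y] \<or>
    \<not> (\<exists>c \<in> set cs. x \<in> set c \<and> y \<in> set c) \<and> concat (rev cs) = [y, x]"
  using assms(1)
proof (induction cs)
  case (Cons c cs)
  have nil: "concat (rev ds) = []" if "concat ds = []" for ds :: "'a list list"
    using that by (simp only: concat_eq_Nil_conv set_rev)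
  have single: "concat (rev ds) = [v]" if "concat ds = [v]" for ds and v :: 'a
    using that
  proof (induction ds)
    case (Cons d ds)
    show ?case
    proof (cases "d = []")
      case False
      hence "d = [v]" "concat ds = []" using Cons.prems by (simp_all add: append_eq_Cons_conv)
      thus ?thesis using nil[of ds] by simp
    qed (use Cons in simp)
  qed simp
  consider "c = []" | "c = [x]" "concat cs = [y]" | "c = [x, y]" "concat cs = []"
    using Cons.prems by (auto simp: append_eq_Cons_conv)
  thus ?case
  proof cases
    case 1
    hence "concat cs = [x, y]" using Cons.prems by simp
    from Cons.IH[OF this] 1 show ?thesis by simp
  next
    case 2
    have "x \<notin> set d" if "d \<in> set cs" for d
    proof
      assume "x \<in> set d"
      hence "x \<in> set (concat cs)" using that by auto
      thus False using 2 assms by simp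
    qed
    hence "\<not> (\<exists>d \<in> set (c # cs). x \<in> set d \<and> y \<in> set d)"
      using 2 assms by simp
    moreover have "concat (rev (c # cs)) = [y, x]" using 2 single[of cs y] by simp
    ultimately show ?thesis by blast
  next
    case 3
    thus ?thesis using nil[of cs] by simp
  qed
qed simp

abbreviation restr :: "nat \<Rightarrow> int list \<Rightarrow> int list"
  where "restr i \<equiv> filter (\<lambda>x. x = int i \<or> x = int (Suc i))"

lemma restr_swap:
  fixes a b :: int
  assumes "\<bar>a - b\<bar> > 1"
  shows "restr i [a, b] = restr i [b, a]"
proof (cases "a = int i \<or> a = int (Suc i)")
  case True
  have "\<not> (b = int i \<or> b = int (Suc i))" using assms True by presburger
  thus ?thesis by (simp only: filter.simps if_False)
next
  case False
  thus ?thesis by (simp only: filter.simps if_False)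
qed

text \<open>The relative order of \<open>i\<close> and \<open>i + 1\<close> is an invariant of commuting swaps.\<close>

lemma restr_commuting: "commuting_swap\<^sup>*\<^sup>* u v \<Longrightarrow> restr i u = restr i v"
proof (induction rule: rtranclp_induct)
  case (step v w)
  from step(2) have "restr i v = restr i w"
    by cases (simp only: filter_append restr_swap)
  thus ?case by (rule trans[OF step.IH])
qed simp

lemma restr_upto:
  assumes "i < k"
  shows "restr i [0..int k] = [int i, int (Suc i)]"
proof -
  have "[0..int k] = [0..int i - 1] @ [int i..int k]"
    using assms by (intro upto_split1) auto
  also have "[int i..int k] = int i # int (Suc i) # [int i + 2..int k]"
    using assms by (simp add: upto_rec1 add.commute)
  finally have *: "[0..int k] = [0..int i - 1] @ int i # int (Suc i) # [int i + 2..int k]" .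
  have "restr i [0..int i - 1] = []" "restr i [int i + 2..int k] = []"
    by (auto simp: filter_empty_conv)
  thus ?thesis unfolding * by (simp only: filter_append filter.simps) simp
qed

lemma restr_csf:
  assumes "is_csf k bs" "i < k"
  shows "restr i (concat bs) = (if together bs i then [int i, int (Suc i)] else [int (Suc i), int i])"
proof -
  let ?cs = "map (restr i) (rev bs)"
  have "concat ?cs = [int i, int (Suc i)]"
    using assms restr_upto[of i k] by (simp add: is_csf_def filter_concat[symmetric])
  moreover have "concat (rev ?cs) = restr i (concat bs)"
    by (simp add: rev_map filter_concat)
  moreover have "(\<exists>c \<in> set ?cs. int i \<in> set c \<and> int (Suc i) \<in> set c) \<longleftrightarrow> together bs i"
    by (auto simp: together_def)
  ultimately show ?thesis using concat_pair[of ?cs "int i" "int (Suc i)"] by auto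
qed

text \<open>A decomposition of an interval into consecutive nonempty strings is determined by the places where
  no cut occurs.\<close>

lemma concat_upto_unique:
  fixes cs cs' :: "int list list"
  assumes "concat cs = [a..b]" "concat cs' = [a..b]" "[] \<notin> set cs" "[] \<notin> set cs'"
    and "\<And>i. a \<le> i \<Longrightarrow> i < b \<Longrightarrow>
      (\<exists>c \<in> set cs. i \<in> set c \<and> i + 1 \<in> set c) \<longleftrightarrow> (\<exists>c \<in> set cs'. i \<in> set c \<and> i + 1 \<in> set c)"
  shows "cs = cs'"
  using assms
proof (induction cs arbitrary: a cs')
  case Nil
  thus ?case by (cases cs') auto
next
  case (Cons c cs)
  obtain c' ds where cs': "cs' = c' # ds"
    using Cons.prems by (cases cs') (auto simp: upto_Nil)
  have split: "\<exists>e. a \<le> e \<and> e \<le> b \<and> d = [a..e] \<and> concat es = [e + 1..b]"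
    if "d @ concat es = [a..b]" "d \<noteq> []" for d es
  proof -
    have ab: "a \<le> b" using that by (cases "a \<le> b") auto
    define e where "e = a + int (length d) - 1"
    have len: "length d \<le> nat (b - a + 1)" using arg_cong[OF that(1), of length] by simp
    have e: "a \<le> e" "e \<le> b" using that len ab by (auto simp: e_def Suc_le_eq length_greater_0_conv[symmetric] simp del: length_greater_0_conv)
    have "[a..b] = [a..e] @ [e + 1..b]" using upto_split2[of a e b] e by simp
    moreover have "length d = length [a..e]" by (simp add: e_def)
    ultimately show ?thesis using that e by (metis append_eq_append_conv)
  qed
  obtain e where e: "a \<le> e" "e \<le> b" "c = [a..e]" "concat cs = [e + 1..b]"
    using split[of c cs] Cons.prems by auto
  obtain e' where e': "a \<le> e'" "e' \<le> b" "c' = [a..e']" "concat ds = [e' + 1..b]"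
    using split[of c' ds] Cons.prems cs' by auto
  have sub: "set x \<subseteq> {e + 1..b}" if "x \<in> set cs" for x
  proof -
    have "set x \<subseteq> set (concat cs)" using that by auto
    thus ?thesis using e(4) by simp
  qed
  have sub': "set x \<subseteq> {e' + 1..b}" if "x \<in> set ds" for x
  proof -
    have "set x \<subseteq> set (concat ds)" using that by auto
    thus ?thesis using e'(4) by simp
  qed
  have tog: "(\<exists>x \<in> set (c # cs). i \<in> set x \<and> i + 1 \<in> set x) \<longleftrightarrow> (\<exists>x \<in> set (c' # ds). i \<in> set x \<and> i + 1 \<in> set x)"
    if "a \<le> i" "i < b" for i
    using Cons.prems(5)[OF that] cs' by simp
  have "\<not> e < e'"
  proof
    assume "e < e'"
    hence "\<exists>x \<in> set (c # cs). e \<in> set x \<and> e + 1 \<in> set x"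
      using tog[of e] e e' by auto
    thus False using sub e by fastforce
  qed
  moreover have "\<not> e' < e"
  proof
    assume "e' < e"
    hence "\<exists>x \<in> set (c' # ds). e' \<in> set x \<and> e' + 1 \<in> set x"
      using tog[of e'] e e' by auto
    thus False using sub' e' by fastforce
  qed
  ultimately have ee: "e' = e" by simp
  have "cs = ds"
  proof (rule Cons.IH[of "e + 1"])
    fix i assume i: "e + 1 \<le> i" "i < b"
    show "(\<exists>c \<in> set cs. i \<in> set c \<and> i + 1 \<in> set c) \<longleftrightarrow> (\<exists>c \<in> set ds. i \<in> set c \<and> i + 1 \<in> set c)"
      using tog[of i] i e e' ee by auto
  qed (use Cons.prems cs' e e' ee in auto)
  thus ?case using cs' e e' ee by simp
qed

lemma csf_unique:
  assumes "is_csf k bs" "is_csf k bs'" "\<And>i. i < k \<Longrightarrow> restr i (concat bs) = restr i (concat bs')"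
  shows "bs = bs'"
proof -
  have tog: "together bs i \<longleftrightarrow> together bs' i" if "i < k" for i
    using assms(3)[OF that] restr_csf[OF assms(1) that] restr_csf[OF assms(2) that] by (auto split: if_splits)
  have "rev bs = rev bs'"
  proof (rule concat_upto_unique[of _ 0 "int k"])
    fix i :: int assume "0 \<le> i" "i < int k"
    then obtain j where "i = int j" "j < k" by (metis nonneg_int_cases of_nat_less_iff)
    thus "(\<exists>c \<in> set (rev bs). i \<in> set c \<and> i + 1 \<in> set c) \<longleftrightarrow> (\<exists>c \<in> set (rev bs'). i \<in> set c \<and> i + 1 \<in> set c)"
      using tog[of j] by (simp add: together_def add.commute)
  qed (use assms in \<open>auto simp: is_csf_def\<close>)
  thus ?thesis by simp
qed

text \<open>The orders of all pairs \<open>i, i + 1\<close> are invariant under commuting swaps, and they determine which pairs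
  share a string, hence the column standard form. This replaces the definite description by any
  witness.\<close>

lemma csf_eq:
  assumes "is_csf k bs" "commuting_swap\<^sup>*\<^sup>* \<beta> (concat bs)"
  shows "csf k \<beta> = bs"
  unfolding csf_def
proof (rule the_equality)
  fix bs' assume "is_csf k bs' \<and> commuting_swap\<^sup>*\<^sup>* \<beta> (concat bs')"
  hence bs': "is_csf k bs'" "commuting_swap\<^sup>*\<^sup>* \<beta> (concat bs')" by auto
  show "bs' = bs"
    by (rule csf_unique[OF bs'(1) assms(1)]) (use restr_commuting[OF bs'(2)] restr_commuting[OF assms(2)] in simp)
qed (use assms in simp)

lemma move_first_app:
  assumes "\<forall>b \<in> set pre. hd b \<noteq> s"
  shows "move_first s (pre @ b # post) = pre @ move_first s (b # post)"
  using assms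
proof (induction pre)
  case (Cons b' pre)
  thus ?case by (cases pre) auto
qed simp

text \<open>On states, \<open>z_r\<close> is the step \<open>stp\<close>, and a right index of type 1 is a legal one: if a string with at
  least two entries starts with \<open>s\<close>, then \<open>s\<close> is marked and \<open>s - 1\<close> is not.\<close>

lemma together_move:
  assumes csf: "is_csf k bs" and s: "right_index_type1 k (concat bs) (int s)"
  shows "together bs s" and "s > 0 \<Longrightarrow> \<not> together bs (s - 1)"
    and "is_csf k (move_first (int s) bs)" and "together (move_first (int s) bs) = stp (together bs) s"
proof -
  have "csf k (concat bs) = bs" by (rule csf_eq[OF csf]) simp
  then obtain t where t: "int s < t" "[int s..t] \<in> set bs"
    using s by (auto simp: right_index_type1_def)
  define b where "b = [int s..t]"
  obtain pre post where bs: "bs = pre @ b # post" using t split_list by (fastforce simp: b_def)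
  define u where "u = concat (rev post)"
  define v where "v = concat (rev pre)"
  have b: "b = int s # [int s + 1..t]" using t by (simp add: b_def upto_rec1)
  have cat: "u @ b @ v = [0..int k]"
    using csf by (simp add: is_csf_def bs u_def v_def)
  hence dist: "distinct (u @ b @ v)" by simp
  have "int s \<in> set (u @ b @ v)" using b by simp
  hence "int s \<in> set [0..int k]" unfolding cat .
  hence "[0..int k] = [0..int s - 1] @ int s # [int s + 1..int k]"
    using upto_split3[of 0 "int s" "int k"] by simp
  hence "u @ int s # ([int s + 1..t] @ v) = [0..int s - 1] @ int s # [int s + 1..int k]"
    using cat b by simp
  moreover have "int s \<notin> set u" "int s \<notin> set ([int s + 1..t] @ v)" using dist b by auto
  ultimately have u: "u = [0..int s - 1]" using append_Cons_eq_iff by metis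
  have setb: "set b = {int s..t}" by (simp add: b_def)
  have disj: "set b \<inter> set v = {}" "set u \<inter> set v = {}" using dist by auto
  have pre: "set x \<subseteq> set v" if "x \<in> set pre" for x using that by (auto simp: v_def)
  have post: "set x \<subseteq> {0..int s - 1}" if "x \<in> set post" for x
  proof -
    have "set x \<subseteq> set u" using that by (auto simp: u_def)
    thus ?thesis using u by simp
  qed
  have sv: "int s \<notin> set v" using disj setb t by auto
  have pre_s: "int s \<notin> set x" if "x \<in> set pre" for x using pre[OF that] sv by blast
  have post_s: "int s \<notin> set x" "int (Suc s) \<notin> set x" if "x \<in> set post" for x
    using subsetD[OF post[OF that], of "int s"] subsetD[OF post[OF that], of "int (Suc s)"] by auto
  show tog: "together bs s"
    unfolding together_def bs using setb t by (intro bexI[of _ b]) auto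
  show ntog: "\<not> together bs (s - 1)" if "s > 0"
  proof
    assume "together bs (s - 1)"
    moreover have "int (s - 1) = int s - 1" "Suc (s - 1) = s" using that by auto
    ultimately obtain x where x: "x \<in> set bs" "int s - 1 \<in> set x" "int s \<in> set x"
      by (metis together_def)
    thus False using pre_s[of x] post_s[of x] setb by (auto simp: bs)
  qed
  have ne: "[] \<notin> set bs" using csf by (simp add: is_csf_def)
  have "hd x \<noteq> int s" if "x \<in> set pre" for x
    using pre[OF that] sv ne that by (metis Un_iff bs hd_in_set set_append subsetD)
  hence "move_first (int s) (pre @ b # post) = pre @ move_first (int s) (b # post)"
    by (intro move_first_app) auto
  moreover define N where "N = move_first (int s) bs"
  ultimately have mf: "N = pre @ move_first (int s) (b # post)" by (simp add: bs)
  have tlb: "tl b = [int s + 1..t]" "hd b = int s" using b by auto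
  have ne': "[] \<notin> set pre" "[] \<notin> set post" "tl b \<noteq> []" using ne t by (auto simp: bs tlb)
  define P where "P = (\<lambda>x i. int i \<in> set x \<and> int (Suc i) \<in> set x)"
  have tP: "together cs i \<longleftrightarrow> (\<exists>x \<in> set cs. P x i)" for cs i by (simp add: together_def P_def)
  have tailP: "P (tl b) i \<longleftrightarrow> P b i \<and> i \<noteq> s" for i
    using setb by (auto simp: P_def tlb)
  have preP: "\<not> P x s" if "x \<in> set pre" for x using pre_s[OF that] by (simp add: P_def)
  have postP: "\<not> P x s" if "x \<in> set post" for x using post_s[OF that] by (simp add: P_def)
  have "is_csf k N \<and> together N = stp (together bs) s"
  proof (cases post)
    case Nil
    hence s0: "s = 0" using u by (cases "s = 0") (auto simp: u_def)
    have mf': "N = pre @ [tl b, [int s]]" by (simp add: mf Nil tlb)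
    have "concat (rev N) = [0..int k]"
      using cat b by (simp add: mf' Nil u_def v_def tlb)
    hence "is_csf k N"
      using ne' by (simp add: is_csf_def mf' Nil)
    moreover have "together N i = stp (together bs) s i" for i
    proof -
      have "P [int s] i \<longleftrightarrow> False" by (simp add: P_def)
      thus ?thesis using preP by (cases "i = s") (auto simp: tP mf' bs Nil stp_def s0 tailP)
    qed
    ultimately show ?thesis by (auto simp: fun_eq_iff)
  next
    case (Cons b' post')
    have mf': "N = pre @ tl b # (b' @ [int s]) # post'" by (simp add: mf Cons tlb)
    have "concat (rev N) = [0..int k]"
      using cat b by (simp add: mf' Cons u_def v_def tlb)
    hence c: "is_csf k N"
      using ne' by (simp add: is_csf_def mf' Cons)
    have b'ne: "b' \<noteq> []" using ne by (auto simp: bs Cons)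
    have u': "concat (rev post') @ b' = [0..int s - 1]" using u by (simp add: u_def Cons)
    hence s0: "s > 0" using b'ne by (cases s) auto
    have "[0..int s - 1] = [0..int s - 2] @ [int s - 1]"
      using upto_rec2[of 0 "int s - 1"] s0 by simp
    hence "last b' = int s - 1" using arg_cong[OF u', of last] b'ne by simp
    hence last: "int (s - 1) \<in> set b'" using b'ne s0 last_in_set[of b'] by (simp add: of_nat_diff)
    have "together N i = stp (together bs) s i" for i
    proof -
      have b'P: "P (b' @ [int s]) i \<longleftrightarrow> P b' i \<or> i = s - 1" for i
        using post_s[of b'] last s0 by (auto simp: P_def Cons)
      show ?thesis using preP postP s0
        by (cases "i = s") (auto simp: tP mf' bs Cons stp_def tailP b'P)
    qed
    thus ?thesis using c by (auto simp: fun_eq_iff)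
  qed
  thus "is_csf k (move_first (int s) bs)" "together (move_first (int s) bs) = stp (together bs) s"
    by (auto simp: N_def)
qed

lemma right_tuple_mv:
  assumes "is_csf k bs" "csf k \<beta> = bs" "right_index_tuple_type1 k \<beta> (map int t)"
  shows "mv (together bs) t"
  using assms
proof (induction t arbitrary: bs \<beta>)
  case (Cons s t)
  have self: "csf k (concat bs') = bs'" if "is_csf k bs'" for bs'
    using csf_eq[OF that] by simp
  have r: "right_index_type1 k (concat bs) (int s)"
    using Cons.prems self[OF Cons.prems(1)] by (simp add: right_index_type1_def)
  note m = together_move[OF Cons.prems(1) r]
  have "mv (together (move_first (int s) bs)) t"
    using Cons.prems by (intro Cons.IH[OF m(3) self[OF m(3)]]) (simp add: z_r_def)
  thus ?case using m by simp
qed simp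

fun csf_strings :: "nat \<Rightarrow> nat \<Rightarrow> nat list list" where
  "csf_strings p 0 = map (\<lambda>i. [i]) (rev [0..<p])"
| "csf_strings p (Suc j) = [p + 2 * j, p + 2 * j + 1] # csf_strings p j"

lemma csf_strings_letters: "i \<in> set (concat (csf_strings p j)) \<Longrightarrow> i < p + 2 * j"
  by (induction j) fastforce+

text \<open>With \<open>k = p + 2j\<close> and \<open>j > 0\<close>, the last two letters \<open>k, k - 1\<close> of the reversed tuple move to the left: \<open>k\<close>
  past everything, \<open>k - 1\<close> until it meets \<open>k - 2\<close>. This leaves the strings \<open>(k), (k - 2:k - 1), \<dots>, (p:p + 1), (p - 1), \<dots>, (0)\<close>.\<close>

lemma rev_adm_csf: "rev (adm p j) \<approx> concat ([p + 2 * j] # csf_strings p j)"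
proof (induction j)
  case 0
  have "concat (map (\<lambda>i. [i]) xs) = xs" for xs :: "nat list" by (induction xs) auto
  thus ?case by simp
next
  case (Suc j)
  let ?k = "p + 2 * j" and ?r = "concat (csf_strings p j)"
  have "rev (adm p (Suc j)) = rev (adm p j) @ [Suc (Suc ?k), Suc ?k]" by simp
  also have "\<dots> \<approx> concat ([?k] # csf_strings p j) @ [Suc (Suc ?k), Suc ?k]"
    by (intro weq_app[OF Suc] weq_refl)
  also have "\<dots> = (([?k] @ ?r) @ [Suc (Suc ?k)]) @ [Suc ?k]" by simp
  also have "\<dots> \<approx> ([Suc (Suc ?k)] @ ([?k] @ ?r)) @ [Suc ?k]"
    by (rule weq_app[OF weq_comm weq_refl]) (use csf_strings_letters[of _ p j] in \<open>fastforce simp: apart_def\<close>)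
  also have "\<dots> = [Suc (Suc ?k), ?k] @ (?r @ [Suc ?k])" by simp
  also have "\<dots> \<approx> [Suc (Suc ?k), ?k] @ ([Suc ?k] @ ?r)"
    by (rule weq_app[OF weq_refl weq_comm]) (use csf_strings_letters[of _ p j] in \<open>fastforce simp: apart_def\<close>)
  finally show ?case by simp
qed

lemma csf_strings_is_csf: "is_csf (p + 2 * j) (map (map int) ([p + 2 * j] # csf_strings p j))"
proof -
  have "concat (rev ([p + 2 * j] # csf_strings p j)) = [0..<Suc (p + 2 * j)]"
  proof (induction j)
    case 0
    have "concat (map (\<lambda>i. [i]) xs) = xs" for xs :: "nat list" by (induction xs) auto
    thus ?case by (simp add: rev_map)
  next
    case (Suc j)
    thus ?case by (simp add: upt_Suc)
  qed
  hence "concat (rev (map (map int) ([p + 2 * j] # csf_strings p j))) = map int [0..<Suc (p + 2 * j)]"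
    by (metis map_concat rev_map)
  also have "\<dots> = [0..int (p + 2 * j)]"
    by (intro nth_equalityI) (auto simp: nth_append)
  finally have "concat (rev (map (map int) ([p + 2 * j] # csf_strings p j))) = [0..int (p + 2 * j)]" .
  moreover have "[] \<notin> set (csf_strings p j)" by (induction j) auto
  ultimately show ?thesis by (auto simp: is_csf_def)
qed

lemma together_csf_strings:
  "together (map (map int) ([p + 2 * j] # csf_strings p j)) = simple_state p (p + 2 * j)"
proof
  fix i
  have "(\<exists>b \<in> set (csf_strings p j). i \<in> set b \<and> Suc i \<in> set b) \<longleftrightarrow> simple_state p (p + 2 * j) i"
  proof (induction j)
    case (Suc j)
    have "simple_state p (p + 2 * Suc j) i \<longleftrightarrow> simple_state p (p + 2 * j) i \<or> i = p + 2 * j"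
    proof (cases "i < p + 2 * j")
      case True
      hence "p + 2 * Suc j - i = Suc (Suc (p + 2 * j - i))" by auto
      thus ?thesis using True by (auto simp: simple_state_def)
    qed (auto simp: simple_state_def less_Suc_eq)
    thus ?case using Suc by auto
  qed (auto simp: simple_state_def)
  moreover have "together (map (map int) cs) i \<longleftrightarrow> (\<exists>b \<in> set cs. i \<in> set b \<and> Suc i \<in> set b)" for cs
  proof -
    have "int a \<in> int ` B \<longleftrightarrow> a \<in> B" for a B by auto
    thus ?thesis by (simp add: together_def del: of_nat_Suc)
  qed
  ultimately show "together (map (map int) ([p + 2 * j] # csf_strings p j)) i = simple_state p (p + 2 * j) i"
    by (auto simp del: list.map)
qed

lemma right_tuple_adm_mv:
  assumes "right_index_tuple_type1 (p + 2 * j) (rev (map int (adm p j))) (map int t)"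
  shows "mv (simple_state p (p + 2 * j)) t"
proof -
  let ?bs = "[p + 2 * j] # csf_strings p j"
  have "commuting_swap\<^sup>*\<^sup>* (rev (map int (adm p j))) (concat (map (map int) ?bs))"
    using rev_adm_csf[of p j] unfolding weq_def by (simp only: rev_map map_concat)
  from right_tuple_mv[OF csf_strings_is_csf csf_eq[OF csf_strings_is_csf this] assms]
  show ?thesis by (simp only: together_csf_strings)
qed

lemma admissible_tuple_adm:
  assumes "admissible_tuple k p w"
  shows "p \<le> k" "even (k - p)" "w = map int (adm p ((k - p) div 2))"
proof -
  show p: "p \<le> k" "even (k - p)" using assms by (auto simp: admissible_tuple_def)
  have upt: "map int [0..<Suc p] = [0..int p]" for p
    by (intro nth_equalityI) (auto simp: nth_append)
  have "concat (map (\<lambda>i. [int (p + 2 * j - 2 * i) - 1..int (p + 2 * j - 2 * i)]) [0..<j]) @ [0..int p] = map int (adm p j)" for j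
  proof (induction j)
    case (Suc j)
    have "[0..<Suc j] = 0 # map Suc [0..<j]" by (simp add: map_Suc_upt upt_conv_Cons)
    moreover have "[int (p + 2 * Suc j) - 1..int (p + 2 * Suc j)] = map int [p + 2 * j + 1, p + 2 * j + 2]"
      by (simp add: upto_rec1)
    moreover have "map (\<lambda>i. [int (p + 2 * Suc j - 2 * Suc i) - 1..int (p + 2 * Suc j - 2 * Suc i)]) [0..<j] =
        map (\<lambda>i. [int (p + 2 * j - 2 * i) - 1..int (p + 2 * j - 2 * i)]) [0..<j]"
      by (rule map_cong) auto
    ultimately show ?case using Suc by (simp add: comp_def del: upt_Suc)
  qed (simp add: upt del: upt_Suc)
  from this[of "(k - p) div 2"] show "w = map int (adm p ((k - p) div 2))"
    using assms p by (simp add: admissible_tuple_def)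
qed

lemma symmetric_complement_csym:
  assumes "p \<le> k" "even (k - p)"
  shows "symmetric_complement k p = map int (csym p ((k - p) div 2))"
proof -
  have upt: "map int [0..<p] = [0..int p - 1]" for p
    by (intro nth_equalityI) auto
  have tri: "concat (map (\<lambda>j. [0..int p - 1 - int j]) [0..<p]) = map int (tri p)"
  proof (induction p)
    case (Suc p)
    have "[0..<Suc p] = 0 # map Suc [0..<p]" by (simp add: map_Suc_upt upt_conv_Cons)
    hence "concat (map (\<lambda>j. [0..int (Suc p) - 1 - int j]) [0..<Suc p]) =
        [0..int p] @ concat (map (\<lambda>j. [0..int p - 1 - int j]) [0..<p])"
      by (simp add: comp_def algebra_simps del: upt_Suc)
    also have "\<dots> = map int [0..<Suc p] @ map int (tri p)"
      unfolding Suc upt[of "Suc p"] by simp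
    finally show ?case by simp
  qed simp
  have "map (\<lambda>i. int (p + 2 * j - 2 * i) - 1) [0..<j] @ map int (tri p) = map int (csym p j)" for j
  proof (induction j)
    case (Suc j)
    have "[0..<Suc j] = 0 # map Suc [0..<j]" by (simp add: map_Suc_upt upt_conv_Cons)
    moreover have "map (\<lambda>i. int (p + 2 * Suc j - 2 * Suc i) - 1) [0..<j] = map (\<lambda>i. int (p + 2 * j - 2 * i) - 1) [0..<j]"
      by (rule map_cong) auto
    ultimately show ?case using Suc by (simp add: comp_def del: upt_Suc)
  qed simp
  from this[of "(k - p) div 2"] show ?thesis
    using assms by (simp add: symmetric_complement_def tri)
qed

section \<open>Chains of Fiedler-like factors\<close>

lemma smult_smult_eq: "a \<cdot>\<^sub>m (b \<cdot>\<^sub>m X) = (a * b :: 'a :: semigroup_mult) \<cdot>\<^sub>m X"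
  by (intro eq_matI) (auto simp: mult.assoc)

lemma one_smult_eq [simp]: "(1 :: 'a :: monoid_mult) \<cdot>\<^sub>m X = X"
  by (intro eq_matI) auto

text \<open>A chain of generators \<open>M i\<close> in which consecutive ones share a block position. \<open>pos i\<close> is the position
  of the coefficient \<open>C i\<close>, and the last \<open>I\<close> of \<open>M i\<close> sits between \<open>pos i\<close> and \<open>pos (i - 1)\<close>. For \<open>i = 0\<close> the
  truncated subtraction makes \<open>M 0\<close> block diagonal.\<close>

locale chain =
  fixes n m K :: nat and pos :: "nat \<Rightarrow> nat" and C :: "nat \<Rightarrow> complex mat"
  assumes pos_inj: "inj_on pos {..<K}" and pos_less: "\<And>i. i < K \<Longrightarrow> pos i < m"
    and C: "\<And>i. i < K \<Longrightarrow> C i \<in> carrier_mat n n"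
begin

definition M :: "nat \<Rightarrow> complex mat"
  where "M i = gen n m (pos i) (pos (i - 1)) (C i)"

abbreviation "N \<equiv> m * n"
abbreviation "e q \<equiv> bcol n m (pos q) :: complex mat"
abbreviation "W t \<equiv> wprod N M t"

lemma M_carrier [simp, intro]: "M i \<in> carrier_mat N N"
  by (simp add: M_def)

lemma M_dim [simp]: "dim_row (M i) = N" "dim_col (M i) = N"
  by (simp_all add: M_def)

lemma W_carrier [simp, intro]: "W t \<in> carrier_mat N N"
  by (intro wprod_carrier M_carrier)

lemma mult_N [simp]:
  "X \<in> carrier_mat N N \<Longrightarrow> Y \<in> carrier_mat N N \<Longrightarrow> X * Y \<in> carrier_mat N N"
  "X \<in> carrier_mat N N \<Longrightarrow> v \<in> carrier_mat N n \<Longrightarrow> X * v \<in> carrier_mat N n"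
  for X Y v :: "complex mat"
  by (auto intro: mult_carrier_mat)

lemma one_N [simp]: "M i * 1\<^sub>m N = M i"
  by (rule right_mult_one_mat[OF M_carrier])

lemma W_append: "W (u @ v) = W u * W v"
  by (intro wprod_append M_carrier)

lemma pos_eq_iff: "i < K \<Longrightarrow> j < K \<Longrightarrow> pos i = pos j \<longleftrightarrow> i = j"
  using pos_inj by (auto simp: inj_on_def)

lemma assoc3: "X \<in> carrier_mat N N \<Longrightarrow> Y \<in> carrier_mat N N \<Longrightarrow> v \<in> carrier_mat N q \<Longrightarrow> X * Y * v = X * (Y * (v :: complex mat))"
  by (rule assoc_mult_mat)

lemma assoc3': "u \<in> carrier_mat q N \<Longrightarrow> X \<in> carrier_mat N N \<Longrightarrow> Y \<in> carrier_mat N r \<Longrightarrow> u * X * Y = u * (X * (Y :: complex mat))"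
  by (rule assoc_mult_mat)

lemma swp_less: "s < K \<Longrightarrow> q < K \<Longrightarrow> swp s q < K"
  by (auto simp: swp_def)

text \<open>The generator \<open>M s\<close> exchanges the unit block columns \<open>s - 1\<close> and \<open>s\<close>, up to an extra term with \<open>C s\<close> that
  appears only if it is applied to column \<open>s\<close> itself.\<close>

lemma M_e:
  assumes "s < K" "q < K"
  shows "q \<noteq> s \<Longrightarrow> M s * e q = e (swp s q)"
    and "s > 0 \<Longrightarrow> M s * e s = e (s - 1) + e s * C s"
    and "M 0 * e 0 = e 0 * C 0"
proof -
  have "s - 1 < K" "0 < K" using assms by auto
  note act = gen_mult_bcol[OF C pos_less pos_less pos_less]
  show "q \<noteq> s \<Longrightarrow> M s * e q = e (swp s q)"
    using assms \<open>s - 1 < K\<close> pos_less pos_eq_iff[OF assms(2) assms(1)] pos_eq_iff[OF assms(2) \<open>s - 1 < K\<close>]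
    by (simp add: M_def gen_mult_bcol C swp_def)
  show "s > 0 \<Longrightarrow> M s * e s = e (s - 1) + e s * C s"
  proof -
    assume "s > 0"
    hence "pos s \<noteq> pos (s - 1)" using pos_eq_iff[OF assms(1) \<open>s - 1 < K\<close>] by linarith
    thus ?thesis using assms \<open>s - 1 < K\<close> pos_less by (simp add: M_def gen_mult_bcol C)
  qed
  show "M 0 * e 0 = e 0 * C 0"
    using \<open>0 < K\<close> pos_less by (simp add: M_def gen_mult_bcol C)
qed

lemma M_fix: "s < K \<Longrightarrow> a < m \<Longrightarrow> a \<noteq> pos s \<Longrightarrow> a \<noteq> pos (s - 1) \<Longrightarrow> M s * bcol n m a = bcol n m a"
  using pos_less[of s] pos_less[of "s - 1"] by (simp add: M_def gen_mult_bcol C)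

lemma transpose_chain: "chain n m K pos (\<lambda>i. transpose_mat (C i))"
  using pos_inj pos_less C by unfold_locales auto

lemma M_transpose: "s < K \<Longrightarrow> transpose_mat (M s) = chain.M n m pos (\<lambda>i. transpose_mat (C i)) s"
  unfolding M_def chain.M_def[OF transpose_chain] using C by (simp add: gen_transpose)

lemma e_M:
  assumes "s < K" "q < K"
  shows "q \<noteq> s \<Longrightarrow> transpose_mat (e q) * M s = transpose_mat (e (swp s q))"
    and "s > 0 \<Longrightarrow> transpose_mat (e s) * M s = transpose_mat (e (s - 1)) + C s * transpose_mat (e s)"
proof -
  have t: "transpose_mat (e q) * M s = transpose_mat (transpose_mat (M s) * e q)" for q
    by (subst transpose_mult[of _ N N _ n]) auto
  note act = chain.M_e[OF transpose_chain assms]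
  show "q \<noteq> s \<Longrightarrow> transpose_mat (e q) * M s = transpose_mat (e (swp s q))"
    unfolding t M_transpose[OF assms(1)] using act(1) by simp
  have "transpose_mat (e (s - 1) + e s * transpose_mat (C s)) = transpose_mat (e (s - 1)) + transpose_mat (e s * transpose_mat (C s))"
    by (rule transpose_add[of _ N n]) (use C[OF assms(1)] in auto)
  also have "transpose_mat (e s * transpose_mat (C s)) = C s * transpose_mat (e s)"
    using C[OF assms(1)] by (subst transpose_mult[of _ N n _ n]) auto
  finally show "s > 0 \<Longrightarrow> transpose_mat (e s) * M s = transpose_mat (e (s - 1)) + C s * transpose_mat (e s)"
    unfolding t M_transpose[OF assms(1)] using act(2) by simp
qed

lemma e_e: "i < K \<Longrightarrow> j < K \<Longrightarrow> transpose_mat (e i) * e j = (if i = j then 1\<^sub>m n else 0\<^sub>m n n)"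
  using bcol_transpose_mult_bcol[of "pos i" m "pos j" n] pos_less pos_eq_iff by simp

lemma M_comm: "i < K \<Longrightarrow> j < K \<Longrightarrow> apart i j \<Longrightarrow> M i * M j = M j * M i"
  unfolding M_def apart_def
  by (intro gen_comm) (auto simp: C pos_less pos_eq_iff)

lemma W_weq: "u \<approx> v \<Longrightarrow> set u \<subseteq> {..<K} \<Longrightarrow> W u = W v"
  by (rule weq_wprod[where K = "{..<K}"]) (auto intro: M_comm)

subsection \<open>Signed transposition\<close>

definition twisted :: "complex mat \<Rightarrow> (nat \<Rightarrow> complex) \<Rightarrow> (nat \<Rightarrow> complex) \<Rightarrow> bool"
  where "twisted X d d' \<longleftrightarrow> transpose_mat X = sgnm n m d * X * sgnm n m d'"

definition signs :: "(nat \<Rightarrow> complex) \<Rightarrow> bool"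
  where "signs d \<longleftrightarrow> (\<forall>a. d a * d a = 1)"

definition neg :: "nat \<Rightarrow> (nat \<Rightarrow> complex) \<Rightarrow> nat \<Rightarrow> complex"
  where "neg s d a = (if a = pos s \<or> a = pos (s - 1) then - d a else d a)"

text \<open>The sign change on the positions of the letters below \<open>j\<close>.\<close>

definition eta :: "nat \<Rightarrow> nat \<Rightarrow> complex"
  where "eta j a = (if a \<in> pos ` {..<j} then - 1 else 1)"

lemma sgnm_square: "signs d \<Longrightarrow> sgnm n m d * sgnm n m d = 1\<^sub>m N"
  by (simp add: sgnm_mult_sgnm signs_def sgnm_one)

lemma signs_neg [simp]: "signs d \<Longrightarrow> signs (neg s d)"
  by (simp add: signs_def neg_def)

lemma signs_eta [simp]: "signs d \<Longrightarrow> signs (\<lambda>a. d a * eta j a)"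
  by (simp add: signs_def eta_def)

text \<open>Conjugation with signs changes the sign of the skew-symmetric block \<open>C s\<close> and of nothing else: the two
  off-diagonal blocks keep their sign because \<open>d\<close> takes opposite values at their two positions.\<close>

lemma M_twisted:
  assumes s: "s < K" and sk: "transpose_mat (C s) = - C s" and d: "signs d"
    and opp: "s > 0 \<Longrightarrow> d (pos s) = - d (pos (s - 1))"
  shows "twisted (M s) d (neg s d)"
  unfolding twisted_def
proof (rule blockcol_eqI[of _ N m n])
  let ?D = "sgnm n m d" and ?D' = "sgnm n m (neg s d)"
  fix a assume a: "a < m"
  have sq: "d b * d b = 1" for b using d by (simp add: signs_def)
  have s1: "s - 1 < K" "0 < K" using s by auto
  have "?D * M s * ?D' * bcol n m a = ?D * M s * (neg s d a \<cdot>\<^sub>m bcol n m a)"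
    unfolding sgnm_mult_bcol[OF a, symmetric] by (rule assoc3) auto
  also have "\<dots> = neg s d a \<cdot>\<^sub>m (?D * (M s * bcol n m a))"
    by (subst mult_smult_distrib[of _ N N _ n]) (auto simp: assoc3[of ?D "M s" _ n])
  finally have rhs: "?D * M s * ?D' * bcol n m a = neg s d a \<cdot>\<^sub>m (?D * (M s * bcol n m a))" .
  consider "a \<noteq> pos s" "a \<noteq> pos (s - 1)" | "s > 0" "a = pos (s - 1)" | "s > 0" "a = pos s" | "s = 0" "a = pos 0"
    by (cases "s = 0") auto
  thus "transpose_mat (M s) * bcol n m a = ?D * M s * ?D' * bcol n m a"
  proof cases
    case 1
    thus ?thesis
      unfolding rhs M_transpose[OF s] using M_fix[OF s a] chain.M_fix[OF transpose_chain s a]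
      by (simp add: neg_def sgnm_mult_bcol a sq smult_smult_eq)
  next
    case 2
    have "M s * bcol n m a = e s" "chain.M n m pos (\<lambda>i. transpose_mat (C i)) s * bcol n m a = e s"
      using 2 M_e(1)[OF s s1(1)] chain.M_e(1)[OF transpose_chain s s1(1)] by (simp_all add: swp_def)
    moreover have "neg s d a * d (pos s) = 1" using 2 opp sq by (simp add: neg_def)
    ultimately show ?thesis
      unfolding rhs M_transpose[OF s] by (simp add: sgnm_mult_bcol pos_less s smult_smult_eq)
  next
    case 3
    have 1: "M s * bcol n m a = e (s - 1) + e s * C s"
      "chain.M n m pos (\<lambda>i. transpose_mat (C i)) s * bcol n m a = e (s - 1) + e s * - C s"
      using 3 M_e(2)[OF s s] chain.M_e(2)[OF transpose_chain s s] by (simp_all add: sk)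
    have "?D * (e s * C s) = ?D * e s * C s"
      using C[OF s] by (intro assoc_mult_mat[symmetric, of _ N N _ n _ n]) auto
    also have "\<dots> = d (pos s) \<cdot>\<^sub>m (e s * C s)"
      using C[OF s] mult_smult_assoc_mat[of "e s" N n "C s" n] by (simp add: sgnm_mult_bcol pos_less s)
    finally have "?D * (e (s - 1) + e s * C s) = d (pos (s - 1)) \<cdot>\<^sub>m e (s - 1) + d (pos s) \<cdot>\<^sub>m (e s * C s)"
      using C[OF s] sgnm_mult_bcol[OF pos_less[OF s1(1)], of n d]
      by (subst mult_add_distrib_mat[of _ N N _ n]) (auto intro!: mult_carrier_mat[of _ N n])
    hence "neg s d a \<cdot>\<^sub>m (?D * (M s * bcol n m a)) =
        (neg s d a * d (pos (s - 1))) \<cdot>\<^sub>m e (s - 1) + (neg s d a * d (pos s)) \<cdot>\<^sub>m (e s * C s)"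
      unfolding 1 using C[OF s] add_smult_distrib_left_mat[of "d (pos (s - 1)) \<cdot>\<^sub>m e (s - 1)" N n "d (pos s) \<cdot>\<^sub>m (e s * C s)" "neg s d a"]
      by (simp add: smult_smult_eq mult_carrier_mat[of _ N n])
    moreover have "neg s d a * d (pos (s - 1)) = 1" "neg s d a * d (pos s) = -1"
      using 3 opp sq by (simp_all add: neg_def)
    moreover have "e s * - C s = (-1) \<cdot>\<^sub>m (e s * C s)"
      using C[OF s] by (auto simp: uminus_mult_right_mat)
    ultimately show ?thesis
      unfolding rhs M_transpose[OF s] 1 by (simp only: one_smult_eq)
  next
    case 4
    have 1: "M s * bcol n m a = e 0 * C 0" "chain.M n m pos (\<lambda>i. transpose_mat (C i)) s * bcol n m a = e 0 * - C 0"
      using 4 M_e(3)[OF s s] chain.M_e(3)[OF transpose_chain s s] sk by simp_all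
    have "?D * (e 0 * C 0) = ?D * e 0 * C 0"
      using C[OF s1(2)] by (intro assoc_mult_mat[symmetric, of _ N N _ n _ n]) auto
    also have "\<dots> = d (pos 0) \<cdot>\<^sub>m (e 0 * C 0)"
      using C[OF s1(2)] mult_smult_assoc_mat[of "e 0" N n "C 0" n] by (simp add: sgnm_mult_bcol pos_less s1)
    finally have "neg s d a \<cdot>\<^sub>m (?D * (M s * bcol n m a)) = (neg s d a * d (pos 0)) \<cdot>\<^sub>m (e 0 * C 0)"
      unfolding 1 by (simp add: smult_smult_eq)
    moreover have "neg s d a * d (pos 0) = -1" using 4 sq by (simp add: neg_def)
    moreover have "e 0 * - C 0 = (-1) \<cdot>\<^sub>m (e 0 * C 0)"
      using C[OF s1(2)] by (auto simp: uminus_mult_right_mat)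
    ultimately show ?thesis
      unfolding rhs M_transpose[OF s] 1 by simp
  qed
qed (auto intro!: mult_carrier_mat[of _ N N])

text \<open>Transposition reverses a product, so the factors have to commute for the signs in the middle to cancel.\<close>

lemma twisted_mult:
  assumes X: "X \<in> carrier_mat N N" and Y: "Y \<in> carrier_mat N N" and comm: "X * Y = Y * X"
    and d': "signs d'" and tw: "twisted X d d'" "twisted Y d' d''"
  shows "twisted (X * Y) d d''"
proof -
  let ?D = "sgnm n m d" and ?D' = "sgnm n m d'" and ?D'' = "sgnm n m d''"
  have "transpose_mat (X * Y) = transpose_mat X * transpose_mat Y"
    unfolding comm using X Y by (rule transpose_mult[of Y N N X N, rotated])
  also have "\<dots> = ?D * X * ?D' * (?D' * Y * ?D'')"
    using tw by (simp add: twisted_def)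
  also have "\<dots> = ?D * X * (?D' * ?D') * Y * ?D''"
    using X Y by (simp add: assoc_mult_mat[of _ N N _ N _ N])
  also have "\<dots> = ?D * (X * Y) * ?D''"
    using X Y by (simp add: sgnm_square[OF d'] assoc_mult_mat[of _ N N _ N _ N])
  finally show ?thesis by (simp add: twisted_def)
qed

lemma twisted_conj:
  assumes X: "X \<in> carrier_mat N N" and s: "Y \<in> carrier_mat N N"
    and d: "signs d" "signs d'" and tw: "twisted Y d1 d" "twisted X d d'" "twisted Y d' d1'"
  shows "twisted (Y * X * Y) d1 d1'"
proof -
  let ?D = "sgnm n m d" and ?D' = "sgnm n m d'" and ?D1 = "sgnm n m d1" and ?D1' = "sgnm n m d1'"
  have "transpose_mat (Y * X * Y) = transpose_mat Y * (transpose_mat X * transpose_mat Y)"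
    using X s by (simp add: transpose_mult[of _ N N _ N] mult_carrier_mat[of _ N N _ N])
  also have "\<dots> = transpose_mat Y * transpose_mat X * transpose_mat Y"
    using X s by (intro assoc_mult_mat[symmetric, of _ N N _ N _ N]) auto
  also have "\<dots> = (?D1 * Y * ?D) * (?D * X * ?D') * (?D' * Y * ?D1')"
    using tw by (simp add: twisted_def)
  also have "\<dots> = ?D1 * Y * (?D * ?D) * X * (?D' * ?D') * Y * ?D1'"
    using X s by (simp add: assoc_mult_mat[of _ N N _ N _ N])
  also have "\<dots> = ?D1 * (Y * X * Y) * ?D1'"
    using X s by (simp add: sgnm_square d assoc_mult_mat[of _ N N _ N _ N])
  finally show ?thesis by (simp add: twisted_def)
qed

lemma evw_odd: "s \<in> set (evw j) \<Longrightarrow> odd (j - s)"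
  by (induction j rule: evw.induct) (auto simp: Suc_diff_le dest: evw_letters)

lemma evw_twisted:
  assumes sk: "\<And>i. i < K \<Longrightarrow> transpose_mat (C i) = - C i"
  shows "j \<le> K \<Longrightarrow> signs d \<Longrightarrow> (\<And>s. s \<in> set (evw j) \<Longrightarrow> s > 0 \<Longrightarrow> d (pos s) = - d (pos (s - 1))) \<Longrightarrow>
    twisted (W (evw j)) d (\<lambda>a. d a * eta j a)"
proof (induction j arbitrary: d rule: evw.induct)
  case 1
  have "sgnm n m d * 1\<^sub>m N * sgnm n m d = 1\<^sub>m N" using sgnm_square[OF 1(2)] by simp
  thus ?case by (simp add: twisted_def eta_def)
next
  case 2
  have "twisted (M 0) d (neg 0 d)" using 2 sk by (intro M_twisted) auto
  moreover have "neg 0 d = (\<lambda>a. d a * eta (Suc 0) a)" by (auto simp: neg_def eta_def fun_eq_iff)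
  ultimately show ?case using right_mult_one_mat[OF M_carrier[of 0]] by simp
next
  case (3 j)
  let ?d = "neg (Suc j) d"
  have j: "Suc j < K" "j < K" using 3 by auto
  have d: "?d (pos i) = d (pos i)" if "i < j" for i
    using that j by (simp add: neg_def pos_eq_iff)
  have "twisted (W (evw j)) ?d (\<lambda>a. ?d a * eta j a)"
  proof (rule 3(1))
    fix s assume s: "s \<in> set (evw j)" "s > 0"
    thus "?d (pos s) = - ?d (pos (s - 1))" using 3(4)[of s] d evw_letters[OF s(1)] by auto
  qed (use 3 in auto)
  moreover have "(\<lambda>a. ?d a * eta j a) = (\<lambda>a. d a * eta (Suc (Suc j)) a)"
  proof
    fix a
    have "pos j \<notin> pos ` {..<j}" "pos (Suc j) \<notin> pos ` {..<j}"
      using j by (auto simp: pos_eq_iff)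
    thus "?d a * eta j a = d a * eta (Suc (Suc j)) a"
      by (auto simp: neg_def eta_def lessThan_Suc)
  qed
  moreover have "twisted (M (Suc j)) d ?d"
    using 3(4)[of "Suc j"] 3(3) j sk by (intro M_twisted) auto
  moreover have "M (Suc j) * W (evw j) = W (evw j) * M (Suc j)"
  proof -
    have "M (Suc j) * M i = M i * M (Suc j)" if "i \<in> set (evw j)" for i
      using evw_letters[OF that] j by (intro M_comm) (auto simp: apart_def)
    thus ?thesis using wprod_comm[of "[Suc j]" "evw j" M N] right_mult_one_mat[OF M_carrier[of "Suc j"]] by auto
  qed
  ultimately show ?case using twisted_mult[of "M (Suc j)" "W (evw j)" ?d d] 3(3) by simp
qed

text \<open>Conjugation letter by letter, the form in which the invariants of a palindrome are propagated.\<close>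

primrec conj :: "complex mat \<Rightarrow> nat list \<Rightarrow> complex mat" where
  "conj X [] = X" | "conj X (s # ss) = conj (M s * X * M s) ss"

lemma conj_W: "X \<in> carrier_mat N N \<Longrightarrow> conj X t = W (rev t) * X * W t"
proof (induction t arbitrary: X)
  case (Cons s t)
  have "conj X (s # t) = W (rev t) * (M s * X * M s) * W t" using Cons by simp
  also have "\<dots> = W (rev t) * M s * X * (M s * W t)"
    using Cons.prems by (simp add: assoc_mult_mat[of _ N N _ N _ N])
  also have "\<dots> = W (rev (s # t)) * X * W (s # t)"
    by (simp add: W_append)
  finally show ?case .
qed simp

text \<open>The sign of a position depends only on whether its index is marked, with opposite signs for marked
  and unmarked ones.\<close>

definition compatible :: "(nat \<Rightarrow> bool) \<Rightarrow> nat \<Rightarrow> (nat \<Rightarrow> complex) \<Rightarrow> bool"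
  where "compatible c j d \<longleftrightarrow> signs d \<and> (\<exists>\<kappa>. \<forall>i<j. d (pos i) = (if c i then - \<kappa> else \<kappa>))"

text \<open>A legal move at \<open>s\<close> has \<open>s\<close> marked and \<open>s - 1\<close> unmarked, hence opposite signs there, as
  \<open>M_twisted\<close> requires. Exchanging the two signs on both sides of the palindrome yields signs
  compatible with the new state.\<close>

lemma conj_twisted:
  assumes sk: "\<And>i. i < K \<Longrightarrow> transpose_mat (C i) = - C i" and j: "j \<le> K"
  shows "mv c t \<Longrightarrow> (\<And>s. s \<in> set t \<Longrightarrow> s < j) \<Longrightarrow> X \<in> carrier_mat N N \<Longrightarrow>
    (\<And>d. compatible c j d \<Longrightarrow> twisted X d (\<lambda>a. d a * eta j a)) \<Longrightarrow>
    compatible (stl c t) j d \<Longrightarrow> twisted (conj X t) d (\<lambda>a. d a * eta j a)"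
proof (induction t arbitrary: c X)
  case (Cons s t)
  have s: "s < j" "s < K" "s - 1 < j" "s - 1 < K" using Cons.prems(2)[of s] j by auto
  have cs: "c s" "s > 0 \<Longrightarrow> \<not> c (s - 1)" using Cons.prems(1) by auto
  have step: "twisted (M s * X * M s) d (\<lambda>a. d a * eta j a)" if comp: "compatible (stp c s) j d" for d
  proof -
    obtain \<kappa> where sg: "signs d" and \<kappa>: "\<And>i. i < j \<Longrightarrow> d (pos i) = (if stp c s i then - \<kappa> else \<kappa>)"
      using comp by (auto simp: compatible_def)
    have opp: "s > 0 \<Longrightarrow> d (pos s) = - d (pos (s - 1))"
      using \<kappa>[OF s(1)] \<kappa>[OF s(3)] by (simp add: stp_def)
    have "compatible c j (neg s d)"
      unfolding compatible_def
    proof (intro conjI exI[of _ \<kappa>] allI impI)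
      fix i assume i: "i < j"
      hence iff: "pos i = pos s \<longleftrightarrow> i = s" "pos i = pos (s - 1) \<longleftrightarrow> i = s - 1"
        using j s by (auto simp: pos_eq_iff)
      show "neg s d (pos i) = (if c i then - \<kappa> else \<kappa>)"
        using \<kappa>[OF i] cs unfolding neg_def iff by (cases "s = 0") (auto simp: stp_def split: if_splits)
    qed (use sg in simp)
    hence X: "twisted X (neg s d) (\<lambda>a. neg s d a * eta j a)" by (rule Cons.prems(4))
    have eta: "eta j (pos s) = -1" "eta j (pos (s - 1)) = -1" using s by (auto simp: eta_def)
    have "twisted (M s) d (neg s d)"
      using sg opp s sk by (intro M_twisted) auto
    moreover have "twisted (M s) (\<lambda>a. neg s d a * eta j a) (neg s (\<lambda>a. neg s d a * eta j a))"
      using opp s sk eta sg by (intro M_twisted signs_eta signs_neg) (auto simp: neg_def)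
    moreover have "neg s (\<lambda>a. neg s d a * eta j a) = (\<lambda>a. d a * eta j a)"
      by (auto simp: neg_def)
    ultimately show ?thesis
      using twisted_conj[OF Cons.prems(3) M_carrier, of "neg s d" "\<lambda>a. neg s d a * eta j a" s d] X sg by simp
  qed
  show ?case unfolding conj.simps
    by (rule Cons.IH[of "stp c s"])
      (use Cons.prems step in \<open>auto simp: mult_carrier_mat[of _ N N _ N]\<close>)
qed simp

lemma palindrome_twisted:
  assumes sk: "\<And>i. i < K \<Longrightarrow> transpose_mat (C i) = - C i" and j: "j \<le> K"
    and t: "mv (simple_state 0 j) t" and d: "compatible (stl (simple_state 0 j) t) j d"
  shows "twisted (W (rev t @ evw j @ t)) d (\<lambda>a. d a * eta j a)"
proof -
  have "twisted (conj (W (evw j)) t) d (\<lambda>a. d a * eta j a)"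
  proof (rule conj_twisted[OF sk j t])
    fix s assume "s \<in> set t"
    thus "s < j" by (rule mv_letters[OF t, rotated]) (simp add: simple_state_def)
  next
    fix d assume d: "compatible (simple_state 0 j) j d"
    then obtain \<kappa> where \<kappa>: "\<And>i. i < j \<Longrightarrow> d (pos i) = (if simple_state 0 j i then - \<kappa> else \<kappa>)"
      by (auto simp: compatible_def)
    show "twisted (W (evw j)) d (\<lambda>a. d a * eta j a)"
    proof (rule evw_twisted[OF sk j])
      fix s assume s: "s \<in> set (evw j)" "s > 0"
      have "odd (j - s)" "s < j" using evw_odd[OF s(1)] evw_letters[OF s(1)] by auto
      moreover from this have "even (j - (s - 1))" using s by simp
      ultimately show "d (pos s) = - d (pos (s - 1))"
        using \<kappa>[of s] \<kappa>[of "s - 1"] by (auto simp: simple_state_def)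
    qed (use d in \<open>auto simp: compatible_def\<close>)
  qed (use d in auto)
  thus ?thesis by (simp add: conj_W W_append assoc_mult_mat[of _ N N _ N _ N])
qed

subsection \<open>Tracking a block unit vector\<close>

lemma swp_greedy: "q \<noteq> s \<Longrightarrow> swp s q = (if s = Suc q then s else q)"
  by (auto simp: swp_def)

lemma stp_swp: "\<not> c q \<Longrightarrow> c s \<Longrightarrow> \<not> stp c s (swp s q)"
  by (cases s) (auto simp: stp_def swp_def)

text \<open>A unit block row at an unmarked index \<open>q\<close> never meets the letter \<open>q\<close>, because legal letters are marked.
  It is therefore moved only by the letter \<open>q + 1\<close>, which is the rule of \<open>greedy\<close>.\<close>

lemma track:
  assumes "mv c t" "\<not> c q" "\<And>s. s \<in> set t \<Longrightarrow> s < K" "q < K"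
  shows "transpose_mat (e q) * W t = transpose_mat (e (greedy q t)) \<and> W (rev t) * e q = e (greedy q t)
    \<and> greedy q t < K"
  using assms
proof (induction t arbitrary: c q)
  case (Cons s t)
  have s: "s < K" "q \<noteq> s" "c s" using Cons.prems by auto
  have sw: "swp s q = (if s = Suc q then s else q)" using swp_greedy[OF s(2)] .
  have IH: "transpose_mat (e (swp s q)) * W t = transpose_mat (e (greedy (swp s q) t)) \<and>
      W (rev t) * e (swp s q) = e (greedy (swp s q) t) \<and> greedy (swp s q) t < K"
    using Cons.prems s stp_swp[of c q s] swp_less[of s q] by (intro Cons.IH[of "stp c s"]) auto
  have "transpose_mat (e q) * W (s # t) = transpose_mat (e q) * M s * W t"
    by (simp add: assoc3'[of "transpose_mat (e q)" n "M s" "W t" N])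
  moreover have "W (rev (s # t)) * e q = W (rev t) * (M s * e q)"
    by (simp add: W_append assoc3[of "W (rev t)" "M s" "e q" n])
  ultimately show ?case
    using IH e_M(1)[OF s(1) Cons.prems(4) s(2)] M_e(1)[OF s(1) Cons.prems(4) s(2)] sw by simp
qed (auto simp: carrier_matI)

subsection \<open>Links between block positions\<close>

definition blk :: "complex mat \<Rightarrow> nat \<Rightarrow> nat \<Rightarrow> complex mat"
  where "blk X y q = transpose_mat (e y) * X * e q"

text \<open>The palindrome joins \<open>q\<close> to \<open>y\<close>: as long as \<open>q\<close> is marked by a unit block, and after the mark of \<open>q\<close> has
  left the chain through the letter 0 by a block \<open>C 0\<close>. The flag \<open>ex\<close> tells whether the letter 0 occurs.\<close>

definition linked :: "bool \<Rightarrow> (nat \<Rightarrow> bool) \<Rightarrow> complex mat \<Rightarrow> nat \<Rightarrow> nat \<Rightarrow> bool"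
  where "linked ex c X q y \<longleftrightarrow>
    c q \<and> X * e q = e y \<and> transpose_mat (e q) * X = transpose_mat (e y) \<or>
    \<not> c q \<and> ex \<and> blk X y q = C 0"

lemma swp_0 [simp]: "swp 0 i = i"
  by (simp add: swp_def)

lemma swp_swp [simp]: "swp s (swp s q) = q"
  by (auto simp: swp_def)

text \<open>Conjugation by \<open>M s\<close> relabels the links by \<open>swp s\<close>. The marked index \<open>s\<close> has a partner \<open>z\<close> with
  \<open>X e\<^sub>s = e\<^sub>z\<close>; if \<open>s = 0\<close>, the block \<open>C 0\<close> of \<open>M 0\<close> takes the place of the unit block. The separation
  hypotheses keep the other terms of \<open>M s X M s\<close> away from the block in question.\<close>

lemma linked_step:
  assumes X: "X \<in> carrier_mat N N" and s: "s < K" "c s" "s > 0 \<Longrightarrow> \<not> c (s - 1)" and ex: "s = 0 \<Longrightarrow> ex"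
    and qy: "q < K" "y < K" "q \<noteq> y" "\<not> c y" "linked ex c X q y"
    and z: "z < K" "X * e s = e z" "transpose_mat (e s) * X = transpose_mat (e z)"
    and sep: "q \<noteq> s \<Longrightarrow> y \<noteq> z" "q \<noteq> z"
  shows "linked ex (stp c s) (M s * X * M s) (swp s q) (swp s y)"
proof -
  have ys: "y \<noteq> s" using s qy by auto
  have a1: "M s * X * M s * v = M s * (X * (M s * v))" if "v \<in> carrier_mat N n" for v
    using that X by (simp add: assoc3[of _ _ _ n])
  have a2: "u * (M s * X * M s) = u * M s * X * M s" if "u \<in> carrier_mat n N" for u
  proof -
    have "u * (M s * X * M s) = u * (M s * X) * M s"
      by (rule assoc_mult_mat[symmetric, of _ n N _ N _ N]) (use that X in auto)
    also have "u * (M s * X) = u * M s * X"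
      by (rule assoc_mult_mat[symmetric, of _ n N _ N _ N]) (use that X in auto)
    finally show ?thesis .
  qed
  have a3: "blk (M s * X * M s) i j = (transpose_mat (e i) * M s) * X * (M s * e j)" for i j
  proof -
    have "blk (M s * X * M s) i j = transpose_mat (e i) * M s * X * M s * e j"
      unfolding blk_def by (subst a2) auto
    also have "\<dots> = transpose_mat (e i) * M s * X * (M s * e j)"
      using X by (intro assoc_mult_mat[of _ n N _ N _ n]) (auto intro!: mult_carrier_mat[of _ n N])
    finally show ?thesis .
  qed
  note sl = swp_less[OF s(1)]
  show ?thesis
  proof (cases "s = 0")
    case s0: True
    have swp0 [simp]: "swp 0 i = i" for i by (simp add: swp_def)
    show ?thesis
    proof (cases "q = 0")
      case True
      have "X * e 0 = e y" "transpose_mat (e 0) * X = transpose_mat (e y)"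
        using qy(5) s s0 True by (auto simp: linked_def)
      moreover have "M 0 * e 0 = e 0 * C 0" using M_e(3)[OF s(1) s(1)] .
      moreover have "transpose_mat (e y) * M 0 = transpose_mat (e y)"
        using e_M(1)[OF s(1) qy(2) ys] s0 by simp
      moreover have "transpose_mat (e y) * X * (e 0 * C 0) = transpose_mat (e y) * (X * e 0) * C 0"
        using X C[of 0] s s0 by (simp add: assoc_mult_mat[of _ n N _ N _ n] assoc_mult_mat[of _ n N _ n _ n] assoc_mult_mat[of _ N N _ n _ n] mult_carrier_mat[of _ n N] mult_carrier_mat[of _ N n])
      ultimately have "blk (M 0 * X * M 0) y 0 = C 0"
        using a3[of y 0] e_e[OF qy(2) qy(2)] C[of 0] s s0 by simp
      thus ?thesis using True s0 ex by (simp add: linked_def stp_def)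
    next
      case False
      hence fx: "M 0 * e q = e q" "transpose_mat (e y) * M 0 = transpose_mat (e y)"
        "transpose_mat (e q) * M 0 = transpose_mat (e q)" "M 0 * e y = e y"
        using s0 s qy ys M_e(1)[OF s(1) qy(1)] e_M(1)[OF s(1) qy(2)] e_M(1)[OF s(1) qy(1)] M_e(1)[OF s(1) qy(2)] by auto
      show ?thesis
        using qy(5) False s0 a1[of "e q"] a2[of "transpose_mat (e q)"] a3[of y q] fx
        by (auto simp: linked_def stp_def blk_def)
    qed
  next
    case sp: False
    have s1: "s - 1 < K" "s - 1 \<noteq> s" using s sp by auto
    show ?thesis
    proof (cases "c q")
      case True
      hence X1: "X * e q = e y" "transpose_mat (e q) * X = transpose_mat (e y)" and q: "q \<noteq> s - 1"
        using qy(5) s(3) sp by (auto simp: linked_def)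
      have sq: "swp s q \<noteq> s" using q by (auto simp: swp_def)
      have "M s * e (swp s q) = e q" "transpose_mat (e (swp s q)) * M s = transpose_mat (e q)"
        using M_e(1)[OF s(1) sl[OF qy(1)] sq] e_M(1)[OF s(1) sl[OF qy(1)] sq] by simp_all
      moreover have "M s * e y = e (swp s y)" "transpose_mat (e y) * M s = transpose_mat (e (swp s y))"
        using M_e(1)[OF s(1) qy(2) ys] e_M(1)[OF s(1) qy(2) ys] by simp_all
      moreover have "stp c s (swp s q)" using True q s sp by (auto simp: stp_def swp_def)
      ultimately show ?thesis
        using X1 a1[of "e (swp s q)"] a2[of "transpose_mat (e (swp s q))"] by (simp add: linked_def)
    next
      case False
      hence b: "blk X y q = C 0" and ex: ex and q: "q \<noteq> s"
        using qy(5) s by (auto simp: linked_def)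
      have nc: "\<not> stp c s (swp s q)" using False s by (intro stp_swp)
      have zz: "transpose_mat (e y) * e z = 0\<^sub>m n n" "transpose_mat (e z) * e q = 0\<^sub>m n n"
        using e_e[OF qy(2) z(1)] e_e[OF z(1) qy(1)] sep q by auto
      have Cs: "C s \<in> carrier_mat n n" using C s by simp
      have row: "transpose_mat (e (swp s y)) * M s * X * e q = C 0"
      proof (cases "y = s - 1")
        case True
        hence "swp s y = s" using s1 by (simp add: swp_def)
        hence "transpose_mat (e (swp s y)) * M s * X * e q =
            (transpose_mat (e y) + C s * transpose_mat (e s)) * X * e q"
          using e_M(2)[OF s(1) s(1)] sp True by simp
        also have "\<dots> = (transpose_mat (e y) * X + C s * (transpose_mat (e s) * X)) * e q"
          using X Cs by (simp add: add_mult_distrib_mat[of _ n N] assoc_mult_mat[of _ n n _ N _ N] mult_carrier_mat[of _ n n])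
        also have "\<dots> = transpose_mat (e y) * X * e q + C s * (transpose_mat (e z) * e q)"
        proof -
          have p: "transpose_mat (e y) * X \<in> carrier_mat n N" "C s * transpose_mat (e z) \<in> carrier_mat n N"
            by (rule mult_carrier_mat[of _ n N], simp, rule X) (rule mult_carrier_mat[OF Cs], simp)
          show ?thesis
            unfolding z(3) using add_mult_distrib_mat[OF p bcol_carrier] Cs
            by (simp add: assoc_mult_mat[of "C s" n n _ N _ n])
        qed
        also have "\<dots> = C 0"
          using b Cs C[of 0] s unfolding zz blk_def by (simp add: right_add_zero_mat[of _ n n])
        finally show ?thesis .
      next
        case False
        hence "swp s y = y" using ys by (simp add: swp_def)
        thus ?thesis using e_M(1)[OF s(1) qy(2) ys] b by (simp add: blk_def)
      qed
      show ?thesis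
      proof (cases "q = s - 1")
        case True
        hence y: "y \<noteq> s - 1" using qy by auto
        have sy: "swp s y = y" using y ys by (simp add: swp_def)
        have sq: "swp s q = s" using True s1 by (simp add: swp_def)
        have r: "transpose_mat (e (swp s y)) * M s = transpose_mat (e y)"
          using e_M(1)[OF s(1) qy(2) ys] sy by simp
        have "blk (M s * X * M s) (swp s y) (swp s q) = transpose_mat (e y) * X * (e q + e s * C s)"
          unfolding a3 r sq using M_e(2)[OF s(1) s(1)] sp True by simp
        also have "\<dots> = transpose_mat (e y) * X * e q + transpose_mat (e y) * (X * e s) * C s"
          using X Cs by (subst mult_add_distrib_mat[of _ n N _ n])
            (auto simp: assoc_mult_mat[of _ n N _ N _ n] assoc_mult_mat[of _ n N _ n _ n] assoc_mult_mat[of _ N N _ n _ n]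
              mult_carrier_mat[of _ N n _ n] intro!: mult_carrier_mat[of _ n N] mult_carrier_mat[of _ N n])
        also have "\<dots> = C 0" using b Cs C[of 0] s unfolding z(2) zz blk_def by (simp add: right_add_zero_mat[of _ n n])
        finally show ?thesis using nc ex by (simp add: linked_def)
      next
        case False
        hence "swp s q = q" using q by (simp add: swp_def)
        moreover have "M s * e q = e q" using M_e(1)[OF s(1) qy(1) q] calculation by simp
        ultimately show ?thesis using nc ex row a3[of "swp s y" q] by (simp add: linked_def)
      qed
    qed
  qed
qed

lemma linked_conj:
  assumes A: "\<And>a. A a \<Longrightarrow> Suc a < j \<and> \<not> A (Suc a)" and j: "j \<le> K"
  shows "mv c t \<Longrightarrow> (\<And>s. s \<in> set t \<Longrightarrow> s < j) \<Longrightarrow> (0 \<in> set t \<Longrightarrow> ex) \<Longrightarrow> X \<in> carrier_mat N N \<Longrightarrow>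
    inj_on p {..<j} \<Longrightarrow> p ` {..<j} \<subseteq> {..<j} \<Longrightarrow> (\<And>l. l < j \<Longrightarrow> \<not> A l \<Longrightarrow> \<not> c (p l)) \<Longrightarrow>
    (\<And>a. A a \<Longrightarrow> linked ex c X (p a) (p (Suc a))) \<Longrightarrow>
    A a \<Longrightarrow> linked ex (stl c t) (conj X t) (prm t (p a)) (prm t (p (Suc a)))"
proof (induction t arbitrary: c X p)
  case (Cons s t)
  have s: "s < j" "s < K" "c s" "s > 0 \<Longrightarrow> \<not> c (s - 1)" using Cons.prems(1) Cons.prems(2)[of s] less_le_trans[OF Cons.prems(2)[of s] j] by simp_all
  have pj: "p l < j" "p l < K" if "l < j" for l using Cons.prems(6) that j by auto
  have inj: "p l = p l' \<longleftrightarrow> l = l'" if "l < j" "l' < j" for l l'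
    using Cons.prems(5) that by (auto simp: inj_on_def)
  have "p ` {..<j} = {..<j}"
    by (rule endo_inj_surj[OF finite_lessThan Cons.prems(6,5)])
  hence "s \<in> p ` {..<j}" using s(1) by simp
  then obtain \<sigma> where \<sigma>: "\<sigma> < j" "p \<sigma> = s" by (elim imageE) simp
  have A\<sigma>: "A \<sigma>" using Cons.prems(7)[of \<sigma>] \<sigma> s by auto
  have ls: "linked ex c X s (p (Suc \<sigma>))" using Cons.prems(8)[OF A\<sigma>] \<sigma> by simp
  hence z: "X * e s = e (p (Suc \<sigma>))" "transpose_mat (e s) * X = transpose_mat (e (p (Suc \<sigma>)))"
    using s by (auto simp: linked_def)
  let ?p = "\<lambda>l. swp s (p l)"
  have step: "linked ex (stp c s) (M s * X * M s) (?p b) (?p (Suc b))" if b: "A b" for b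
  proof (rule linked_step[OF Cons.prems(4) s(2-4), where z = "p (Suc \<sigma>)"])
    note Ab = A[OF b] A[OF A\<sigma>]
    show "linked ex c X (p b) (p (Suc b))" using Cons.prems(8)[OF b] .
    show "\<not> c (p (Suc b))" using Cons.prems(7)[of "Suc b"] Ab by auto
    show "p b \<noteq> p (Suc b)" using Ab inj[of b "Suc b"] by auto
    show "p b \<noteq> s \<Longrightarrow> p (Suc b) \<noteq> p (Suc \<sigma>)" using Ab inj[of "Suc b" "Suc \<sigma>"] \<sigma> by auto
    show "p b \<noteq> p (Suc \<sigma>)" using Ab b inj[of b "Suc \<sigma>"] by auto
    show "s = 0 \<Longrightarrow> ex" using Cons.prems(3) by simp
    show "p b < K" "p (Suc b) < K" "p (Suc \<sigma>) < K" using pj(2)[of b] pj(2)[of "Suc b"] pj(2)[of "Suc \<sigma>"] Ab by simp_all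
  qed (use z in auto)
  have "linked ex (stl (stp c s) t) (conj (M s * X * M s) t) (prm t (?p a)) (prm t (?p (Suc a)))"
  proof (rule Cons.IH[where p = ?p])
    show "inj_on ?p {..<j}"
    proof (rule inj_onI)
      fix l l' assume "l \<in> {..<j}" "l' \<in> {..<j}" "?p l = ?p l'"
      moreover have "p l = p l'" using arg_cong[OF \<open>?p l = ?p l'\<close>, of "swp s"] by simp
      ultimately show "l = l'" using inj[of l l'] by simp
    qed
    show "?p ` {..<j} \<subseteq> {..<j}" using pj s by (auto simp: swp_def less_imp_diff_less)
    show "\<not> stp c s (?p l)" if "l < j" "\<not> A l" for l
      using Cons.prems(7)[OF that] s by (intro stp_swp) auto
  qed (use Cons.prems step in auto)
  thus ?case by simp
qed simp

text \<open>The block at \<open>(y, q)\<close> is nonzero, and commutation multiplies it by \<open>\<rho> (pos y)\<close> and \<open>\<rho> (pos q)\<close>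
  from the two sides.\<close>

lemma linked_commute:
  assumes n: "n > 0" and X: "X \<in> carrier_mat N N" and comm: "sgnm n m \<rho> * X = X * sgnm n m \<rho>"
    and qy: "q < K" "y < K" and l: "linked ex c X q y" and C0: "ex \<Longrightarrow> C 0 \<noteq> 0\<^sub>m n n"
  shows "\<rho> (pos q) = \<rho> (pos y)"
proof -
  let ?R = "sgnm n m \<rho>"
  have Re: "?R * e i = \<rho> (pos i) \<cdot>\<^sub>m e i" if "i < K" for i
    using sgnm_mult_bcol[OF pos_less[OF that]] .
  have XR: "X * (?R * e q) = \<rho> (pos q) \<cdot>\<^sub>m (X * e q)"
    unfolding Re[OF qy(1)] using X by (intro mult_smult_distrib[of _ N N]) auto
  have RX: "?R * (X * e q) = \<rho> (pos q) \<cdot>\<^sub>m (X * e q)"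
  proof -
    have "?R * (X * e q) = ?R * X * e q" using X by (simp add: assoc3[of ?R X _ n])
    also have "\<dots> = X * (?R * e q)" unfolding comm using X by (simp add: assoc3[of X ?R _ n])
    finally show ?thesis using XR by simp
  qed
  show ?thesis using l unfolding linked_def
  proof (elim disjE conjE)
    assume Xe: "X * e q = e y"
    have "\<rho> (pos y) \<cdot>\<^sub>m e y = \<rho> (pos q) \<cdot>\<^sub>m e y" using RX Re[OF qy(2)] unfolding Xe by simp
    moreover have "pos y * n + 0 < N" using n pos_less[OF qy(2)] by (intro block_index_less) auto
    ultimately have "(\<rho> (pos y) \<cdot>\<^sub>m e y) $$ (pos y * n, 0) = (\<rho> (pos q) \<cdot>\<^sub>m e y) $$ (pos y * n, 0)" "pos y * n < N" by auto
    thus ?thesis using n by (simp add: bcol_index)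
  next
    assume b: "blk X y q = C 0" and ex
    have c0: "C 0 \<in> carrier_mat n n" using C qy by auto
    have yR: "transpose_mat (e y) * ?R = \<rho> (pos y) \<cdot>\<^sub>m transpose_mat (e y)"
    proof -
      have "transpose_mat (e y) * ?R = transpose_mat (?R * e y)" by (subst transpose_mult[of _ N N _ n]) auto
      also have "\<dots> = \<rho> (pos y) \<cdot>\<^sub>m transpose_mat (e y)" unfolding Re[OF qy(2)] by (intro eq_matI) auto
      finally show ?thesis .
    qed
    have tc: "transpose_mat (e y) \<in> carrier_mat n N" by simp
    have bl: "blk X y q = transpose_mat (e y) * (X * e q)"
      unfolding blk_def using X by (intro assoc_mult_mat[of _ n N _ N _ n]) auto
    have "\<rho> (pos y) \<cdot>\<^sub>m blk X y q = transpose_mat (e y) * ?R * (X * e q)"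
      unfolding yR bl using X by (intro mult_smult_assoc_mat[symmetric, of _ n N _ n]) auto
    also have "\<dots> = transpose_mat (e y) * (?R * (X * e q))"
      using X by (intro assoc_mult_mat[of _ n N _ N _ n]) auto
    also have "\<dots> = \<rho> (pos q) \<cdot>\<^sub>m blk X y q"
      unfolding RX bl using X by (intro mult_smult_distrib[of _ n N _ n]) auto
    finally have eq: "\<rho> (pos y) \<cdot>\<^sub>m C 0 = \<rho> (pos q) \<cdot>\<^sub>m C 0" unfolding b .
    obtain i j where "i < n" "j < n" "C 0 $$ (i, j) \<noteq> 0"
      using C0[OF \<open>ex\<close>] c0 by (metis eq_matI index_zero_mat carrier_matD)
    thus ?thesis using arg_cong[OF eq, of "\<lambda>Y. Y $$ (i, j)"] c0 by auto
  qed
qed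

lemma evw_linked:
  assumes "j \<le> K" "simple_state 0 j a"
  shows "W (evw j) * e a = e (Suc a)" "transpose_mat (e a) * W (evw j) = transpose_mat (e (Suc a))"
proof -
  have t: "transpose_mat (e i) * M s = transpose_mat (chain.M n m pos (\<lambda>i. transpose_mat (C i)) s * e i)" if "s < K" for i s
    unfolding M_transpose[OF that, symmetric] by (subst transpose_mult[of _ N N _ n]) auto
  have "W (evw j) * e a = e (Suc a) \<and> transpose_mat (e a) * W (evw j) = transpose_mat (e (Suc a))"
    using assms
  proof (induction j rule: evw.induct)
    case (3 j)
    have j: "Suc j < K" "j < K" using 3 by auto
    have a: "a < Suc (Suc j)" "even (Suc (Suc j) - a)" using 3(3) by (auto simp: simple_state_def)
    have l: "W (evw (Suc (Suc j))) * e i = M (Suc j) * (W (evw j) * e i)"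
      "transpose_mat (e i) * W (evw (Suc (Suc j))) = transpose_mat (e i) * M (Suc j) * W (evw j)" for i
      by (simp_all add: assoc3[of _ _ _ n] assoc3'[of "transpose_mat (e i)" n "M (Suc j)" "W (evw j)" N])
    show ?case
    proof (cases "a < j")
      case True
      hence "simple_state 0 j a" using a by (auto simp: simple_state_def Suc_diff_le)
      hence IH: "W (evw j) * e a = e (Suc a)" "transpose_mat (e a) * W (evw j) = transpose_mat (e (Suc a))"
        using 3 by auto
      have "even (j - a)" using a True by (simp add: Suc_diff_le)
      hence "Suc a \<noteq> j" by auto
      hence "Suc a < j" using True by simp
      hence "M (Suc j) * e (Suc a) = e (Suc a)" "transpose_mat (e a) * M (Suc j) = transpose_mat (e a)"
        using M_e(1)[OF j(1), of "Suc a"] e_M(1)[OF j(1), of a] j by (simp_all add: swp_def)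
      thus ?thesis unfolding l using IH by simp
    next
      case False
      have "a \<noteq> Suc j" using a by auto
      hence aj: "a = j" using False a by simp
      have fix1: "W (evw j) * e j = e j"
      proof (rule wprod_fixes[of _ _ N _ n])
        fix i assume "i \<in> set (evw j)"
        hence "i < j" by (rule evw_letters)
        moreover from this have "j \<noteq> i - Suc 0" by simp
        ultimately show "M i * e j = e j" using M_e(1)[of i j] j by (simp add: swp_def)
      qed auto
      have fix2: "transpose_mat (e (Suc j)) * W (evw j) = transpose_mat (e (Suc j))"
      proof -
        have aux: "transpose_mat (e (Suc j)) * W u = transpose_mat (e (Suc j))" if "\<And>s. s \<in> set u \<Longrightarrow> s < j" for u
          using that
        proof (induction u)
          case (Cons s u)
          have "transpose_mat (e (Suc j)) * M s = transpose_mat (e (Suc j))"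
          proof -
            have "s < j" using Cons.prems by simp
            moreover from this have "Suc j \<noteq> s - Suc 0" by simp
            ultimately show ?thesis using e_M(1)[of s "Suc j"] j by (simp add: swp_def)
          qed
          thus ?case using Cons assoc3'[of "transpose_mat (e (Suc j))" n "M s" "W u" N] by simp
        qed simp
        show ?thesis by (rule aux[OF evw_letters])
      qed
      have "M (Suc j) * e j = e (Suc j)" "transpose_mat (e j) * M (Suc j) = transpose_mat (e (Suc j))"
        using M_e(1)[OF j(1), of j] e_M(1)[OF j(1), of j] j by (simp_all add: swp_def)
      thus ?thesis unfolding l aj using fix1 fix2 by simp
    qed
  qed (auto simp: simple_state_def)
  thus "W (evw j) * e a = e (Suc a)" "transpose_mat (e a) * W (evw j) = transpose_mat (e (Suc a))" by auto
qed

lemma palindrome_links: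
  assumes n: "n > 0" and j: "j \<le> K" and t: "mv (simple_state 0 j) t" and C0: "0 \<in> set t \<Longrightarrow> C 0 \<noteq> 0\<^sub>m n n"
    and a: "simple_state 0 j a"
    and X: "X = W (rev t @ evw j @ t)" and comm: "sgnm n m \<rho> * X = X * sgnm n m \<rho>"
  shows "\<rho> (pos (prm t a)) = \<rho> (pos (prm t (Suc a)))"
proof -
  have tl: "s < j" if "s \<in> set t" for s
    using that by (rule mv_letters[OF t, rotated]) (simp add: simple_state_def)
  have A: "Suc b < j \<and> \<not> simple_state 0 j (Suc b)" if "simple_state 0 j b" for b
  proof -
    have "b < j" "even (j - b)" using that by (auto simp: simple_state_def)
    moreover from this have "Suc b \<noteq> j" by auto
    ultimately show ?thesis by (auto simp: simple_state_def)
  qed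
  have prm_less: "prm u i < j" if "\<And>s. s \<in> set u \<Longrightarrow> s < j" "i < j" for u i
    using that by (induction u arbitrary: i) (auto simp: swp_def)
  have "linked (0 \<in> set t) (stl (simple_state 0 j) t) (conj (W (evw j)) t) (prm t a) (prm t (Suc a))"
  proof (rule linked_conj[OF A j t, where p = "\<lambda>l. l"])
    show "linked (0 \<in> set t) (simple_state 0 j) (W (evw j)) b (Suc b)" if "simple_state 0 j b" for b
      using evw_linked[OF j that] that by (simp add: linked_def)
  qed (use tl a in auto)
  moreover have "conj (W (evw j)) t = X"
    unfolding X by (simp add: conj_W W_append assoc_mult_mat[of _ N N _ N _ N])
  ultimately have l: "linked (0 \<in> set t) (stl (simple_state 0 j) t) X (prm t a) (prm t (Suc a))" by simp
  have Xc: "X \<in> carrier_mat N N" by (simp add: X)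
  show ?thesis
    using C0 j A[OF a] prm_less[of t a] prm_less[of t "Suc a"] tl
    by (intro linked_commute[OF n Xc comm _ _ l]) auto
qed

end

lemma prm_evw: "prm (evw K) i = (if i < K then (if odd (K - i) then i - 1 else i + 1) else i)"
proof (induction K arbitrary: i rule: evw.induct)
  case (3 K)
  consider "i = Suc K" | "i = K" | "i < K" | "i > Suc K" by linarith
  thus ?case
  proof cases
    case 3
    thus ?thesis using "3.IH" by (auto simp: swp_def Suc_diff_le)
  qed (auto simp: swp_def "3.IH")
qed (auto simp: swp_def)

lemma prm_fixes: "(\<And>s. s \<in> set t \<Longrightarrow> s < k) \<Longrightarrow> k \<le> i \<Longrightarrow> prm t i = i"
proof (induction t)
  case (Cons s t)
  have "s < k" using Cons.prems(1)[of s] by simp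
  hence "swp s i = i" using Cons.prems(2) by (auto simp: swp_def)
  thus ?case using Cons by simp
qed simp

text \<open>The partners given by the two palindromes, \<open>(a, a + 1)\<close> with \<open>k - a\<close> even and the same with \<open>k + 1\<close> moved by
  \<open>evw k\<close>, interlace to a path through all indices up to \<open>k\<close>.\<close>

lemma links_connect:
  fixes f :: "nat \<Rightarrow> 'a"
  assumes 1: "\<And>a. simple_state 0 k a \<Longrightarrow> f a = f (Suc a)"
    and 2: "\<And>a. simple_state 0 (Suc k) a \<Longrightarrow> f (prm (evw k) a) = f (prm (evw k) (Suc a))"
  shows "i \<le> k \<Longrightarrow> f i = f k"
proof (induction "k - i" arbitrary: i rule: less_induct)
  case less
  show ?case
  proof (cases "i = k")
    case False
    hence ik: "i < k" using less by simp
    have main: "f i = f k" if ev: "even (k - i)" "i < k" and IH: "\<And>l. l > i + 2 \<Longrightarrow> l \<le> k \<Longrightarrow> f l = f k" for i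
    proof -
      have "Suc i \<noteq> k" using ev by auto
      hence "Suc i < k" using ev by simp
      have d: "k - i = Suc (k - Suc i)" "k - Suc i = Suc (k - Suc (Suc i))"
        using \<open>Suc i < k\<close> by simp_all
      hence par: "odd (k - Suc i)" "even (k - Suc (Suc i))" using ev by simp_all
      have "prm (evw k) (Suc i) = i" using par \<open>Suc i < k\<close> by (simp only: prm_evw if_True) simp
      moreover have "simple_state 0 (Suc k) (Suc i)" using ev by (simp add: simple_state_def)
      ultimately have "f i = f (prm (evw k) (Suc (Suc i)))"
        using 2[of "Suc i"] by simp
      also have "\<dots> = f k"
      proof (cases "Suc (Suc i) = k")
        case False
        hence "prm (evw k) (Suc (Suc i)) = i + 3" unfolding prm_evw using par \<open>Suc i < k\<close> by simp
        moreover have "i + 3 \<le> k" using False \<open>Suc i < k\<close> by simp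
        ultimately show ?thesis using IH[of "i + 3"] by simp
      qed (simp add: prm_evw)
      finally show ?thesis .
    qed
    show ?thesis
    proof (cases "even (k - i)")
      case True
      show ?thesis
      proof (rule main[OF True ik])
        fix l assume "l > i + 2" "l \<le> k"
        thus "f l = f k" by (intro less(1)) auto
      qed
    next
      case odd: False
      show ?thesis
      proof (cases i)
        case 0
        hence s: "simple_state 0 (Suc k) 0" using odd by (simp add: simple_state_def)
        show ?thesis
        proof (cases "k = 1")
          case True
          hence "prm (evw k) 0 = 0" "prm (evw k) (Suc 0) = Suc 0" by (simp_all add: swp_def)
          thus ?thesis using 2[OF s] 0 True by simp
        next
          case False
          hence "Suc 0 < k" using ik 0 by simp
          hence "k = Suc (k - Suc 0)" by simp
          hence par: "odd k" "even (k - Suc 0)" using odd 0 by simp_all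
          have "prm (evw k) 0 = 0" "prm (evw k) (Suc 0) = 2"
            unfolding prm_evw using par \<open>Suc 0 < k\<close> by simp_all
          hence "f 0 = f 2" using 2[OF s] by simp
          thus ?thesis using less(1)[of 2] \<open>Suc 0 < k\<close> 0 by simp
        qed
      next
        case (Suc i')
        have "k - i' = Suc (k - i)" using Suc ik by simp
        hence ev: "even (k - i')" "i' < k" using odd Suc ik by simp_all
        hence "f i' = f i" using 1[of i'] Suc by (simp add: simple_state_def)
        moreover have "f i' = f k"
        proof (rule main[OF ev])
          fix l assume "l > i' + 2" "l \<le> k"
          thus "f l = f k" using Suc by (intro less(1)) auto
        qed
        ultimately show ?thesis by simp
      qed
    qed
  qed simp
qed

section \<open>Block elimination in a Fiedler pencil\<close>

text \<open>A set instead of a type, so that proper rational functions and all polynomials can be treated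
  in the same elimination.\<close>

definition subring :: "'a :: comm_ring_1 set \<Rightarrow> bool"
  where "subring S \<longleftrightarrow> 0 \<in> S \<and> 1 \<in> S \<and> (\<forall>x \<in> S. \<forall>y \<in> S. x + y \<in> S \<and> x * y \<in> S \<and> - x \<in> S)"

definition mat_over :: "'a set \<Rightarrow> 'a mat \<Rightarrow> bool"
  where "mat_over S X \<longleftrightarrow> (\<forall>i < dim_row X. \<forall>j < dim_col X. X $$ (i, j) \<in> S)"

lemma subringD:
  assumes "subring S"
  shows "0 \<in> S" "1 \<in> S" "x \<in> S \<Longrightarrow> y \<in> S \<Longrightarrow> x + y \<in> S" "x \<in> S \<Longrightarrow> y \<in> S \<Longrightarrow> x * y \<in> S" "x \<in> S \<Longrightarrow> - x \<in> S"
  using assms by (auto simp: subring_def)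

lemma subring_sum: "subring S \<Longrightarrow> (\<And>i. i \<in> I \<Longrightarrow> f i \<in> S) \<Longrightarrow> sum f I \<in> S"
  by (induction I rule: infinite_finite_induct) (auto simp: subringD)

lemma subring_prod: "subring S \<Longrightarrow> (\<And>i. i \<in> I \<Longrightarrow> f i \<in> S) \<Longrightarrow> prod f I \<in> S"
  by (induction I rule: infinite_finite_induct) (auto simp: subringD)

lemma mat_over_mult:
  assumes "subring S" "mat_over S X" "mat_over S Y" "dim_col X = dim_row Y"
  shows "mat_over S (X * Y)"
  using assms by (auto simp: mat_over_def scalar_prod_def intro!: subring_sum subringD(4))

lemma mat_over_add:
  assumes "subring S" "mat_over S X" "mat_over S Y" "dim_row X = dim_row Y" "dim_col X = dim_col Y"
  shows "mat_over S (X + Y)"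
  using assms by (auto simp: mat_over_def subringD)

lemma mat_over_uminus: "subring S \<Longrightarrow> mat_over S X \<Longrightarrow> mat_over S (- X)"
  by (auto simp: mat_over_def subringD)

lemma mat_over_smult: "subring S \<Longrightarrow> k \<in> S \<Longrightarrow> mat_over S X \<Longrightarrow> mat_over S (k \<cdot>\<^sub>m X)"
  by (auto simp: mat_over_def subringD)

lemma mat_over_zero: "subring S \<Longrightarrow> mat_over S (0\<^sub>m a b)"
  by (auto simp: mat_over_def subringD)

lemma mat_over_one: "subring S \<Longrightarrow> mat_over S (1\<^sub>m a)"
  by (auto simp: mat_over_def subringD)

lemma mat_over_bcol: "subring S \<Longrightarrow> mat_over S (bcol n m a)"
  by (auto simp: mat_over_def subringD bcol_def)

lemma mat_over_transpose: "mat_over S X \<Longrightarrow> mat_over S (transpose_mat X)"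
  by (auto simp: mat_over_def)

lemma mat_over_gen: "subring S \<Longrightarrow> mat_over S C \<Longrightarrow> C \<in> carrier_mat n n \<Longrightarrow> mat_over S (gen n m p q C)"
  unfolding mat_over_def by (auto simp: gen_index subringD block_mod_less)

lemma mat_over_wprod:
  assumes S: "subring S" and M: "\<And>i. i \<in> set t \<Longrightarrow> M i \<in> carrier_mat N N \<and> mat_over S (M i)"
  shows "mat_over S (wprod N M t)"
  using M
proof (induction t)
  case (Cons i t)
  have "wprod N M t \<in> carrier_mat N N" using Cons.prems by (intro wprod_carrier) auto
  moreover have "M i \<in> carrier_mat N N" "mat_over S (M i)" "mat_over S (wprod N M t)" using Cons by auto
  ultimately show ?case unfolding wprod_simps by (intro mat_over_mult[OF S]) auto
qed (use S in \<open>simp add: mat_over_one\<close>)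

lemma mat_over_four_block:
  assumes "A \<in> carrier_mat a1 b1" "B \<in> carrier_mat a1 b2" "C \<in> carrier_mat a2 b1" "D \<in> carrier_mat a2 b2"
    and "mat_over S A" "mat_over S B" "mat_over S C" "mat_over S D"
  shows "mat_over S (four_block_mat A B C D)"
  using assms by (auto simp: mat_over_def)

abbreviation bdiag :: "nat \<Rightarrow> nat \<Rightarrow> 'a :: zero mat \<Rightarrow> 'a mat \<Rightarrow> 'a mat"
  where "bdiag a b X Y \<equiv> four_block_mat X (0\<^sub>m a b) (0\<^sub>m b a) Y"

lemma bdiag_mult:
  fixes X :: "'a :: semiring_1 mat"
  assumes "X \<in> carrier_mat a a" "X' \<in> carrier_mat a a" "Y \<in> carrier_mat b b" "Y' \<in> carrier_mat b b"
  shows "bdiag a b X Y * bdiag a b X' Y' = bdiag a b (X * X') (Y * Y')"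
  using assms by (subst mult_four_block_mat[of _ a a _ b _ b _ _ a _ b]) auto

lemma gen_Suc_shift:
  assumes "n > 0" "p > 0" "q > 0" "C \<in> carrier_mat n n"
  shows "gen n (Suc m) p q C = bdiag n (m * n) (1\<^sub>m n) (gen n m (p - 1) (q - 1) C)" (is "_ = ?R")
proof (rule eq_matI)
  fix i j assume "i < dim_row ?R" "j < dim_col ?R"
  hence ij: "i < Suc m * n" "j < Suc m * n" by auto
  have d: "i div n = (if i < n then 0 else Suc ((i - n) div n))" "i mod n = (if i < n then i else (i - n) mod n)" for i
    using assms(1) by (auto simp: le_div_geq le_mod_geq not_less)
  have pq: "p = Suc (p - 1)" "q = Suc (q - 1)" using assms by auto
  show "gen n (Suc m) p q C $$ (i, j) = ?R $$ (i, j)"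
  proof (cases "i < n"; cases "j < n")
    assume "\<not> i < n" "\<not> j < n"
    hence l: "i - n < m * n" "j - n < m * n" "i = j \<longleftrightarrow> i - n = j - n" using ij by auto
    have s: "Suc x = p \<longleftrightarrow> x = p - 1" "Suc x = q \<longleftrightarrow> x = q - 1" for x using pq by auto
    show ?thesis unfolding gen_index[OF ij] using \<open>\<not> i < n\<close> \<open>\<not> j < n\<close> ij l(3)
      by (simp add: gen_index[OF l(1,2)] d[of i] d[of j] s)
  qed (use assms ij in \<open>auto simp: gen_index d[of i] d[of j]\<close>)
qed (use assms in auto)

lemma gen_Suc_first:
  assumes "n > 0" "C \<in> carrier_mat n n"
  shows "gen n (Suc m) 0 0 C = bdiag n (m * n) C (1\<^sub>m (m * n))" (is "_ = ?R")
proof (rule eq_matI)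
  fix i j assume "i < dim_row ?R" "j < dim_col ?R"
  hence ij: "i < Suc m * n" "j < Suc m * n" using assms by auto
  have d: "i div n = 0 \<longleftrightarrow> i < n" for i using assms(1) by (simp add: div_eq_0_iff)
  show "gen n (Suc m) 0 0 C $$ (i, j) = ?R $$ (i, j)"
    unfolding gen_index[OF ij] d using assms ij by auto
qed (use assms in auto)

lemma gen_Suc_second:
  assumes n: "n > 0" and m: "m > 0" and C: "C \<in> carrier_mat n n"
  shows "gen n (Suc m) 1 0 C =
    four_block_mat (0\<^sub>m n n) (transpose_mat (bcol n m 0)) (bcol n m 0) (gen n m 0 0 C)" (is "_ = ?R")
proof (rule eq_matI)
  fix i j assume "i < dim_row ?R" "j < dim_col ?R"
  hence ij: "i < Suc m * n" "j < Suc m * n" using assms by auto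
  have d: "i div n = (if i < n then 0 else Suc ((i - n) div n))" "i mod n = (if i < n then i else (i - n) mod n)" for i
    using assms(1) by (auto simp: le_div_geq le_mod_geq not_less)
  have z: "x div n = 0 \<longleftrightarrow> x < n" for x using n by (simp add: div_eq_0_iff)
  show "gen n (Suc m) 1 0 C $$ (i, j) = ?R $$ (i, j)"
  proof (cases "i < n"; cases "j < n")
    assume c: "\<not> i < n" "\<not> j < n"
    hence l: "i - n < m * n" "j - n < m * n" "i = j \<longleftrightarrow> i - n = j - n" using ij by auto
    show ?thesis unfolding gen_index[OF ij] using c ij l(3)
      by (simp add: gen_index[OF l(1,2)] d[of i] d[of j])
  next
    assume c: "i < n" "\<not> j < n"
    hence "j - n < m * n" using ij by auto
    thus ?thesis unfolding gen_index[OF ij] using c ij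
      by (auto simp: d[of i] d[of j] bcol_index z)
  next
    assume c: "\<not> i < n" "j < n"
    hence "i - n < m * n" using ij by auto
    thus ?thesis unfolding gen_index[OF ij] using c ij
      by (auto simp: d[of i] d[of j] bcol_index z)
  next
    assume c: "i < n" "j < n"
    thus ?thesis unfolding gen_index[OF ij] using c ij by (auto simp: d[of i] d[of j])
  qed
qed (use assms in auto)

lemma gen_add_diagonal:
  fixes C D :: "'a :: comm_ring_1 mat"
  assumes C: "C \<in> carrier_mat n n" and D: "D \<in> carrier_mat n n" and p: "p < m"
  shows "gen n m p p C + bcol n m p * D * transpose_mat (bcol n m p) = gen n m p p (C + D)"
proof (rule eq_matI)
  let ?b = "bcol n m p :: 'a mat"
  have Db: "D * transpose_mat ?b \<in> carrier_mat n (m * n)" using D by (auto intro!: mult_carrier_mat[of _ _ n])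
  have tr: "D * transpose_mat ?b = transpose_mat (?b * transpose_mat D)"
  proof -
    have "transpose_mat D \<in> carrier_mat n n" using D by simp
    from transpose_mult[OF bcol_carrier this, of m p] show ?thesis by (simp only: transpose_transpose)
  qed
  have as: "?b * D * transpose_mat ?b = ?b * (D * transpose_mat ?b)"
    by (rule assoc_mult_mat[OF bcol_carrier D]) auto
  fix i j assume "i < dim_row (gen n m p p (C + D))" "j < dim_col (gen n m p p (C + D))"
  hence i: "i < m * n" and j: "j < m * n" by auto
  note md = block_mod_less[OF i] block_mod_less[OF j]
  have tD: "transpose_mat D \<in> carrier_mat n n" using D by simp
  have "(D * transpose_mat ?b) $$ (i mod n, j) = (?b * transpose_mat D) $$ (j, i mod n)"
    unfolding tr using j md D by simp
  also have "\<dots> = (if j div n = p then D $$ (i mod n, j mod n) else 0)"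
    unfolding bcol_mult_index[OF tD j md(1)] using md D by simp
  finally have 1: "(?b * D * transpose_mat ?b) $$ (i, j) = (if i div n = p then if j div n = p then D $$ (i mod n, j mod n) else 0 else 0)"
    unfolding as bcol_mult_index[OF Db i j] by simp
  have "(gen n m p p C + ?b * D * transpose_mat ?b) $$ (i, j) = gen n m p p C $$ (i, j) + (?b * D * transpose_mat ?b) $$ (i, j)"
    by (rule index_add_mat(1)) (use i j in auto)
  thus "(gen n m p p C + ?b * D * transpose_mat ?b) $$ (i, j) = gen n m p p (C + D) $$ (i, j)"
    unfolding 1 gen_index[OF i j] using md C D by auto
qed auto

lemma wprod_shift:
  fixes C :: "nat \<Rightarrow> 'a :: comm_ring_1 mat"
  assumes n: "n > 0" and u: "\<And>i. i \<in> set u \<Longrightarrow> i \<ge> 2 \<and> C i \<in> carrier_mat n n"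
  shows "wprod (Suc m * n) (\<lambda>i. gen n (Suc m) i (i - 1) (C i)) u =
    bdiag n (m * n) (1\<^sub>m n) (wprod (m * n) (\<lambda>i. gen n m i (i - 1) (C (Suc i))) (map (\<lambda>i. i - 1) u))"
  using u
proof (induction u)
  case Nil
  show ?case by simp
next
  case (Cons i u)
  let ?w = "wprod (m * n) (\<lambda>i. gen n m i (i - 1) (C (Suc i))) (map (\<lambda>i. i - 1) u)"
  have i: "i \<ge> 2" "C i \<in> carrier_mat n n" using Cons.prems by auto
  have w: "?w \<in> carrier_mat (m * n) (m * n)" by (intro wprod_carrier) auto
  have "gen n (Suc m) i (i - 1) (C i) = bdiag n (m * n) (1\<^sub>m n) (gen n m (i - 1) (i - 1 - 1) (C (Suc (i - 1))))"
    using i n by (subst gen_Suc_shift) auto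
  thus ?case using Cons.IH Cons.prems w by (simp add: bdiag_mult[of _ n _ _ "m * n"])
qed

text \<open>In this form \<open>l\<close> may be \<open>\<lambda>\<close> or \<open>1/\<lambda>\<close>, and \<open>C i\<close> is the coefficient of \<open>l\<close> to the power \<open>m - i\<close>.\<close>

definition leading_eval :: "nat \<Rightarrow> 'a :: comm_ring_1 \<Rightarrow> nat \<Rightarrow> (nat \<Rightarrow> 'a mat) \<Rightarrow> 'a mat \<Rightarrow> 'a mat"
  where "leading_eval n l m C A0 = mat n n (\<lambda>(a, b). (\<Sum>i<m. l ^ (m - i) * C i $$ (a, b)) + A0 $$ (a, b))"

lemma leading_eval_step:
  assumes m: "m > 0" and C: "\<And>i. i < Suc m \<Longrightarrow> C i \<in> carrier_mat n n"
  shows "leading_eval n l m (\<lambda>i. if i = 0 then C 1 + l \<cdot>\<^sub>m C 0 else C (Suc i)) A0 = leading_eval n l (Suc m) C A0"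
proof (rule eq_matI)
  fix a b assume "a < dim_row (leading_eval n l (Suc m) C A0)" "b < dim_col (leading_eval n l (Suc m) C A0)"
  hence ab: "a < n" "b < n" by (auto simp: leading_eval_def)
  obtain k where k: "m = Suc k" using m by (cases m) auto
  have C01: "C 0 \<in> carrier_mat n n" "C 1 \<in> carrier_mat n n" using C k by auto
  have "(\<Sum>i<m. l ^ (m - i) * (if i = 0 then C 1 + l \<cdot>\<^sub>m C 0 else C (Suc i)) $$ (a, b)) =
    l ^ m * (C 1 $$ (a, b) + l * C 0 $$ (a, b)) + (\<Sum>i<k. l ^ (k - i) * C (Suc (Suc i)) $$ (a, b))"
    unfolding k sum.lessThan_Suc_shift using ab C01 by simp
  also have "\<dots> = (\<Sum>i<Suc m. l ^ (Suc m - i) * C i $$ (a, b))"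
    unfolding k sum.lessThan_Suc_shift by (simp add: algebra_simps)
  finally show "leading_eval n l m (\<lambda>i. if i = 0 then C 1 + l \<cdot>\<^sub>m C 0 else C (Suc i)) A0 $$ (a, b) =
      leading_eval n l (Suc m) C A0 $$ (a, b)"
    using ab by (simp add: leading_eval_def)
qed (auto simp: leading_eval_def)

text \<open>All letters except 1 commute with 0, so the factors 0 and 1 can be made adjacent, in one of the
  two orders.\<close>

lemma word_split:
  fixes C :: "nat \<Rightarrow> 'a :: comm_ring_1 mat"
  assumes n: "n > 0" and m: "m > 0" and C: "\<And>i. i < Suc m \<Longrightarrow> C i \<in> carrier_mat n n"
    and w: "distinct w" "set w = {..<Suc m}"
  defines "G \<equiv> \<lambda>i. gen n (Suc m) i (i - 1) (C i)"
  obtains u v where "distinct (u @ v)" "set (u @ v) = {2..<Suc m}"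
    "wprod (Suc m * n) G w = wprod (Suc m * n) G u * (G 0 * G 1) * wprod (Suc m * n) G v \<or>
     wprod (Suc m * n) G w = wprod (Suc m * n) G u * (G 1 * G 0) * wprod (Suc m * n) G v"
proof -
  define N where "N = Suc m * n"
  let ?W = "wprod N G"
  have Gc: "G i \<in> carrier_mat N N" for i unfolding G_def N_def by (rule gen_carrier)
  have Wc: "?W t \<in> carrier_mat N N" for t by (intro wprod_carrier Gc)
  have Wa: "?W (s @ t) = ?W s * ?W t" for s t by (intro wprod_append Gc)
  note Gm = mult_carrier_mat[of _ "N" "N" _ "N"]
  note as = assoc_mult_mat[of _ "N" "N" _ "N" _ "N"]
  have G1: "X * 1\<^sub>m N = X" if "X \<in> carrier_mat N N" for X :: "'a mat" using that by (rule right_mult_one_mat)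
  have comm0: "?W t * G 0 = G 0 * ?W t" if t: "set t \<subseteq> {2..<Suc m}" for t
  proof -
    have "G i * G 0 = G 0 * G i" if i: "i \<in> set t" for i
    proof -
      have "i \<ge> 2" "i < Suc m" using i t by auto
      thus ?thesis unfolding G_def using C by (intro gen_comm) auto
    qed
    hence "?W t * ?W [0] = ?W [0] * ?W t" by (intro wprod_comm Gc) auto
    thus ?thesis using G1[OF Gc] by simp
  qed
  have comm0': "?W t * (G 0 * X) = G 0 * (?W t * X)" if "set t \<subseteq> {2..<Suc m}" "X \<in> carrier_mat N N" for t X
    using comm0[OF that(1)] as[OF Wc Gc that(2), of t 0] as[OF Gc Wc that(2), of 0 t] by simp
  have rng: "{..<Suc m} - {0, 1} = {2..<Suc m}"
  proof (intro equalityI subsetI)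
    fix i :: nat assume "i \<in> {..<Suc m} - {0, 1}"
    thus "i \<in> {2..<Suc m}" by (cases i) auto
  qed auto
  have "0 \<in> set w" "1 \<in> set w" using w m by auto
  then obtain x y where xy: "w = x @ 0 # y" using split_list by metis
  show ?thesis
  proof (cases "1 \<in> set y")
    case True
    then obtain y1 z where y: "y = y1 @ 1 # z" using split_list by metis
    have dist: "distinct ((x @ y1) @ z)" using w unfolding xy y by auto
    have ss: "set ((x @ y1) @ z) = {2..<Suc m}"
    proof -
      have "set ((x @ y1) @ z) = set w - {0, 1}" using w(1) unfolding xy y by auto
      thus ?thesis unfolding w(2) rng .
    qed
    have "?W w = ?W x * (G 0 * (?W y1 * (G 1 * ?W z)))" by (simp add: xy y Wa)
    also have "\<dots> = ?W x * (?W y1 * G 0) * (G 1 * ?W z)"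
    proof -
      have "set y1 \<subseteq> {2..<Suc m}" using ss by auto
      thus ?thesis using comm0'[of y1 "G 1 * ?W z"] by (simp add: as Gm Gc Wc)
    qed
    also have "\<dots> = ?W (x @ y1) * (G 0 * G 1) * ?W z"
      by (simp add: as Gm Gc Wc Wa)
    finally show ?thesis using that[OF dist ss] by (simp add: N_def)
  next
    case False
    hence "1 \<in> set x" using \<open>1 \<in> set w\<close> xy by auto
    then obtain x1 x2 where x: "x = x1 @ 1 # x2" using split_list by metis
    have dist: "distinct (x1 @ (x2 @ y))" using w unfolding xy x by auto
    have ss: "set (x1 @ (x2 @ y)) = {2..<Suc m}"
    proof -
      have "set (x1 @ (x2 @ y)) = set w - {0, 1}" using w(1) unfolding xy x by auto
      thus ?thesis unfolding w(2) rng .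
    qed
    have "?W w = ?W x1 * (G 1 * (?W x2 * (G 0 * ?W y)))" by (simp add: xy x Wa as Gm Gc Wc)
    also have "\<dots> = ?W x1 * (G 1 * (?W x2 * G 0) * ?W y)"
      by (simp add: as Gm Gc Wc)
    also have "\<dots> = ?W x1 * (G 1 * G 0) * ?W (x2 @ y)"
    proof -
      have "set x2 \<subseteq> {2..<Suc m}" using ss by auto
      thus ?thesis using comm0'[of x2 "?W y"] by (simp add: as Gm Gc Wc Wa)
    qed
    finally show ?thesis using that[OF dist ss] by (simp add: N_def)
  qed
qed

lemma det_bdiag:
  fixes X Y :: "'a :: idom mat"
  assumes "X \<in> carrier_mat a a" "Y \<in> carrier_mat b b"
  shows "det (bdiag a b X Y) = det X * det Y"
  using assms by (intro det_four_block_mat_upper_right_zero) auto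

lemma det_unitriangular:
  fixes R R' :: "'a :: idom mat"
  shows "R \<in> carrier_mat a b \<Longrightarrow> det (four_block_mat (1\<^sub>m a) R (0\<^sub>m b a) (1\<^sub>m b)) = 1"
    and "R' \<in> carrier_mat b a \<Longrightarrow> det (four_block_mat (- 1\<^sub>m a) (0\<^sub>m a b) R' (1\<^sub>m b)) \<in> {1, -1}"
proof -
  show "R \<in> carrier_mat a b \<Longrightarrow> det (four_block_mat (1\<^sub>m a) R (0\<^sub>m b a) (1\<^sub>m b)) = 1"
    by (subst det_four_block_mat_lower_left_zero[of _ a _ b]) auto
  have "(- 1\<^sub>m a :: 'a mat) = (-1) \<cdot>\<^sub>m 1\<^sub>m a" by (intro eq_matI) auto
  hence "det (- 1\<^sub>m a :: 'a mat) = (-1) ^ a" by simp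
  moreover have "(-1 :: 'a) ^ a \<in> {1, -1}" by (cases "even a") auto
  moreover have "det (four_block_mat (- 1\<^sub>m a) (0\<^sub>m a b) R' (1\<^sub>m b)) = det (- 1\<^sub>m a :: 'a mat)"
    if "R' \<in> carrier_mat b a"
    using that by (subst det_four_block_mat_upper_right_zero[of _ a _ b]) auto
  ultimately show "R' \<in> carrier_mat b a \<Longrightarrow> det (four_block_mat (- 1\<^sub>m a) (0\<^sub>m a b) R' (1\<^sub>m b)) \<in> {1, -1}"
    by simp
qed

text \<open>The pivot \<open>- I\<close> in the first block is its own inverse, so the elimination needs no division.\<close>

lemma schur_step:
  fixes R c D' F :: "'a :: comm_ring_1 mat"
  assumes R: "R \<in> carrier_mat a b" and c: "c \<in> carrier_mat b a" and F: "F \<in> carrier_mat b b"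
  shows "four_block_mat (- 1\<^sub>m a) (0\<^sub>m a b) c (1\<^sub>m b) * four_block_mat (- 1\<^sub>m a) R c F *
    four_block_mat (1\<^sub>m a) R (0\<^sub>m b a) (1\<^sub>m b) = bdiag a b (1\<^sub>m a) (F + c * R)"
proof -
  have neg: "- 1\<^sub>m a * (- 1\<^sub>m a) = (1\<^sub>m a :: 'a mat)" "- 1\<^sub>m a * R = - R" "c * - 1\<^sub>m a = - c"
    using R c by (simp_all add: uminus_mult_left_mat uminus_mult_right_mat)
  have cR: "c * R \<in> carrier_mat b b" using c R by (rule mult_carrier_mat)
  have "four_block_mat (- 1\<^sub>m a) (0\<^sub>m a b) c (1\<^sub>m b) * four_block_mat (- 1\<^sub>m a) R c F =
      four_block_mat (1\<^sub>m a) (- R) (0\<^sub>m b a) (c * R + F)"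
  proof -
    have "- c + c = 0\<^sub>m b a" using c by auto
    thus ?thesis using R c F cR
      by (subst mult_four_block_mat[of _ a a _ b _ b _ _ a _ b]) (auto simp: neg)
  qed
  also have "\<dots> * four_block_mat (1\<^sub>m a) R (0\<^sub>m b a) (1\<^sub>m b) = bdiag a b (1\<^sub>m a) (F + c * R)"
  proof -
    have "R + - R = 0\<^sub>m a b" using R by auto
    thus ?thesis using R c F cR
      by (subst mult_four_block_mat[of _ a a _ b _ b _ _ a _ b]) (auto simp: comm_add_mat[of _ b b])
  qed
  finally show ?thesis .
qed

lemma bdiag_one_one:
  fixes P :: "'a :: semiring_1 mat"
  assumes P: "P \<in> carrier_mat n n" and m: "m > 0"
  shows "bdiag n (m * n) (1\<^sub>m n) (bdiag ((m - 1) * n) n (1\<^sub>m ((m - 1) * n)) P) = bdiag (m * n) n (1\<^sub>m (m * n)) P"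
proof -
  define q where "q = (m - 1) * n"
  have mn: "m * n = n + q" using m by (cases m) (auto simp: q_def)
  have qz: "bdiag q 0 (1\<^sub>m q) (0\<^sub>m 0 0) = (1\<^sub>m q :: 'a mat)" by (intro eq_matI) auto
  have pz: "bdiag n 0 P (0\<^sub>m 0 0) = P" using P by (intro eq_matI) auto
  have "diag_block_mat [1\<^sub>m n, 1\<^sub>m q, P] = bdiag n (n + q) (1\<^sub>m n) (bdiag q n (1\<^sub>m q) P)"
    using P pz by (simp add: Let_def add.commute)
  moreover have "diag_block_mat ([1\<^sub>m n, 1\<^sub>m q] @ [P]) = bdiag (n + q) n (1\<^sub>m (n + q)) P"
    unfolding diag_block_mat_last using P qz by (simp add: Let_def)
  ultimately show ?thesis unfolding mn q_def[symmetric] by simp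
qed

lemma bcol_last_Suc:
  assumes "m > 0"
  shows "bcol n (Suc m) m = four_block_mat (0\<^sub>m n n) (0\<^sub>m n 0) (bcol n m (m - 1)) (0\<^sub>m (m * n) 0)" (is "_ = ?R")
proof (rule eq_matI)
  have mn: "m * n = (m - 1) * n + n" using assms by (cases m) auto
  fix i j assume "i < dim_row ?R" "j < dim_col ?R"
  hence ij: "i < Suc m * n" "i < n + m * n" "j < n" by auto
  show "bcol n (Suc m) m $$ (i, j) = ?R $$ (i, j)"
  proof (cases "i < n")
    case True
    hence "i \<noteq> m * n + j" using mn by linarith
    thus ?thesis using True ij by (simp add: bcol_index[OF ij(1,3)])
  next
    case False
    hence "i - n < m * n" "i = m * n + j \<longleftrightarrow> i - n = (m - 1) * n + j" using ij mn by linarith+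
    thus ?thesis using False ij by (simp add: bcol_index[OF ij(1,3)] bcol_index)
  qed
qed auto

lemma fixes_last:
  fixes U :: "'a :: comm_ring_1 mat"
  assumes m: "m > 0" and U: "U \<in> carrier_mat (m * n) (m * n)"
    and X: "X \<in> carrier_mat n n" and Y: "Y \<in> carrier_mat (m * n) n" and fixed: "U * bcol n m (m - 1) = bcol n m (m - 1)"
  shows "four_block_mat X (0\<^sub>m n (m * n)) Y U * bcol n (Suc m) m = bcol n (Suc m) m"
  unfolding bcol_last_Suc[OF m] using assms
  by (subst mult_four_block_mat[of _ n n _ "m * n" _ "m * n" _ _ n _ 0]) auto

lemma fixes_last':
  fixes V :: "'a :: comm_ring_1 mat"
  assumes m: "m > 0" and V: "V \<in> carrier_mat (m * n) (m * n)"
    and X: "X \<in> carrier_mat n n" and Y: "Y \<in> carrier_mat n (m * n)"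
    and fixed: "transpose_mat (bcol n m (m - 1)) * V = transpose_mat (bcol n m (m - 1))"
  shows "transpose_mat (bcol n (Suc m) m) * four_block_mat X Y (0\<^sub>m (m * n) n) V = transpose_mat (bcol n (Suc m) m)"
proof -
  have t: "transpose_mat (bcol n (Suc m) m :: 'a mat) = four_block_mat (0\<^sub>m n n) (transpose_mat (bcol n m (m - 1))) (0\<^sub>m 0 n) (0\<^sub>m 0 (m * n))"
    unfolding bcol_last_Suc[OF m] by (subst transpose_four_block_mat[of _ n n _ 0 _ "m * n"]) auto
  show ?thesis
    unfolding t using V X Y fixed
    by (subst mult_four_block_mat[of _ n n _ "m * n" _ 0 _ _ n _ "m * n"]) auto
qed

text \<open>Induction on the number of blocks. The first block of the pencil has the pivot \<open>- I\<close>, which comes from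
  the second summand, and eliminating it
  replaces \<open>C 1\<close> by \<open>C 1 + l C 0\<close>: a Horner step. Both elimination matrices are block triangular and
  touch the last block row and column only in ways that fix the last unit block.\<close>

lemma fiedler_elimination:
  fixes C :: "nat \<Rightarrow> 'a :: idom mat"
  assumes n: "n > 0" and S: "subring S" "l \<in> S" and A0: "A0 \<in> carrier_mat n n" "mat_over S A0" and m: "m > 0"
    and C: "\<And>i. i < m \<Longrightarrow> C i \<in> carrier_mat n n \<and> mat_over S (C i)"
    and w: "distinct w" "set w = {..<m}"
  shows "\<exists>U V. U \<in> carrier_mat (m * n) (m * n) \<and> V \<in> carrier_mat (m * n) (m * n) \<and>
    mat_over S U \<and> mat_over S V \<and> det U \<in> {1, -1} \<and> det V \<in> {1, -1} \<and>
    U * (l \<cdot>\<^sub>m wprod (m * n) (\<lambda>i. gen n m i (i - 1) (C i)) w - gen n m (m - 1) (m - 1) (- A0)) * V =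
      bdiag ((m - 1) * n) n (1\<^sub>m ((m - 1) * n)) (leading_eval n l m C A0) \<and>
    U * bcol n m (m - 1) = bcol n m (m - 1) \<and>
    transpose_mat (bcol n m (m - 1)) * V = transpose_mat (bcol n m (m - 1))"
  using m C w
proof (induction m arbitrary: C w rule: nat_induct_non_zero)
  case 1
  hence w: "w = [0]" by (metis distinct_length_2_or_more lessThan_0 lessThan_Suc_eq_insert_0 One_nat_def image_empty set_empty2 insert_not_empty distinct.simps(2) list.exhaust list.set(2) singleton_iff subset_singletonD subset_insertI insertI1 set_subset_Cons)
  have g: "gen n (Suc 0) 0 0 X = X" if "X \<in> carrier_mat n n" for X :: "'a mat"
    using that n by (intro eq_matI) (auto simp: gen_index)
  have C0: "C 0 \<in> carrier_mat n n" using 1 by auto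
  have "l \<cdot>\<^sub>m C 0 - - A0 = leading_eval n l 1 C A0"
    using C0 A0 by (intro eq_matI) (auto simp: leading_eval_def)
  hence "l \<cdot>\<^sub>m wprod (1 * n) (\<lambda>i. gen n 1 i (i - 1) (C i)) w - gen n 1 (1 - 1) (1 - 1) (- A0) = leading_eval n l 1 C A0"
    using C0 A0 by (simp add: w g)
  moreover have P: "leading_eval n l 1 C A0 \<in> carrier_mat n n" by (simp add: leading_eval_def)
  moreover have "bdiag 0 n (1\<^sub>m 0) X = X" if "X \<in> carrier_mat n n" for X :: "'a mat"
    using that by (intro eq_matI) auto
  ultimately show ?case
    by (intro exI[of _ "1\<^sub>m n"]) (auto simp: mat_over_one S)
next
  case (Suc m)
  let ?N = "m * n"
  define C' where "C' = (\<lambda>i. if i = 0 then C 1 + l \<cdot>\<^sub>m C 0 else C (Suc i))"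
  define G where "G = (\<lambda>i. gen n (Suc m) i (i - 1) (C i))"
  define G' where "G' = (\<lambda>i. gen n m i (i - 1) (C' i))"
  have C: "C i \<in> carrier_mat n n" "mat_over S (C i)" if "i < Suc m" for i using Suc.prems that by auto
  have C01: "C 0 \<in> carrier_mat n n" "C 1 \<in> carrier_mat n n" "mat_over S (C 0)" "mat_over S (C 1)" using C Suc.hyps by auto
  have C'c: "C' i \<in> carrier_mat n n" "mat_over S (C' i)" if "i < m" for i
  proof -
    have "C 1 + l \<cdot>\<^sub>m C 0 \<in> carrier_mat n n" using C01 by auto
    moreover have "mat_over S (C 1 + l \<cdot>\<^sub>m C 0)"
      by (rule mat_over_add[OF S(1) C01(4) mat_over_smult[OF S C01(3)]]) (use C01 in auto)
    ultimately show "C' i \<in> carrier_mat n n" "mat_over S (C' i)"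
      using that C[of "Suc i"] by (auto simp: C'_def)
  qed
  have g01: "gen n (Suc m) 0 (0 - 1) (C 0) = G 0" "gen n (Suc m) 1 (1 - 1) (C 1) = G 1"
    by (simp_all only: G_def)
  obtain u v where uv: "distinct (u @ v)" "set (u @ v) = {2..<Suc m}"
    and split: "wprod (Suc m * n) G w = wprod (Suc m * n) G u * (G 0 * G 1) * wprod (Suc m * n) G v \<or>
      wprod (Suc m * n) G w = wprod (Suc m * n) G u * (G 1 * G 0) * wprod (Suc m * n) G v"
  proof (rule word_split[OF n Suc.hyps, of C w, folded G_def, unfolded g01])
    show "C i \<in> carrier_mat n n" if "i < Suc m" for i using C(1)[OF that] .
    show "distinct w" "set w = {..<Suc m}" by fact+
    fix u v assume "distinct (u @ v)" "set (u @ v) = {2..<Suc m}"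
      "wprod (Suc m * n) G w = wprod (Suc m * n) G u * (G 0 * G 1) * wprod (Suc m * n) G v \<or>
       wprod (Suc m * n) G w = wprod (Suc m * n) G u * (G 1 * G 0) * wprod (Suc m * n) G v"
    thus thesis by (rule that)
  qed
  let ?e = "bcol n m 0 :: 'a mat"
  define d where "d = gen n m 0 0 (C 1)"
  define X where "X = wprod ?N G' (map (\<lambda>i. i - 1) u)"
  define Z where "Z = wprod ?N G' (map (\<lambda>i. i - 1) v)"
  have Xc: "X \<in> carrier_mat ?N ?N" "Z \<in> carrier_mat ?N ?N" "d \<in> carrier_mat ?N ?N"
    by (auto simp: X_def Z_def G'_def d_def intro!: wprod_carrier)
  have shift: "wprod (Suc m * n) G t = bdiag n ?N (1\<^sub>m n) (wprod ?N G' (map (\<lambda>i. i - 1) t))"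
    if "set t \<subseteq> {2..<Suc m}" for t
  proof -
    have "wprod (Suc m * n) G t = bdiag n ?N (1\<^sub>m n) (wprod ?N (\<lambda>i. gen n m i (i - 1) (C (Suc i))) (map (\<lambda>i. i - 1) t))"
      unfolding G_def using that C by (intro wprod_shift[OF n]) auto
    also have "wprod ?N (\<lambda>i. gen n m i (i - 1) (C (Suc i))) (map (\<lambda>i. i - 1) t) = wprod ?N G' (map (\<lambda>i. i - 1) t)"
      using that by (intro wprod_cong) (auto simp: G'_def C'_def)
    finally show ?thesis .
  qed
  have Gu: "wprod (Suc m * n) G u = bdiag n ?N (1\<^sub>m n) X" "wprod (Suc m * n) G v = bdiag n ?N (1\<^sub>m n) Z"
    unfolding X_def Z_def by (rule shift, use uv(2) in force)+
  have G0: "G 0 = bdiag n ?N (C 0) (1\<^sub>m ?N)" unfolding G_def using gen_Suc_first[OF n C01(1)] by simp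
  have G1: "G 1 = four_block_mat (0\<^sub>m n n) (transpose_mat ?e) ?e d"
    unfolding G_def d_def using gen_Suc_second[OF n Suc.hyps C01(2)] by simp
  obtain R c where Rc: "R \<in> carrier_mat n ?N" "c \<in> carrier_mat ?N n" "mat_over S R" "mat_over S c"
    and cR_eq: "c * R = ?e * C 0 * transpose_mat ?e"
    and K: "wprod (Suc m * n) G w = bdiag n ?N (1\<^sub>m n) X * four_block_mat (0\<^sub>m n n) R c d * bdiag n ?N (1\<^sub>m n) Z"
  proof -
    have te: "transpose_mat ?e \<in> carrier_mat n ?N" by simp
    have eC: "C 0 * transpose_mat ?e \<in> carrier_mat n ?N" "?e * C 0 \<in> carrier_mat ?N n"
      using mult_carrier_mat[OF C01(1) te] mult_carrier_mat[OF bcol_carrier[of n m 0] C01(1)] by auto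
    have F01: "G 0 * G 1 = four_block_mat (0\<^sub>m n n) (C 0 * transpose_mat ?e) ?e d"
      unfolding G0 G1 using C01 Xc by (subst mult_four_block_mat[of _ n n _ ?N _ ?N _ _ n _ ?N]) auto
    have F10: "G 1 * G 0 = four_block_mat (0\<^sub>m n n) (transpose_mat ?e) (?e * C 0) d"
      unfolding G0 G1 using C01 Xc eC by (subst mult_four_block_mat[of _ n n _ ?N _ ?N _ _ n _ ?N]) auto
    have eCe: "?e * (C 0 * transpose_mat ?e) = ?e * C 0 * transpose_mat ?e"
      using C01 by (intro assoc_mult_mat[symmetric, of _ ?N n _ n _ ?N]) auto
    have ov: "mat_over S ?e" "mat_over S (transpose_mat ?e)"
      using S by (simp_all add: mat_over_bcol mat_over_transpose)
    have ov': "mat_over S (C 0 * transpose_mat ?e)" "mat_over S (?e * C 0)"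
      by (rule mat_over_mult[OF S(1) C01(3) ov(2)], use C01 in simp)
        (rule mat_over_mult[OF S(1) ov(1) C01(3)], use C01 in simp)
    from split show ?thesis
    proof
      assume W: "wprod (Suc m * n) G w = wprod (Suc m * n) G u * (G 0 * G 1) * wprod (Suc m * n) G v"
      show ?thesis
        by (rule that[OF eC(1) bcol_carrier ov'(1) ov(1) eCe]) (simp only: W Gu F01)
    next
      assume W: "wprod (Suc m * n) G w = wprod (Suc m * n) G u * (G 1 * G 0) * wprod (Suc m * n) G v"
      show ?thesis
        by (rule that[OF te eC(2) ov(2) ov'(2) refl]) (simp only: W Gu F10)
    qed
  qed
  define D where "D = gen n m (m - 1) (m - 1) (- A0)"
  have Dc: "D \<in> carrier_mat ?N ?N" by (simp add: D_def)
  have D: "gen n (Suc m) (Suc m - 1) (Suc m - 1) (- A0) = bdiag n ?N (1\<^sub>m n) D"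
    using n Suc.hyps A0 by (simp add: gen_Suc_shift D_def)
  define F where "F = l \<cdot>\<^sub>m (X * d * Z) - D"
  define r where "r = l \<cdot>\<^sub>m (R * Z)"
  define q where "q = l \<cdot>\<^sub>m (X * c)"
  have rq: "r \<in> carrier_mat n ?N" "q \<in> carrier_mat ?N n" "F \<in> carrier_mat ?N ?N"
    using Rc Xc Dc by (auto simp: r_def q_def F_def)
  have pencil: "l \<cdot>\<^sub>m wprod (Suc m * n) G w - gen n (Suc m) (Suc m - 1) (Suc m - 1) (- A0) = four_block_mat (- 1\<^sub>m n) r q F"
  proof -
    have "bdiag n ?N (1\<^sub>m n) X * four_block_mat (0\<^sub>m n n) R c d = four_block_mat (0\<^sub>m n n) R (X * c) (X * d)"
      using Rc Xc by (subst mult_four_block_mat[of _ n n _ ?N _ ?N _ _ n _ ?N]) auto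
    also have "\<dots> * bdiag n ?N (1\<^sub>m n) Z = four_block_mat (0\<^sub>m n n) (R * Z) (X * c) (X * d * Z)"
      using Rc Xc mult_carrier_mat[OF Xc(1) Rc(2)] by (subst mult_four_block_mat[of _ n n _ ?N _ ?N _ _ n _ ?N]) auto
    finally have W: "wprod (Suc m * n) G w = four_block_mat (0\<^sub>m n n) (R * Z) (X * c) (X * d * Z)"
      unfolding K .
    show ?thesis unfolding W D
      by (rule eq_matI) (use Rc Xc Dc in \<open>auto simp: r_def q_def F_def\<close>)
  qed
  have schur: "F + q * r = l \<cdot>\<^sub>m (X * G' 0 * Z) - D"
  proof -
    have G'0: "G' 0 = d + l \<cdot>\<^sub>m (c * R)"
    proof -
      have "d + ?e * (l \<cdot>\<^sub>m C 0) * transpose_mat ?e = G' 0"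
        unfolding d_def G'_def C'_def using gen_add_diagonal[OF C01(2), of "l \<cdot>\<^sub>m C 0" 0 m] Suc.hyps C01 by simp
      moreover have "?e * (l \<cdot>\<^sub>m C 0) * transpose_mat ?e = l \<cdot>\<^sub>m (?e * C 0 * transpose_mat ?e)"
      proof -
        have "?e * (l \<cdot>\<^sub>m C 0) = l \<cdot>\<^sub>m (?e * C 0)" using C01 by (intro mult_smult_distrib[of _ ?N n _ n]) auto
        moreover have "l \<cdot>\<^sub>m (?e * C 0) * transpose_mat ?e = l \<cdot>\<^sub>m (?e * C 0 * transpose_mat ?e)"
          using mult_carrier_mat[OF bcol_carrier[of n m 0] C01(1)] by (intro mult_smult_assoc_mat[of _ ?N n _ ?N]) auto
        ultimately show ?thesis by simp
      qed
      ultimately show ?thesis using cR_eq by simp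
    qed
    have qr: "q * r = l \<cdot>\<^sub>m (X * (l \<cdot>\<^sub>m (c * R)) * Z)"
    proof -
      have cR: "c * R \<in> carrier_mat ?N ?N" "X * c \<in> carrier_mat ?N n" "R * Z \<in> carrier_mat n ?N"
        using Rc Xc by auto
      have "q * r = l \<cdot>\<^sub>m (X * c * (l \<cdot>\<^sub>m (R * Z)))"
        unfolding q_def r_def using cR by (intro mult_smult_assoc_mat[of _ ?N n _ ?N]) auto
      also have "X * c * (l \<cdot>\<^sub>m (R * Z)) = l \<cdot>\<^sub>m (X * c * (R * Z))"
        using cR by (intro mult_smult_distrib[of _ ?N n _ ?N])
      also have "X * c * (R * Z) = X * (c * R) * Z"
        using Rc Xc cR by (simp add: assoc_mult_mat[of _ ?N n _ ?N _ ?N] assoc_mult_mat[of _ ?N ?N _ n _ ?N] assoc_mult_mat[of _ ?N ?N _ ?N _ ?N])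
      also have "l \<cdot>\<^sub>m (X * (c * R) * Z) = l \<cdot>\<^sub>m (X * (c * R)) * Z"
        using cR Xc by (intro mult_smult_assoc_mat[symmetric, of _ ?N ?N _ ?N]) auto
      also have "l \<cdot>\<^sub>m (X * (c * R)) = X * (l \<cdot>\<^sub>m (c * R))"
        using cR Xc by (intro mult_smult_distrib[symmetric, of _ ?N ?N _ ?N]) auto
      finally show ?thesis .
    qed
    define x where "x = X * d * Z"
    define y where "y = X * (l \<cdot>\<^sub>m (c * R)) * Z"
    have cR: "l \<cdot>\<^sub>m (c * R) \<in> carrier_mat ?N ?N" using Rc by auto
    have xy: "x \<in> carrier_mat ?N ?N" "y \<in> carrier_mat ?N ?N" unfolding x_def y_def
      using cR Xc by (auto intro!: mult_carrier_mat[of _ ?N ?N])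
    have "X * G' 0 * Z = (X * d + X * (l \<cdot>\<^sub>m (c * R))) * Z"
      unfolding G'0 using cR Xc by (subst mult_add_distrib_mat[of _ ?N ?N _ ?N]) auto
    also have "\<dots> = x + y"
      unfolding x_def y_def using cR Xc by (intro add_mult_distrib_mat[of _ ?N ?N _ _ ?N]) auto
    finally have XGZ: "X * G' 0 * Z = x + y" .
    show ?thesis
      unfolding XGZ qr F_def x_def[symmetric] y_def[symmetric]
      using xy Dc by (intro eq_matI) (auto simp: algebra_simps)
  qed
  define w' where "w' = map (\<lambda>i. i - 1) u @ 0 # map (\<lambda>i. i - 1) v"
  have w': "distinct w'" "set w' = {..<m}"
  proof -
    have inj: "inj_on (\<lambda>i. i - 1) (set (u @ v))" unfolding uv(2) by (auto simp: inj_on_def)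
    have img: "(\<lambda>i. i - 1) ` set (u @ v) = {1..<m}"
    proof -
      have "(\<lambda>i. i - 1) ` {2..<Suc m} = {1..<m}"
      proof (intro equalityI subsetI)
        fix x assume "x \<in> {1..<m}"
        thus "x \<in> (\<lambda>i. i - 1) ` {2..<Suc m}" by (intro image_eqI[of _ _ "Suc x"]) auto
      qed auto
      thus ?thesis using uv(2) by simp
    qed
    have "distinct (map (\<lambda>i. i - 1) (u @ v))" using uv(1) inj by (simp only: distinct_map)
    moreover have "0 \<notin> set (map (\<lambda>i. i - 1) (u @ v))" unfolding set_map img by simp
    ultimately show "distinct w'" unfolding w'_def by auto
    have "set w' = insert 0 ((\<lambda>i. i - 1) ` set (u @ v))" by (auto simp: w'_def)
    also have "\<dots> = {..<m}" unfolding img using Suc.hyps by auto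
    finally show "set w' = {..<m}" .
  qed
  have G'c: "G' i \<in> carrier_mat ?N ?N" for i by (simp add: G'_def)
  have "wprod ?N G' w' = X * G' 0 * Z"
    unfolding w'_def X_def Z_def using assoc_mult_mat[of X ?N ?N "G' 0" ?N Z ?N] Xc G'c
    by (simp add: wprod_append[OF G'c] X_def Z_def)
  hence Fq: "F + q * r = l \<cdot>\<^sub>m wprod ?N G' w' - D" using schur by simp
  obtain U V where UV: "U \<in> carrier_mat ?N ?N" "V \<in> carrier_mat ?N ?N" "mat_over S U" "mat_over S V"
    "det U \<in> {1, -1}" "det V \<in> {1, -1}"
    "U * (F + q * r) * V = bdiag ((m - 1) * n) n (1\<^sub>m ((m - 1) * n)) (leading_eval n l m C' A0)"
    "U * bcol n m (m - 1) = bcol n m (m - 1)"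
    "transpose_mat (bcol n m (m - 1)) * V = transpose_mat (bcol n m (m - 1))"
    using Suc.IH[of C' w'] C'c w' unfolding Fq G'_def D_def by blast
  define U0 where "U0 = four_block_mat (- 1\<^sub>m n) (0\<^sub>m n ?N) q (1\<^sub>m ?N)"
  define V0 where "V0 = four_block_mat (1\<^sub>m n) r (0\<^sub>m ?N n) (1\<^sub>m ?N)"
  define U1 where "U1 = four_block_mat (- 1\<^sub>m n) (0\<^sub>m n ?N) (U * q) U"
  define V1 where "V1 = four_block_mat (1\<^sub>m n) (r * V) (0\<^sub>m ?N n) V"
  let ?K = "four_block_mat (- 1\<^sub>m n) r q F"
  have c: "U0 \<in> carrier_mat (n + ?N) (n + ?N)" "V0 \<in> carrier_mat (n + ?N) (n + ?N)" "U1 \<in> carrier_mat (n + ?N) (n + ?N)" "V1 \<in> carrier_mat (n + ?N) (n + ?N)"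
    "?K \<in> carrier_mat (n + ?N) (n + ?N)" "bdiag n ?N (1\<^sub>m n) U \<in> carrier_mat (n + ?N) (n + ?N)" "bdiag n ?N (1\<^sub>m n) V \<in> carrier_mat (n + ?N) (n + ?N)"
    using rq UV by (auto simp: U0_def V0_def U1_def V1_def)
  have U1: "U1 = bdiag n ?N (1\<^sub>m n) U * U0"
    unfolding U1_def U0_def using rq UV by (subst mult_four_block_mat[of _ n n _ ?N _ ?N _ _ n _ ?N]) auto
  have V1: "V1 = V0 * bdiag n ?N (1\<^sub>m n) V"
    unfolding V1_def V0_def using rq UV by (subst mult_four_block_mat[of _ n n _ ?N _ ?N _ _ n _ ?N]) auto
  have Fqr: "F + q * r \<in> carrier_mat ?N ?N" using rq by auto
  have "U1 * ?K * V1 = bdiag n ?N (1\<^sub>m n) U * (U0 * ?K * V0) * bdiag n ?N (1\<^sub>m n) V"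
    unfolding U1 V1 using c by (simp add: assoc_mult_mat[of _ "n + ?N" "n + ?N" _ "n + ?N" _ "n + ?N"] mult_carrier_mat[of _ "n + ?N" "n + ?N" _ "n + ?N"])
  also have "U0 * ?K * V0 = bdiag n ?N (1\<^sub>m n) (F + q * r)"
    unfolding U0_def V0_def by (rule schur_step[OF rq])
  also have "bdiag n ?N (1\<^sub>m n) U * bdiag n ?N (1\<^sub>m n) (F + q * r) * bdiag n ?N (1\<^sub>m n) V = bdiag n ?N (1\<^sub>m n) (U * (F + q * r) * V)"
    using UV Fqr by (simp add: bdiag_mult[of _ n _ _ ?N])
  also have "\<dots> = bdiag ?N n (1\<^sub>m ?N) (leading_eval n l m C' A0)"
    unfolding UV(7) using Suc.hyps by (intro bdiag_one_one) (auto simp: leading_eval_def)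
  also have "leading_eval n l m C' A0 = leading_eval n l (Suc m) C A0"
    unfolding C'_def using Suc.hyps C by (intro leading_eval_step) auto
  finally have main: "U1 * ?K * V1 = bdiag ?N n (1\<^sub>m ?N) (leading_eval n l (Suc m) C A0)" .
  have "mat_over S (wprod ?N G' t)" if "set t \<subseteq> {..<m}" for t
    using that C'c S by (intro mat_over_wprod) (auto simp: G'_def intro!: mat_over_gen)
  moreover have "set (map (\<lambda>i. i - 1) u) \<subseteq> {..<m}" "set (map (\<lambda>i. i - 1) v) \<subseteq> {..<m}"
    using w'(2) unfolding w'_def by auto
  ultimately have XZ: "mat_over S X" "mat_over S Z" unfolding X_def Z_def by blast+
  have ov: "mat_over S q" "mat_over S r"
    unfolding q_def r_def
    using mat_over_mult[OF S(1) XZ(1) Rc(4)] mat_over_mult[OF S(1) Rc(3) XZ(2)] Rc Xc S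
    by (auto intro!: mat_over_smult)
  have Uq: "U * q \<in> carrier_mat ?N n" "r * V \<in> carrier_mat n ?N"
    using mult_carrier_mat[OF UV(1) rq(2)] mult_carrier_mat[OF rq(1) UV(2)] by auto
  have Uqo: "mat_over S (U * q)" "mat_over S (r * V)"
    using mat_over_mult[OF S(1) UV(3) ov(1)] mat_over_mult[OF S(1) ov(2) UV(4)] UV rq by auto
  have triv: "mat_over S (- 1\<^sub>m n)" "mat_over S (1\<^sub>m n)" "mat_over S (0\<^sub>m n ?N)" "mat_over S (0\<^sub>m ?N n)"
    using S by (simp_all add: mat_over_zero mat_over_one mat_over_uminus)
  have "mat_over S U1" unfolding U1_def
    by (rule mat_over_four_block[of _ n n _ ?N _ ?N]) (simp_all add: UV Uq Uqo triv)
  moreover have "mat_over S V1" unfolding V1_def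
    by (rule mat_over_four_block[of _ n n _ ?N _ ?N]) (simp_all add: UV Uq Uqo triv)
  moreover have "det U1 \<in> {1, -1}" "det V1 \<in> {1, -1}"
  proof -
    have "det U1 = det U * det U0" unfolding U1 using c UV by (subst det_mult[of _ "n + ?N"]) (auto simp: det_bdiag)
    moreover have "det U0 \<in> {1, -1}" unfolding U0_def using rq by (intro det_unitriangular) auto
    ultimately show "det U1 \<in> {1, -1}" using UV(5) by auto
    have "det V1 = det V0 * det V" unfolding V1 using c UV by (subst det_mult[of _ "n + ?N"]) (auto simp: det_bdiag)
    moreover have "det V0 = 1" unfolding V0_def using rq by (intro det_unitriangular) auto
    ultimately show "det V1 \<in> {1, -1}" using UV(6) by auto
  qed
  moreover have "U1 * bcol n (Suc m) m = bcol n (Suc m) m"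
    unfolding U1_def using Suc.hyps UV rq by (intro fixes_last) auto
  moreover have "transpose_mat (bcol n (Suc m) m) * V1 = transpose_mat (bcol n (Suc m) m)"
    unfolding V1_def using Suc.hyps UV rq by (intro fixes_last') auto
  ultimately show ?case
    using main c(3,4) pencil unfolding G_def
    by (intro exI[of _ U1] exI[of _ V1]) simp
qed

section \<open>Rational functions at infinity\<close>

abbreviation "rt \<equiv> rat_tendsto_at_infinity"

lemma eventually_poly_nonzero: "q \<noteq> 0 \<Longrightarrow> eventually (\<lambda>x. poly q x \<noteq> 0) at_infinity" for q :: "complex poly"
proof -
  assume "q \<noteq> 0"
  hence "finite {x. poly q x = 0}" by (rule poly_roots_finite)
  hence "eventually (\<lambda>x. \<forall>z \<in> {x. poly q x = 0}. x \<noteq> z) at_infinity"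
    by (intro eventually_ball_finite) (auto intro: eventually_not_equal_at_infinity)
  thus ?thesis by eventually_elim auto
qed

lemma rt_FractI: "q \<noteq> 0 \<Longrightarrow> ((\<lambda>x. poly p x / poly q x) \<longlongrightarrow> l) at_infinity \<Longrightarrow> rt (Fraction_Field.Fract p q) l"
  unfolding rat_tendsto_at_infinity_def by blast

lemma rt_const: "rt (to_fract [:c:]) c"
  unfolding to_fract_def by (rule rt_FractI) auto

lemma rt_0: "rt 0 0" and rt_1: "rt 1 1"
proof -
  have "rt (to_fract [:0:]) 0" "rt (to_fract [:1:]) 1" by (rule rt_const)+
  thus "rt 0 0" "rt 1 1" by (simp_all add: one_pCons[symmetric])
qed

lemma rt_inverse_lam: "rt (inverse (to_fract lam)) 0"
proof -
  have "inverse (to_fract lam) = Fraction_Field.Fract 1 lam" by (simp add: to_fract_def)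
  moreover have "((\<lambda>x. poly 1 x / poly lam x) \<longlongrightarrow> 0) at_infinity"
    using tendsto_inverse_0 by (simp add: inverse_eq_divide[abs_def])
  ultimately show ?thesis by (metis rt_FractI pCons_eq_0_iff one_neq_zero)
qed

lemma rt_add: assumes "rt f a" "rt g b" shows "rt (f + g) (a + b)"
proof -
  obtain p q p' q' where f: "q \<noteq> 0" "f = Fraction_Field.Fract p q" "((\<lambda>x. poly p x / poly q x) \<longlongrightarrow> a) at_infinity"
    and g: "q' \<noteq> 0" "g = Fraction_Field.Fract p' q'" "((\<lambda>x. poly p' x / poly q' x) \<longlongrightarrow> b) at_infinity"
    using assms unfolding rat_tendsto_at_infinity_def by blast
  have "eventually (\<lambda>x. poly p x / poly q x + poly p' x / poly q' x = poly (p * q' + p' * q) x / poly (q * q') x) at_infinity"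
    using eventually_poly_nonzero[OF f(1)] eventually_poly_nonzero[OF g(1)]
    by eventually_elim (simp add: field_simps)
  hence "((\<lambda>x. poly (p * q' + p' * q) x / poly (q * q') x) \<longlongrightarrow> a + b) at_infinity"
    using tendsto_add[OF f(3) g(3)] by (rule Lim_transform_eventually[rotated])
  moreover have "f + g = Fraction_Field.Fract (p * q' + p' * q) (q * q')" using f g by simp
  ultimately show ?thesis using f g by (metis rt_FractI mult_eq_0_iff)
qed

lemma rt_mult: assumes "rt f a" "rt g b" shows "rt (f * g) (a * b)"
proof -
  obtain p q p' q' where f: "q \<noteq> 0" "f = Fraction_Field.Fract p q" "((\<lambda>x. poly p x / poly q x) \<longlongrightarrow> a) at_infinity"
    and g: "q' \<noteq> 0" "g = Fraction_Field.Fract p' q'" "((\<lambda>x. poly p' x / poly q' x) \<longlongrightarrow> b) at_infinity"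
    using assms unfolding rat_tendsto_at_infinity_def by blast
  have "((\<lambda>x. poly (p * p') x / poly (q * q') x) \<longlongrightarrow> a * b) at_infinity"
    using tendsto_mult[OF f(3) g(3)] by simp
  moreover have "f * g = Fraction_Field.Fract (p * p') (q * q')" using f g by simp
  ultimately show ?thesis using f g by (metis rt_FractI mult_eq_0_iff)
qed

lemma rt_uminus: "rt f a \<Longrightarrow> rt (- f) (- a)"
proof -
  assume "rt f a"
  moreover have "to_fract [:- 1:] = (- 1 :: complex poly fract)"
    by (metis one_pCons to_fract_1 to_fract_uminus minus_pCons neg_0_equal_iff_equal)
  ultimately show ?thesis using rt_mult[OF rt_const[of "-1"], of f a] by simp
qed

lemma at_infinity_complex: "(at_infinity :: complex filter) \<noteq> bot"
proof -
  have "b \<le> norm (complex_of_real b)" for b by simp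
  thus ?thesis unfolding trivial_limit_def eventually_at_infinity by blast
qed

lemma rt_inverse: assumes "rt f a" "a \<noteq> 0" shows "f \<noteq> 0" "rt (inverse f) (inverse a)"
proof -
  obtain p q where f: "q \<noteq> 0" "f = Fraction_Field.Fract p q" "((\<lambda>x. poly p x / poly q x) \<longlongrightarrow> a) at_infinity"
    using assms unfolding rat_tendsto_at_infinity_def by blast
  have p: "p \<noteq> 0"
  proof
    assume "p = 0"
    hence "((\<lambda>x :: complex. 0 :: complex) \<longlongrightarrow> a) at_infinity" using f(3) by simp
    thus False using assms(2) tendsto_unique[OF at_infinity_complex _ tendsto_const] by auto
  qed
  show "f \<noteq> 0" using f p by (simp add: eq_fract Zero_fract_def)
  have "((\<lambda>x. poly q x / poly p x) \<longlongrightarrow> inverse a) at_infinity"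
    using tendsto_inverse[OF f(3) assms(2)] by simp
  thus "rt (inverse f) (inverse a)" using f p by (metis rt_FractI inverse_fract)
qed

lemma rt_unique: assumes "rt f a" "rt f b" shows "a = b"
proof -
  obtain p q p' q' where f: "q \<noteq> 0" "f = Fraction_Field.Fract p q" "((\<lambda>x. poly p x / poly q x) \<longlongrightarrow> a) at_infinity"
    and g: "q' \<noteq> 0" "f = Fraction_Field.Fract p' q'" "((\<lambda>x. poly p' x / poly q' x) \<longlongrightarrow> b) at_infinity"
    using assms unfolding rat_tendsto_at_infinity_def by blast
  have "p * q' = p' * q" using f g by (simp add: eq_fract)
  hence e: "poly p x * poly q' x = poly p' x * poly q x" for x by (metis poly_mult)
  have "eventually (\<lambda>x. poly p x / poly q x = poly p' x / poly q' x) at_infinity"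
    using eventually_poly_nonzero[OF f(1)] eventually_poly_nonzero[OF g(1)]
    by eventually_elim (simp add: frac_eq_eq e)
  hence "((\<lambda>x. poly p' x / poly q' x) \<longlongrightarrow> a) at_infinity"
    using f(3) by (rule Lim_transform_eventually[rotated])
  thus ?thesis using g(3) by (rule tendsto_unique[OF at_infinity_complex])
qed

definition proper :: "complex poly fract set"
  where "proper = {f. \<exists>l. rt f l}"

lemma subring_proper: "subring proper"
  unfolding subring_def proper_def using rt_0 rt_1 rt_add rt_mult rt_uminus by blast

lemma rt_sum: "(\<And>i. i \<in> I \<Longrightarrow> rt (f i) (g i)) \<Longrightarrow> rt (sum f I) (sum g I)"
  by (induction I rule: infinite_finite_induct) (auto simp: rt_0 rt_add)

lemma rt_prod: "(\<And>i. i \<in> I \<Longrightarrow> rt (f i) (g i)) \<Longrightarrow> rt (prod f I) (prod g I)"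
  by (induction I rule: infinite_finite_induct) (auto simp: rt_1 rt_mult)

lemma permutes_upt_less: "p permutes {0..<k} \<Longrightarrow> i < k \<Longrightarrow> p i < (k :: nat)"
  using permutes_in_image[of p "{0..<k}" i] by (simp add: atLeast0LessThan)

text \<open>The determinant is a polynomial in the entries, and limits are compatible with sums and products.\<close>

lemma rt_det:
  assumes R: "R \<in> carrier_mat k k" and N: "N \<in> carrier_mat k k"
    and rt: "\<And>i j. i < k \<Longrightarrow> j < k \<Longrightarrow> rt (R $$ (i, j)) (N $$ (i, j))"
  shows "rt (det R) (det N)"
proof -
  have sg: "rt (signof p) (signof p)" for p
    using rt_1 rt_uminus[OF rt_1] by (simp add: sign_def)
  show ?thesis
    unfolding det_def'[OF R] det_def'[OF N]
    by (intro rt_sum rt_mult rt_prod sg rt) (auto dest: permutes_upt_less)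
qed

text \<open>The limit of the determinant is the determinant of the limit, so a constant determinant keeps the
  limit matrix nonsingular.\<close>

lemma biproperI:
  assumes R: "R \<in> carrier_mat k k" and ov: "mat_over proper R" and d: "det R \<in> {1, -1}"
  shows "biproper R"
proof -
  have "\<forall>i<k. \<forall>j<k. \<exists>l. rt (R $$ (i, j)) l"
    using ov R by (auto simp: mat_over_def proper_def)
  then obtain L where L: "\<And>i j. i < k \<Longrightarrow> j < k \<Longrightarrow> rt (R $$ (i, j)) (L i j)" by metis
  define N where "N = mat k k (\<lambda>(i, j). L i j)"
  have N: "N \<in> carrier_mat k k" by (simp add: N_def)
  have rtN: "rt (R $$ (i, j)) (N $$ (i, j))" if "i < k" "j < k" for i j using L that by (simp add: N_def)
  have "rt (det R) (det N)" by (rule rt_det[OF R N rtN])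
  moreover have "rt (det R) 1 \<or> rt (det R) (- 1)" using d rt_1 rt_uminus[OF rt_1] by auto
  ultimately have "det N \<noteq> 0" using rt_unique by force
  thus ?thesis unfolding biproper_def nonsingular_def using R N rtN
    by (auto intro!: bexI[of _ N])
qed

lemma biproper_const:
  assumes "X \<in> carrier_mat k k" "nonsingular X"
  shows "biproper (rm (pm X))"
  unfolding biproper_def using assms
  by (auto simp: rm_def pm_def rt_const intro!: bexI[of _ X])

lemma biproper_mult:
  assumes X: "biproper X" "X \<in> carrier_mat k k" and Y: "biproper Y" "Y \<in> carrier_mat k k"
  shows "biproper (X * Y)"
proof -
  obtain N where N: "N \<in> carrier_mat k k" "nonsingular N" "\<And>i j. i < k \<Longrightarrow> j < k \<Longrightarrow> rt (X $$ (i, j)) (N $$ (i, j))"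
    using X by (auto simp: biproper_def)
  obtain N' where N': "N' \<in> carrier_mat k k" "nonsingular N'" "\<And>i j. i < k \<Longrightarrow> j < k \<Longrightarrow> rt (Y $$ (i, j)) (N' $$ (i, j))"
    using Y by (auto simp: biproper_def)
  have "rt ((X * Y) $$ (i, j)) ((N * N') $$ (i, j))" if "i < k" "j < k" for i j
  proof -
    have "rt (\<Sum>l = 0..<k. X $$ (i, l) * Y $$ (l, j)) (\<Sum>l = 0..<k. N $$ (i, l) * N' $$ (l, j))"
      using that by (intro rt_sum rt_mult N N') auto
    thus ?thesis using X Y N N' that by (simp add: scalar_prod_def)
  qed
  moreover have "nonsingular (N * N')" using N N' by (simp add: nonsingular_def det_mult)
  ultimately show ?thesis unfolding biproper_def using X Y N N'
    by (auto intro!: bexI[of _ "N * N'"])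
qed

section \<open>Constant, polynomial and rational matrices\<close>

interpretation const_poly: comm_ring_hom "\<lambda>c :: complex. [:c:]"
  by unfold_locales (auto simp: one_pCons)

interpretation fract_of_poly: comm_ring_hom "to_fract :: complex poly \<Rightarrow> _"
  by unfold_locales auto

lemma pm_carrier [simp]: "pm X \<in> carrier_mat a b \<longleftrightarrow> X \<in> carrier_mat a b"
  by (simp add: pm_def)

lemma rm_carrier [simp]: "rm X \<in> carrier_mat a b \<longleftrightarrow> X \<in> carrier_mat a b"
  by (simp add: rm_def)

lemma pm_dim [simp]: "dim_row (pm X) = dim_row X" "dim_col (pm X) = dim_col X"
  by (simp_all add: pm_def)

lemma rm_dim [simp]: "dim_row (rm X) = dim_row X" "dim_col (rm X) = dim_col X"
  by (simp_all add: rm_def)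

lemma pm_index [simp]: "i < dim_row X \<Longrightarrow> j < dim_col X \<Longrightarrow> pm X $$ (i, j) = [:X $$ (i, j):]"
  by (simp add: pm_def)

lemma rm_index [simp]: "i < dim_row X \<Longrightarrow> j < dim_col X \<Longrightarrow> rm X $$ (i, j) = to_fract (X $$ (i, j))"
  by (simp add: rm_def)

lemma pm_mult: "X \<in> carrier_mat a b \<Longrightarrow> Y \<in> carrier_mat b c \<Longrightarrow> pm (X * Y) = pm X * pm Y"
  unfolding pm_def by (rule const_poly.mat_hom_mult)

lemma rm_mult: "X \<in> carrier_mat a b \<Longrightarrow> Y \<in> carrier_mat b c \<Longrightarrow> rm (X * Y) = rm X * rm Y"
  unfolding rm_def by (rule fract_of_poly.mat_hom_mult)

lemma pm_one [simp]: "pm (1\<^sub>m k) = 1\<^sub>m k"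
  by (intro eq_matI) (auto simp: one_pCons[symmetric])

lemma rm_one [simp]: "rm (1\<^sub>m k) = 1\<^sub>m k"
  by (intro eq_matI) auto

lemma pm_transpose: "pm (transpose_mat X) = transpose_mat (pm X)"
  by (intro eq_matI) auto

lemma rm_transpose: "rm (transpose_mat X) = transpose_mat (rm X)"
  by (intro eq_matI) auto

lemma det_pm: "det (pm X) = [:det X:]"
  unfolding pm_def by simp

lemma det_rm: "det (rm X) = to_fract (det X)"
  unfolding rm_def by simp

section \<open>Inverse matrices\<close>

lemma minv_props:
  fixes X :: "'a :: field mat"
  assumes X: "X \<in> carrier_mat k k" and d: "det X \<noteq> 0"
  shows "minv X \<in> carrier_mat k k" "X * minv X = 1\<^sub>m k" "minv X * X = 1\<^sub>m k"
proof -
  have "X \<in> Units (ring_mat TYPE('a) k ())" by (rule det_non_zero_imp_unit[OF X d])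
  then obtain Y where Y: "mat_inverse X = Some Y" using mat_inverse(1)[OF X] by fastforce
  show "minv X \<in> carrier_mat k k" "X * minv X = 1\<^sub>m k" "minv X * X = 1\<^sub>m k"
    using mat_inverse(2)[OF X Y] Y by (auto simp: minv_def)
qed

lemma right_inverse_eq_minv:
  fixes X :: "'a :: field mat"
  assumes X: "X \<in> carrier_mat k k" and d: "det X \<noteq> 0" and Y: "Y \<in> carrier_mat k k" and XY: "X * Y = 1\<^sub>m k"
  shows "Y = minv X"
proof -
  note m = minv_props[OF X d]
  have "Y = minv X * X * Y" using m Y by simp
  also have "\<dots> = minv X * (X * Y)" using m X Y by (intro assoc_mult_mat) auto
  finally show ?thesis using m XY by simp
qed

lemma minv_uminus:
  fixes X :: "'a :: field mat"
  assumes X: "X \<in> carrier_mat k k" and d: "det X \<noteq> 0"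
  shows "minv (- X) = - minv X"
proof (rule right_inverse_eq_minv[symmetric])
  note m = minv_props[OF X d]
  show mX: "- X \<in> carrier_mat k k" using X by simp
  have "- X = (- 1) \<cdot>\<^sub>m X" by (intro eq_matI) auto
  thus "det (- X) \<noteq> 0" using d by simp
  show "- minv X \<in> carrier_mat k k" using m by simp
  show "- X * - minv X = 1\<^sub>m k" using m X by (simp add: uminus_mult_left_mat uminus_mult_right_mat)
qed

lemma minv_transpose:
  fixes X :: "'a :: field mat"
  assumes X: "X \<in> carrier_mat k k" and d: "det X \<noteq> 0"
  shows "minv (transpose_mat X) = transpose_mat (minv X)"
proof (rule right_inverse_eq_minv[symmetric])
  note m = minv_props[OF X d]
  show "transpose_mat X * transpose_mat (minv X) = 1\<^sub>m k"
    using m X by (simp add: transpose_mult[symmetric, of _ k k _ k])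
qed (use assms minv_props[OF X d] in \<open>auto simp: det_transpose\<close>)

lemma to_fract_smult: "to_fract (Polynomial.smult c p) = to_fract p * to_fract [:c:]"
proof -
  have "Polynomial.smult c p = p * [:c:]" by simp
  thus ?thesis by (metis to_fract_mult)
qed

text \<open>Dividing by \<open>\<lambda>\<close> turns the state pencil into one with the limit \<open>E\<close> at infinity.\<close>

lemma rm_pencil_factor:
  assumes "A \<in> carrier_mat r r" "E \<in> carrier_mat r r" "p \<noteq> 0"
  shows "rm (p \<cdot>\<^sub>m pm E - pm A) = to_fract p \<cdot>\<^sub>m (rm (pm E) - inverse (to_fract p) \<cdot>\<^sub>m rm (pm A))"
  using assms by (intro eq_matI) (auto simp: to_fract_smult right_diff_distrib mult.assoc[symmetric])

context
  fixes r :: nat and A E :: "complex mat"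
  assumes A: "A \<in> carrier_mat r r" and E: "E \<in> carrier_mat r r" and nE: "det E \<noteq> 0"
begin

lemma pencil_at_infinity:
  defines "T \<equiv> rm (pm E) - inverse (to_fract lam) \<cdot>\<^sub>m rm (pm A)"
  shows "T \<in> carrier_mat r r" "mat_over proper T" "rt (det T) (det E)"
    "rm (lam \<cdot>\<^sub>m pm E - pm A) = to_fract lam \<cdot>\<^sub>m T"
proof -
  show Tc: "T \<in> carrier_mat r r" using A E by (auto simp: T_def)
  have T: "rt (T $$ (i, j)) (E $$ (i, j))" if "i < r" "j < r" for i j
  proof -
    have "rt (to_fract [:E $$ (i, j):] + - (inverse (to_fract lam) * to_fract [:A $$ (i, j):])) (E $$ (i, j) + - (0 * A $$ (i, j)))"
      by (intro rt_add rt_uminus rt_mult rt_const rt_inverse_lam)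
    thus ?thesis using that A E by (simp add: T_def)
  qed
  thus "mat_over proper T" using Tc by (auto simp: mat_over_def proper_def)
  show "rt (det T) (det E)" by (rule rt_det[OF Tc E T])
  show "rm (lam \<cdot>\<^sub>m pm E - pm A) = to_fract lam \<cdot>\<^sub>m T"
    unfolding T_def by (rule rm_pencil_factor[OF A E]) simp
qed

lemma det_pencil: "det (lam \<cdot>\<^sub>m pm E - pm A) \<noteq> 0" "det (rm (lam \<cdot>\<^sub>m pm E - pm A)) \<noteq> 0"
proof -
  let ?T = "rm (pm E) - inverse (to_fract lam) \<cdot>\<^sub>m rm (pm A)"
  have "det ?T \<noteq> 0" using rt_inverse(1)[OF pencil_at_infinity(3) nE] .
  thus "det (rm (lam \<cdot>\<^sub>m pm E - pm A)) \<noteq> 0"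
    unfolding pencil_at_infinity(4) by simp
  thus "det (lam \<cdot>\<^sub>m pm E - pm A) \<noteq> 0" by (simp add: det_rm)
qed

lemma pencil_carrier: "lam \<cdot>\<^sub>m pm E - pm A \<in> carrier_mat r r"
  using A E by auto

text \<open>By Cramer's rule the inverse is \<open>1/\<lambda>\<close> times the adjugate of a proper matrix, divided by a
  determinant with nonzero limit.\<close>

lemma minv_pencil_proper: "mat_over proper (minv (rm (lam \<cdot>\<^sub>m pm E - pm A)))"
proof -
  define T where "T = rm (pm E) - inverse (to_fract lam) \<cdot>\<^sub>m rm (pm A)"
  note T = pencil_at_infinity[folded T_def]
  have dT: "det T \<noteq> 0" "rt (inverse (det T)) (inverse (det E))" using rt_inverse[OF T(3) nE] by auto
  define Y where "Y = (inverse (to_fract lam) * inverse (det T)) \<cdot>\<^sub>m adj_mat T"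
  note adj = adj_mat[OF T(1)]
  have "rm (lam \<cdot>\<^sub>m pm E - pm A) * Y = 1\<^sub>m r"
  proof -
    have "rm (lam \<cdot>\<^sub>m pm E - pm A) * Y = (to_fract lam * (inverse (to_fract lam) * inverse (det T)) * det T) \<cdot>\<^sub>m 1\<^sub>m r"
      unfolding T(4) Y_def using T(1) adj
      by (simp add: mult_smult_assoc_mat[of _ r r _ r] mult_smult_distrib[of _ r r _ r] smult_smult_eq ac_simps)
    moreover have "x * (inverse x * inverse (det T)) * det T = 1" if "x \<noteq> 0" for x
      using that dT(1) by (simp add: field_simps)
    ultimately show ?thesis by simp
  qed
  hence "Y = minv (rm (lam \<cdot>\<^sub>m pm E - pm A))"
    using pencil_carrier det_pencil(2) adj by (intro right_inverse_eq_minv[of _ r]) (auto simp: Y_def)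
  moreover have "mat_over proper (adj_mat T)"
  proof -
    have "cofactor T i j \<in> proper" if "i < r" "j < r" for i j
    proof -
      have md: "mat_delete T i j \<in> carrier_mat (r - 1) (r - 1)" using mat_delete_carrier[OF T(1)] .
      have "mat_delete T i j $$ (a, b) \<in> proper" if "a < r - 1" "b < r - 1" for a b
        using that T(1,2) md by (auto simp: mat_delete_def mat_over_def)
      hence "det (mat_delete T i j) \<in> proper"
        unfolding det_def'[OF md]
        by (intro subring_sum[OF subring_proper] subringD(4)[OF subring_proper] subring_prod[OF subring_proper])
          (auto dest: permutes_upt_less simp: sign_def subringD[OF subring_proper])
      moreover have "(-1) ^ (i + j) \<in> proper"
        by (cases "even (i + j)") (auto simp: subringD[OF subring_proper])
      ultimately show ?thesis unfolding cofactor_def by (rule subringD(4)[OF subring_proper, rotated])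
    qed
    thus ?thesis using T(1) by (auto simp: adj_mat_def mat_over_def)
  qed
  moreover have "inverse (to_fract lam) * inverse (det T) \<in> proper"
    using rt_mult[OF rt_inverse_lam dT(2)] by (auto simp: proper_def)
  ultimately show ?thesis
    unfolding Y_def using mat_over_smult[OF subring_proper] by metis
qed

end

section \<open>Minimality implies irreducibility\<close>

lemma bdiag_lower_zero_mult:
  fixes X :: "'a :: semiring_1 mat"
  assumes "X \<in> carrier_mat a a" "R \<in> carrier_mat a 1" "s \<in> carrier_mat 1 1" "Y \<in> carrier_mat a c"
  shows "four_block_mat X R (0\<^sub>m 1 a) s * four_block_mat Y (0\<^sub>m a 0) (0\<^sub>m 1 c) (0\<^sub>m 1 0) =
    four_block_mat (X * Y) (0\<^sub>m a 0) (0\<^sub>m 1 c) (0\<^sub>m 1 0)"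
  using assms by (subst mult_four_block_mat[of _ a a _ 1 _ 1 _ _ c _ 0]) auto

text \<open>Unit rows for all indices except one where \<open>v\<close> does not vanish, followed by \<open>v\<close>.\<close>

lemma completing_matrix:
  fixes v :: "'a :: field vec"
  assumes v: "v \<in> carrier_vec (Suc k)" "v \<noteq> 0\<^sub>v (Suc k)"
  obtains Q where "Q \<in> carrier_mat (Suc k) (Suc k)" "det Q \<noteq> 0" "row Q k = v"
proof -
  obtain i0 where i0: "i0 < Suc k" "v $ i0 \<noteq> 0"
    using v by (metis eq_vecI carrier_vecD index_zero_vec(1) index_zero_vec(2))
  define Q where "Q = mat (Suc k) (Suc k) (\<lambda>(i, j). if i < k then (if j = (if i < i0 then i else Suc i) then 1 else 0) else v $ j)"
  have Q: "Q \<in> carrier_mat (Suc k) (Suc k)" by (simp add: Q_def)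
  have "row Q k = v" using v by (intro eq_vecI) (auto simp: Q_def)
  moreover have "det Q \<noteq> 0"
  proof
    assume "det Q = 0"
    then obtain y where y: "y \<in> carrier_vec (Suc k)" "y \<noteq> 0\<^sub>v (Suc k)" "Q *\<^sub>v y = 0\<^sub>v (Suc k)"
      using det_0_iff_vec_prod_zero[OF Q] by blast
    have prod: "(\<Sum>j = 0..<Suc k. Q $$ (i, j) * y $ j) = 0" if "i < Suc k" for i
    proof -
      have "(Q *\<^sub>v y) $ i = 0" using y(3) that by simp
      thus ?thesis using that Q y(1) by (simp add: scalar_prod_def)
    qed
    have yj: "y $ j = 0" if j: "j < Suc k" "j \<noteq> i0" for j
    proof -
      define i where "i = (if j < i0 then j else j - 1)"
      have i: "i < k" "(if i < i0 then i else Suc i) = j" using j i0 by (auto simp: i_def)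
      have "(\<Sum>l = 0..<Suc k. Q $$ (i, l) * y $ l) = (\<Sum>l\<in>{0..<Suc k}. if l = j then y $ l else 0)"
        using i by (intro sum.cong) (auto simp: Q_def)
      also have "\<dots> = y $ j" using j by (simp add: sum.delta)
      finally show ?thesis using prod[of i] i by simp
    qed
    have "(\<Sum>l = 0..<Suc k. Q $$ (k, l) * y $ l) = (\<Sum>l\<in>{0..<Suc k}. if l = i0 then v $ l * y $ l else 0)"
      using yj by (intro sum.cong) (auto simp: Q_def)
    also have "\<dots> = v $ i0 * y $ i0" using i0 by (simp add: sum.delta)
    finally have "y $ i0 = 0" using prod[of k] i0 by simp
    hence "y = 0\<^sub>v (Suc k)" using yj y(1) by (intro eq_vecI) (metis carrier_vecD index_zero_vec(1) index_zero_vec(2), simp)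
    thus False using y(2) by simp
  qed
  ultimately show ?thesis using that Q by blast
qed

lemma to_fract_pconst: "to_fract [:- c:] = - to_fract [:c:]"
  by (metis minus_pCons minus_zero to_fract_uminus)

text \<open>The vector \<open>v\<close> spans an uncontrollable direction. In a basis of the state space in which \<open>v\<close> is the last
  coordinate form, the pencil has last row \<open>(0, \<dots>, 0, \<lambda> - x)\<close> and the input matrix has last row 0.
  The last state is then identically 0 and can be deleted.\<close>

lemma realization_reducible:
  assumes real: "is_realization n (Suc k) P A E B C G"
    and v: "v \<in> carrier_vec (Suc k)" "v \<noteq> 0\<^sub>v (Suc k)"
    and vA: "transpose_mat A *\<^sub>v v = x \<cdot>\<^sub>v (transpose_mat E *\<^sub>v v)" and vB: "transpose_mat B *\<^sub>v v = 0\<^sub>v n"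
  shows "\<exists>P' A' E' B' C'. is_realization n k P' A' E' B' C' G"
proof -
  let ?r = "Suc k"
  have P: "P \<in> carrier_mat n n" and A: "A \<in> carrier_mat ?r ?r" and E: "E \<in> carrier_mat ?r ?r" and nE: "det E \<noteq> 0"
    and B: "B \<in> carrier_mat ?r n" and C: "C \<in> carrier_mat n ?r"
    and G: "G = rm P + rm (pm C) * minv (rm (lam \<cdot>\<^sub>m pm E - pm A)) * rm (pm B)"
    using real by (auto simp: is_realization_def nonsingular_def)
  obtain Q where Q: "Q \<in> carrier_mat ?r ?r" "det Q \<noteq> 0" "row Q k = v" by (rule completing_matrix[OF v])
  have QE: "Q * E \<in> carrier_mat ?r ?r" "det (Q * E) \<noteq> 0" using Q E nE by (auto simp: det_mult[of _ ?r])
  \<comment> \<open>The pencil becomes \<open>Q (\<lambda>E - A) W = \<lambda>I - A'\<close>.\<close>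
  define W where "W = minv (Q * E)"
  have W: "W \<in> carrier_mat ?r ?r" "Q * E * W = 1\<^sub>m ?r" using minv_props[OF QE] by (auto simp: W_def)
  have QA: "Q * A \<in> carrier_mat ?r ?r" using Q A by auto
  have rowX: "row (Q * X) k = transpose_mat X *\<^sub>v v" if "X \<in> carrier_mat ?r c" for X c
  proof (rule eq_vecI)
    fix j assume "j < dim_vec (transpose_mat X *\<^sub>v v)"
    hence j: "j < c" using that by simp
    have "row (Q * X) k $ j = row Q k \<bullet> col X j" using j Q that by simp
    also have "\<dots> = col X j \<bullet> v" unfolding Q(3)
      by (rule comm_scalar_prod[OF v(1) carrier_vecI]) (simp add: carrier_matD(1)[OF that])
    also have "\<dots> = (transpose_mat X *\<^sub>v v) $ j" using j carrier_matD(2)[OF that] by simp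
    finally show "row (Q * X) k $ j = (transpose_mat X *\<^sub>v v) $ j" .
  qed (simp add: carrier_matD(2)[OF that])
  define A' where "A' = Q * A * W"
  define B' where "B' = Q * B"
  define C' where "C' = C * W"
  have c': "A' \<in> carrier_mat ?r ?r" "B' \<in> carrier_mat ?r n" "C' \<in> carrier_mat n ?r"
    unfolding A'_def B'_def C'_def
    by (rule mult_carrier_mat[OF QA W(1)], rule mult_carrier_mat[OF Q(1) B], rule mult_carrier_mat[OF C W(1)])
  have lastB: "B' $$ (k, j) = 0" if "j < n" for j
  proof -
    have "row B' k = 0\<^sub>v n" unfolding B'_def using rowX[OF B] vB by simp
    thus ?thesis using c' that by (metis carrier_matD index_row(1) index_zero_vec(1) lessI)
  qed
  have lastA: "A' $$ (k, j) = (if j = k then x else 0)" if "j < ?r" for j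
  proof -
    have rA: "row (Q * A) k = x \<cdot>\<^sub>v row (Q * E) k" using rowX[OF A] rowX[OF E] vA by simp
    have d: "dim_row (Q * A) = ?r" "dim_row (Q * E) = ?r" "dim_col W = ?r" using Q(1) W(1) by auto
    have "A' $$ (k, j) = row (Q * A) k \<bullet> col W j"
      unfolding A'_def by (rule index_mult_mat(1)) (use d that in auto)
    also have "\<dots> = x * (row (Q * E) k \<bullet> col W j)"
      unfolding rA by (rule smult_scalar_prod_distrib[of _ ?r]) (auto intro!: carrier_vecI simp: carrier_matD[OF QE(1)] carrier_matD[OF W(1)] carrier_matD[OF E])
    also have "row (Q * E) k \<bullet> col W j = (Q * E * W) $$ (k, j)"
      by (rule index_mult_mat(1)[symmetric]) (use d that in auto)
    finally show ?thesis unfolding W(2) using that by auto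
  qed
  define A1 where "A1 = mat k k (\<lambda>(i, j). A' $$ (i, j))"
  define a2 where "a2 = mat k 1 (\<lambda>(i, j). A' $$ (i, k))"
  define B1 where "B1 = mat k n (\<lambda>(i, j). B' $$ (i, j))"
  define C1 where "C1 = mat n k (\<lambda>(i, j). C' $$ (i, j))"
  define c2 where "c2 = mat n 1 (\<lambda>(i, j). C' $$ (i, k))"
  have c1: "A1 \<in> carrier_mat k k" "a2 \<in> carrier_mat k 1" "B1 \<in> carrier_mat k n" "C1 \<in> carrier_mat n k" "c2 \<in> carrier_mat n 1"
    by (auto simp: A1_def a2_def B1_def C1_def c2_def)
  have A'b: "A' = four_block_mat A1 a2 (0\<^sub>m 1 k) (mat 1 1 (\<lambda>_. x))"
    by (rule eq_matI) (use c' lastA in \<open>auto simp: A1_def a2_def less_Suc_eq\<close>)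
  have B'b: "B' = four_block_mat B1 (0\<^sub>m k 0) (0\<^sub>m 1 n) (0\<^sub>m 1 0)"
    by (rule eq_matI) (use c' lastB in \<open>auto simp: B1_def less_Suc_eq\<close>)
  have C'b: "C' = four_block_mat C1 c2 (0\<^sub>m 0 k) (0\<^sub>m 0 1)"
    by (rule eq_matI) (use c' in \<open>auto simp: C1_def c2_def less_Suc_eq\<close>)
  let ?D = "rm (lam \<cdot>\<^sub>m pm E - pm A)" and ?D1 = "rm (lam \<cdot>\<^sub>m pm (1\<^sub>m k) - pm A1)"
  define Y where "Y = minv ?D1 * rm (pm B1)"
  note pD = det_pencil(2)[OF A E nE] pencil_carrier[OF A E nE]
  have pD1: "det ?D1 \<noteq> 0" "?D1 \<in> carrier_mat k k"
    using det_pencil(2)[of A1 k "1\<^sub>m k"] pencil_carrier[of A1 k "1\<^sub>m k"] c1 by auto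
  have Y: "Y \<in> carrier_mat k n" "?D1 * Y = rm (pm B1)"
  proof -
    note m = minv_props[OF pD1(2,1)]
    show "Y \<in> carrier_mat k n" using m c1 by (auto simp: Y_def)
    have "?D1 * Y = ?D1 * minv ?D1 * rm (pm B1)"
      unfolding Y_def using m pD1 c1 by (intro assoc_mult_mat[symmetric]) auto
    thus "?D1 * Y = rm (pm B1)" using m c1 by simp
  qed
  \<comment> \<open>The solution of the full system is the one of the reduced system, padded by a zero row.\<close>
  define Yb where "Yb = four_block_mat Y (0\<^sub>m k 0) (0\<^sub>m 1 n) (0\<^sub>m 1 0)"
  have Yb: "Yb \<in> carrier_mat ?r n" unfolding Yb_def carrier_mat_def using Y by auto
  have qdw: "rm (pm Q) * ?D * rm (pm W) = rm (lam \<cdot>\<^sub>m 1\<^sub>m ?r - pm A')"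
  proof -
    have p: "pm Q * (lam \<cdot>\<^sub>m pm E - pm A) * pm W = lam \<cdot>\<^sub>m 1\<^sub>m ?r - pm A'"
    proof -
      have "pm Q * (lam \<cdot>\<^sub>m pm E - pm A) = pm Q * (lam \<cdot>\<^sub>m pm E) - pm Q * pm A"
        using Q A E by (intro mult_minus_distrib_mat) auto
      also have "pm Q * (lam \<cdot>\<^sub>m pm E) = lam \<cdot>\<^sub>m pm (Q * E)"
        unfolding pm_mult[OF Q(1) E] using Q E by (intro mult_smult_distrib) auto
      also have "pm Q * pm A = pm (Q * A)" by (rule pm_mult[OF Q(1) A, symmetric])
      finally have "pm Q * (lam \<cdot>\<^sub>m pm E - pm A) * pm W = (lam \<cdot>\<^sub>m pm (Q * E) - pm (Q * A)) * pm W" by simp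
      also have "\<dots> = (lam \<cdot>\<^sub>m pm (Q * E)) * pm W - pm (Q * A) * pm W"
        using QE QA W by (intro minus_mult_distrib_mat) auto
      also have "(lam \<cdot>\<^sub>m pm (Q * E)) * pm W = lam \<cdot>\<^sub>m pm (Q * E * W)"
        unfolding pm_mult[OF QE(1) W(1)] using QE W by (intro mult_smult_assoc_mat) auto
      also have "pm (Q * A) * pm W = pm A'" unfolding A'_def by (rule pm_mult[OF QA W(1), symmetric])
      also have "lam \<cdot>\<^sub>m pm (Q * E * W) = lam \<cdot>\<^sub>m 1\<^sub>m ?r" unfolding W(2) by simp
      finally show ?thesis .
    qed
    have "rm (pm Q * (lam \<cdot>\<^sub>m pm E - pm A) * pm W) = rm (pm Q) * ?D * rm (pm W)"
    proof -
      have "pm Q * (lam \<cdot>\<^sub>m pm E - pm A) \<in> carrier_mat ?r ?r" by (rule mult_carrier_mat) (use Q pD(2) in auto)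
      hence "rm (pm Q * (lam \<cdot>\<^sub>m pm E - pm A) * pm W) = rm (pm Q * (lam \<cdot>\<^sub>m pm E - pm A)) * rm (pm W)"
        by (rule rm_mult) (use W in auto)
      also have "rm (pm Q * (lam \<cdot>\<^sub>m pm E - pm A)) = rm (pm Q) * ?D"
        by (rule rm_mult) (use Q pD(2) in auto)
      finally show ?thesis .
    qed
    thus ?thesis unfolding p by simp
  qed
  have block: "rm (lam \<cdot>\<^sub>m 1\<^sub>m ?r - pm A') = four_block_mat ?D1 (- rm (pm a2)) (0\<^sub>m 1 k) (mat 1 1 (\<lambda>_. to_fract (lam - [:x:])))"
    unfolding A'b by (rule eq_matI) (use c1 in \<open>auto simp: to_fract_pconst\<close>)
  have "rm (lam \<cdot>\<^sub>m 1\<^sub>m ?r - pm A') * Yb = four_block_mat (?D1 * Y) (0\<^sub>m k 0) (0\<^sub>m 1 n) (0\<^sub>m 1 0)"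
    unfolding block Yb_def using pD1 Y c1 by (intro bdiag_lower_zero_mult) auto
  also have "\<dots> = rm (pm B')" unfolding Y(2) B'b by (rule eq_matI) (use c1 in auto)
  finally have 0: "rm (pm Q) * ?D * rm (pm W) * Yb = rm (pm B')" unfolding qdw .
  have QD: "rm (pm Q) * ?D \<in> carrier_mat ?r ?r" by (rule mult_carrier_mat[of _ _ ?r]) (use Q pD(2) in auto)
  have WY: "rm (pm W) * Yb \<in> carrier_mat ?r n" by (rule mult_carrier_mat[of _ _ ?r]) (use W Yb in auto)
  have "rm (pm Q) * (?D * (rm (pm W) * Yb)) = rm (pm Q) * ?D * (rm (pm W) * Yb)"
    by (rule assoc_mult_mat[symmetric]) (use Q pD(2) WY in auto)
  also have "\<dots> = rm (pm Q) * ?D * rm (pm W) * Yb"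
    by (rule assoc_mult_mat[symmetric, OF QD _ Yb]) (use W in auto)
  also have "\<dots> = rm (pm Q * pm B)" unfolding 0 B'_def using pm_mult[OF Q(1) B] by simp
  also have "\<dots> = rm (pm Q) * rm (pm B)" by (rule rm_mult) (use Q B in auto)
  finally have 1: "rm (pm Q) * (?D * (rm (pm W) * Yb)) = rm (pm Q) * rm (pm B)" .
  have Qi: "det (rm (pm Q)) \<noteq> 0" "rm (pm Q) \<in> carrier_mat ?r ?r" using Q by (auto simp: det_rm det_pm)
  have cancel: "S = T" if "X * S = X * T" "X \<in> carrier_mat ?r ?r" "det X \<noteq> 0" "S \<in> carrier_mat ?r n" "T \<in> carrier_mat ?r n"
    for X S T :: "complex poly fract mat"
  proof -
    note m = minv_props[OF that(2,3)]
    have "S = minv X * X * S" unfolding m(3) using that(4) by simp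
    also have "\<dots> = minv X * (X * S)" by (rule assoc_mult_mat[OF m(1) that(2,4)])
    also have "\<dots> = minv X * X * T" unfolding that(1) by (rule assoc_mult_mat[OF m(1) that(2,5), symmetric])
    finally show ?thesis unfolding m(3) using that(5) by simp
  qed
  have 2: "?D * (rm (pm W) * Yb) = rm (pm B)"
    by (rule cancel[OF 1 Qi(2,1) mult_carrier_mat[of _ _ ?r]]) (use pD(2) WY B in auto)
  note mD = minv_props[OF _ pD(1)]
  have Dc: "?D \<in> carrier_mat ?r ?r" using pD by simp
  have "minv ?D * rm (pm B) = minv ?D * ?D * (rm (pm W) * Yb)"
    unfolding 2[symmetric] by (rule assoc_mult_mat[OF mD(1)[OF Dc] Dc WY, symmetric])
  hence 3: "minv ?D * rm (pm B) = rm (pm W) * Yb" unfolding mD(3)[OF Dc] left_mult_one_mat[OF WY] .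
  have "rm (pm C) * minv ?D * rm (pm B) = rm (pm C) * (minv ?D * rm (pm B))"
    using mD[OF Dc] C B by (intro assoc_mult_mat) auto
  also have "\<dots> = rm (pm C') * Yb"
  proof -
    have "rm (pm C') = rm (pm C) * rm (pm W)"
      unfolding C'_def pm_mult[OF C W(1)] by (rule rm_mult) (use C W in auto)
    thus ?thesis unfolding 3
      using assoc_mult_mat[of "rm (pm C)" n ?r "rm (pm W)" ?r Yb n] C W Yb by simp
  qed
  also have "\<dots> = four_block_mat (rm (pm C1)) (rm (pm c2)) (0\<^sub>m 0 k) (0\<^sub>m 0 1) * Yb"
    unfolding C'b by (rule arg_cong2[where f = "(*)", OF _ refl], rule eq_matI) (use c1 in auto)
  also have "\<dots> = four_block_mat (rm (pm C1) * Y) (0\<^sub>m n 0) (0\<^sub>m 0 n) (0\<^sub>m 0 0)"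
    unfolding Yb_def using c1 Y by (subst mult_four_block_mat[of _ n k _ 1 _ 0 _ _ n _ 0]) auto
  also have "\<dots> = rm (pm C1) * Y" by (rule eq_matI) (use c1 Y in auto)
  also have "\<dots> = rm (pm C1) * minv ?D1 * rm (pm B1)"
    unfolding Y_def using c1 minv_props[OF pD1(2,1)] by (intro assoc_mult_mat[symmetric]) auto
  finally have "G = rm P + rm (pm C1) * minv ?D1 * rm (pm B1)" using G by simp
  hence "is_realization n k P A1 (1\<^sub>m k) B1 C1 G"
    using P c1 by (simp add: is_realization_def nonsingular_def)
  thus ?thesis by blast
qed

section \<open>Full rank\<close>

lemma full_column_rank:
  fixes X :: "complex mat"
  assumes X: "X \<in> carrier_mat q r" and ker: "\<And>v. v \<in> carrier_vec r \<Longrightarrow> X *\<^sub>v v = 0\<^sub>v q \<Longrightarrow> v = 0\<^sub>v r"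
  shows "vec_space.rank q X = r"
proof -
  interpret vec_space "TYPE(complex)" q .
  have dist: "distinct (cols X)"
  proof (rule ccontr)
    assume "\<not> distinct (cols X)"
    then obtain i j where "i < length (cols X)" "j < length (cols X)" "i \<noteq> j" "cols X ! i = cols X ! j"
      unfolding distinct_conv_nth by blast
    hence ij: "i < r" "j < r" "i \<noteq> j" "col X i = col X j" using carrier_matD(2)[OF X] by simp_all
    have "X *\<^sub>v (unit_vec r i - unit_vec r j) = X *\<^sub>v unit_vec r i - X *\<^sub>v unit_vec r j"
      by (rule mult_minus_distrib_mat_vec[OF X]) auto
    also have "\<dots> = 0\<^sub>v q"
    proof -
      have "X *\<^sub>v unit_vec r i = col X i" "X *\<^sub>v unit_vec r j = col X j"
        using carrier_matD[OF X] ij(1,2) by (auto intro!: eq_vecI)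
      thus ?thesis unfolding ij(4) using carrier_matD[OF X] by (auto intro!: eq_vecI)
    qed
    finally have "unit_vec r i - unit_vec r j = (0\<^sub>v r :: complex vec)" by (intro ker) auto
    hence "(unit_vec r i - unit_vec r j) $ i = (0\<^sub>v r :: complex vec) $ i" by simp
    thus False using ij by simp
  qed
  show ?thesis
  proof (rule lin_indpt_full_rank[OF X dist])
    show "lin_indpt (set (cols X))"
    proof
      assume "lin_dep (set (cols X))"
      then obtain v where "v \<in> carrier_vec r" "v \<noteq> 0\<^sub>v r" "X *\<^sub>v v = 0\<^sub>v q"
        by (rule lin_depE[OF X _ dist])
      thus False using ker by blast
    qed
  qed
qed

text \<open>The Gram matrix \<open>X X\<^sup>*\<close> is invertible, which exhibits every vector as an image under \<open>X\<close>.\<close>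

lemma full_row_rank:
  fixes X :: "complex mat"
  assumes X: "X \<in> carrier_mat r q" and ker: "\<And>v. v \<in> carrier_vec r \<Longrightarrow> transpose_mat X *\<^sub>v v = 0\<^sub>v q \<Longrightarrow> v = 0\<^sub>v r"
  shows "vec_space.rank r X = r"
proof -
  interpret vec_space "TYPE(complex)" r .
  \<comment> \<open>A kernel vector \<open>y\<close> of the transposed Gram matrix yields \<open>z = X\<^sup>T y\<close> with \<open>z \<bullet>c z = 0\<close>, hence \<open>z = 0\<close>.\<close>
  define H where "H = X * transpose_mat (map_mat cnj X)"
  have H: "H \<in> carrier_mat r r" using X by (auto simp: H_def)
  have Xc: "transpose_mat (map_mat cnj X) \<in> carrier_mat q r" using X by auto
  have "det (transpose_mat H) \<noteq> 0"
  proof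
    assume "det (transpose_mat H) = 0"
    then obtain y where y: "y \<in> carrier_vec r" "y \<noteq> 0\<^sub>v r" "transpose_mat H *\<^sub>v y = 0\<^sub>v r"
      using det_0_iff_vec_prod_zero[of "transpose_mat H" r] H by auto
    define z where "z = transpose_mat X *\<^sub>v y"
    have z: "z \<in> carrier_vec q" using X y by (auto simp: z_def)
    have "transpose_mat H = map_mat cnj X * transpose_mat X"
      unfolding H_def using X Xc by (subst transpose_mult[of _ r q _ r]) auto
    hence "map_mat cnj X *\<^sub>v z = 0\<^sub>v r"
      unfolding z_def using X y by (simp add: assoc_mult_mat_vec[of "map_mat cnj X" r q "transpose_mat X" r y])
    have "z \<bullet>c z = z \<bullet> (transpose_mat (map_mat cnj X) *\<^sub>v conjugate y)"
    proof -
      have "conjugate z = transpose_mat (map_mat cnj X) *\<^sub>v conjugate y"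
        unfolding z_def using X y by (intro eq_vecI) (auto simp: scalar_prod_def)
      thus ?thesis by simp
    qed
    also have "\<dots> = (map_mat cnj X *\<^sub>v z) \<bullet> conjugate y"
      using X y z transpose_vec_mult_scalar[of "map_mat cnj X" r q z "conjugate y"]
      by (simp add: comm_scalar_prod[of _ q] comm_scalar_prod[of _ r])
    also have "\<dots> = 0" using \<open>map_mat cnj X *\<^sub>v z = 0\<^sub>v r\<close> y by simp
    finally have "z = 0\<^sub>v q" using z by simp
    thus False using ker[OF y(1)] y(2) by (simp add: z_def)
  qed
  hence dH: "det H \<noteq> 0" using H by (simp add: det_transpose)
  note m = minv_props[OF H dH]
  have "col_space X = carrier_vec r"
  proof -
    have "y \<in> col_space X" if y: "y \<in> carrier_vec r" for y
    proof -
      have my: "minv H *\<^sub>v y \<in> carrier_vec r" using m(1) y by (rule mult_mat_vec_carrier)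
      have "X *\<^sub>v (transpose_mat (map_mat cnj X) *\<^sub>v (minv H *\<^sub>v y)) = H *\<^sub>v (minv H *\<^sub>v y)"
        unfolding H_def[of] by (rule assoc_mult_mat_vec[OF X Xc my[unfolded H_def], symmetric])
      also have "\<dots> = H * minv H *\<^sub>v y" by (rule assoc_mult_mat_vec[OF H m(1) y, symmetric])
      also have "\<dots> = y" using m y by simp
      finally show ?thesis
        unfolding col_space_eq[OF X] using X Xc m y
        by (auto intro!: bexI[of _ "transpose_mat (map_mat cnj X) *\<^sub>v (minv H *\<^sub>v y)"])
    qed
    moreover have "col_space X \<subseteq> carrier_vec r" unfolding col_space_eq[OF X] using X by auto
    ultimately show ?thesis by blast
  qed
  hence "span (set (cols X)) = carrier V" by (simp add: col_space_def module_vec_def)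
  hence "span_vs (set (cols X)) = V" by (simp add: module_vec_def)
  thus ?thesis unfolding rank_def using dim_is_n by simp
qed

section \<open>Fiedler matrices in block form\<close>

lemma gen_embed_lower:
  assumes n: "n > 0" and a: "a \<le> m" "a \<le> p" "a \<le> q"
  shows "gen n m p q C = bdiag (a * n) ((m - a) * n) (1\<^sub>m (a * n)) (gen n (m - a) (p - a) (q - a) C)" (is "_ = ?R")
proof (rule eq_matI)
  have e: "a * n + (m - a) * n = m * n" using a by (metis add_mult_distrib le_add_diff_inverse)
  show d: "dim_row (gen n m p q C) = dim_row ?R" "dim_col (gen n m p q C) = dim_col ?R" using e by auto
  fix i j assume "i < dim_row ?R" "j < dim_col ?R"
  hence i: "i < m * n" and j: "j < m * n" using e by auto
  have low: "x div n < a" if "x < a * n" for x using that by (simp add: less_mult_imp_div_less)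
  have up: "x div n = a + (x - a * n) div n" "x mod n = (x - a * n) mod n" "x - a * n < (m - a) * n"
    if "\<not> x < a * n" "x < m * n" for x
  proof -
    define y where "y = x - a * n"
    have x: "x = y + a * n" using that by (simp add: y_def)
    show "x div n = a + (x - a * n) div n" "x mod n = (x - a * n) mod n"
      unfolding y_def[symmetric] unfolding x using n by simp_all
    have "y + a * n < a * n + (m - a) * n" using that(2) unfolding e x .
    thus "x - a * n < (m - a) * n" unfolding y_def[symmetric] by simp
  qed
  consider "i < a * n" "j < a * n" | "i < a * n" "\<not> j < a * n" | "\<not> i < a * n" "j < a * n" | "\<not> i < a * n" "\<not> j < a * n" by blast
  thus "gen n m p q C $$ (i, j) = ?R $$ (i, j)"
  proof cases
    case 1 thus ?thesis using i j a low[of i] low[of j] by (auto simp: gen_index)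
  next
    case 2 thus ?thesis using i j a low[of i] up[of j] by (auto simp: gen_index)
  next
    case 3 thus ?thesis using i j a low[of j] up[of i] by (auto simp: gen_index)
  next
    case 4
    have eq: "(a + x = p) = (x = p - a)" "(a + x = q) = (x = q - a)" for x using a by auto
    define i' where "i' = i - a * n"
    define j' where "j' = j - a * n"
    have ij: "i = a * n + i'" "j = a * n + j'" using 4 by (simp_all add: i'_def j'_def)
    have dm: "i div n = a + i' div n" "i mod n = i' mod n" "i' < (m - a) * n"
      "j div n = a + j' div n" "j mod n = j' mod n" "j' < (m - a) * n"
      using up[OF 4(1) i] up[OF 4(2) j] by (simp_all only: i'_def j'_def)
    have "?R $$ (i, j) = gen n (m - a) (p - a) (q - a) C $$ (i', j')" using 4 i j e by (simp add: i'_def j'_def)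
    also have "\<dots> = gen n m p q C $$ (i, j)"
      unfolding gen_index[OF i j] gen_index[OF dm(3,6)] dm(1,2,4,5) eq by (simp add: ij)
    finally show ?thesis by simp
  qed
qed

lemma gen_embed_upper:
  assumes n: "n > 0" and a: "a \<le> m" "p < a" "q < a"
  shows "gen n m p q C = bdiag (a * n) ((m - a) * n) (gen n a p q C) (1\<^sub>m ((m - a) * n))" (is "_ = ?R")
proof (rule eq_matI)
  have e: "a * n + (m - a) * n = m * n" using a by (metis add_mult_distrib le_add_diff_inverse)
  show d: "dim_row (gen n m p q C) = dim_row ?R" "dim_col (gen n m p q C) = dim_col ?R" using e by auto
  fix i j assume "i < dim_row ?R" "j < dim_col ?R"
  hence i: "i < m * n" and j: "j < m * n" using e by auto
  have low: "x div n < a" if "x < a * n" for x using that by (simp add: less_mult_imp_div_less)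
  have up: "x div n \<ge> a" "x - a * n < (m - a) * n" if "\<not> x < a * n" "x < m * n" for x
  proof -
    show "x div n \<ge> a" using that n by (simp add: less_eq_div_iff_mult_less_eq)
    define y where "y = x - a * n"
    have x: "x = y + a * n" using that by (simp add: y_def)
    have "y + a * n < a * n + (m - a) * n" using that(2) unfolding e x .
    thus "x - a * n < (m - a) * n" unfolding y_def[symmetric] by simp
  qed
  consider "i < a * n" "j < a * n" | "i < a * n" "\<not> j < a * n" | "\<not> i < a * n" "j < a * n" | "\<not> i < a * n" "\<not> j < a * n" by blast
  thus "gen n m p q C $$ (i, j) = ?R $$ (i, j)"
  proof cases
    case 1 thus ?thesis using i j a by (simp add: gen_index)
  next
    case 2 thus ?thesis using i j a low[of i] up[of j] by (auto simp: gen_index)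
  next
    case 3 thus ?thesis using i j a low[of j] up[of i] by (auto simp: gen_index)
  next
    case 4 thus ?thesis using i j a up[of i] up[of j] by (auto simp: gen_index)
  qed
qed

lemma gen_one_block: "C \<in> carrier_mat n n \<Longrightarrow> gen n 1 0 0 C = C"
  by (intro eq_matI) (auto simp: gen_index)

lemma gen_two_blocks:
  fixes C :: "'a :: semiring_1 mat"
  assumes C: "C \<in> carrier_mat n n" and n: "n > 0"
  shows "gen n 2 0 1 C = four_block_mat C (1\<^sub>m n) (1\<^sub>m n) (0\<^sub>m n n)"
    and "gen n 2 1 0 C = four_block_mat (0\<^sub>m n n) (1\<^sub>m n) (1\<^sub>m n) C"
proof -
  have hi: "x div n = 1" "x mod n = x - n" if "x < n + n" "\<not> x < n" for x
    using that n by (auto simp: div_nat_eqI mod_if)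
  show "gen n 2 0 1 C = four_block_mat C (1\<^sub>m n) (1\<^sub>m n) (0\<^sub>m n n)"
  proof (rule eq_matI)
    fix i j assume "i < dim_row (four_block_mat C (1\<^sub>m n) (1\<^sub>m n) (0\<^sub>m n n))" "j < dim_col (four_block_mat C (1\<^sub>m n) (1\<^sub>m n) (0\<^sub>m n n))"
    hence "i < n + n" "j < n + n" using C by auto
    thus "gen n 2 0 1 C $$ (i, j) = four_block_mat C (1\<^sub>m n) (1\<^sub>m n) (0\<^sub>m n n) $$ (i, j)"
      using C hi[of i] hi[of j] by (cases "i < n"; cases "j < n") (auto simp: gen_index)
  qed (use C in auto)
  show "gen n 2 1 0 C = four_block_mat (0\<^sub>m n n) (1\<^sub>m n) (1\<^sub>m n) C"
  proof (rule eq_matI)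
    fix i j assume "i < dim_row (four_block_mat (0\<^sub>m n n) (1\<^sub>m n) (1\<^sub>m n) C)" "j < dim_col (four_block_mat (0\<^sub>m n n) (1\<^sub>m n) (1\<^sub>m n) C)"
    hence "i < n + n" "j < n + n" using C by auto
    thus "gen n 2 1 0 C $$ (i, j) = four_block_mat (0\<^sub>m n n) (1\<^sub>m n) (1\<^sub>m n) C $$ (i, j)"
      using C hi[of i] hi[of j] by (cases "i < n"; cases "j < n") (auto simp: gen_index)
  qed (use C in auto)
qed

lemma diag_block_two: "X \<in> carrier_mat a a \<Longrightarrow> Y \<in> carrier_mat b b \<Longrightarrow> diag_block_mat [X, Y] = bdiag a b X Y"
  by (intro eq_matI) (auto simp: Let_def)

lemma diag_block_three:
  "X \<in> carrier_mat a a \<Longrightarrow> Y \<in> carrier_mat b b \<Longrightarrow> Z \<in> carrier_mat c c \<Longrightarrow>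
    diag_block_mat [X, Y, Z] = bdiag a (b + c) X (bdiag b c Y Z)"
proof -
  assume X: "X \<in> carrier_mat a a" and Y: "Y \<in> carrier_mat b b" and Z: "Z \<in> carrier_mat c c"
  have "diag_block_mat [X, Y, Z] = (let B = diag_block_mat [Y, Z] in
    four_block_mat X (0\<^sub>m (dim_row X) (dim_col B)) (0\<^sub>m (dim_row B) (dim_col X)) B)" by (rule diag_block_mat.simps(2))
  thus ?thesis unfolding diag_block_two[OF Y Z] using X Y Z by (simp add: Let_def)
qed

lemma fiedler_nonneg:
  assumes n: "n > 0" and i: "i < m" and A: "A i \<in> carrier_mat n n"
  shows "fiedler n m A (int i) = gen n m (m - 1 - i) (m - 1 - (i - 1)) (- A i)"
proof (cases "i = 0")
  case True
  have "gen n m (m - 1) (m - 1) (- A 0) = bdiag ((m - 1) * n) n (1\<^sub>m ((m - 1) * n)) (- A 0)"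
    using gen_embed_lower[OF n, of "m - 1" m "m - 1" "m - 1" "- A 0"] i A True gen_one_block[of "- A 0" n] by simp
  moreover have "fiedler n m A 0 = bdiag ((m - 1) * n) n (1\<^sub>m ((m - 1) * n)) (- A 0)"
    unfolding fiedler_def Let_def using diag_block_two[of "1\<^sub>m ((m - 1) * n)" "(m - 1) * n" "- A 0" n] True A
    by (simp del: diag_block_mat.simps)
  ultimately show ?thesis using True by simp
next
  case False
  then obtain i' where i': "i = Suc i'" by (cases i) auto
  define a where "a = m - 1 - i"
  have m: "m = a + 2 + i'" using i i' by (simp add: a_def)
  have p: "m - 1 - i = a" "m - 1 - (i - 1) = a + 1" "m - i - 1 = a" "i - 1 = i'" using m i' by auto
  have Ci: "- A i \<in> carrier_mat n n" using A by simp
  have 1: "gen n m a (a + 1) (- A i) = bdiag (a * n) ((2 + i') * n) (1\<^sub>m (a * n)) (gen n (2 + i') 0 1 (- A i))"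
    using gen_embed_lower[OF n, of a m a "a + 1" "- A i"] unfolding m by simp
  have 2: "gen n (2 + i') 0 1 (- A i) = bdiag (2 * n) (i' * n) (gen n 2 0 1 (- A i)) (1\<^sub>m (i' * n))"
    using gen_embed_upper[OF n, of 2 "2 + i'" 0 1 "- A i"] by simp
  have e: "(2 + i') * n = 2 * n + i' * n" by (simp add: add_mult_distrib)
  have FB: "four_block_mat (- A i) (1\<^sub>m n) (1\<^sub>m n) (0\<^sub>m n n) \<in> carrier_mat (2 * n) (2 * n)"
    using A by (auto simp: mult_2 intro!: four_block_carrier_mat)
  have "fiedler n m A (int i) = diag_block_mat [1\<^sub>m (a * n), four_block_mat (- A i) (1\<^sub>m n) (1\<^sub>m n) (0\<^sub>m n n), 1\<^sub>m (i' * n)]"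
  proof -
    have "int i \<noteq> 0" "int i \<noteq> - int m" "int i > 0" "nat \<bar>int i\<bar> = i" using False i by auto
    thus ?thesis unfolding fiedler_def Let_def by (simp only: if_False if_True p simp_thms)
  qed
  also have "\<dots> = gen n m a (a + 1) (- A i)"
    unfolding 1 2 gen_two_blocks(1)[OF Ci n] e by (rule diag_block_three) (use FB in auto)
  finally show ?thesis unfolding p(1,2) .
qed

lemma fiedler_neg:
  assumes n: "n > 0" and l: "l < m" and A: "A (m - l) \<in> carrier_mat n n"
  shows "fiedler n m A (int l - int m) = gen n m l (l - 1) (A (m - l))"
proof (cases "l = 0")
  case True
  obtain m' where m': "m = Suc m'" using l by (cases m) auto
  have "fiedler n m A (- int m) = bdiag n (m' * n) (A m) (1\<^sub>m (m' * n))"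
    unfolding fiedler_def Let_def using diag_block_two[of "A m" n "1\<^sub>m (m' * n)" "m' * n"] True A m'
    by (simp del: diag_block_mat.simps)
  thus ?thesis using True A n gen_Suc_first[of n "A m" m'] unfolding m' by simp
next
  case False
  define a where "a = l - 1"
  define c where "c = m - l - 1"
  have m: "m = a + 2 + c" "l = a + 1" "m - l = Suc c" using l False by (auto simp: a_def c_def)
  have FB: "four_block_mat (0\<^sub>m n n) (1\<^sub>m n) (1\<^sub>m n) (A (m - l)) \<in> carrier_mat (2 * n) (2 * n)"
    using A by (auto simp: mult_2 intro!: four_block_carrier_mat)
  have 1: "gen n m l (l - 1) (A (m - l)) = bdiag (a * n) ((2 + c) * n) (1\<^sub>m (a * n)) (gen n (2 + c) 1 0 (A (m - l)))"
    using gen_embed_lower[OF n, of a m l "l - 1" "A (m - l)"] m by simp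
  have 2: "gen n (2 + c) 1 0 (A (m - l)) = bdiag (2 * n) (c * n) (gen n 2 1 0 (A (m - l))) (1\<^sub>m (c * n))"
    using gen_embed_upper[OF n, of 2 "2 + c" 1 0 "A (m - l)"] by simp
  have e: "(2 + c) * n = 2 * n + c * n" by (simp add: add_mult_distrib)
  have ne: "int l - int m \<noteq> 0" "int l - int m \<noteq> - int m" "\<not> int l - int m > 0" "nat \<bar>int l - int m\<bar> = m - l"
    using l False by auto
  have p: "m - (m - l) - 1 = a" "m - l - 1 = c" using m by auto
  have "fiedler n m A (int l - int m) = diag_block_mat [1\<^sub>m (a * n), four_block_mat (0\<^sub>m n n) (1\<^sub>m n) (1\<^sub>m n) (A (m - l)), 1\<^sub>m (c * n)]"
    unfolding fiedler_def Let_def ne(4) p using ne(1-3) by (simp only: if_False)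
  also have "\<dots> = gen n m l (l - 1) (A (m - l))"
    unfolding 1 2 gen_two_blocks(2)[OF A n] e by (rule diag_block_three) (use FB in auto)
  finally show ?thesis .
qed

text \<open>The two unit blocks change roles with the zero block: this is the relation between the Fiedler
  matrices of index \<open>i\<close> and \<open>-i\<close>.\<close>

lemma gen_inverse:
  fixes C :: "'a :: comm_ring_1 mat"
  assumes C: "C \<in> carrier_mat n n" and pq: "p < m" "q < m" "p \<noteq> q"
  shows "gen n m p q C * gen n m q p (- C) = 1\<^sub>m (m * n)"
proof (rule blockcol_eqI)
  fix a assume a: "a < m"
  let ?G = "gen n m p q C" and ?H = "gen n m q p (- C)"
  have mC: "- C \<in> carrier_mat n n" using C by simp
  have "?G * ?H * bcol n m a = ?G * (?H * bcol n m a)" by (rule assoc_mult_mat) auto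
  also have "\<dots> = bcol n m a"
  proof (cases "a = q")
    case True
    have "?G * (?H * bcol n m a) = ?G * (bcol n m p + bcol n m q * (- C))"
      using gen_mult_bcol[OF mC pq(2,1) a] True pq by simp
    also have "\<dots> = ?G * bcol n m p + ?G * (bcol n m q * (- C))"
      by (rule mult_add_distrib_mat[of _ _ "m * n" _ n]) (use C in auto)
    also have "?G * (bcol n m q * (- C)) = ?G * bcol n m q * (- C)"
      by (rule assoc_mult_mat[symmetric]) (use C in auto)
    also have "?G * bcol n m q = bcol n m p" using gen_mult_bcol[OF C pq(1,2,2)] pq by simp
    also have "?G * bcol n m p = bcol n m q + bcol n m p * C" using gen_mult_bcol[OF C pq(1,2,1)] pq by simp
    also have "bcol n m p * (- C) = - (bcol n m p * C)" using C by (simp add: uminus_mult_right_mat)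
    also have "bcol n m q + bcol n m p * C + - (bcol n m p * C) = bcol n m q"
      using C by (intro eq_matI) auto
    finally show ?thesis using True by simp
  next
    case False
    show ?thesis
      using gen_mult_bcol[OF mC pq(2,1) a] gen_mult_bcol[OF C pq(1,2) a] gen_mult_bcol[OF C pq(1,2,2)] False pq
      by (cases "a = p") auto
  qed
  also have "\<dots> = 1\<^sub>m (m * n) * bcol n m a" by simp
  finally show "?G * ?H * bcol n m a = 1\<^sub>m (m * n) * bcol n m a" .
qed auto

section \<open>Block flips\<close>

text \<open>Reverses the order of the blocks; it exchanges the directions of the two chains.\<close>

definition flip :: "nat \<Rightarrow> nat \<Rightarrow> 'a :: zero_neq_one mat"
  where "flip n m = mat (m * n) (m * n) (\<lambda>(i, j). if i = (m - 1 - j div n) * n + j mod n then 1 else 0)"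

lemma flip_carrier [simp, intro]: "flip n m \<in> carrier_mat (m * n) (m * n)"
  by (simp add: flip_def)

lemma flip_dim [simp]: "dim_row (flip n m) = m * n" "dim_col (flip n m) = m * n"
  by (simp_all add: flip_def)

lemma flip_bcol:
  assumes "a < m"
  shows "flip n m * bcol n m a = (bcol n m (m - 1 - a) :: 'a :: semiring_1 mat)"
proof (rule eq_matI)
  fix i j assume "i < dim_row (bcol n m (m - 1 - a) :: 'a mat)" "j < dim_col (bcol n m (m - 1 - a) :: 'a mat)"
  hence i: "i < m * n" and j: "j < n" by auto
  show "(flip n m * bcol n m a) $$ (i, j) = (bcol n m (m - 1 - a) :: 'a mat) $$ (i, j)"
    unfolding mult_bcol_index[OF flip_carrier assms i j] bcol_index[OF i j]
    using i block_index_less[OF assms j] by (simp add: flip_def block_index_div[OF j] block_index_mod[OF j] mod_less[OF j])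
qed auto

lemma flip_flip: "flip n m * flip n m = (1\<^sub>m (m * n) :: 'a :: comm_ring_1 mat)"
proof (rule blockcol_eqI)
  fix a assume a: "a < m"
  have "flip n m * flip n m * bcol n m a = flip n m * (flip n m * (bcol n m a :: 'a mat))" by (rule assoc_mult_mat) auto
  thus "flip n m * flip n m * bcol n m a = 1\<^sub>m (m * n) * (bcol n m a :: 'a mat)" using a by (simp add: flip_bcol)
qed auto

lemma flip_gen:
  fixes C :: "'a :: comm_ring_1 mat"
  assumes C: "C \<in> carrier_mat n n" and pq: "p < m" "q < m"
  shows "flip n m * gen n m p q C = gen n m (m - 1 - p) (m - 1 - q) C * flip n m"
proof (rule blockcol_eqI)
  fix a assume a: "a < m"
  let ?R = "flip n m :: 'a mat" and ?G = "gen n m p q C" and ?H = "gen n m (m - 1 - p) (m - 1 - q) C"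
  have pq': "m - 1 - p < m" "m - 1 - q < m" "m - 1 - a < m" using pq by auto
  have inj: "m - 1 - x = m - 1 - y \<longleftrightarrow> x = y" if "x < m" "y < m" for x y using that by auto
  have R: "?R * bcol n m x = bcol n m (m - 1 - x)" if "x < m" for x using flip_bcol that by blast
  have RC: "?R * (bcol n m x * C) = bcol n m (m - 1 - x) * C" if "x < m" for x
    using assoc_mult_mat[of ?R "m * n" "m * n" "bcol n m x" n C n] C R[OF that] by simp
  have "?R * ?G * bcol n m a = ?R * (?G * bcol n m a)" by (rule assoc_mult_mat) auto
  also have "\<dots> = ?H * bcol n m (m - 1 - a)"
  proof -
    have add: "?R * (bcol n m q + bcol n m p * C) = bcol n m (m - 1 - q) + bcol n m (m - 1 - p) * C"
    proof -
      have "bcol n m p * C \<in> carrier_mat (m * n) n" by (rule mult_carrier_mat[OF bcol_carrier C])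
      hence "?R * (bcol n m q + bcol n m p * C) = ?R * bcol n m q + ?R * (bcol n m p * C)"
        by (intro mult_add_distrib_mat) auto
      thus ?thesis unfolding R[OF pq(2)] RC[OF pq(1)] .
    qed
    show ?thesis
      unfolding gen_mult_bcol[OF C pq a] gen_mult_bcol[OF C pq'] inj[OF a pq(1)] inj[OF a pq(2)] inj[OF pq]
      using add R RC pq a by auto
  qed
  also have "\<dots> = ?H * (?R * bcol n m a)" using R[OF a] by simp
  also have "\<dots> = ?H * ?R * bcol n m a" by (rule assoc_mult_mat[symmetric]) auto
  finally show "?R * ?G * bcol n m a = ?H * ?R * bcol n m a" .
qed auto

lemma flip_wprod:
  fixes C :: "nat \<Rightarrow> 'a :: comm_ring_1 mat"
  assumes "\<And>i. i \<in> set t \<Longrightarrow> i < m \<and> C i \<in> carrier_mat n n"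
  shows "flip n m * wprod (m * n) (\<lambda>i. gen n m (m - 1 - i) (m - 1 - (i - 1)) (C i)) t =
    wprod (m * n) (\<lambda>i. gen n m i (i - 1) (C i)) t * flip n m"
  using assms
proof (induction t)
  case Nil show ?case by simp
next
  case (Cons i t)
  let ?R = "flip n m :: 'a mat" and ?W = "wprod (m * n) (\<lambda>i. gen n m (m - 1 - i) (m - 1 - (i - 1)) (C i)) t"
    and ?V = "wprod (m * n) (\<lambda>i. gen n m i (i - 1) (C i)) t"
  let ?G = "gen n m (m - 1 - i) (m - 1 - (i - 1)) (C i)" and ?H = "gen n m i (i - 1) (C i)"
  have c: "?W \<in> carrier_mat (m * n) (m * n)" "?V \<in> carrier_mat (m * n) (m * n)" by (auto intro!: wprod_carrier)
  have i: "i < m" "C i \<in> carrier_mat n n" using Cons.prems by auto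
  have "?R * (?G * ?W) = ?R * ?G * ?W" by (rule assoc_mult_mat[symmetric]) (use c in auto)
  also have "?R * ?G = ?H * ?R"
  proof -
    have "m - 1 - (m - 1 - i) = i" "m - 1 - (m - 1 - (i - 1)) = i - 1" "m - 1 - i < m" "m - 1 - (i - 1) < m"
      using i(1) by auto
    note e = this
    show ?thesis using flip_gen[OF i(2) e(3,4)] unfolding e(1,2) .
  qed
  also have "?H * ?R * ?W = ?H * (?R * ?W)" by (rule assoc_mult_mat) (use c in auto)
  also have "?R * ?W = ?V * ?R" using Cons by simp
  also have "?H * (?V * ?R) = ?H * ?V * ?R" by (rule assoc_mult_mat[symmetric]) (use c in auto)
  finally show ?case by simp
qed

section \<open>Kronecker products with unit vectors and quasi-identities\<close>

lemma kronecker_ecol: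
  assumes X: "X \<in> carrier_mat n q" and j: "1 \<le> j" "j \<le> m"
  shows "ecol m j \<otimes>\<^sub>K X = bcol n m (j - 1) * (X :: 'a :: semiring_1 mat)"
proof (rule eq_matI)
  fix i c assume "i < dim_row (bcol n m (j - 1) * X)" "c < dim_col (bcol n m (j - 1) * X)"
  hence i: "i < m * n" and c: "c < q" using X by auto
  have "ecol m j $$ (i div n, 0) = (if i div n = j - 1 then 1 else 0 :: 'a)"
    unfolding ecol_def using block_div_less[OF i] j by (simp add: mat_of_cols_index)
  thus "(ecol m j \<otimes>\<^sub>K X) $$ (i, c) = (bcol n m (j - 1) * X) $$ (i, c)"
    using i c X bcol_mult_index[OF X i c] by (simp add: kronecker_def ecol_def)
qed (use X in \<open>auto simp: kronecker_def ecol_def\<close>)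

lemma kronecker_transpose:
  "transpose_mat X \<otimes>\<^sub>K Y = transpose_mat (X \<otimes>\<^sub>K transpose_mat (Y :: 'a :: times mat))"
proof (rule eq_matI)
  fix i j assume "i < dim_row (transpose_mat (X \<otimes>\<^sub>K transpose_mat Y))" "j < dim_col (transpose_mat (X \<otimes>\<^sub>K transpose_mat Y))"
  hence i: "i < dim_col X * dim_row Y" and j: "j < dim_row X * dim_col Y" by (auto simp: kronecker_def)
  thus "(transpose_mat X \<otimes>\<^sub>K Y) $$ (i, j) = transpose_mat (X \<otimes>\<^sub>K transpose_mat Y) $$ (i, j)"
    using block_div_less[OF i] block_mod_less[OF i] block_div_less[OF j] block_mod_less[OF j]
    by (simp add: kronecker_def)
qed (auto simp: kronecker_def)

lemma diag_block_signs:
  fixes f :: "nat \<Rightarrow> 'a :: semiring_1"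
  assumes n: "n > 0"
  shows "diag_block_mat (map (\<lambda>j. f j \<cdot>\<^sub>m 1\<^sub>m n) [0..<m]) = sgnm n m f"
proof (induction m arbitrary: f)
  case 0 show ?case by (intro eq_matI) auto
next
  case (Suc m)
  have l: "[0..<Suc m] = 0 # map Suc [0..<m]" by (metis map_Suc_upt upt_conv_Cons zero_less_Suc)
  have d: "diag_block_mat (map (\<lambda>j. f (Suc j) \<cdot>\<^sub>m 1\<^sub>m n) [0..<m]) = sgnm n m (\<lambda>j. f (Suc j))" by (rule Suc)
  have "diag_block_mat (map (\<lambda>j. f j \<cdot>\<^sub>m 1\<^sub>m n) [0..<Suc m]) =
    bdiag n (m * n) (f 0 \<cdot>\<^sub>m 1\<^sub>m n) (sgnm n m (\<lambda>j. f (Suc j)))"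
    unfolding l by (simp add: d[symmetric] o_def Let_def) (simp add: d)
  also have "\<dots> = sgnm n (Suc m) f" (is "?L = _")
  proof (rule eq_matI)
    fix i j assume "i < dim_row (sgnm n (Suc m) f)" "j < dim_col (sgnm n (Suc m) f)"
    hence i: "i < n + m * n" and j: "j < n + m * n" by auto
    have dv: "i div n = Suc ((i - n) div n)" if "\<not> i < n" using that n by (simp add: le_div_geq)
    show "?L $$ (i, j) = sgnm n (Suc m) f $$ (i, j)"
      using i j dv by (cases "i < n"; cases "j < n") (auto simp: sgnm_def)
  qed auto
  finally show ?case .
qed

lemma quasi_identity_signs:
  assumes "n > 0" "quasi_identity n m \<epsilon> Q"
  shows "Q = sgnm n m (\<lambda>a. \<epsilon> (Suc a))"
proof -
  have "map (\<lambda>j. \<epsilon> j \<cdot>\<^sub>m 1\<^sub>m n) [1..<Suc m] = map (\<lambda>j. \<epsilon> (Suc j) \<cdot>\<^sub>m 1\<^sub>m n) [0..<m]"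
    unfolding One_nat_def map_Suc_upt[symmetric] by (simp add: o_def)
  thus ?thesis using assms diag_block_signs[of n "\<lambda>j. \<epsilon> (Suc j)" m] by (simp add: quasi_identity_def)
qed

lemma signs_quasi_identity:
  assumes "n > 0" "\<And>a. a < m \<Longrightarrow> d a \<in> {1, -1}"
  shows "quasi_identity n m (\<lambda>j. d (j - 1)) (sgnm n m d)"
proof -
  have "map (\<lambda>j. d (j - 1) \<cdot>\<^sub>m 1\<^sub>m n) [1..<Suc m] = map (\<lambda>j. d j \<cdot>\<^sub>m 1\<^sub>m n) [0..<m]"
    unfolding One_nat_def map_Suc_upt[symmetric] by (simp add: o_def)
  moreover have "d (j - 1) \<in> {1, -1}" if "j \<in> {1..m}" for j by (rule assms(2)) (use that in auto)
  ultimately show ?thesis using assms diag_block_signs[of n d m] by (simp add: quasi_identity_def)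
qed

section \<open>Transport along the coefficient embeddings\<close>

lemma pm_gen: "C \<in> carrier_mat n n \<Longrightarrow> pm (gen n m p q C) = gen n m p q (pm C)"
  by (intro eq_matI) (auto simp: gen_index one_pCons[symmetric] block_mod_less)

lemma rm_gen: "C \<in> carrier_mat n n \<Longrightarrow> rm (gen n m p q C) = gen n m p q (rm C)"
  by (intro eq_matI) (auto simp: gen_index block_mod_less)

lemma pm_bcol [simp]: "pm (bcol n m a) = bcol n m a"
  by (intro eq_matI) (auto simp: bcol_index one_pCons[symmetric])

lemma rm_bcol [simp]: "rm (bcol n m a) = bcol n m a"
  by (intro eq_matI) (auto simp: bcol_index)

lemma pm_wprod: "(\<And>i. i \<in> set t \<Longrightarrow> M i \<in> carrier_mat N N) \<Longrightarrow> pm (wprod N M t) = wprod N (\<lambda>i. pm (M i)) t"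
proof (induction t)
  case (Cons i t)
  have "wprod N M t \<in> carrier_mat N N" by (rule wprod_carrier) (use Cons in auto)
  thus ?case using Cons pm_mult[of "M i" N N "wprod N M t" N] by simp
qed simp

lemma rm_wprod: "(\<And>i. i \<in> set t \<Longrightarrow> M i \<in> carrier_mat N N) \<Longrightarrow> rm (wprod N M t) = wprod N (\<lambda>i. rm (M i)) t"
proof (induction t)
  case (Cons i t)
  have "wprod N M t \<in> carrier_mat N N" by (rule wprod_carrier) (use Cons in auto)
  thus ?case using Cons rm_mult[of "M i" N N "wprod N M t" N] by simp
qed simp

lemma pm_uminus: "pm (- X) = - pm X"
  by (intro eq_matI) auto

lemma rm_uminus: "rm (- X) = - rm X"
  by (intro eq_matI) auto

lemma skew_entries:
  fixes X :: "'a :: group_add mat"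
  assumes X: "X \<in> carrier_mat k k"
  shows "transpose_mat X = - X \<longleftrightarrow> (\<forall>i<k. \<forall>j<k. X $$ (j, i) = - X $$ (i, j))"
proof
  assume e: "transpose_mat X = - X"
  show "\<forall>i<k. \<forall>j<k. X $$ (j, i) = - X $$ (i, j)"
  proof (intro allI impI)
    fix i j assume ij: "i < k" "j < k"
    have "transpose_mat X $$ (i, j) = (- X) $$ (i, j)" using e by simp
    thus "X $$ (j, i) = - X $$ (i, j)" using ij carrier_matD[OF X] by simp
  qed
next
  assume a: "\<forall>i<k. \<forall>j<k. X $$ (j, i) = - X $$ (i, j)"
  show "transpose_mat X = - X"
  proof (rule eq_matI)
    fix i j assume "i < dim_row (- X)" "j < dim_col (- X)"
    hence ij: "i < k" "j < k" using carrier_matD[OF X] by auto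
    have "transpose_mat X $$ (i, j) = X $$ (j, i)" using ij carrier_matD[OF X] by simp
    also have "\<dots> = - X $$ (i, j)" using a ij by blast
    also have "\<dots> = (- X) $$ (i, j)" using ij carrier_matD[OF X] by simp
    finally show "transpose_mat X $$ (i, j) = (- X) $$ (i, j)" .
  qed (use carrier_matD[OF X] in simp_all)
qed

text \<open>A polynomial pencil determines its two coefficients.\<close>

lemma pencil_skew_iff:
  assumes X: "X \<in> carrier_mat k k" and Y: "Y \<in> carrier_mat k k"
  shows "skew_symmetric (lam \<cdot>\<^sub>m pm X - pm Y) \<longleftrightarrow> transpose_mat X = - X \<and> transpose_mat Y = - Y"
proof -
  have c: "lam \<cdot>\<^sub>m pm X - pm Y \<in> carrier_mat k k" using X Y by auto
  have ix: "(lam \<cdot>\<^sub>m pm X - pm Y) $$ (i, j) = [:- Y $$ (i, j), X $$ (i, j):]" if "i < k" "j < k" for i j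
    using that carrier_matD[OF X] carrier_matD[OF Y] by simp
  have key: "[:- b, a:] = - [:- d, c:] \<longleftrightarrow> a = - c \<and> b = - d" for a b c d :: complex
    by (simp, metis minus_minus)
  have "skew_symmetric (lam \<cdot>\<^sub>m pm X - pm Y) \<longleftrightarrow>
    (\<forall>i<k. \<forall>j<k. [:- Y $$ (j, i), X $$ (j, i):] = - [:- Y $$ (i, j), X $$ (i, j):])"
    unfolding skew_symmetric_def skew_entries[OF c] by (simp only: ix cong: imp_cong)
  also have "\<dots> \<longleftrightarrow> (\<forall>i<k. \<forall>j<k. X $$ (j, i) = - X $$ (i, j)) \<and> (\<forall>i<k. \<forall>j<k. Y $$ (j, i) = - Y $$ (i, j))"
    unfolding key by blast
  finally show ?thesis unfolding skew_entries[OF X] skew_entries[OF Y] .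
qed

text \<open>The determinant of an involution is 1 or -1.\<close>

lemma involution_biproper:
  assumes X: "X \<in> carrier_mat k k" and ov: "mat_over proper X" and inv: "X * X = 1\<^sub>m k"
  shows "biproper X"
proof (rule biproperI[OF X ov])
  have "det X * det X = 1" using det_mult[OF X X] inv by simp
  thus "det X \<in> {1, -1}" by (simp add: square_eq_1_iff)
qed

section \<open>The two chains of a matrix polynomial\<close>

lemma adm_set: "set (adm p j) = {..p + 2 * j}"
  by (induction j) (auto simp: atMost_Suc)

lemma adm_distinct: "distinct (adm p j)"
  by (induction j) (auto simp: adm_set)

lemma adm_ne: "adm p j \<noteq> []"
  by (cases j) auto

lemma adm_zero_last: "adm 0 j = butlast (adm 0 j) @ [0]"
proof -
  have "last (adm 0 j) = 0" by (induction j) (auto simp: adm_ne)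
  thus ?thesis using append_butlast_last_id[OF adm_ne[of 0 j]] by simp
qed

lemma adm_zero_butlast_set: "set (butlast (adm 0 j)) = {1..2 * j}"
proof -
  have d: "distinct (butlast (adm 0 j) @ [0])" using adm_distinct[of 0 j] adm_zero_last[of j] by simp
  have "set (butlast (adm 0 j) @ [0]) = {..2 * j}" using adm_set[of 0 j] adm_zero_last[of j] by simp
  hence "insert 0 (set (butlast (adm 0 j))) = {..2 * j}" by simp
  moreover have "0 \<notin> set (butlast (adm 0 j))" using d unfolding distinct_append by simp
  moreover have "S = {1..b}" if "insert 0 S = {..b}" "0 \<notin> S" for S and b :: nat
  proof -
    have "S = insert 0 S - {0}" using that(2) by simp
    also have "\<dots> = {1..b}" unfolding that(1) by auto
    finally show ?thesis .
  qed
  ultimately show ?thesis by blast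
qed

lemma csym_zero: "csym 0 j = evw (2 * j)"
  by (induction j) auto

lemma greedy_append: "greedy q (u @ v) = greedy (greedy q u) v"
  by (induction u arbitrary: q) auto

lemma greedy_le: "q \<le> h \<Longrightarrow> (\<And>s. s \<in> set t \<Longrightarrow> s \<le> h) \<Longrightarrow> greedy q t \<le> h"
  by (induction t arbitrary: q) auto

lemma prm_rev: "prm t (prm (rev t) y) = y"
proof (induction t arbitrary: y)
  case (Cons s t)
  have "swp s (swp s x) = x" for x by (simp add: swp_def)
  thus ?case using Cons by (simp add: prm_append)
qed simp

lemma prm_le: "x \<le> k \<Longrightarrow> (\<And>s. s \<in> set t \<Longrightarrow> s \<le> k) \<Longrightarrow> prm t x \<le> k"
  by (induction t arbitrary: x) (auto simp: swp_def)

lemma stl_bound: "(\<And>i. c i \<Longrightarrow> i < k) \<Longrightarrow> mv c t \<Longrightarrow> stl c t i \<Longrightarrow> i < k"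
proof (induction t arbitrary: c)
  case (Cons s t)
  have "s < k" using Cons.prems by simp
  hence "\<And>i. stp c s i \<Longrightarrow> i < k" using Cons.prems(1) by (auto simp: stp_def split: if_splits)
  thus ?case using Cons.IH[of "stp c s"] Cons.prems by simp
qed simp

lemma sgnm_cong: "(\<And>a. a < m \<Longrightarrow> d a = d' a) \<Longrightarrow> sgnm n m d = sgnm n m d'"
  by (intro eq_matI) (auto simp: sgnm_def block_div_less)

lemma sgnm_uminus: "sgnm n m (\<lambda>a. - d a) = - (sgnm n m d :: 'a :: group_add mat)"
  by (intro eq_matI) (auto simp: sgnm_def)

lemma transpose_uminus_mat: "transpose_mat (- X) = - transpose_mat (X :: 'a :: group_add mat)"
  by (intro eq_matI) auto

text \<open>The reordering that separates the two chains in a generalized Fiedler pencil. Letters \<open>W\<close> and \<open>Z\<close>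
  stand for factors from the two chains; the hypotheses are the commutations that are available.\<close>

lemma sandwich_right:
  fixes Zr :: "'a :: semiring_1 mat"
  assumes c: "Zr \<in> carrier_mat N N" "Wr \<in> carrier_mat N N" "Za \<in> carrier_mat N N" "Ws \<in> carrier_mat N N"
    "Wt \<in> carrier_mat N N" "Zs \<in> carrier_mat N N" "Zt \<in> carrier_mat N N"
    and 1: "Wr * Za = Za * Wr" and 2: "(Wr * (Ws * Wt)) * (Zs * Zt) = (Zs * Zt) * (Wr * (Ws * Wt))"
  shows "Zr * Wr * Za * Ws * Wt * Zs * Zt = (Zr * (Za * (Zs * Zt))) * (Wr * (Ws * Wt))"
proof -
  note as = assoc_mult_mat[of _ "N" "N" _ "N" _ "N"]
  note mc = mult_carrier_mat[of _ "N" "N" _ "N"]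
  have "Zr * Wr * Za * Ws * Wt * Zs * Zt = Zr * ((Wr * Za) * ((Ws * Wt) * (Zs * Zt)))"
    by (simp only: as mc c)
  also have "\<dots> = Zr * (Za * ((Wr * (Ws * Wt)) * (Zs * Zt)))" unfolding 1 by (simp only: as mc c)
  also have "\<dots> = (Zr * (Za * (Zs * Zt))) * (Wr * (Ws * Wt))" unfolding 2 by (simp only: as mc c)
  finally show ?thesis .
qed

lemma sandwich_left:
  fixes Zr :: "'a :: semiring_1 mat"
  assumes c: "Zr \<in> carrier_mat N N" "Wr \<in> carrier_mat N N" "Wa \<in> carrier_mat N N" "Ws \<in> carrier_mat N N"
    "Wt \<in> carrier_mat N N" "Zs \<in> carrier_mat N N" "Zt \<in> carrier_mat N N"
    and 1: "Zr * (Wr * (Wa * (Ws * Wt))) = (Wr * (Wa * (Ws * Wt))) * Zr"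
  shows "Zr * Wr * Wa * Ws * Wt * Zs * Zt = (Wr * (Wa * (Ws * Wt))) * (Zr * (Zs * Zt))"
proof -
  note as = assoc_mult_mat[of _ "N" "N" _ "N" _ "N"]
  note mc = mult_carrier_mat[of _ "N" "N" _ "N"]
  have "Zr * Wr * Wa * Ws * Wt * Zs * Zt = (Zr * (Wr * (Wa * (Ws * Wt)))) * (Zs * Zt)"
    by (simp only: as mc c)
  also have "\<dots> = (Wr * (Wa * (Ws * Wt))) * (Zr * (Zs * Zt))" unfolding 1 by (simp only: as mc c)
  finally show ?thesis .
qed

text \<open>On a block column fixed by \<open>Y\<close> the product acts like \<open>X\<close>; on the others \<open>X\<close> acts as the identity.\<close>

lemma commute_factor:
  fixes X Y :: "'a :: comm_ring_1 mat"
  assumes X: "X \<in> carrier_mat (m * n) (m * n)" and Y: "Y \<in> carrier_mat (m * n) (m * n)"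
    and disj: "\<And>a. a < m \<Longrightarrow> X * bcol n m a = bcol n m a \<or> Y * bcol n m a = bcol n m a"
    and comm: "sgnm n m \<rho> * (X * Y) = (X * Y) * sgnm n m \<rho>"
  shows "sgnm n m \<rho> * X = X * sgnm n m \<rho>"
proof (rule blockcol_eqI)
  let ?D = "sgnm n m \<rho>"
  fix a assume a: "a < m"
  let ?e = "bcol n m a :: 'a mat"
  have D: "?D * ?e = \<rho> a \<cdot>\<^sub>m ?e" by (rule sgnm_mult_bcol[OF a])
  have r: "X * ?D * ?e = \<rho> a \<cdot>\<^sub>m (X * ?e)"
  proof -
    have "X * ?D * ?e = X * (?D * ?e)" by (rule assoc_mult_mat[OF X]) auto
    also have "\<dots> = \<rho> a \<cdot>\<^sub>m (X * ?e)" unfolding D by (rule mult_smult_distrib[OF X bcol_carrier])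
    finally show ?thesis .
  qed
  have l: "?D * X * ?e = ?D * (X * ?e)" by (rule assoc_mult_mat[OF _ X]) auto
  show "?D * X * ?e = X * ?D * ?e"
  proof (cases "X * ?e = ?e")
    case True thus ?thesis unfolding l r by (simp add: D)
  next
    case False
    hence Ye: "Y * ?e = ?e" using disj[OF a] by blast
    have XY: "X * Y \<in> carrier_mat (m * n) (m * n)" using X Y by (rule mult_carrier_mat)
    have XYe: "X * Y * ?e = X * ?e" using assoc_mult_mat[OF X Y bcol_carrier] Ye by metis
    have "?D * (X * ?e) = ?D * (X * Y) * ?e"
      using assoc_mult_mat[OF _ XY bcol_carrier, of ?D "m * n"] XYe by (metis sgnm_carrier)
    also have "\<dots> = X * Y * (?D * ?e)" unfolding comm by (rule assoc_mult_mat[OF XY]) auto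
    also have "\<dots> = \<rho> a \<cdot>\<^sub>m (X * ?e)" unfolding D XYe[symmetric] by (rule mult_smult_distrib[OF XY bcol_carrier])
    finally show ?thesis unfolding l r .
  qed
qed (use X in auto)

lemma wprod_comm_two:
  fixes M :: "'i \<Rightarrow> 'a :: semiring_1 mat" and M' :: "'j \<Rightarrow> 'a mat"
  assumes c: "\<And>i. i \<in> set u \<Longrightarrow> M i \<in> carrier_mat N N" "\<And>j. j \<in> set v \<Longrightarrow> M' j \<in> carrier_mat N N"
    and comm: "\<And>i j. i \<in> set u \<Longrightarrow> j \<in> set v \<Longrightarrow> M i * M' j = M' j * M i"
  shows "wprod N M u * wprod N M' v = wprod N M' v * wprod N M u"
proof -
  have "wprod N (case_sum M M') (map Inl u) * wprod N (case_sum M M') (map Inr v) =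
    wprod N (case_sum M M') (map Inr v) * wprod N (case_sum M M') (map Inl u)"
    by (rule wprod_comm) (use c comm in auto)
  thus ?thesis unfolding wprod_map by simp
qed

text \<open>Block positions of the Fiedler matrices of nonnegative index, which run upwards from the last block.\<close>

definition wpos :: "nat \<Rightarrow> nat \<Rightarrow> nat"
  where "wpos m i = m - 1 - i"

text \<open>The matrices of index \<open>0, \<dots>, m - 1\<close> form the chain \<open>w\<close>, and those of index \<open>-m, \<dots>, -1\<close>, shifted by \<open>m\<close>, form
  the chain \<open>z\<close>. The two sublocales carry the results on chains to both.\<close>

locale matrix_poly =
  fixes n m :: nat and A :: "nat \<Rightarrow> complex mat"
  assumes n: "n > 0" and m: "m \<ge> 1" and A: "\<And>i. i \<le> m \<Longrightarrow> A i \<in> carrier_mat n n"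

sublocale matrix_poly \<subseteq> w: chain n m m "wpos m" "\<lambda>i. - A i"
  by unfold_locales (use m in \<open>auto simp: inj_on_def wpos_def intro: A\<close>)

sublocale matrix_poly \<subseteq> z: chain n m m "\<lambda>i. i" "\<lambda>i. A (m - i)"
  by unfold_locales (auto intro: A)

context matrix_poly
begin

lemma fiedler_w: "i < m \<Longrightarrow> fiedler n m A (int i) = w.M i"
  unfolding w.M_def wpos_def using fiedler_nonneg[OF n, of i m A] A[of i] by simp

lemma fiedler_z: "i < m \<Longrightarrow> fiedler n m A (int i - int m) = z.M i"
  unfolding z.M_def using fiedler_neg[OF n, of i m A] A[of "m - i"] by simp

text \<open>The \<open>w\<close>-generator \<open>i\<close> occupies positions from \<open>m - 1 - i\<close> on, the \<open>z\<close>-generator \<open>j\<close> positions up to \<open>j\<close>.\<close>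

lemma wz_comm:
  assumes "\<And>i j. i \<in> set u \<Longrightarrow> j \<in> set v \<Longrightarrow> i + j + 1 < m"
  shows "w.W u * z.W v = z.W v * w.W u"
proof (rule wprod_comm_two)
  fix i j assume ij: "i \<in> set u" "j \<in> set v"
  have l: "i + j + 1 < m" using assms ij by blast
  show "w.M i * z.M j = z.M j * w.M i"
    unfolding w.M_def z.M_def wpos_def by (rule gen_comm) (use l A[of i] A[of "m - j"] in auto)
qed auto

lemma z_fix:
  assumes "\<And>s. s \<in> set t \<Longrightarrow> s < a" "a < m"
  shows "z.W t * bcol n m a = bcol n m a" "transpose_mat (bcol n m a) * z.W t = transpose_mat (bcol n m a)"
proof -
  have *: "z.M s * bcol n m a = bcol n m a" if "s \<in> set t" for s
    using assms(1)[OF that] assms(2) by (intro z.M_fix) auto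
  show "z.W t * bcol n m a = bcol n m a" by (rule wprod_fixes) (use * in auto)
  have "transpose_mat (z.M s) * bcol n m a = bcol n m a" if s: "s \<in> set t" for s
  proof -
    have C: "A (m - s) \<in> carrier_mat n n" by (rule A) simp
    have "s - 1 < m" "s < m" "a \<noteq> s" "a \<noteq> s - 1" using assms(1)[OF s] assms(2) by auto
    thus ?thesis unfolding z.M_def gen_transpose[OF C]
      using gen_mult_bcol[of "transpose_mat (A (m - s))" n s m "s - 1" a] C assms(2) by simp
  qed
  hence "wprod (m * n) (\<lambda>s. transpose_mat (z.M s)) (rev t) * bcol n m a = bcol n m a"
    by (intro wprod_fixes[of _ _ "m * n" _ n]) auto
  hence "transpose_mat (z.W t) * bcol n m a = bcol n m a" by (subst wprod_transpose) auto
  hence "transpose_mat (transpose_mat (z.W t) * bcol n m a) = transpose_mat (bcol n m a)" by simp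
  thus "transpose_mat (bcol n m a) * z.W t = transpose_mat (bcol n m a)"
    by (subst (asm) transpose_mult[of _ "m * n" "m * n" _ n]) auto
qed

lemma w_fix:
  assumes "\<And>s. s \<in> set t \<Longrightarrow> s + a + 1 < m" "a < m"
  shows "w.W t * bcol n m a = bcol n m a"
proof (rule wprod_fixes)
  fix s assume "s \<in> set t"
  hence "s + a + 1 < m" using assms by blast
  thus "w.M s * bcol n m a = bcol n m a" by (intro w.M_fix) (auto simp: wpos_def)
qed auto

lemma w_z_inverse: "1 \<le> i \<Longrightarrow> i < m \<Longrightarrow> w.M i * z.M (m - i) = 1\<^sub>m (m * n) \<and> z.M (m - i) * w.M i = 1\<^sub>m (m * n)"
proof -
  assume i: "1 \<le> i" "i < m"
  have C: "A i \<in> carrier_mat n n" "- A i \<in> carrier_mat n n" using A[of i] i by auto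
  have e: "m - 1 - (i - 1) = m - i" "m - i - 1 = m - 1 - i" "m - (m - i) = i" using i by auto
  have "gen n m (m - i) (m - 1 - i) (A i) * gen n m (m - 1 - i) (m - i) (- A i) = 1\<^sub>m (m * n)"
    by (rule gen_inverse) (use i C in auto)
  moreover have "gen n m (m - 1 - i) (m - i) (- A i) * gen n m (m - i) (m - 1 - i) (- (- A i)) = 1\<^sub>m (m * n)"
    by (rule gen_inverse) (use i C in auto)
  moreover have "- (- A i) = A i" by (intro eq_matI) auto
  ultimately show ?thesis unfolding w.M_def z.M_def wpos_def e by simp
qed

end

section \<open>Signs of a skew-symmetric pencil\<close>

text \<open>With \<open>D' = - D\<close> the twisted symmetry \<open>X\<^sup>T = D X D'\<close> says that \<open>D X\<close> is skew-symmetric.\<close>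

lemma skew_of_twisted:
  fixes X :: "complex mat"
  assumes X: "X \<in> carrier_mat (m * n) (m * n)" and d: "\<And>a. d a * d a = 1"
    and tw: "transpose_mat X = sgnm n m d * X * sgnm n m d'" and d': "\<And>a. a < m \<Longrightarrow> d' a = - d a"
  shows "transpose_mat (sgnm n m d * X) = - (sgnm n m d * X)"
proof -
  let ?D = "sgnm n m d"
  have DX: "?D * X \<in> carrier_mat (m * n) (m * n)" by (rule mult_carrier_mat[OF sgnm_carrier X])
  have D': "sgnm n m d' = - ?D" unfolding sgnm_uminus[symmetric] by (rule sgnm_cong) (rule d')
  have DD: "?D * ?D = 1\<^sub>m (m * n)" unfolding sgnm_mult_sgnm d by (rule sgnm_one)
  have "transpose_mat (?D * X) = transpose_mat X * ?D"
    using transpose_mult[OF sgnm_carrier X, of d] by simp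
  also have "\<dots> = ?D * X * (- ?D) * ?D" unfolding tw D' ..
  also have "\<dots> = ?D * X * ((- ?D) * ?D)" by (rule assoc_mult_mat[OF DX]) auto
  also have "(- ?D) * ?D = - (1\<^sub>m (m * n))" using uminus_mult_left_mat[of ?D ?D] DD by simp
  also have "?D * X * (- (1\<^sub>m (m * n))) = - (?D * X * 1\<^sub>m (m * n))"
    by (rule uminus_mult_right_mat) (simp add: carrier_matD[OF DX] carrier_matD[OF X])
  also have "?D * X * 1\<^sub>m (m * n) = ?D * X" using DX by (rule right_mult_one_mat)
  finally show ?thesis .
qed

text \<open>Both hypotheses express \<open>X\<^sup>T\<close> through \<open>X\<close>, as \<open>- D X D\<close> and as \<open>- D' X D'\<close>; comparing them shows that \<open>D' D\<close>
  commutes with \<open>X\<close>.\<close>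

lemma commute_of_skew:
  fixes X :: "complex mat"
  assumes X: "X \<in> carrier_mat (m * n) (m * n)" and d: "\<And>a. d a * d a = 1" "\<And>a. d' a * d' a = 1"
    and sk: "transpose_mat (sgnm n m d * X) = - (sgnm n m d * X)" "transpose_mat (sgnm n m d' * X) = - (sgnm n m d' * X)"
  shows "sgnm n m (\<lambda>a. d' a * d a) * X = X * sgnm n m (\<lambda>a. d' a * d a)"
proof -
  have D2: "sgnm n m f * sgnm n m f = 1\<^sub>m (m * n)" if "\<And>a. f a * f a = 1" for f :: "nat \<Rightarrow> complex"
    unfolding sgnm_mult_sgnm that by (rule sgnm_one)
  have t: "transpose_mat X = - (sgnm n m f * X * sgnm n m f)"
    if f: "\<And>a. f a * f a = 1" and s: "transpose_mat (sgnm n m f * X) = - (sgnm n m f * X)" for f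
  proof -
    let ?D = "sgnm n m f"
    have DX: "?D * X \<in> carrier_mat (m * n) (m * n)" by (rule mult_carrier_mat[OF sgnm_carrier X])
    have "transpose_mat X * ?D = - (?D * X)" using transpose_mult[OF sgnm_carrier X, of f] s by simp
    hence "transpose_mat X * ?D * ?D = - (?D * X) * ?D" by simp
    moreover have "transpose_mat X * ?D * ?D = transpose_mat X * (?D * ?D)"
      by (rule assoc_mult_mat) (use X in auto)
    moreover have "transpose_mat X * 1\<^sub>m (m * n) = transpose_mat X" using X by (intro right_mult_one_mat) auto
    moreover have "- (?D * X) * ?D = - (?D * X * ?D)" using DX by (intro uminus_mult_left_mat) auto
    ultimately show ?thesis unfolding D2[OF f] by simp
  qed
  let ?D = "sgnm n m d" and ?E = "sgnm n m d'"
  have c: "?D \<in> carrier_mat (m * n) (m * n)" "?E \<in> carrier_mat (m * n) (m * n)" by auto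
  have "?D * X * ?D = ?E * X * ?E"
  proof -
    have "- (?D * X * ?D) = - (?E * X * ?E)" using t[OF d(1) sk(1)] t[OF d(2) sk(2)] by simp
    hence "- (- (?D * X * ?D)) = - (- (?E * X * ?E))" by simp
    thus ?thesis by (simp only: uminus_uminus_mat)
  qed
  hence eq: "?E * (?D * X * ?D) * ?D = ?E * (?E * X * ?E) * ?D" by simp
  note as = assoc_mult_mat[of _ "m * n" "m * n" _ "m * n" _ "m * n"]
  note mc = mult_carrier_mat[of _ "m * n" "m * n" _ "m * n"]
  have "?E * (?D * X * ?D) * ?D = ?E * ?D * X * (?D * ?D)" by (simp only: as mc c X)
  also have "\<dots> = ?E * ?D * X" unfolding D2[OF d(1)] by (rule right_mult_one_mat[of _ "m * n" "m * n"]) (simp only: mc c X)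
  finally have 1: "?E * (?D * X * ?D) * ?D = ?E * ?D * X" .
  have 2: "?E * (?D * X * ?D) * ?D = ?E * (?E * X * ?E) * ?D" by (rule eq)
  have "?E * (?E * X * ?E) * ?D = ?E * ?E * (X * (?E * ?D))" by (simp only: as mc c X)
  also have "\<dots> = X * (?E * ?D)" unfolding D2[OF d(2)] by (rule left_mult_one_mat[of _ "m * n" "m * n"]) (simp only: mc c X)
  finally have "?E * ?D * X = X * (?E * ?D)" using 1 2 by argo
  thus ?thesis unfolding sgnm_mult_sgnm .
qed

section \<open>The structure of a symmetric generalized Fiedler pencil\<close>

text \<open>The index data of the pencil as lists of natural numbers: the tuples for the chain \<open>z\<close> are shifted by
  \<open>m\<close>, and being a right index tuple is replaced by legality of the moves. Here \<open>aw\<close>, \<open>sw\<close>, \<open>az\<close>, \<open>sz\<close>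
  are the admissible tuples and their complements, and the pencil is \<open>\<lambda> L1 - L0\<close>.\<close>

locale gfpr_words = matrix_poly +
  fixes h pz :: nat and tw tz :: "nat list"
  assumes skew: "\<And>i. i \<le> m \<Longrightarrow> transpose_mat (A i) = - A i"
    and h: "h \<le> m - 1" "even h" and pz: "pz \<le> m - 1 - h" "even (m - 1 - h - pz)"
    and tw: "mv (simple_state 0 h) tw" and tz: "mv (simple_state pz (m - 1 - h)) tz"
begin

definition k :: nat where "k = m - 1 - h"
definition aw :: "nat list" where "aw = adm 0 (h div 2)"
definition sw :: "nat list" where "sw = csym 0 (h div 2)"
definition az :: "nat list" where "az = adm pz ((k - pz) div 2)"
definition sz :: "nat list" where "sz = csym pz ((k - pz) div 2)"
definition Tz :: "nat list" where "Tz = exits pz @ tz"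

definition "Lm = z.W (rev tz) * w.W (rev tw)"
definition "Rm = w.W sw * w.W tw * z.W sz * z.W tz"
definition "L1 = z.W (rev tz) * w.W (rev tw) * z.W az * w.W sw * w.W tw * z.W sz * z.W tz"
definition "L0 = z.W (rev tz) * w.W (rev tw) * w.W aw * w.W sw * w.W tw * z.W sz * z.W tz"

lemma mhk: "m = h + k + 1" using h m by (simp add: k_def)

lemma pzk: "pz \<le> k" "even (k - pz)" "pz + 2 * ((k - pz) div 2) = k" using pz by (auto simp: k_def)

lemma hh: "2 * (h div 2) = h" using h by simp

lemma tw_less: "s \<in> set tw \<Longrightarrow> s < h"
  using mv_letters[OF tw, of h s] by (simp add: simple_state_def)

lemma tz_less: "s \<in> set tz \<Longrightarrow> s < k"
  using mv_letters[OF tz, of k s] by (simp add: simple_state_def k_def)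

lemma sw_evw: "sw = evw h" unfolding sw_def csym_zero hh ..

lemma sw_less: "s \<in> set sw \<Longrightarrow> s < h" unfolding sw_evw by (rule evw_letters)

lemma aw_set: "set aw = {..h}" unfolding aw_def adm_set hh by simp

lemma az_set: "set az = {..k}" unfolding az_def adm_set pzk(3) ..

lemma sz_less: "s \<in> set sz \<Longrightarrow> s < k" using csym_letters[of s pz "(k - pz) div 2"] pzk(3) by (simp add: sz_def)

lemma Tz_mv: "mv (simple_state 0 k) Tz"
  using mv_exits[OF pzk(1,2)] tz by (simp add: Tz_def mv_append k_def)

lemma Tz_less: "s \<in> set Tz \<Longrightarrow> s < k"
  using mv_letters[OF Tz_mv, of k s] by (simp add: simple_state_def)

lemma evw_mv: "mv (simple_state 0 k') t \<Longrightarrow> mv (simple_state 0 (Suc k')) (evw k' @ t)"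
  by (simp add: mv_append mv_evw)

lemma L_carrier [simp, intro]: "L0 \<in> carrier_mat (m * n) (m * n)" "L1 \<in> carrier_mat (m * n) (m * n)"
  "Lm \<in> carrier_mat (m * n) (m * n)" "Rm \<in> carrier_mat (m * n) (m * n)"
  unfolding L0_def L1_def Lm_def Rm_def by (intro w.mult_N w.W_carrier z.W_carrier)+

definition "X0 = w.W (rev (evw h @ tw) @ evw (Suc h) @ (evw h @ tw))"
definition "Y0 = z.W (rev Tz @ evw k @ Tz)"
definition "X1 = z.W (rev (evw k @ Tz) @ evw (Suc k) @ (evw k @ Tz))"
definition "Y1 = w.W (rev tw @ evw h @ tw)"

lemma XY_carrier [simp, intro]: "X0 \<in> carrier_mat (m * n) (m * n)" "Y0 \<in> carrier_mat (m * n) (m * n)"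
  "X1 \<in> carrier_mat (m * n) (m * n)" "Y1 \<in> carrier_mat (m * n) (m * n)"
  unfolding X0_def Y0_def X1_def Y1_def by auto

lemma X0_letters: "s \<in> set (rev (evw h @ tw) @ evw (Suc h) @ (evw h @ tw)) \<Longrightarrow> s \<le> h"
  using tw_less evw_letters[of s h] evw_letters[of s "Suc h"] by fastforce

lemma Y0_letters: "s \<in> set (rev Tz @ evw k @ Tz) \<Longrightarrow> s < k"
  using Tz_less evw_letters[of s k] by auto

lemma X1_letters: "s \<in> set (rev (evw k @ Tz) @ evw (Suc k) @ (evw k @ Tz)) \<Longrightarrow> s \<le> k"
  using Tz_less evw_letters[of s k] evw_letters[of s "Suc k"] by fastforce

lemma Y1_letters: "s \<in> set (rev tw @ evw h @ tw) \<Longrightarrow> s < h"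
  using tw_less evw_letters[of s h] by auto

lemma X0_alt: "w.W (rev tw) * (w.W aw * (w.W sw * w.W tw)) = X0"
proof -
  have "rev tw @ (aw @ sw) @ tw \<approx> rev tw @ palin h 0 @ tw"
    unfolding aw_def sw_def using adm_csym_weq[of 0 "h div 2"] hh by (intro weq_ctx) simp
  moreover have "set (rev tw @ (aw @ sw) @ tw) \<subseteq> {..<m}"
    using tw_less sw_less aw_set mhk by fastforce
  ultimately have "w.W (rev tw @ (aw @ sw) @ tw) = w.W (rev tw @ palin h 0 @ tw)" by (rule w.W_weq)
  thus ?thesis unfolding X0_def by (simp add: palin_def w.W_append)
qed

lemma Y0_alt: "z.W (rev tz) * (z.W sz * z.W tz) = Y0"
proof -
  have "rev tz @ sz @ tz \<approx> rev tz @ palin' k pz @ tz"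
    unfolding sz_def using csym_weq[of pz "(k - pz) div 2"] pzk(3) by (intro weq_ctx) simp
  moreover have "set (rev tz @ sz @ tz) \<subseteq> {..<m}"
    using tz_less sz_less mhk by fastforce
  ultimately have "z.W (rev tz @ sz @ tz) = z.W (rev tz @ palin' k pz @ tz)" by (rule z.W_weq)
  thus ?thesis unfolding Y0_def Tz_def by (simp add: palin'_def z.W_append)
qed

lemma X1_alt: "z.W (rev tz) * (z.W az * (z.W sz * z.W tz)) = X1"
proof -
  have "rev tz @ (az @ sz) @ tz \<approx> rev tz @ palin k pz @ tz"
    unfolding az_def sz_def using adm_csym_weq[of pz "(k - pz) div 2"] pzk(3) by (intro weq_ctx) simp
  moreover have "set (rev tz @ (az @ sz) @ tz) \<subseteq> {..<m}"
    using tz_less sz_less az_set mhk by fastforce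
  ultimately have "z.W (rev tz @ (az @ sz) @ tz) = z.W (rev tz @ palin k pz @ tz)" by (rule z.W_weq)
  thus ?thesis unfolding X1_def Tz_def by (simp add: palin_def z.W_append)
qed

lemma Y1_alt: "w.W (rev tw) * (w.W sw * w.W tw) = Y1"
  unfolding Y1_def sw_evw by (simp add: w.W_append)

text \<open>The letters of \<open>z\<close> are below \<open>k\<close> here, so they commute with all of the chain \<open>w\<close>. In \<open>L1\<close> it is the
  other way round: the letters of \<open>w\<close> are below \<open>h\<close>, those of \<open>z\<close> go up to \<open>k\<close>.\<close>

lemma L0_split: "L0 = X0 * Y0" and L0_comm: "X0 * Y0 = Y0 * X0"
proof -
  show "X0 * Y0 = Y0 * X0"
    unfolding X0_def Y0_def by (rule wz_comm) (use X0_letters Y0_letters mhk in fastforce)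
  have "w.W (rev (evw h @ tw) @ evw (Suc h) @ (evw h @ tw)) * z.W (rev tz) = z.W (rev tz) * w.W (rev (evw h @ tw) @ evw (Suc h) @ (evw h @ tw))"
    by (rule wz_comm) (use X0_letters tz_less mhk in fastforce)
  hence c: "z.W (rev tz) * X0 = X0 * z.W (rev tz)" by (simp only: X0_def)
  show "L0 = X0 * Y0"
    unfolding L0_def X0_alt[symmetric] Y0_alt[symmetric]
    by (rule sandwich_left[of _ "m * n"]) (use c in \<open>simp_all only: X0_alt w.W_carrier z.W_carrier\<close>)
qed

lemma L1_split: "L1 = X1 * Y1" and L1_comm: "X1 * Y1 = Y1 * X1"
proof -
  show "X1 * Y1 = Y1 * X1"
    unfolding X1_def Y1_def by (rule wz_comm[symmetric]) (use X1_letters Y1_letters mhk in fastforce)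
  have c1: "w.W (rev tw) * z.W az = z.W az * w.W (rev tw)"
    by (rule wz_comm) (use az_set tw_less mhk in fastforce)
  have "w.W (rev tw @ evw h @ tw) * z.W (sz @ tz) = z.W (sz @ tz) * w.W (rev tw @ evw h @ tw)"
    by (rule wz_comm) (use Y1_letters sz_less tz_less mhk in fastforce)
  hence c2: "Y1 * (z.W sz * z.W tz) = (z.W sz * z.W tz) * Y1" by (simp only: Y1_def z.W_append)
  show "L1 = X1 * Y1"
    unfolding L1_def X1_alt[symmetric] Y1_alt[symmetric]
    by (rule sandwich_right[of _ "m * n"]) (use c1 c2 in \<open>simp_all only: Y1_alt w.W_carrier z.W_carrier\<close>)
qed

text \<open>Signs compatible with the final states of both chains exist because the only common position, the
  one of the highest index of each chain, is unmarked in both. In each coefficient the two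
  palindromes together change the sign on every position exactly once.\<close>

lemma skew_signs_exist:
  obtains d where "\<And>a. d a \<in> {1, -1 :: complex}"
    "transpose_mat (sgnm n m d * L0) = - (sgnm n m d * L0)" "transpose_mat (sgnm n m d * L1) = - (sgnm n m d * L1)"
proof -
  define cZ where "cZ = stl (simple_state 0 k) Tz"
  define cW where "cW = stl (simple_state 0 h) tw"
  have cW: "cW i \<Longrightarrow> i < h" for i unfolding cW_def by (rule stl_bound[OF _ tw]) (auto simp: simple_state_def)
  have cZ: "cZ i \<Longrightarrow> i < k" for i unfolding cZ_def by (rule stl_bound[OF _ Tz_mv]) (auto simp: simple_state_def)
  \<comment> \<open>Position \<open>k\<close> belongs to both chains; it has index \<open>k\<close> in \<open>z\<close> and index \<open>h\<close> in \<open>w\<close>.\<close>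
  define d :: "nat \<Rightarrow> complex" where "d a = (if a \<le> k then (if cZ a then -1 else 1) else (if cW (m - 1 - a) then -1 else 1))" for a
  have d1: "d a \<in> {1, -1}" for a by (simp add: d_def)
  have dd: "d a * d a = 1" for a by (simp add: d_def)
  have dW: "d (wpos m i) = (if cW i then -1 else 1)" if "i < Suc h" for i
  proof (cases "i = h")
    case True
    hence "m - 1 - i = k" using mhk by simp
    moreover have "\<not> cW h" "\<not> cZ k" using cW cZ by blast+
    ultimately show ?thesis using True by (simp add: d_def wpos_def)
  next
    case False
    hence "\<not> m - 1 - i \<le> k" "m - 1 - (m - 1 - i) = i" using that mhk by auto
    thus ?thesis unfolding d_def wpos_def by (simp only: if_False)
  qed
  have skw: "transpose_mat (- A i) = - (- A i)" if "i < m" for i using skew[of i] that by (simp add: transpose_uminus_mat)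
  have skz: "transpose_mat (A (m - i)) = - A (m - i)" if "i < m" for i using skew[of "m - i"] by simp
  have stW: "stl (simple_state 0 (Suc h)) (evw h @ tw) = cW" by (simp add: mv_evw(2) cW_def)
  have stZ: "stl (simple_state 0 (Suc k)) (evw k @ Tz) = cZ" by (simp add: mv_evw(2) cZ_def)
  have signs: "w.signs d" using dd by (simp add: w.signs_def)
  have etaW: "w.eta j a = (if m - j \<le> a then -1 else 1)" if "j \<le> Suc h" "a < m" for j a
  proof -
    have "a \<in> wpos m ` {..<j} \<longleftrightarrow> m - j \<le> a"
    proof
      assume "m - j \<le> a"
      hence "m - 1 - a \<in> {..<j}" "a = wpos m (m - 1 - a)" using that mhk by (auto simp: wpos_def)
      thus "a \<in> wpos m ` {..<j}" by blast
    qed (use that mhk in \<open>auto simp: wpos_def\<close>)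
    thus ?thesis by (simp add: w.eta_def)
  qed
  have etaZ: "z.eta j a = (if a < j then -1 else 1)" for j a by (simp add: z.eta_def)
  have tX0: "w.twisted X0 d (\<lambda>a. d a * w.eta (Suc h) a)"
    unfolding X0_def
  proof (rule w.palindrome_twisted[OF skw])
    show "w.compatible (stl (simple_state 0 (Suc h)) (evw h @ tw)) (Suc h) d"
      unfolding stW w.compatible_def using signs dW by (intro conjI exI[of _ 1]) auto
  qed (use mhk evw_mv[OF tw] in auto)
  have tX1: "z.twisted X1 d (\<lambda>a. d a * z.eta (Suc k) a)"
    unfolding X1_def
  proof (rule z.palindrome_twisted[OF skz])
    show "z.compatible (stl (simple_state 0 (Suc k)) (evw k @ Tz)) (Suc k) d"
      unfolding stZ z.compatible_def using signs by (intro conjI exI[of _ 1]) (auto simp: d_def)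
  qed (use mhk evw_mv[OF Tz_mv] in auto)
  have tY0: "z.twisted Y0 (\<lambda>a. d a * w.eta (Suc h) a) (\<lambda>a. d a * w.eta (Suc h) a * z.eta k a)"
    unfolding Y0_def
  proof (rule z.palindrome_twisted[OF skz])
    have "d i * w.eta (Suc h) i = (if cZ i then - 1 else 1)" if "i < k" for i
      using that mhk etaW[of "Suc h" i] by (simp add: d_def)
    thus "z.compatible (stl (simple_state 0 k) Tz) k (\<lambda>a. d a * w.eta (Suc h) a)"
      unfolding z.compatible_def cZ_def[symmetric] using signs w.signs_eta by (intro conjI exI[of _ 1]) auto
  qed (use mhk Tz_mv in auto)
  have tY1: "w.twisted Y1 (\<lambda>a. d a * z.eta (Suc k) a) (\<lambda>a. d a * z.eta (Suc k) a * w.eta h a)"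
    unfolding Y1_def
  proof (rule w.palindrome_twisted[OF skw])
    have "d (wpos m i) * z.eta (Suc k) (wpos m i) = (if cW i then - 1 else 1)" if "i < h" for i
      using that mhk dW[of i] etaZ[of "Suc k" "wpos m i"] by (simp add: wpos_def)
    thus "w.compatible (stl (simple_state 0 h) tw) h (\<lambda>a. d a * z.eta (Suc k) a)"
      unfolding w.compatible_def cW_def[symmetric] using signs z.signs_eta by (intro conjI exI[of _ 1]) auto
  qed (use mhk tw in auto)
  have "w.twisted (X0 * Y0) d (\<lambda>a. d a * w.eta (Suc h) a * z.eta k a)"
    by (rule w.twisted_mult[OF _ _ L0_comm _ tX0 tY0]) (use signs w.signs_eta in auto)
  hence "transpose_mat L0 = sgnm n m d * L0 * sgnm n m (\<lambda>a. d a * w.eta (Suc h) a * z.eta k a)"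
    unfolding L0_split w.twisted_def .
  hence s0: "transpose_mat (sgnm n m d * L0) = - (sgnm n m d * L0)"
    by (rule skew_of_twisted[OF L_carrier(1) dd]) (use mhk in \<open>auto simp: etaW etaZ\<close>)
  have "z.twisted (X1 * Y1) d (\<lambda>a. d a * z.eta (Suc k) a * w.eta h a)"
    by (rule z.twisted_mult[OF _ _ L1_comm _ tX1 tY1]) (use signs z.signs_eta in auto)
  hence "transpose_mat L1 = sgnm n m d * L1 * sgnm n m (\<lambda>a. d a * z.eta (Suc k) a * w.eta h a)"
    unfolding L1_split z.twisted_def .
  hence s1: "transpose_mat (sgnm n m d * L1) = - (sgnm n m d * L1)"
    by (rule skew_of_twisted[OF L_carrier(2) dd]) (use mhk in \<open>auto simp: etaW etaZ\<close>)
  show ?thesis using that[of d] d1 s0 s1 by blast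
qed

text \<open>The quotient of two solutions commutes with both coefficients, hence with all four palindromes.
  The links inside each chain make it constant there, and the chains share the position \<open>k\<close>.\<close>

lemma skew_signs_unique:
  assumes d: "\<And>a. d a * d a = 1" "\<And>a. d' a * d' a = 1"
    and sk: "transpose_mat (sgnm n m d * L0) = - (sgnm n m d * L0)" "transpose_mat (sgnm n m d * L1) = - (sgnm n m d * L1)"
      "transpose_mat (sgnm n m d' * L0) = - (sgnm n m d' * L0)" "transpose_mat (sgnm n m d' * L1) = - (sgnm n m d' * L1)"
    and A0: "0 \<in> set tw \<Longrightarrow> A 0 \<noteq> 0\<^sub>m n n" and Am: "A m \<noteq> 0\<^sub>m n n" and a: "a < m"
  shows "d' a * d a = d' k * d k"
proof -
  define \<rho> where "\<rho> = (\<lambda>a. d' a * d a)"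
  let ?S = "sgnm n m \<rho>"
  have c0: "?S * (X0 * Y0) = (X0 * Y0) * ?S" unfolding \<rho>_def L0_split[symmetric] by (rule commute_of_skew[OF L_carrier(1) d sk(1,3)])
  have c1: "?S * (X1 * Y1) = (X1 * Y1) * ?S" unfolding \<rho>_def L1_split[symmetric] by (rule commute_of_skew[OF L_carrier(2) d sk(2,4)])
  have fX0: "X0 * bcol n m a = bcol n m a" if "a < k" for a
    unfolding X0_def by (rule w_fix) (use X0_letters that mhk in fastforce)+
  have fY0: "Y0 * bcol n m a = bcol n m a" if "k \<le> a" "a < m" for a
    unfolding Y0_def by (rule z_fix(1)) (use Y0_letters that in fastforce)+
  have fX1: "X1 * bcol n m a = bcol n m a" if "k < a" "a < m" for a
    unfolding X1_def by (rule z_fix(1)) (use X1_letters that in fastforce)+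
  have fY1: "Y1 * bcol n m a = bcol n m a" if "a \<le> k" for a
    unfolding Y1_def by (rule w_fix) (use Y1_letters that mhk in fastforce)+
  have 1: "?S * X0 = X0 * ?S" by (rule commute_factor[OF XY_carrier(1,2) _ c0]) (use fX0 fY0 not_less in blast)
  have 2: "?S * Y0 = Y0 * ?S" by (rule commute_factor[OF XY_carrier(2,1) _ c0[unfolded L0_comm]]) (use fX0 fY0 not_less in blast)
  have 3: "?S * X1 = X1 * ?S" by (rule commute_factor[OF XY_carrier(3,4) _ c1]) (use fX1 fY1 not_less in blast)
  have 4: "?S * Y1 = Y1 * ?S" by (rule commute_factor[OF XY_carrier(4,3) _ c1[unfolded L1_comm]]) (use fX1 fY1 not_less in blast)
  have A0': "- A 0 \<noteq> 0\<^sub>m n n" if "0 \<in> set tw"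
  proof
    assume "- A 0 = 0\<^sub>m n n"
    hence "- (- A 0) = - 0\<^sub>m n n" by simp
    moreover have "- 0\<^sub>m n n = (0\<^sub>m n n :: complex mat)" by (intro eq_matI) auto
    ultimately show False using A0[OF that] by (simp only: uminus_uminus_mat)
  qed
  have ev0: "0 \<notin> set (evw h)" using w.evw_odd[of 0 h] h by auto
  have linkW: "\<rho> (wpos m (prm tw i)) = \<rho> (wpos m (prm tw h))" if "i \<le> h" for i
  proof (rule links_connect[where f = "\<lambda>i. \<rho> (wpos m (prm tw i))", OF _ _ that])
    fix a assume a: "simple_state 0 h a"
    show "\<rho> (wpos m (prm tw a)) = \<rho> (wpos m (prm tw (Suc a)))"
      by (rule w.palindrome_links[OF n _ tw _ a Y1_def 4]) (use mhk A0' in auto)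
  next
    fix a assume a: "simple_state 0 (Suc h) a"
    have "\<rho> (wpos m (prm (evw h @ tw) a)) = \<rho> (wpos m (prm (evw h @ tw) (Suc a)))"
      by (rule w.palindrome_links[OF n _ evw_mv[OF tw] _ a X0_def 1]) (use mhk A0' ev0 in auto)
    thus "\<rho> (wpos m (prm tw (prm (evw h) a))) = \<rho> (wpos m (prm tw (prm (evw h) (Suc a))))" by (simp only: prm_append)
  qed
  have linkZ: "\<rho> (prm Tz i) = \<rho> (prm Tz k)" if "i \<le> k" for i
  proof (rule links_connect[where f = "\<lambda>i. \<rho> (prm Tz i)", OF _ _ that])
    fix a assume a: "simple_state 0 k a"
    show "\<rho> (prm Tz a) = \<rho> (prm Tz (Suc a))"
      by (rule z.palindrome_links[OF n _ Tz_mv _ a Y0_def 2]) (use mhk Am in auto)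
  next
    fix a assume a: "simple_state 0 (Suc k) a"
    have "\<rho> (prm (evw k @ Tz) a) = \<rho> (prm (evw k @ Tz) (Suc a))"
      by (rule z.palindrome_links[OF n _ evw_mv[OF Tz_mv] _ a X1_def 3]) (use mhk Am in auto)
    thus "\<rho> (prm Tz (prm (evw k) a)) = \<rho> (prm Tz (prm (evw k) (Suc a)))" by (simp only: prm_append)
  qed
  have fixh: "prm tw h = h" by (rule prm_fixes[of tw h]) (use tw_less in auto)
  have fixk: "prm Tz k = k" by (rule prm_fixes[of Tz k]) (use Tz_less in auto)
  have "\<rho> a = \<rho> k"
  proof (cases "a \<le> k")
    case True
    have "prm (rev Tz) a \<le> k" by (rule prm_le[OF True]) (use Tz_less in fastforce)
    thus ?thesis using linkZ[of "prm (rev Tz) a"] fixk by (simp add: prm_rev)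
  next
    case False
    have "prm (rev tw) (m - 1 - a) \<le> h" by (rule prm_le) (use tw_less False mhk a in fastforce)+
    moreover have "wpos m (m - 1 - a) = a" "wpos m h = k" using a mhk by (auto simp: wpos_def)
    ultimately show ?thesis using linkW[of "prm (rev tw) (m - 1 - a)"] fixh by (simp only: prm_rev)
  qed
  thus ?thesis by (simp add: \<rho>_def)
qed

definition \<alpha> :: nat where "\<alpha> = greedy (greedy 0 (evw h)) tw"

lemma alpha_le: "\<alpha> \<le> h"
proof -
  have "greedy 0 (evw h) \<le> h" by (rule greedy_le) (use evw_letters[of _ h] in \<open>auto intro: less_imp_le\<close>)
  thus ?thesis unfolding \<alpha>_def by (rule greedy_le) (use tw_less in \<open>auto intro: less_imp_le\<close>)
qed

lemma c0_alpha: "c0 (map int (aw @ sw @ tw)) = \<alpha>"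
proof -
  have aw: "aw = butlast aw @ [0]" unfolding aw_def by (rule adm_zero_last)
  have "0 \<notin> set (butlast aw)" unfolding aw_def adm_zero_butlast_set by simp
  hence "c0 (map int (butlast aw) @ [0]) = 0" by (intro c0_last_zero) auto
  moreover have "map int aw = map int (butlast aw) @ [0]" by (subst aw) simp
  ultimately have c: "c0 (map int aw) = 0" by simp
  have "0 \<in> set (map int aw)" by (simp add: aw_set)
  hence "c0 (map int aw @ map int (sw @ tw)) = greedy (c0 (map int aw)) (sw @ tw)" by (rule c0_greedy)
  thus ?thesis unfolding c by (simp add: greedy_append sw_evw \<alpha>_def)
qed

text \<open>Only the letter 1 of the word moves the last block column, to the position of index 1.\<close>

lemma w_butlast_col: "2 * j < m \<Longrightarrow> w.W (butlast (adm 0 j)) * w.e 0 = w.e (greedy 0 (evw (2 * j)))"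
proof (induction j)
  case 0
  have "w.W (butlast (adm 0 0)) = 1\<^sub>m (m * n)" by simp
  thus ?case by simp
next
  case (Suc j)
  let ?q = "greedy 0 (evw (2 * j))"
  have q: "?q = (if j = 0 then 0 else 1)" by (simp add: greedy_evw)
  have q': "greedy 0 (evw (2 * Suc j)) = 1" unfolding greedy_evw by simp
  have b: "butlast (adm 0 (Suc j)) = (2 * j + 1) # (2 * j + 2) # butlast (adm 0 j)" by (simp add: adm_ne)
  have lt: "2 * j + 2 < m" using Suc.prems by simp
  have IH: "w.W (butlast (adm 0 j)) * w.e 0 = w.e ?q" using Suc by simp
  have "w.W (butlast (adm 0 (Suc j))) * w.e 0 =
    w.M (2 * j + 1) * (w.M (2 * j + 2) * w.W (butlast (adm 0 j))) * w.e 0" unfolding b by simp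
  also have "\<dots> = w.M (2 * j + 1) * (w.M (2 * j + 2) * w.W (butlast (adm 0 j)) * w.e 0)"
    by (rule w.assoc3) (auto intro: w.mult_N)
  also have "w.M (2 * j + 2) * w.W (butlast (adm 0 j)) * w.e 0 = w.M (2 * j + 2) * (w.W (butlast (adm 0 j)) * w.e 0)"
    by (rule w.assoc3) auto
  also have "\<dots> = w.M (2 * j + 2) * w.e ?q" unfolding IH ..
  also have "\<dots> = w.e (swp (2 * j + 2) ?q)" by (rule w.M_e(1)) (use lt q in auto)
  also have "swp (2 * j + 2) ?q = ?q" using q by (simp add: swp_def)
  also have "w.M (2 * j + 1) * w.e ?q = w.e (swp (2 * j + 1) ?q)" by (rule w.M_e(1)) (use lt q in auto)
  also have "swp (2 * j + 1) ?q = 1" using q by (simp add: swp_def)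
  finally show ?case unfolding q' .
qed

lemma track_tw:
  "transpose_mat (w.e (greedy 0 (evw h))) * w.W tw = transpose_mat (w.e \<alpha>)" "w.W (rev tw) * w.e (greedy 0 (evw h)) = w.e \<alpha>"
proof -
  have "\<not> simple_state 0 h (greedy 0 (evw h))" unfolding greedy_evw simple_state_def using h by auto
  hence "transpose_mat (w.e (greedy 0 (evw h))) * w.W tw = transpose_mat (w.e (greedy (greedy 0 (evw h)) tw)) \<and>
    w.W (rev tw) * w.e (greedy 0 (evw h)) = w.e (greedy (greedy 0 (evw h)) tw) \<and> greedy (greedy 0 (evw h)) tw < m"
    by (intro w.track[OF tw]) (use tw_less mhk in \<open>auto simp: greedy_evw dest: tw_less\<close>)
  thus "transpose_mat (w.e (greedy 0 (evw h))) * w.W tw = transpose_mat (w.e \<alpha>)" "w.W (rev tw) * w.e (greedy 0 (evw h)) = w.e \<alpha>"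
    by (auto simp: \<alpha>_def)
qed

text \<open>The last block column is moved by the word of the chain \<open>w\<close> to index \<open>\<alpha>\<close>, which is at most \<open>h\<close> and so out of
  reach of the remaining letters of the chain \<open>z\<close>.\<close>

lemma left_column: "Lm * w.W (butlast aw) * w.e 0 = w.e \<alpha>"
proof -
  have "Lm * w.W (butlast aw) * w.e 0 = Lm * (w.W (butlast aw) * w.e 0)"
    by (rule w.assoc3) auto
  also have "w.W (butlast aw) * w.e 0 = w.e (greedy 0 (evw h))"
    using w_butlast_col[of "h div 2"] hh mhk unfolding aw_def by simp
  also have "Lm * w.e (greedy 0 (evw h)) = z.W (rev tz) * (w.W (rev tw) * w.e (greedy 0 (evw h)))"
    unfolding Lm_def by (rule w.assoc3) auto
  also have "\<dots> = w.e \<alpha>"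
    unfolding track_tw by (rule z_fix(1)) (use tz_less alpha_le mhk in \<open>fastforce simp: wpos_def\<close>)+
  finally show ?thesis .
qed

text \<open>The complement \<open>evw h\<close> and then \<open>tw\<close> move the last block row as in \<open>track\<close>; the chain \<open>z\<close> fixes the result.\<close>

lemma right_row: "transpose_mat (w.e 0) * Rm = transpose_mat (w.e \<alpha>)"
proof -
  let ?e = "\<lambda>q. transpose_mat (w.e q)"
  have ev: "?e 0 * w.W (evw h) = ?e (greedy 0 (evw h))"
  proof -
    have "?e 0 * w.W (evw h) = ?e (greedy 0 (evw h)) \<and>
      w.W (rev (evw h)) * w.e 0 = w.e (greedy 0 (evw h)) \<and> greedy 0 (evw h) < m"
      by (rule w.track[OF mv_evw(1)]) (use h m mhk evw_letters[of _ h] in \<open>auto simp: simple_state_def dest: evw_letters\<close>)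
    thus ?thesis by blast
  qed
  have c: "?e 0 \<in> carrier_mat n (m * n)" by auto
  have "?e 0 * Rm = ?e 0 * w.W sw * w.W tw * z.W sz * z.W tz"
  proof -
    have "?e 0 * Rm = ?e 0 * (w.W sw * w.W tw * z.W sz) * z.W tz"
      unfolding Rm_def by (rule assoc_mult_mat[OF c, symmetric, of _ "m * n"]) (auto intro!: w.mult_N)
    also have "?e 0 * (w.W sw * w.W tw * z.W sz) = ?e 0 * (w.W sw * w.W tw) * z.W sz"
      by (rule assoc_mult_mat[OF c, symmetric, of _ "m * n"]) (auto intro!: w.mult_N)
    also have "?e 0 * (w.W sw * w.W tw) = ?e 0 * w.W sw * w.W tw"
      by (rule assoc_mult_mat[OF c, symmetric, of _ "m * n"]) auto
    finally show ?thesis .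
  qed
  also have "?e 0 * w.W sw = ?e (greedy 0 (evw h))" unfolding sw_evw by (rule ev)
  also have "?e (greedy 0 (evw h)) * w.W tw = ?e \<alpha>" by (rule track_tw)
  also have "?e \<alpha> * z.W sz = ?e \<alpha>" by (rule z_fix(2)) (use sz_less alpha_le mhk in \<open>fastforce simp: wpos_def\<close>)+
  also have "?e \<alpha> * z.W tz = ?e \<alpha>" by (rule z_fix(2)) (use tz_less alpha_le mhk in \<open>fastforce simp: wpos_def\<close>)+
  finally show ?thesis by simp
qed

end

section \<open>Pencils and block products\<close>

lemma pencil_mult_left:
  assumes "X \<in> carrier_mat N N" "Y \<in> carrier_mat N N" "Z \<in> carrier_mat N N"
  shows "pm X * (lam \<cdot>\<^sub>m pm Y - pm Z) = lam \<cdot>\<^sub>m pm (X * Y) - pm (X * Z)"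
proof -
  have "pm X * (lam \<cdot>\<^sub>m pm Y - pm Z) = pm X * (lam \<cdot>\<^sub>m pm Y) - pm X * pm Z"
    by (rule mult_minus_distrib_mat[of _ N N _ N]) (use assms in auto)
  also have "pm X * (lam \<cdot>\<^sub>m pm Y) = lam \<cdot>\<^sub>m (pm X * pm Y)"
    by (rule mult_smult_distrib[of _ N N _ N]) (use assms in auto)
  finally show ?thesis unfolding pm_mult[OF assms(1,2)] pm_mult[OF assms(1,3)] .
qed

lemma pencil_mult_right:
  assumes "X \<in> carrier_mat N N" "Y \<in> carrier_mat N N" "Z \<in> carrier_mat N N"
  shows "(lam \<cdot>\<^sub>m pm Y - pm Z) * pm X = lam \<cdot>\<^sub>m pm (Y * X) - pm (Z * X)"
proof -
  have "(lam \<cdot>\<^sub>m pm Y - pm Z) * pm X = (lam \<cdot>\<^sub>m pm Y) * pm X - pm Z * pm X"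
    by (rule minus_mult_distrib_mat[of _ N N _ _ N]) (use assms in auto)
  also have "(lam \<cdot>\<^sub>m pm Y) * pm X = lam \<cdot>\<^sub>m (pm Y * pm X)"
    by (rule mult_smult_assoc_mat[of _ N N _ N]) (use assms in auto)
  finally show ?thesis unfolding pm_mult[OF assms(2,1)] pm_mult[OF assms(3,1)] .
qed

lemma gfpr_pencil:
  defines "tp \<equiv> tuple_prod"
  assumes c: "tp N M (rev tz) \<in> carrier_mat N N" "tp N M (rev tw) \<in> carrier_mat N N" "tp N M cw \<in> carrier_mat N N"
    "tp N M tw \<in> carrier_mat N N" "tp N M cz \<in> carrier_mat N N" "tp N M tz \<in> carrier_mat N N"
    "tp N M' z \<in> carrier_mat N N" "tp N M' w \<in> carrier_mat N N"
  shows "gfpr N M M' w z cw tw cz tz =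
    lam \<cdot>\<^sub>m pm (tp N M (rev tz) * tp N M (rev tw) * tp N M' z * tp N M cw * tp N M tw * tp N M cz * tp N M tz) -
    pm (tp N M (rev tz) * tp N M (rev tw) * tp N M' w * tp N M cw * tp N M tw * tp N M cz * tp N M tz)"
proof -
  note c' = c mult_carrier_mat[of _ N N _ N]
  show ?thesis
    unfolding gfpr_def tp_def[symmetric] pm_mult[OF c(1,2), symmetric]
    by (simp only: pencil_mult_left[of _ N] pencil_mult_right[of _ N] c')
qed

lemma bdiag_mult_four_block:
  fixes X :: "'a :: semiring_1 mat"
  assumes "X \<in> carrier_mat a a" "Y \<in> carrier_mat b b" "P \<in> carrier_mat a c" "Q \<in> carrier_mat a d"
    "R \<in> carrier_mat b c" "S \<in> carrier_mat b d"
  shows "bdiag a b X Y * four_block_mat P Q R S = four_block_mat (X * P) (X * Q) (Y * R) (Y * S)"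
proof -
  have c: "X * P \<in> carrier_mat a c" "X * Q \<in> carrier_mat a d" "Y * R \<in> carrier_mat b c" "Y * S \<in> carrier_mat b d"
    using assms by (auto intro: mult_carrier_mat)
  show ?thesis
    unfolding mult_four_block_mat[OF assms(1) zero_carrier_mat zero_carrier_mat assms(2) assms(3-6)]
    using assms c by simp
qed

lemma four_block_mult_bdiag:
  fixes X :: "'a :: semiring_1 mat"
  assumes "X \<in> carrier_mat c c" "Y \<in> carrier_mat d d" "P \<in> carrier_mat a c" "Q \<in> carrier_mat a d"
    "R \<in> carrier_mat b c" "S \<in> carrier_mat b d"
  shows "four_block_mat P Q R S * bdiag c d X Y = four_block_mat (P * X) (Q * Y) (R * X) (S * Y)"
proof -
  have c: "P * X \<in> carrier_mat a c" "Q * Y \<in> carrier_mat a d" "R * X \<in> carrier_mat b c" "S * Y \<in> carrier_mat b d"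
    using assms by (auto intro: mult_carrier_mat)
  show ?thesis
    unfolding mult_four_block_mat[OF assms(3-6) assms(1) zero_carrier_mat zero_carrier_mat assms(2)]
    using assms c by simp
qed

lemma wprod_bdiag:
  fixes M :: "'i \<Rightarrow> 'a :: semiring_1 mat"
  assumes "\<And>i. i \<in> set t \<Longrightarrow> M i \<in> carrier_mat N N"
  shows "wprod (N + r) (\<lambda>i. bdiag N r (M i) (1\<^sub>m r)) t = bdiag N r (wprod N M t) (1\<^sub>m r)"
  using assms
proof (induction t)
  case Nil show ?case by (intro eq_matI) auto
next
  case (Cons i t)
  have "wprod N M t \<in> carrier_mat N N" by (rule wprod_carrier) (use Cons in auto)
  thus ?case using Cons bdiag_mult[of "M i" N "wprod N M t" "1\<^sub>m r" r "1\<^sub>m r"] by simp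
qed

section \<open>The system pencil\<close>

locale gfpr_system = gfpr_words +
  fixes r :: nat and As E B :: "complex mat"
  assumes As: "As \<in> carrier_mat r r" and E: "E \<in> carrier_mat r r" and B: "B \<in> carrier_mat r n"
begin

abbreviation "zi \<equiv> map (\<lambda>i. int i - int m)"
abbreviation "wi \<equiv> map int"

lemma fiedler_words:
  "(\<And>s. s \<in> set t \<Longrightarrow> s < m) \<Longrightarrow> tuple_prod (m * n) (fiedler n m A) (wi t) = w.W t"
  "(\<And>s. s \<in> set t \<Longrightarrow> s < m) \<Longrightarrow> tuple_prod (m * n) (fiedler n m A) (zi t) = z.W t"
  unfolding tuple_prod_wprod wprod_map by (auto intro!: wprod_cong simp: fiedler_w fiedler_z)

lemma ext_w: "s < m \<Longrightarrow> fiedler_ext n m r A (int s) = bdiag (m * n) r (w.M s) (1\<^sub>m r)"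
  unfolding fiedler_ext_def fiedler_w by (rule diag_block_two) auto

lemma ext_z: "s < m \<Longrightarrow> fiedler_ext n m r A (int s - int m) = bdiag (m * n) r (z.M s) (1\<^sub>m r)"
  unfolding fiedler_ext_def fiedler_z by (rule diag_block_two) auto

lemma ext_words:
  "(\<And>s. s \<in> set t \<Longrightarrow> s < m) \<Longrightarrow> tuple_prod (m * n + r) (fiedler_ext n m r A) (wi t) = bdiag (m * n) r (w.W t) (1\<^sub>m r)"
  "(\<And>s. s \<in> set t \<Longrightarrow> s < m) \<Longrightarrow> tuple_prod (m * n + r) (fiedler_ext n m r A) (zi t) = bdiag (m * n) r (z.W t) (1\<^sub>m r)"
proof -
  assume t: "\<And>s. s \<in> set t \<Longrightarrow> s < m"
  show "tuple_prod (m * n + r) (fiedler_ext n m r A) (wi t) = bdiag (m * n) r (w.W t) (1\<^sub>m r)"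
    unfolding tuple_prod_wprod wprod_map wprod_bdiag[OF w.M_carrier, symmetric]
    by (rule wprod_cong) (simp add: t ext_w)
  show "tuple_prod (m * n + r) (fiedler_ext n m r A) (zi t) = bdiag (m * n) r (z.W t) (1\<^sub>m r)"
    unfolding tuple_prod_wprod wprod_map wprod_bdiag[OF z.M_carrier, symmetric]
    by (rule wprod_cong) (simp add: t ext_z)
qed

definition "b = w.e \<alpha>"
abbreviation "bB \<equiv> b * transpose_mat B"
abbreviation "Bb \<equiv> B * transpose_mat b"
abbreviation "e0 \<equiv> w.e 0"

lemma b_carrier [simp, intro]: "b \<in> carrier_mat (m * n) n" by (simp add: b_def)

lemma bB_carrier [simp, intro]: "bB \<in> carrier_mat (m * n) r" "Bb \<in> carrier_mat r (m * n)"
  using B by (auto intro!: mult_carrier_mat[of _ _ n])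

text \<open>Among the letters only \<open>0\<close>, that is the Fiedler index \<open>-m\<close>, carries the matrix \<open>E\<close>, and it occurs exactly
  once.\<close>

lemma sys_z: "tuple_prod (m * n + r) (fiedler_sys n m r A As E B) (zi az) = bdiag (m * n) r (z.W az) E"
proof -
  have "0 \<in> set az" by (simp add: az_set)
  then obtain u v where uv: "az = u @ 0 # v" by (meson split_list)
  have "distinct az" unfolding az_def by (rule adm_distinct)
  hence nz: "0 \<notin> set u" "0 \<notin> set v" unfolding uv by auto
  have lt: "s < m" if "s \<in> set u \<union> set v" for s
  proof -
    have "s \<in> set az" using that unfolding uv by auto
    thus ?thesis using az_set mhk by simp
  qed
  let ?F = "\<lambda>i. fiedler_sys n m r A As E B (int i - int m)"
  have F: "?F i = bdiag (m * n) r (z.M i) (1\<^sub>m r)" if "i \<in> set u \<union> set v" for i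
  proof -
    have "i \<noteq> 0" "i < m" using that nz lt by (metis UnE, blast)
    hence "int i - int m \<noteq> 0" "int i - int m \<noteq> - int m" "i < m" by auto
    thus ?thesis unfolding fiedler_sys_def using ext_z[of i] unfolding fiedler_ext_def by simp
  qed
  have F0: "?F 0 = bdiag (m * n) r (z.M 0) E"
  proof -
    have "?F 0 = diag_block_mat [fiedler n m A (int 0 - int m), E]" using m by (simp add: fiedler_sys_def)
    also have "\<dots> = bdiag (m * n) r (z.M 0) E"
    proof -
      have "0 < m" using m by simp
      thus ?thesis unfolding fiedler_z[OF \<open>0 < m\<close>] by (intro diag_block_two) (use E in auto)
    qed
    finally show ?thesis .
  qed
  have wp: "wprod (m * n + r) ?F t = bdiag (m * n) r (z.W t) (1\<^sub>m r)" if "set t \<subseteq> set u \<union> set v" for t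
    unfolding wprod_bdiag[OF z.M_carrier, symmetric] by (rule wprod_cong) (use that F in auto)
  have carr: "?F i \<in> carrier_mat (m * n + r) (m * n + r)" if "i \<in> set u \<union> set (0 # v)" for i
    using that F[of i] F0 E by (cases "i = 0") auto
  have "wprod (m * n + r) ?F az = wprod (m * n + r) ?F u * (?F 0 * wprod (m * n + r) ?F v)"
    by (simp only: uv wprod_append[of u "0 # v" ?F "m * n + r", OF carr] wprod_simps)
  also have "\<dots> = bdiag (m * n) r (z.W u) (1\<^sub>m r) * (bdiag (m * n) r (z.M 0) E * bdiag (m * n) r (z.W v) (1\<^sub>m r))"
    by (simp only: wp[OF Un_upper1] wp[OF Un_upper2] F0)
  also have "bdiag (m * n) r (z.M 0) E * bdiag (m * n) r (z.W v) (1\<^sub>m r) = bdiag (m * n) r (z.M 0 * z.W v) (E * 1\<^sub>m r)"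
    by (rule bdiag_mult) (use E in auto)
  also have "bdiag (m * n) r (z.W u) (1\<^sub>m r) * \<dots> = bdiag (m * n) r (z.W u * (z.M 0 * z.W v)) (1\<^sub>m r * (E * 1\<^sub>m r))"
    by (rule bdiag_mult) (use E in auto)
  also have "z.W u * (z.M 0 * z.W v) = z.W az" unfolding uv by (simp add: z.W_append)
  also have "1\<^sub>m r * (E * 1\<^sub>m r) = E" using E by simp
  finally show ?thesis unfolding tuple_prod_wprod wprod_map .
qed

text \<open>The Fiedler index 0 carries the coupling blocks; it is the last letter of the word.\<close>

lemma sys_w: "tuple_prod (m * n + r) (fiedler_sys n m r A As E B) (wi aw) =
  four_block_mat (w.W aw) (w.W (butlast aw) * (e0 * transpose_mat B)) (- (B * transpose_mat e0)) As"
proof -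
  let ?F = "\<lambda>i. fiedler_sys n m r A As E B (int i)"
  let ?u = "butlast aw"
  have aw: "aw = ?u @ [0]" unfolding aw_def by (rule adm_zero_last)
  have us: "1 \<le> s" "s < m" if "s \<in> set ?u" for s
    using that adm_zero_butlast_set[of "h div 2"] hh mhk unfolding aw_def by auto
  have F: "?F i = bdiag (m * n) r (w.M i) (1\<^sub>m r)" if "i \<in> set ?u" for i
  proof -
    have "int i \<noteq> 0" "int i \<noteq> - int m" "i < m" using us[OF that] by auto
    thus ?thesis unfolding fiedler_sys_def using ext_w[of i] unfolding fiedler_ext_def by simp
  qed
  have eB: "e0 * transpose_mat B \<in> carrier_mat (m * n) r" "- (B * transpose_mat e0) \<in> carrier_mat r (m * n)"
    using B by (auto intro!: mult_carrier_mat[of _ _ n])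
  have F0: "?F 0 = four_block_mat (w.M 0) (e0 * transpose_mat B) (- (B * transpose_mat e0)) As"
  proof -
    have "ecol m m \<otimes>\<^sub>K transpose_mat B = e0 * transpose_mat B"
      unfolding wpos_def using kronecker_ecol[of "transpose_mat B" n r m m] B m by simp
    moreover have "transpose_mat (e0 * transpose_mat B) = B * transpose_mat e0"
      using transpose_mult[of e0 "m * n" n "transpose_mat B" r] B by simp
    moreover have "fiedler n m A 0 = w.M 0" using fiedler_w[of 0] m by simp
    ultimately show ?thesis unfolding fiedler_sys_def by (simp add: kronecker_transpose)
  qed
  have wp: "wprod (m * n + r) ?F ?u = bdiag (m * n) r (w.W ?u) (1\<^sub>m r)"
    unfolding wprod_bdiag[OF w.M_carrier, symmetric] by (rule wprod_cong) (use F in auto)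
  have F0c: "?F 0 \<in> carrier_mat (m * n + r) (m * n + r)"
    unfolding F0 by (rule four_block_carrier_mat) (use As in auto)
  have carr: "?F i \<in> carrier_mat (m * n + r) (m * n + r)" if "i \<in> set ?u \<union> set [0]" for i
    using that F[of i] F0c by auto
  have "wprod (m * n + r) ?F aw = wprod (m * n + r) ?F ?u * ?F 0"
    by (subst aw, subst wprod_append[OF carr]) (use F0c in auto)
  also have "\<dots> = four_block_mat (w.W ?u * w.M 0) (w.W ?u * (e0 * transpose_mat B)) (1\<^sub>m r * - (B * transpose_mat e0)) (1\<^sub>m r * As)"
    unfolding wp F0 by (rule bdiag_mult_four_block) (use eB As in auto)
  also have "w.W ?u * w.M 0 = w.W aw" by (subst (2) aw, simp only: w.W_append) simp
  also have "1\<^sub>m r * - (B * transpose_mat e0) = - (B * transpose_mat e0)" by (rule left_mult_one_mat[OF eB(2)])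
  also have "1\<^sub>m r * As = As" using As by simp
  finally show ?thesis unfolding tuple_prod_wprod wprod_map .
qed

lemma words_less: "s \<in> set (rev tw) \<Longrightarrow> s < m" "s \<in> set (rev tz) \<Longrightarrow> s < m" "s \<in> set tw \<Longrightarrow> s < m" "s \<in> set tz \<Longrightarrow> s < m"
  "s \<in> set sw \<Longrightarrow> s < m" "s \<in> set sz \<Longrightarrow> s < m" "s \<in> set aw \<Longrightarrow> s < m" "s \<in> set az \<Longrightarrow> s < m"
  using tw_less[of s] tz_less[of s] sw_less[of s] sz_less[of s] aw_set az_set mhk by auto

lemma L_form: "gfpr (m * n) (fiedler n m A) (fiedler n m A) (wi aw) (zi az) (wi sw) (wi tw) (zi sz) (zi tz) =
  lam \<cdot>\<^sub>m pm L1 - pm L0"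
proof -
  note t = fiedler_words(1)[OF words_less(1)] fiedler_words(2)[OF words_less(2)] fiedler_words(1)[OF words_less(3)]
    fiedler_words(2)[OF words_less(4)] fiedler_words(1)[OF words_less(5)] fiedler_words(2)[OF words_less(6)]
    fiedler_words(1)[OF words_less(7)] fiedler_words(2)[OF words_less(8)]
  show ?thesis
    by (subst gfpr_pencil) (simp_all only: rev_map t w.W_carrier z.W_carrier L1_def L0_def)
qed

text \<open>The extended outer factors act on the coupling blocks only through the last block column and row,
  which \<open>left_column\<close> and \<open>right_row\<close> move to index \<open>\<alpha>\<close>.\<close>

lemma LL_form:
  "gfpr (m * n + r) (fiedler_ext n m r A) (fiedler_sys n m r A As E B) (wi aw) (zi az) (wi sw) (wi tw) (zi sz) (zi tz) =
    four_block_mat (lam \<cdot>\<^sub>m pm L1 - pm L0) (- pm bB) (pm Bb) (lam \<cdot>\<^sub>m pm E - pm As)"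
proof -
  note t = ext_words(1)[OF words_less(1)] ext_words(2)[OF words_less(2)] ext_words(1)[OF words_less(3)]
    ext_words(2)[OF words_less(4)] ext_words(1)[OF words_less(5)] ext_words(2)[OF words_less(6)]
    sys_w sys_z
  let ?N = "m * n"
  let ?d = "\<lambda>X. bdiag ?N r X (1\<^sub>m r)"
  have eB: "e0 * transpose_mat B \<in> carrier_mat ?N r" "B * transpose_mat e0 \<in> carrier_mat r ?N"
    using B by (auto intro!: mult_carrier_mat[of _ _ n])
  let ?S = "four_block_mat (w.W aw) (w.W (butlast aw) * (e0 * transpose_mat B)) (- (B * transpose_mat e0)) As"
  have dc: "?d X \<in> carrier_mat (?N + r) (?N + r)" if "X \<in> carrier_mat ?N ?N" for X using that by auto
  have wb: "w.W (butlast aw) * (e0 * transpose_mat B) \<in> carrier_mat ?N r" using eB by (auto intro!: mult_carrier_mat[of _ _ ?N])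
  have Sc: "?S \<in> carrier_mat (?N + r) (?N + r)" by (rule four_block_carrier_mat) (use As in auto)
  have one: "1\<^sub>m r * 1\<^sub>m r = (1\<^sub>m r :: complex mat)" by simp
  have E1: "?d X * bdiag ?N r Z E = bdiag ?N r (X * Z) E" "bdiag ?N r Z E * ?d X = bdiag ?N r (Z * X) E"
    if "X \<in> carrier_mat ?N ?N" "Z \<in> carrier_mat ?N ?N" for X Z
    using bdiag_mult[of X ?N Z "1\<^sub>m r" r E] bdiag_mult[of Z ?N X E r "1\<^sub>m r"] that E by simp_all
  have dd: "?d X * ?d Y = ?d (X * Y)" if "X \<in> carrier_mat ?N ?N" "Y \<in> carrier_mat ?N ?N" for X Y :: "complex mat"
    using bdiag_mult[of X ?N Y "1\<^sub>m r" r "1\<^sub>m r"] that by simp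
  note wc = w.W_carrier z.W_carrier w.mult_N(1)
  have 1: "?d (z.W (rev tz)) * ?d (w.W (rev tw)) * bdiag ?N r (z.W az) E * ?d (w.W sw) * ?d (w.W tw) * ?d (z.W sz) * ?d (z.W tz)
    = bdiag ?N r L1 E"
    unfolding L1_def by (simp only: dd E1 wc)
  have Rd: "?d (w.W sw) * ?d (w.W tw) * ?d (z.W sz) * ?d (z.W tz) = ?d Rm"
    unfolding Rm_def by (simp only: dd wc)
  note as = assoc_mult_mat[of _ "?N + r" "?N + r" _ "?N + r" _ "?N + r"]
  note mc = mult_carrier_mat[of _ "?N + r" "?N + r" _ "?N + r"]
  have "?d (z.W (rev tz)) * ?d (w.W (rev tw)) * ?S * ?d (w.W sw) * ?d (w.W tw) * ?d (z.W sz) * ?d (z.W tz) =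
    ?d (z.W (rev tz)) * ?d (w.W (rev tw)) * ?S * (?d (w.W sw) * ?d (w.W tw) * ?d (z.W sz) * ?d (z.W tz))"
    by (simp only: as mc dc Sc wc)
  also have "\<dots> = ?d Lm * ?S * ?d Rm" unfolding Rd Lm_def by (simp only: dd wc)
  also have "?d Lm * ?S = four_block_mat (Lm * w.W aw) (Lm * (w.W (butlast aw) * (e0 * transpose_mat B)))
    (1\<^sub>m r * - (B * transpose_mat e0)) (1\<^sub>m r * As)"
    by (rule bdiag_mult_four_block) (use eB wb As in auto)
  also have "1\<^sub>m r * - (B * transpose_mat e0) = - (B * transpose_mat e0)"
    using eB(2) by (intro left_mult_one_mat[of _ r "m * n"]) auto
  also have "1\<^sub>m r * As = As" using As by simp
  also have "Lm * (w.W (butlast aw) * (e0 * transpose_mat B)) = bB"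
  proof -
    have "Lm * (w.W (butlast aw) * (e0 * transpose_mat B)) = Lm * w.W (butlast aw) * (e0 * transpose_mat B)"
      by (rule assoc_mult_mat[symmetric]) (use eB in auto)
    also have "\<dots> = Lm * w.W (butlast aw) * e0 * transpose_mat B"
      by (rule assoc_mult_mat[symmetric, of _ ?N ?N _ n]) (use B in \<open>auto intro!: w.mult_N\<close>)
    finally show ?thesis unfolding left_column b_def .
  qed
  also have "four_block_mat (Lm * w.W aw) bB (- (B * transpose_mat e0)) As * ?d Rm =
    four_block_mat (Lm * w.W aw * Rm) (bB * 1\<^sub>m r) (- (B * transpose_mat e0) * Rm) (As * 1\<^sub>m r)"
    by (rule four_block_mult_bdiag) (use eB As in \<open>auto intro!: w.mult_N\<close>)
  also have "bB * 1\<^sub>m r = bB" using bB_carrier(1) by (rule right_mult_one_mat)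
  also have "As * 1\<^sub>m r = As" using As by simp
  also have "- (B * transpose_mat e0) * Rm = - Bb"
  proof -
    have "- (B * transpose_mat e0) * Rm = - (B * transpose_mat e0 * Rm)"
      by (rule uminus_mult_left_mat) (simp add: carrier_matD[OF L_carrier(4)])
    also have "B * transpose_mat e0 * Rm = B * (transpose_mat e0 * Rm)"
      by (rule assoc_mult_mat[OF B]) auto
    finally show ?thesis unfolding right_row b_def .
  qed
  also have "Lm * w.W aw * Rm = L0"
  proof -
    note asN = assoc_mult_mat[of _ "?N" "?N" _ "?N" _ "?N"]
    show ?thesis unfolding Lm_def Rm_def L0_def by (simp only: asN wc)
  qed
  finally have 0: "?d (z.W (rev tz)) * ?d (w.W (rev tw)) * ?S * ?d (w.W sw) * ?d (w.W tw) * ?d (z.W sz) * ?d (z.W tz) =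
    four_block_mat L0 bB (- Bb) As" .
  have Ec: "bdiag ?N r (z.W az) E \<in> carrier_mat (?N + r) (?N + r)" using E by auto
  have "gfpr (m * n + r) (fiedler_ext n m r A) (fiedler_sys n m r A As E B) (wi aw) (zi az) (wi sw) (wi tw) (zi sz) (zi tz) =
    lam \<cdot>\<^sub>m pm (bdiag ?N r L1 E) - pm (four_block_mat L0 bB (- Bb) As)"
    by (subst gfpr_pencil) (simp_all only: rev_map t 1 0 dc Sc Ec w.W_carrier z.W_carrier)
  also have "\<dots> = four_block_mat (lam \<cdot>\<^sub>m pm L1 - pm L0) (- pm bB) (pm Bb) (lam \<cdot>\<^sub>m pm E - pm As)" (is "_ = ?R")
  proof (rule eq_matI)
    have dims: "dim_row L1 = ?N" "dim_col L1 = ?N" "dim_row L0 = ?N" "dim_col L0 = ?N" "dim_row bB = ?N" "dim_col bB = r"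
      "dim_row Bb = r" "dim_col Bb = ?N" "dim_row E = r" "dim_col E = r" "dim_row As = r" "dim_col As = r"
      using L_carrier[THEN carrier_matD(1)] L_carrier[THEN carrier_matD(2)] bB_carrier[THEN carrier_matD(1)] bB_carrier[THEN carrier_matD(2)] carrier_matD[OF E] carrier_matD[OF As]
      by blast+
    fix i j assume "i < dim_row ?R" "j < dim_col ?R"
    hence "i < ?N + r" "j < ?N + r" by (simp_all add: dims)
    thus "(lam \<cdot>\<^sub>m pm (bdiag ?N r L1 E) - pm (four_block_mat L0 bB (- Bb) As)) $$ (i, j) = ?R $$ (i, j)"
      by (cases "i < ?N"; cases "j < ?N") (simp_all add: dims del: index_mult_mat)
  qed (use L_carrier[THEN carrier_matD(1)] L_carrier[THEN carrier_matD(2)] carrier_matD[OF E] carrier_matD[OF As] in simp_all)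
  finally show ?thesis .
qed

section \<open>Irreducibility\<close>

lemma bB_kernel:
  assumes v: "v \<in> carrier_vec r" and z: "bB *\<^sub>v v = 0\<^sub>v (m * n)"
  shows "transpose_mat B *\<^sub>v v = 0\<^sub>v n"
proof -
  have a: "wpos m \<alpha> < m" using m by (simp add: wpos_def)
  have u: "transpose_mat B *\<^sub>v v \<in> carrier_vec n" using B v by auto
  have "transpose_mat b *\<^sub>v (b *\<^sub>v (transpose_mat B *\<^sub>v v)) = transpose_mat b * b *\<^sub>v (transpose_mat B *\<^sub>v v)"
    by (rule assoc_mult_mat_vec[symmetric]) (use u in auto)
  also have "transpose_mat b * b = 1\<^sub>m n" unfolding b_def using bcol_transpose_mult_bcol[OF a a, of n] by simp
  also have "b *\<^sub>v (transpose_mat B *\<^sub>v v) = bB *\<^sub>v v"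
    by (rule assoc_mult_mat_vec[symmetric]) (use B v in auto)
  also have "transpose_mat b *\<^sub>v (bB *\<^sub>v v) = 0\<^sub>v n" unfolding z
    using carrier_matD[OF b_carrier] by (intro eq_vecI) (auto simp: scalar_prod_def)
  finally show ?thesis using u by simp
qed

text \<open>By skew-symmetry of the state pencil, a right kernel vector is also a left kernel vector, and the
  column \<open>b\<close> is injective. Both rank conditions therefore follow from the one excluded by
  minimality.\<close>

lemma irreducible:
  assumes real: "is_realization n r P As E B (transpose_mat B) G"
    and minimal: "\<And>r' P' A' E' B' C'. is_realization n r' P' A' E' B' C' G \<Longrightarrow> r \<le> r'"
    and skE: "transpose_mat E = - E" and skA: "transpose_mat As = - As"
  shows "vec_space.rank r (four_block_mat Bb (- As - x \<cdot>\<^sub>m - E) (0\<^sub>m 0 (m * n)) (0\<^sub>m 0 r)) = r"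
    and "vec_space.rank (m * n + r) (- bB @\<^sub>r (- As - x \<cdot>\<^sub>m - E)) = r"
proof -
  have ker: "v = 0\<^sub>v r" if v: "v \<in> carrier_vec r" and A': "transpose_mat As *\<^sub>v v = x \<cdot>\<^sub>v (transpose_mat E *\<^sub>v v)"
    and B': "transpose_mat B *\<^sub>v v = 0\<^sub>v n" for v
  proof (rule ccontr)
    assume nz: "v \<noteq> 0\<^sub>v r"
    have "r \<noteq> 0" using nz v by (metis carrier_vecD eq_vecI index_zero_vec(2) less_nat_zero_code)
    then obtain r' where r': "r = Suc r'" by (cases r) auto
    have "\<exists>P' A' E' B' C'. is_realization n r' P' A' E' B' C' G"
      by (rule realization_reducible[of n r' P As E B "transpose_mat B" G v x]) (use real v nz A' B' r' in auto)
    thus False using minimal r' by fastforce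
  qed
  let ?H = "- As - x \<cdot>\<^sub>m - E"
  have H: "?H \<in> carrier_mat r r" using As E by auto
  have tH: "transpose_mat ?H = - ?H"
  proof -
    have dm: "dim_row As = r" "dim_col As = r" "dim_row E = r" "dim_col E = r" using As E by auto
    have a: "As $$ (j, i) = - As $$ (i, j)" "E $$ (j, i) = - E $$ (i, j)" if "i < r" "j < r" for i j
      using skA skE skew_entries[OF As] skew_entries[OF E] that by blast+
    show ?thesis
    proof (rule eq_matI)
      fix i j assume "i < dim_row (- ?H)" "j < dim_col (- ?H)"
      hence ij: "i < r" "j < r" by (simp_all add: dm)
      have "transpose_mat ?H $$ (i, j) = - As $$ (j, i) - x * - E $$ (j, i)" using ij by (simp add: dm)
      also have "\<dots> = - (- As $$ (i, j) - x * - E $$ (i, j))" unfolding a[OF ij] by simp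
      also have "\<dots> = (- ?H) $$ (i, j)" using ij by (simp add: dm)
      finally show "transpose_mat ?H $$ (i, j) = (- ?H) $$ (i, j)" .
    qed (simp_all add: dm)
  qed
  have HA: "transpose_mat As *\<^sub>v v = x \<cdot>\<^sub>v (transpose_mat E *\<^sub>v v)" if v: "v \<in> carrier_vec r" and 0: "?H *\<^sub>v v = 0\<^sub>v r" for v
  proof (rule eq_vecI)
    have dm: "dim_row As = r" "dim_col As = r" "dim_row E = r" "dim_col E = r" "dim_vec v = r" using As E v by auto
    fix i assume "i < dim_vec (x \<cdot>\<^sub>v (transpose_mat E *\<^sub>v v))"
    hence i: "i < r" by (simp add: dm)
    have "(\<Sum>j = 0..<r. (- As $$ (i, j) - x * - E $$ (i, j)) * v $ j) = 0"
    proof -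
      have "(?H *\<^sub>v v) $ i = 0" unfolding 0 using i by simp
      thus ?thesis using i by (simp add: dm scalar_prod_def)
    qed
    hence 1: "(\<Sum>j = 0..<r. - As $$ (i, j) * v $ j) = x * (\<Sum>j = 0..<r. - E $$ (i, j) * v $ j)"
      by (simp add: sum_distrib_left left_diff_distrib sum_subtractf sum_negf algebra_simps)
    have "(transpose_mat As *\<^sub>v v) $ i = ((- As) *\<^sub>v v) $ i" unfolding skA ..
    also have "\<dots> = (\<Sum>j = 0..<r. - As $$ (i, j) * v $ j)" using i by (simp add: dm scalar_prod_def sum_negf)
    also have "\<dots> = x * (\<Sum>j = 0..<r. - E $$ (i, j) * v $ j)" by (rule 1)
    also have "\<dots> = (x \<cdot>\<^sub>v ((- E) *\<^sub>v v)) $ i" using i by (simp add: dm scalar_prod_def sum_negf)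
    also have "\<dots> = (x \<cdot>\<^sub>v (transpose_mat E *\<^sub>v v)) $ i" unfolding skE ..
    finally show "(transpose_mat As *\<^sub>v v) $ i = (x \<cdot>\<^sub>v (transpose_mat E *\<^sub>v v)) $ i" .
  qed (use As E in auto)
  have zz: "0\<^sub>v (m * n) @\<^sub>v 0\<^sub>v r = (0\<^sub>v (m * n + r) :: complex vec)" by (intro eq_vecI) auto
  have neg: "(- X) *\<^sub>v v = - (X *\<^sub>v v)" if "X \<in> carrier_mat q r" "v \<in> carrier_vec r" for X :: "complex mat" and q v
    using that by (intro eq_vecI) auto
  have negz: "u = 0\<^sub>v q" if "- u = 0\<^sub>v q" "u \<in> carrier_vec q" for u :: "complex vec" and q
  proof (rule eq_vecI)
    fix i assume "i < dim_vec (0\<^sub>v q :: complex vec)"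
    hence i: "i < q" by simp
    have "(- u) $ i = 0" unfolding that(1) using i by simp
    thus "u $ i = (0\<^sub>v q) $ i" using i that(2) by simp
  qed (use that in auto)
  show "vec_space.rank (m * n + r) (- bB @\<^sub>r ?H) = r"
  proof (rule full_column_rank)
    have nb: "- bB \<in> carrier_mat (m * n) r" using bB_carrier(1) by simp
    show "- bB @\<^sub>r ?H \<in> carrier_mat (m * n + r) r" by (rule carrier_append_rows[OF nb H])
    fix v assume v: "v \<in> carrier_vec r" "(- bB @\<^sub>r ?H) *\<^sub>v v = 0\<^sub>v (m * n + r)"
    have "(- bB @\<^sub>r ?H) *\<^sub>v v = (- bB *\<^sub>v v) @\<^sub>v (?H *\<^sub>v v)"
      by (rule mat_mult_append[OF nb H v(1)])
    hence "(- bB *\<^sub>v v) @\<^sub>v (?H *\<^sub>v v) = 0\<^sub>v (m * n) @\<^sub>v 0\<^sub>v r" using v(2) zz by argo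
    moreover have "- bB *\<^sub>v v \<in> carrier_vec (m * n)" by (rule mult_mat_vec_carrier[OF nb v(1)])
    ultimately have 1: "- bB *\<^sub>v v = 0\<^sub>v (m * n)" "?H *\<^sub>v v = 0\<^sub>v r"
      using append_vec_eq[of "- bB *\<^sub>v v" "m * n" "0\<^sub>v (m * n)"] by auto
    have "bB *\<^sub>v v = 0\<^sub>v (m * n)"
      by (rule negz) (use 1(1) neg[OF bB_carrier(1) v(1)] bB_carrier(1) v(1) in \<open>auto intro: mult_mat_vec_carrier\<close>)
    thus "v = 0\<^sub>v r" using ker[OF v(1) HA[OF v(1) 1(2)] bB_kernel[OF v(1)]] by simp
  qed
  show "vec_space.rank r (four_block_mat Bb ?H (0\<^sub>m 0 (m * n)) (0\<^sub>m 0 r)) = r"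
  proof (rule full_row_rank)
    show c: "four_block_mat Bb ?H (0\<^sub>m 0 (m * n)) (0\<^sub>m 0 r) \<in> carrier_mat r (m * n + r)"
      using four_block_carrier_mat[OF bB_carrier(2) zero_carrier_mat[of 0 r]] by (simp only: add_0_right)
    have tb: "transpose_mat Bb = bB"
    proof -
      have "transpose_mat b \<in> carrier_mat n (m * n)" using b_carrier by simp
      from transpose_mult[OF B this] show ?thesis by (simp only: transpose_transpose)
    qed
    have tr: "transpose_mat (four_block_mat Bb ?H (0\<^sub>m 0 (m * n)) (0\<^sub>m 0 r)) = bB @\<^sub>r (- ?H)"
    proof -
      have "transpose_mat (four_block_mat Bb ?H (0\<^sub>m 0 (m * n)) (0\<^sub>m 0 r)) =
        four_block_mat (transpose_mat Bb) (transpose_mat (0\<^sub>m 0 (m * n))) (transpose_mat ?H) (transpose_mat (0\<^sub>m 0 r))"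
        by (rule transpose_four_block_mat[OF bB_carrier(2) H]) auto
      thus ?thesis unfolding tb tH append_rows_def using carrier_matD[OF bB_carrier(1)] carrier_matD[OF H] by simp
    qed
    fix v assume v: "v \<in> carrier_vec r" "transpose_mat (four_block_mat Bb ?H (0\<^sub>m 0 (m * n)) (0\<^sub>m 0 r)) *\<^sub>v v = 0\<^sub>v (m * n + r)"
    have nH: "- ?H \<in> carrier_mat r r" using H by simp
    have "(bB @\<^sub>r (- ?H)) *\<^sub>v v = (bB *\<^sub>v v) @\<^sub>v (- ?H *\<^sub>v v)"
      by (rule mat_mult_append[OF bB_carrier(1) nH v(1)])
    hence "(bB *\<^sub>v v) @\<^sub>v (- ?H *\<^sub>v v) = 0\<^sub>v (m * n) @\<^sub>v 0\<^sub>v r" using v(2)[unfolded tr] zz by argo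
    moreover have "bB *\<^sub>v v \<in> carrier_vec (m * n)" by (rule mult_mat_vec_carrier[OF bB_carrier(1) v(1)])
    ultimately have 1: "bB *\<^sub>v v = 0\<^sub>v (m * n)" "- ?H *\<^sub>v v = 0\<^sub>v r"
      using append_vec_eq[of "bB *\<^sub>v v" "m * n" "0\<^sub>v (m * n)"] by auto
    have "?H *\<^sub>v v = 0\<^sub>v r"
      by (rule negz) (use 1(2) neg[OF H v(1)] mult_mat_vec_carrier[OF H v(1)] in auto)
    thus "v = 0\<^sub>v r" using ker[OF v(1) HA[OF v(1)] bB_kernel[OF v(1) 1(1)]] by simp
  qed
qed

end

section \<open>Transfer functions\<close>

lemma transfer_function_four_block:
  assumes T: "T11 \<in> carrier_mat a a" "T12 \<in> carrier_mat a r" "T21 \<in> carrier_mat r a" "T22 \<in> carrier_mat r r"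
    and d: "det (rm T22) \<noteq> 0"
  shows "transfer_function a (four_block_mat T11 (- T12) T21 T22) = rm T11 + rm T12 * minv (rm T22) * rm T21"
proof -
  have mT: "- T12 \<in> carrier_mat a r" using T by simp
  have s: "split_block (four_block_mat T11 (- T12) T21 T22) a a = (T11, - T12, T21, T22)"
    unfolding split_block_def Let_def using carrier_matD[OF T(1)] carrier_matD[OF mT] carrier_matD[OF T(3)] carrier_matD[OF T(4)]
    by (auto intro!: eq_matI)
  have r: "rm T22 \<in> carrier_mat r r" using T by simp
  note mi = minv_props[OF r d]
  have "rm (- T12) * minv (rm (- T22)) = rm T12 * minv (rm T22)"
  proof -
    have "rm (- T12) * minv (rm (- T22)) = (- rm T12) * (- minv (rm T22))"
      by (simp only: rm_uminus minv_uminus[OF r d])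
    also have "\<dots> = - (rm T12 * (- minv (rm T22)))"
      by (rule uminus_mult_left_mat) (use T mi in auto)
    also have "rm T12 * (- minv (rm T22)) = - (rm T12 * minv (rm T22))"
      by (rule uminus_mult_right_mat) (use T mi in auto)
    finally show ?thesis by (simp only: uminus_uminus_mat)
  qed
  thus ?thesis unfolding transfer_function_def s by simp
qed

section \<open>Strong linearization\<close>

lemma rm_pencil: "dim_row X = dim_row Y \<Longrightarrow> dim_col X = dim_col Y \<Longrightarrow> rm (p \<cdot>\<^sub>m X - Y) = to_fract p \<cdot>\<^sub>m rm X - rm Y"
  by (intro eq_matI) auto

lemma mat_over_const: "mat_over proper (rm (pm X))"
  using rt_const by (auto simp: mat_over_def proper_def)

lemma mat_over_UNIV: "mat_over UNIV X"
  by (simp add: mat_over_def)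

lemma subring_UNIV: "subring UNIV"
  by (simp add: subring_def)

lemma det_uminus_zero: "X \<in> carrier_mat k k \<Longrightarrow> det (- X) = 0 \<longleftrightarrow> det X = (0 :: 'a :: idom)"
proof -
  assume X: "X \<in> carrier_mat k k"
  have "- X = (- 1) \<cdot>\<^sub>m X" by (intro eq_matI) auto
  thus ?thesis by simp
qed

context matrix_poly
begin

definition iw :: "nat list \<Rightarrow> nat list" where "iw t = rev (map (\<lambda>i. m - i) t)"

lemma w_iw: "(\<And>s. s \<in> set t \<Longrightarrow> 1 \<le> s \<and> s < m) \<Longrightarrow> w.W t * z.W (iw t) = 1\<^sub>m (m * n)"
proof (induction t)
  case Nil show ?case by (simp add: iw_def)
next
  case (Cons i t)
  have i: "w.M i * z.M (m - i) = 1\<^sub>m (m * n)" using w_z_inverse[of i] Cons.prems[of i] by simp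
  note as = assoc_mult_mat[of _ "m * n" "m * n" _ "m * n" _ "m * n"]
  have "w.W (i # t) * z.W (iw (i # t)) = w.M i * w.W t * (z.W (iw t) * z.M (m - i))"
    by (simp add: iw_def z.W_append)
  also have "\<dots> = w.M i * (w.W t * z.W (iw t)) * z.M (m - i)"
    by (simp only: as w.M_carrier z.M_carrier w.W_carrier z.W_carrier w.mult_N(1))
  also have "w.W t * z.W (iw t) = 1\<^sub>m (m * n)" using Cons by simp
  also have "w.M i * 1\<^sub>m (m * n) = w.M i" by (rule w.one_N)
  finally show ?case unfolding i .
qed

text \<open>Generators of positive index are invertible by \<open>w_z_inverse\<close>; the remaining one has determinant
  \<open>det (- A\<^sub>0)\<close>.\<close>

lemma w_det:
  assumes "\<And>s. s \<in> set t \<Longrightarrow> s < m" "0 \<in> set t \<Longrightarrow> det (A 0) \<noteq> 0"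
  shows "det (w.W t) \<noteq> 0"
  using assms
proof (induction t)
  case (Cons i t)
  have "det (w.M i) \<noteq> 0"
  proof (cases "i = 0")
    case True
    have C: "- A 0 \<in> carrier_mat n n" using A[of 0] by simp
    have "w.M 0 = bdiag ((m - 1) * n) ((m - (m - 1)) * n) (1\<^sub>m ((m - 1) * n)) (gen n (m - (m - 1)) 0 0 (- A 0))"
      unfolding w.M_def wpos_def using gen_embed_lower[OF n, of "m - 1" m "m - 1" "m - 1" "- A 0"] by simp
    also have "m - (m - 1) = 1" using m by simp
    finally have "det (w.M 0) = det (- A 0)" using C by (simp add: gen_one_block[simplified] det_bdiag)
    thus ?thesis using True Cons.prems(2) det_uminus_zero[OF A[of 0]] by simp
  next
    case False
    hence "w.M i * z.M (m - i) = 1\<^sub>m (m * n)" using w_z_inverse[of i] Cons.prems by simp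
    hence "det (w.M i) * det (z.M (m - i)) = 1" using det_mult[OF w.M_carrier z.M_carrier, of i "m - i"] by simp
    thus ?thesis by auto
  qed
  thus ?case using Cons det_mult[OF w.M_carrier w.W_carrier, of i t] by simp
qed simp

lemma z_det:
  assumes "\<And>s. s \<in> set t \<Longrightarrow> s < m" "0 \<in> set t \<Longrightarrow> det (A m) \<noteq> 0"
  shows "det (z.W t) \<noteq> 0"
  using assms
proof (induction t)
  case (Cons i t)
  have "det (z.M i) \<noteq> 0"
  proof (cases "i = 0")
    case True
    obtain m' where m': "m = Suc m'" using m by (cases m) auto
    have "z.M 0 = bdiag n (m' * n) (A m) (1\<^sub>m (m' * n))"
      unfolding z.M_def using gen_Suc_first[OF n, of "A m" m'] A[of m] m' by simp
    hence "det (z.M 0) = det (A m)" using A[of m] by (simp add: det_bdiag)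
    thus ?thesis using True Cons.prems(2) by simp
  next
    case False
    hence "w.M (m - i) * z.M (m - (m - i)) = 1\<^sub>m (m * n)" "m - (m - i) = i" using w_z_inverse[of "m - i"] Cons.prems(1)[of i] by auto
    hence "det (w.M (m - i)) * det (z.M i) = 1" using det_mult[OF w.M_carrier z.M_carrier, of "m - i" i] by simp
    thus ?thesis by auto
  qed
  thus ?case using Cons det_mult[OF z.M_carrier z.W_carrier, of i t] by simp
qed simp

lemma inverse_swap: "X \<in> carrier_mat (m * n) (m * n) \<Longrightarrow> Y \<in> carrier_mat (m * n) (m * n) \<Longrightarrow> X * Y = 1\<^sub>m (m * n) \<Longrightarrow> Y * X = 1\<^sub>m (m * n)"
  for X Y :: "complex mat"
  by (rule mat_mult_left_right_inverse)

end

context gfpr_system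
begin

abbreviation "w1 \<equiv> butlast aw"
definition nw :: "nat list" where "nw = iw w1 @ az"

lemma w1_set: "set w1 = {1..h}" unfolding aw_def adm_zero_butlast_set hh ..

lemma w1_inv: "w.W w1 * z.W (iw w1) = 1\<^sub>m (m * n)"
  by (rule w_iw) (use w1_set mhk in auto)

lemma nw_perm: "distinct nw" "set nw = {..<m}"
proof -
  have im: "set (iw w1) = {k + 1..<m}"
  proof
    show "set (iw w1) \<subseteq> {k + 1..<m}" unfolding iw_def using w1_set mhk by auto
    show "{k + 1..<m} \<subseteq> set (iw w1)"
    proof
      fix x assume "x \<in> {k + 1..<m}"
      hence "m - x \<in> set w1" "m - (m - x) = x" using w1_set mhk by auto
      thus "x \<in> set (iw w1)" unfolding iw_def by force
    qed
  qed
  thus "set nw = {..<m}" unfolding nw_def using az_set mhk by auto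
  have "distinct w1" unfolding aw_def using adm_distinct by (rule distinct_butlast)
  hence "distinct (iw w1)" unfolding iw_def using w1_set mhk by (auto simp: distinct_map inj_on_def)
  moreover have "distinct az" unfolding az_def by (rule adm_distinct)
  ultimately show "distinct nw" unfolding nw_def using im az_set by auto
qed

text \<open>Multiplying \<open>\<lambda> M\<^sub>z - M\<^sub>w\<close> by the inverse of the positive part of \<open>w\<close> turns its first coefficient
  into a product of all generators of the chain \<open>z\<close>, each once, and the second into \<open>M\<^sub>0\<close>.\<close>

lemma L_factor:
  assumes Q: "Q \<in> carrier_mat (m * n) (m * n)"
  shows "Q * L1 = Q * Lm * w.W w1 * z.W nw * Rm" "Q * L0 = Q * Lm * w.W w1 * w.M 0 * Rm"
proof -
  let ?N = "m * n"
  note as = assoc_mult_mat[of _ "?N" "?N" _ "?N" _ "?N"]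
  note c = Q w.W_carrier z.W_carrier w.M_carrier z.M_carrier w.mult_N(1) L_carrier
  have L1: "L1 = Lm * z.W az * Rm" unfolding L1_def Lm_def Rm_def by (simp only: as c)
  have L0: "L0 = Lm * w.W aw * Rm" unfolding L0_def Lm_def Rm_def by (simp only: as c)
  have "z.W az = (w.W w1 * z.W (iw w1)) * z.W az" unfolding w1_inv by (rule left_mult_one_mat[OF z.W_carrier, symmetric])
  hence "z.W az = w.W w1 * z.W nw" unfolding nw_def z.W_append by (simp only: as c)
  thus "Q * L1 = Q * Lm * w.W w1 * z.W nw * Rm" unfolding L1 by (simp only: as c)
  have "w.W aw = w.W (w1 @ [0])" using adm_zero_last[of "h div 2"] unfolding aw_def by simp
  also have "\<dots> = w.W w1 * w.M 0" unfolding w.W_append by simp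
  finally show "Q * L0 = Q * Lm * w.W w1 * w.M 0 * Rm" unfolding L0 by (simp only: as c)
qed

lemma b_row_inverse:
  assumes d: "det Rm \<noteq> 0"
  shows "transpose_mat b * minv Rm = transpose_mat e0"
proof -
  note mi = minv_props[OF L_carrier(4) d]
  have "transpose_mat b * minv Rm = transpose_mat e0 * Rm * minv Rm" unfolding b_def right_row ..
  also have "\<dots> = transpose_mat e0 * (Rm * minv Rm)" by (rule assoc_mult_mat) (use mi in auto)
  finally show ?thesis unfolding mi(2) by simp
qed

lemma b_col_inverse:
  assumes P1: "P1 \<in> carrier_mat (m * n) (m * n)" "det P1 \<noteq> 0" "P1 * e0 = b"
  shows "minv P1 * b = e0"
proof -
  note mi = minv_props[OF P1(1,2)]
  have "minv P1 * b = minv P1 * P1 * e0" unfolding P1(3)[symmetric] by (rule assoc_mult_mat[symmetric]) (use mi P1 in auto)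
  thus ?thesis unfolding mi(3) by simp
qed

lemma leading_eval_polynomial:
  "leading_eval n lam m (\<lambda>i. pm (A (m - i))) (pm (A 0)) = matrix_polynomial n m A"
proof (rule eq_matI)
  fix a c assume "a < dim_row (matrix_polynomial n m A)" "c < dim_col (matrix_polynomial n m A)"
  hence ac: "a < n" "c < n" by (auto simp: matrix_polynomial_def)
  have mon: "lam ^ j * [:x:] = monom x j" for j and x :: complex by (simp add: monom_altdef mult.commute)
  have ix: "pm (A i) $$ (a, c) = [:A i $$ (a, c):]" if "i \<le> m" for i using A[OF that] ac by simp
  have "(\<Sum>i<m. lam ^ (m - i) * pm (A (m - i)) $$ (a, c)) = (\<Sum>i<m. monom (A (m - i) $$ (a, c)) (m - i))"
    by (rule sum.cong) (use ix mon in auto)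
  also have "\<dots> = (\<Sum>i\<in>{1..m}. monom (A i $$ (a, c)) i)"
    by (rule sum.reindex_bij_witness[of _ "\<lambda>i. m - i" "\<lambda>i. m - i"]) auto
  finally have "(\<Sum>i<m. lam ^ (m - i) * pm (A (m - i)) $$ (a, c)) + pm (A 0) $$ (a, c) =
    monom (A 0 $$ (a, c)) 0 + (\<Sum>i\<in>{1..m}. monom (A i $$ (a, c)) i)"
    using ix[of 0] by (simp add: monom_0)
  also have "\<dots> = (\<Sum>i\<in>insert 0 {1..m}. monom (A i $$ (a, c)) i)" by simp
  also have "insert 0 {1..m} = {..m}" by auto
  finally show "leading_eval n lam m (\<lambda>i. pm (A (m - i))) (pm (A 0)) $$ (a, c) = matrix_polynomial n m A $$ (a, c)"
    using ac by (simp add: leading_eval_def matrix_polynomial_def)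
qed (auto simp: leading_eval_def matrix_polynomial_def)

text \<open>The elimination over the polynomials, with \<open>l = \<lambda>\<close>. The constant outer factors are undone first; they
  move the last unit block to \<open>b\<close>, and the elimination fixes the last unit block.\<close>

lemma unimodular_part:
  assumes P1: "P1 \<in> carrier_mat (m * n) (m * n)" "det P1 \<noteq> 0" "P1 * e0 = b" and dR: "det Rm \<noteq> 0"
  obtains U V where "U \<in> carrier_mat (m * n) (m * n)" "V \<in> carrier_mat (m * n) (m * n)" "unimodular U" "unimodular V"
    "U * (lam \<cdot>\<^sub>m pm (P1 * z.W nw * Rm) - pm (P1 * w.M 0 * Rm)) * V =
      bdiag ((m - 1) * n) n (1\<^sub>m ((m - 1) * n)) (matrix_polynomial n m A)"
    "U * pm b = bcol n m (m - 1)" "pm (transpose_mat b) * V = transpose_mat (bcol n m (m - 1))"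
proof -
  let ?N = "m * n"
  let ?K = "lam \<cdot>\<^sub>m pm (z.W nw) - pm (w.M 0)"
  have Kc: "?K \<in> carrier_mat ?N ?N" by auto
  have m0: "m > 0" using m by simp
  have A0: "pm (A 0) \<in> carrier_mat n n" using A[of 0] by simp
  have C: "pm (A (m - i)) \<in> carrier_mat n n" for i using A[of "m - i"] by simp
  obtain U0 V0 where UV: "U0 \<in> carrier_mat ?N ?N" "V0 \<in> carrier_mat ?N ?N" "det U0 \<in> {1, -1}" "det V0 \<in> {1, -1}"
    "U0 * (lam \<cdot>\<^sub>m wprod ?N (\<lambda>i. gen n m i (i - 1) (pm (A (m - i)))) nw - gen n m (m - 1) (m - 1) (- pm (A 0))) * V0 =
      bdiag ((m - 1) * n) n (1\<^sub>m ((m - 1) * n)) (leading_eval n lam m (\<lambda>i. pm (A (m - i))) (pm (A 0)))"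
    "U0 * bcol n m (m - 1) = bcol n m (m - 1)" "transpose_mat (bcol n m (m - 1)) * V0 = transpose_mat (bcol n m (m - 1))"
    using fiedler_elimination[OF n subring_UNIV UNIV_I A0 mat_over_UNIV m0 _ nw_perm, of "\<lambda>i. pm (A (m - i))" lam] C mat_over_UNIV
    by blast
  have Nw: "wprod ?N (\<lambda>i. gen n m i (i - 1) (pm (A (m - i)))) nw = pm (z.W nw)"
    by (subst pm_wprod) (auto simp: z.M_def pm_gen A)
  have "- pm (A 0) = pm (- A 0)" unfolding pm_uminus ..
  hence M0: "gen n m (m - 1) (m - 1) (- pm (A 0)) = pm (w.M 0)"
    unfolding w.M_def wpos_def using pm_gen[of "- A 0" n m "m - 1" "m - 1"] A[of 0] by simp
  have core: "U0 * ?K * V0 = bdiag ((m - 1) * n) n (1\<^sub>m ((m - 1) * n)) (matrix_polynomial n m A)"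
    using UV(5) unfolding Nw M0 leading_eval_polynomial .
  note i1 = minv_props[OF P1(1,2)]
  note i2 = minv_props[OF L_carrier(4) dR]
  define U where "U = U0 * pm (minv P1)"
  define V where "V = pm (minv Rm) * V0"
  note as = assoc_mult_mat[of _ "?N" "?N" _ "?N" _ "?N"]
  note mc = mult_carrier_mat[of _ "?N" "?N" _ "?N"]
  have c: "pm (minv P1) \<in> carrier_mat ?N ?N" "pm (minv Rm) \<in> carrier_mat ?N ?N" "pm P1 \<in> carrier_mat ?N ?N" "pm Rm \<in> carrier_mat ?N ?N"
    using i1 i2 P1 by auto
  have UVc: "U \<in> carrier_mat ?N ?N" "V \<in> carrier_mat ?N ?N" unfolding U_def V_def by (intro mc UV c)+
  have one: "pm (minv P1) * pm P1 = 1\<^sub>m ?N" "pm Rm * pm (minv Rm) = 1\<^sub>m ?N"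
    unfolding pm_mult[OF i1(1) P1(1), symmetric] pm_mult[OF L_carrier(4) i2(1), symmetric] i1(3) i2(2) by simp_all
  have T: "lam \<cdot>\<^sub>m pm (P1 * z.W nw * Rm) - pm (P1 * w.M 0 * Rm) = pm P1 * ?K * pm Rm"
    by (simp only: pencil_mult_left[of _ ?N] pencil_mult_right[of _ ?N] P1(1) z.W_carrier w.M_carrier L_carrier w.mult_N(1))
  have "U * (pm P1 * ?K * pm Rm) * V = U0 * ((pm (minv P1) * pm P1) * ?K * (pm Rm * pm (minv Rm))) * V0"
    unfolding U_def V_def by (simp only: as mc UV(1,2) c Kc)
  also have "(pm (minv P1) * pm P1) * ?K * (pm Rm * pm (minv Rm)) = ?K"
    unfolding one left_mult_one_mat[OF Kc] right_mult_one_mat[OF Kc] ..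
  finally have 1: "U * (pm P1 * ?K * pm Rm) * V = U0 * ?K * V0" .
  have 2: "U * pm b = bcol n m (m - 1)"
  proof -
    have "U * pm b = U0 * (pm (minv P1) * pm b)" unfolding U_def by (rule assoc_mult_mat[OF UV(1) c(1)]) auto
    also have "pm (minv P1) * pm b = bcol n m (m - 1)"
      unfolding pm_mult[OF i1(1) b_carrier, symmetric] b_col_inverse[OF P1] by (simp add: wpos_def)
    finally show ?thesis unfolding UV(6) .
  qed
  have 3: "pm (transpose_mat b) * V = transpose_mat (bcol n m (m - 1))"
  proof -
    have tb: "transpose_mat b \<in> carrier_mat n ?N" using b_carrier by simp
    have "pm (transpose_mat b) * V = pm (transpose_mat b) * pm (minv Rm) * V0"
    proof -
      have "pm (transpose_mat b) \<in> carrier_mat n ?N" using tb by simp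
      from assoc_mult_mat[OF this c(2) UV(2)] show ?thesis unfolding V_def by (rule sym)
    qed
    also have "pm (transpose_mat b) * pm (minv Rm) = pm (transpose_mat b * minv Rm)" by (rule pm_mult[OF tb i2(1), symmetric])
    also have "\<dots> = transpose_mat (bcol n m (m - 1))"
      unfolding b_row_inverse[OF dR] pm_transpose by (simp add: wpos_def)
    finally show ?thesis unfolding UV(7) .
  qed
  have u: "unimodular X" if "X \<in> carrier_mat ?N ?N" "det X = x * [:y:]" "x \<in> {1, -1}" "y \<noteq> 0" for X x y
  proof -
    have "det X = [:y:] \<or> det X = [:- y:]" using that by auto
    thus ?thesis unfolding unimodular_def using that by auto
  qed
  have di: "det (minv P1) \<noteq> 0" "det (minv Rm) \<noteq> 0"
    using det_mult[OF P1(1) i1(1)] det_mult[OF L_carrier(4) i2(1)] i1(2) i2(2) by auto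
  have "det U = det U0 * [:det (minv P1):]" unfolding U_def using det_mult[OF UV(1) c(1)] by (simp add: det_pm)
  hence uU: "unimodular U" by (rule u[OF UVc(1)]) (use UV(3) di in auto)
  have "det V = det V0 * [:det (minv Rm):]" unfolding V_def using det_mult[OF c(2) UV(2)] by (simp add: det_pm)
  hence uV: "unimodular V" by (rule u[OF UVc(2)]) (use UV(4) di in auto)
  show ?thesis by (rule that[OF UVc uU uV _ 2 3]) (simp only: T 1 core)
qed

text \<open>The elimination over the rational functions, with \<open>l = 1/\<lambda>\<close> and the subring of proper functions. The
  transfer function only adds \<open>\<Phi> = B\<^sup>T(\<lambda>E - A)\<^sup>-\<^sup>1B\<close>, which is proper, to the coefficient \<open>A\<^sub>0\<close> in the
  last block. Splitting the product of all generators at the one of index \<open>-m\<close> and inverting the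
  remaining ones exchanges the roles of the two ends of the polynomial: the core becomes
  \<open>M\<^sub>-\<^sub>m - \<mu> W\<close> with \<open>W\<close> a product of all generators of nonnegative index. A block flip brings it into the
  form to which \<open>fiedler_elimination\<close> applies.\<close>

lemma infinity_part:
  assumes P1: "P1 \<in> carrier_mat (m * n) (m * n)" "det P1 \<noteq> 0" "P1 * e0 = b" and dR: "det Rm \<noteq> 0"
    and nE: "det E \<noteq> 0"
    and G: "G = rm (matrix_polynomial n m A) + rm (pm (transpose_mat B)) * minv (rm (lam \<cdot>\<^sub>m pm E - pm As)) * rm (pm B)"
  defines "\<mu> \<equiv> inverse (to_fract lam)"
  obtains Ol Or where "Ol \<in> carrier_mat (m * n) (m * n)" "Or \<in> carrier_mat (m * n) (m * n)" "biproper Ol" "biproper Or"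
    "Ol * (\<mu> \<cdot>\<^sub>m (rm (lam \<cdot>\<^sub>m pm (P1 * z.W nw * Rm) - pm (P1 * w.M 0 * Rm)) +
      rm (pm bB) * minv (rm (lam \<cdot>\<^sub>m pm E - pm As)) * rm (pm Bb))) * Or =
      bdiag ((m - 1) * n) n (1\<^sub>m ((m - 1) * n)) (\<mu> ^ m \<cdot>\<^sub>m G)"
proof -
  let ?N = "m * n"
  define rc where "rc = (\<lambda>X :: complex mat. rm (pm X))"
  have rcc: "rc X \<in> carrier_mat p q \<longleftrightarrow> X \<in> carrier_mat p q" for X p q by (simp add: rc_def)
  have rcm: "rc (X * Y) = rc X * rc Y" if "X \<in> carrier_mat p q" "Y \<in> carrier_mat q s" for X Y p q s
    unfolding rc_def pm_mult[OF that] by (rule rm_mult[of _ p q _ s]) (use that in auto)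
  have rc1: "rc (1\<^sub>m q) = 1\<^sub>m q" for q by (simp add: rc_def)
  have rcg: "rc (gen n m p q C) = gen n m p q (rc C)" if "C \<in> carrier_mat n n" for p q C
    unfolding rc_def pm_gen[OF that] by (rule rm_gen) (use that in simp)
  have rcw: "rc (wprod ?N M t) = wprod ?N (\<lambda>i. rc (M i)) t" if "\<And>i. i \<in> set t \<Longrightarrow> M i \<in> carrier_mat ?N ?N" for M :: "nat \<Rightarrow> complex mat" and t
    unfolding rc_def using that by (subst pm_wprod, blast, subst rm_wprod) auto
  have rco: "mat_over proper (rc X)" for X unfolding rc_def by (rule mat_over_const)
  note as = assoc_mult_mat[of _ "?N" "?N" _ "?N" _ "?N"]
  note mc = mult_carrier_mat[of _ "?N" "?N" _ "?N"]
  have lam0: "to_fract lam \<noteq> 0" by simp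
  have mul: "\<mu> * to_fract lam = 1" unfolding \<mu>_def using lam0 by (rule left_inverse)
  have mu: "\<mu> \<in> proper" unfolding \<mu>_def proper_def using rt_inverse_lam by blast
  define Mi where "Mi = minv (rm (lam \<cdot>\<^sub>m pm E - pm As))"
  have pc: "rm (lam \<cdot>\<^sub>m pm E - pm As) \<in> carrier_mat r r" using pencil_carrier[OF As E nE] by simp
  have Mi: "Mi \<in> carrier_mat r r" unfolding Mi_def by (rule minv_props(1)[OF pc det_pencil(2)[OF As E nE]])
  have Mio: "mat_over proper Mi" unfolding Mi_def by (rule minv_pencil_proper[OF As E nE])
  have tB: "transpose_mat B \<in> carrier_mat n r" using B by simp
  define \<Phi> where "\<Phi> = rc (transpose_mat B) * Mi * rc B"
  have BM: "rc (transpose_mat B) * Mi \<in> carrier_mat n r" by (rule mult_carrier_mat[OF _ Mi]) (use tB rcc in simp)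
  have Phi: "\<Phi> \<in> carrier_mat n n" unfolding \<Phi>_def by (rule mult_carrier_mat[OF BM]) (use B rcc in simp)
  have Phio: "mat_over proper \<Phi>"
    unfolding \<Phi>_def using Mi B BM rcc
    by (intro mat_over_mult[OF subring_proper] rco Mio) (auto simp: rc_def)
  \<comment> \<open>The coefficients of the chain \<open>w\<close>, with \<open>A\<^sub>0\<close> replaced by \<open>A\<^sub>0 + \<Phi>\<close>.\<close>
  define C' where "C' = (\<lambda>i. if i = 0 then - rc (A 0) - \<Phi> else rc (- A i))"
  have A0: "A 0 \<in> carrier_mat n n" "- A 0 \<in> carrier_mat n n" using A[of 0] by auto
  have C': "C' i \<in> carrier_mat n n" "mat_over proper (C' i)" if "i < m" for i
  proof -
    show "C' i \<in> carrier_mat n n" unfolding C'_def using A[of i] that Phi rcc by auto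
    have "- rc (A 0) - \<Phi> = rc (- A 0) + (- \<Phi>)" using Phi A0 by (intro eq_matI) (auto simp: rc_def to_fract_pconst)
    moreover have "mat_over proper (rc (- A 0) + (- \<Phi>))"
      by (intro mat_over_add[OF subring_proper] rco mat_over_uminus[OF subring_proper] Phio) (use Phi A0 in \<open>auto simp: rc_def\<close>)
    ultimately show "mat_over proper (C' i)" unfolding C'_def using rco by simp
  qed
  let ?e = "bcol n m (m - 1) :: complex poly fract mat"
  have m0: "m > 0" using m by simp
  define Mh where "Mh = gen n m (m - 1) (m - 1) (C' 0)"
  have Mh: "Mh \<in> carrier_mat ?N ?N" by (simp add: Mh_def)
  have e0: "rc e0 = ?e" by (simp add: rc_def wpos_def)
  have Mhe: "Mh = rc (w.M 0) - ?e * \<Phi> * transpose_mat ?e"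
  proof -
    have M0: "rc (w.M 0) = gen n m (m - 1) (m - 1) (rc (- A 0))" unfolding w.M_def wpos_def using rcg[OF A0(2)] by simp
    have ePe: "?e * \<Phi> \<in> carrier_mat ?N n" "?e * \<Phi> * transpose_mat ?e \<in> carrier_mat ?N ?N"
      using Phi by (auto intro!: mult_carrier_mat[of _ _ n])
    have mP: "- \<Phi> \<in> carrier_mat n n" using Phi by simp
    have "?e * (- \<Phi>) * transpose_mat ?e = - (?e * \<Phi> * transpose_mat ?e)"
    proof -
      have "?e * (- \<Phi>) = - (?e * \<Phi>)" by (rule uminus_mult_right_mat) (use Phi in simp)
      moreover have "- (?e * \<Phi>) * transpose_mat ?e = - (?e * \<Phi> * transpose_mat ?e)"
        by (rule uminus_mult_left_mat) (use Phi in simp)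
      ultimately show ?thesis by simp
    qed
    hence "gen n m (m - 1) (m - 1) (rc (- A 0) + (- \<Phi>)) = rc (w.M 0) + - (?e * \<Phi> * transpose_mat ?e)"
      using gen_add_diagonal[OF _ mP, of "rc (- A 0)" "m - 1" m] A0 rcc m0 unfolding M0 by simp
    moreover have "C' 0 = rc (- A 0) + (- \<Phi>)" unfolding C'_def using Phi A0 by (intro eq_matI) (auto simp: rc_def to_fract_pconst)
    moreover have "rc (w.M 0) + - (?e * \<Phi> * transpose_mat ?e) = rc (w.M 0) - ?e * \<Phi> * transpose_mat ?e"
      using carrier_matD[OF ePe(2)] by (intro eq_matI) (auto simp del: index_mult_mat)
    ultimately show ?thesis unfolding Mh_def by simp
  qed
  note i1 = minv_props[OF P1(1,2)]
  note i2 = minv_props[OF L_carrier(4) dR]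
  have c: "rc P1 \<in> carrier_mat ?N ?N" "rc Rm \<in> carrier_mat ?N ?N" "rc (minv P1) \<in> carrier_mat ?N ?N" "rc (minv Rm) \<in> carrier_mat ?N ?N"
    "rc (z.W t) \<in> carrier_mat ?N ?N" "rc (w.W t) \<in> carrier_mat ?N ?N" "rc (w.M 0) \<in> carrier_mat ?N ?N" for t
    using P1 i1 i2 by (auto simp: rcc)
  define K where "K = rc (z.W nw) - \<mu> \<cdot>\<^sub>m Mh"
  have K: "K \<in> carrier_mat ?N ?N" unfolding K_def using Mh by auto
  have GG: "\<mu> \<cdot>\<^sub>m (rm (lam \<cdot>\<^sub>m pm (P1 * z.W nw * Rm) - pm (P1 * w.M 0 * Rm)) + rm (pm bB) * Mi * rm (pm Bb)) = rc P1 * K * rc Rm"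
  proof -
    have T: "lam \<cdot>\<^sub>m pm (P1 * z.W nw * Rm) - pm (P1 * w.M 0 * Rm) = pm P1 * (lam \<cdot>\<^sub>m pm (z.W nw) - pm (w.M 0)) * pm Rm"
      by (simp only: pencil_mult_left[of _ ?N] pencil_mult_right[of _ ?N] P1(1) z.W_carrier w.M_carrier L_carrier w.mult_N(1))
    let ?Kp = "lam \<cdot>\<^sub>m pm (z.W nw) - pm (w.M 0)"
    have Kpc: "?Kp \<in> carrier_mat ?N ?N" by auto
    have "rm (pm P1 * ?Kp * pm Rm) = rm (pm P1 * ?Kp) * rc Rm"
      unfolding rc_def by (rule rm_mult[OF mult_carrier_mat[OF _ Kpc]]) (use P1 in auto)
    also have "rm (pm P1 * ?Kp) = rc P1 * rm ?Kp" unfolding rc_def by (rule rm_mult[OF _ Kpc]) (use P1 in auto)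
    also have "rm ?Kp = to_fract lam \<cdot>\<^sub>m rc (z.W nw) - rc (w.M 0)" unfolding rc_def
      by (rule rm_pencil) (simp_all add: carrier_matD[OF z.W_carrier] carrier_matD[OF w.M_carrier])
    finally have 1: "rm (lam \<cdot>\<^sub>m pm (P1 * z.W nw * Rm) - pm (P1 * w.M 0 * Rm)) = rc P1 * (to_fract lam \<cdot>\<^sub>m rc (z.W nw) - rc (w.M 0)) * rc Rm"
      unfolding T .
    have ec: "?e \<in> carrier_mat ?N n" "transpose_mat ?e \<in> carrier_mat n ?N" by auto
    have tBc: "rc (transpose_mat B) \<in> carrier_mat n r" "rc B \<in> carrier_mat r n" using B by (auto simp: rcc)
    have bBr: "rc bB = rc P1 * (?e * rc (transpose_mat B))"
    proof -
      have "rc bB = rc b * rc (transpose_mat B)" by (rule rcm[OF b_carrier tB])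
      also have "rc b = rc P1 * ?e" unfolding P1(3)[symmetric] e0[symmetric] by (rule rcm[OF P1(1)]) auto
      also have "rc P1 * ?e * rc (transpose_mat B) = rc P1 * (?e * rc (transpose_mat B))" by (rule assoc_mult_mat[OF c(1) ec(1) tBc(1)])
      finally show ?thesis .
    qed
    have Bbr: "rc Bb = (rc B * transpose_mat ?e) * rc Rm"
    proof -
      have tb: "transpose_mat b \<in> carrier_mat n ?N" "transpose_mat e0 \<in> carrier_mat n ?N" using b_carrier by auto
      have "rc Bb = rc B * rc (transpose_mat b)" by (rule rcm[OF B tb(1)])
      also have "rc (transpose_mat b) = rc (transpose_mat e0) * rc Rm" unfolding b_def right_row[symmetric] by (rule rcm[OF tb(2) L_carrier(4)])
      also have "rc (transpose_mat e0) = transpose_mat ?e" unfolding e0[symmetric] by (simp add: rc_def pm_transpose rm_transpose)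
      also have "rc B * (transpose_mat ?e * rc Rm) = (rc B * transpose_mat ?e) * rc Rm"
        by (rule assoc_mult_mat[symmetric, OF tBc(2) ec(2) c(2)])
      finally show ?thesis .
    qed
    let ?S = "?e * \<Phi> * transpose_mat ?e"
    have Sc: "?S \<in> carrier_mat ?N ?N" by (intro mult_carrier_mat[of _ _ n] ec Phi)
    have 2: "rc bB * Mi * rc Bb = rc P1 * ?S * rc Rm"
    proof -
      have x: "?e * rc (transpose_mat B) \<in> carrier_mat ?N r" "rc B * transpose_mat ?e \<in> carrier_mat r ?N"
        by (rule mult_carrier_mat[OF ec(1) tBc(1)], rule mult_carrier_mat[OF tBc(2) ec(2)])
      have xM: "?e * rc (transpose_mat B) * Mi \<in> carrier_mat ?N r" by (rule mult_carrier_mat[OF x(1) Mi])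
      have "rc bB * Mi * rc Bb = rc P1 * (?e * rc (transpose_mat B) * Mi) * (rc B * transpose_mat ?e * rc Rm)"
        unfolding bBr Bbr assoc_mult_mat[OF c(1) x(1) Mi] ..
      also have "\<dots> = rc P1 * (?e * rc (transpose_mat B) * Mi) * (rc B * transpose_mat ?e) * rc Rm"
        by (rule assoc_mult_mat[symmetric, OF mult_carrier_mat[OF c(1) xM] x(2) c(2)])
      also have "rc P1 * (?e * rc (transpose_mat B) * Mi) * (rc B * transpose_mat ?e) = rc P1 * (?e * rc (transpose_mat B) * Mi * (rc B * transpose_mat ?e))"
        by (rule assoc_mult_mat[OF c(1) xM x(2)])
      also have "?e * rc (transpose_mat B) * Mi * (rc B * transpose_mat ?e) = ?e * rc (transpose_mat B) * Mi * rc B * transpose_mat ?e"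
        by (rule assoc_mult_mat[symmetric, OF xM tBc(2) ec(2)])
      also have "?e * rc (transpose_mat B) * Mi = ?e * (rc (transpose_mat B) * Mi)" by (rule assoc_mult_mat[OF ec(1) tBc(1) Mi])
      also have "?e * (rc (transpose_mat B) * Mi) * rc B = ?e * \<Phi>" unfolding \<Phi>_def by (rule assoc_mult_mat[OF ec(1) BM tBc(2)])
      finally show ?thesis .
    qed
    let ?X = "to_fract lam \<cdot>\<^sub>m rc (z.W nw) - rc (w.M 0)"
    have Xc: "?X \<in> carrier_mat ?N ?N" using c by auto
    have "rc P1 * ?X * rc Rm + rc P1 * ?S * rc Rm = (rc P1 * ?X + rc P1 * ?S) * rc Rm"
      by (rule add_mult_distrib_mat[symmetric, OF mc[OF c(1) Xc] mc[OF c(1) Sc] c(2)])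
    also have "rc P1 * ?X + rc P1 * ?S = rc P1 * (?X + ?S)" by (rule mult_add_distrib_mat[symmetric, OF c(1) Xc Sc])
    also have "?X + ?S = to_fract lam \<cdot>\<^sub>m rc (z.W nw) - Mh"
      unfolding Mhe using carrier_matD[OF Sc] carrier_matD[OF c(7)] carrier_matD[OF c(5)] by (intro eq_matI) (auto simp del: index_mult_mat)
    finally have 3: "rm (lam \<cdot>\<^sub>m pm (P1 * z.W nw * Rm) - pm (P1 * w.M 0 * Rm)) + rm (pm bB) * Mi * rm (pm Bb) =
      rc P1 * (to_fract lam \<cdot>\<^sub>m rc (z.W nw) - Mh) * rc Rm"
      unfolding 1 2[unfolded rc_def, folded rc_def] using 2 unfolding rc_def by simp
    let ?Y = "to_fract lam \<cdot>\<^sub>m rc (z.W nw) - Mh"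
    have Yc: "?Y \<in> carrier_mat ?N ?N" using Mh by auto
    have "\<mu> \<cdot>\<^sub>m (rc P1 * ?Y * rc Rm) = (\<mu> \<cdot>\<^sub>m (rc P1 * ?Y)) * rc Rm"
      by (rule mult_smult_assoc_mat[symmetric, OF mc[OF c(1) Yc] c(2)])
    also have "\<mu> \<cdot>\<^sub>m (rc P1 * ?Y) = rc P1 * (\<mu> \<cdot>\<^sub>m ?Y)" by (rule mult_smult_distrib[symmetric, OF c(1) Yc])
    also have "\<mu> \<cdot>\<^sub>m ?Y = K"
    proof (rule eq_matI)
      fix i j assume "i < dim_row K" "j < dim_col K"
      hence ij: "i < ?N" "j < ?N" using K by auto
      have d: "dim_row (rc (z.W nw)) = ?N" "dim_col (rc (z.W nw)) = ?N" "dim_row Mh = ?N" "dim_col Mh = ?N"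
        using carrier_matD[OF c(5)] carrier_matD[OF Mh] by auto
      have "(\<mu> \<cdot>\<^sub>m ?Y) $$ (i, j) = \<mu> * (to_fract lam * rc (z.W nw) $$ (i, j) - Mh $$ (i, j))" using ij d by simp
      also have "\<dots> = \<mu> * to_fract lam * rc (z.W nw) $$ (i, j) - \<mu> * Mh $$ (i, j)" by (simp only: right_diff_distrib mult.assoc)
      also have "\<dots> = K $$ (i, j)" unfolding mul K_def using ij d by simp
      finally show "(\<mu> \<cdot>\<^sub>m ?Y) $$ (i, j) = K $$ (i, j)" .
    qed (use K Yc in auto)
    finally show ?thesis unfolding 3 .
  qed
  have "0 \<in> set nw" using nw_perm m0 by simp
  then obtain x y where xy: "nw = x @ 0 # y" by (meson split_list)
  have xys: "1 \<le> s \<and> s < m" if "s \<in> set x \<union> set y" for s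
  proof -
    have "s \<noteq> 0" using nw_perm(1) that unfolding xy by auto
    moreover have "s < m" using nw_perm(2) that unfolding xy by auto
    ultimately show ?thesis by simp
  qed
  have inv: "z.W t * w.W (iw t) = 1\<^sub>m ?N" "w.W (iw t) * z.W t = 1\<^sub>m ?N" if "set t \<subseteq> set x \<union> set y" for t
  proof -
    have ms: "m - (m - s) = s" if "s \<in> set t" for s using xys that \<open>set t \<subseteq> _\<close> by fastforce
    have "iw (iw t) = map (\<lambda>s. m - (m - s)) t" unfolding iw_def by (simp add: rev_map o_def)
    also have "\<dots> = t" by (rule map_idI) (rule ms)
    finally have ii: "iw (iw t) = t" .
    have "w.W (iw t) * z.W (iw (iw t)) = 1\<^sub>m ?N"
      by (rule w_iw) (use xys \<open>set t \<subseteq> _\<close> in \<open>fastforce simp: iw_def\<close>)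
    thus 1: "w.W (iw t) * z.W t = 1\<^sub>m ?N" unfolding ii .
    show "z.W t * w.W (iw t) = 1\<^sub>m ?N" by (rule inverse_swap[OF _ _ 1]) auto
  qed
  let ?Xi = "rc (w.W (iw x))" and ?Yi = "rc (w.W (iw y))"
  define word where "word = iw x @ 0 # iw y"
  let ?G = "\<lambda>i. gen n m (m - 1 - i) (m - 1 - (i - 1)) (C' i)"
  let ?H = "\<lambda>i. gen n m i (i - 1) (C' i)"
  have iwx: "1 \<le> s \<and> s < m" if "s \<in> set (iw x) \<union> set (iw y)" for s
    using that xys unfolding iw_def by fastforce
  have wd: "distinct word" "set word = {..<m}"
  proof -
    have dn: "distinct x" "distinct y" "set x \<inter> set y = {}" and n0: "0 \<notin> set x \<union> set y"
      using nw_perm(1) unfolding xy by auto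
    have ins: "insert 0 (set x \<union> set y) = {..<m}" using nw_perm(2) unfolding xy by simp
    have un: "set x \<union> set y = {..<m} - {0}" unfolding ins[symmetric] using n0 by simp
    have inj: "inj_on (\<lambda>i. m - i) (set x \<union> set y)" by (rule inj_onI) (use xys in fastforce)
    have "inj_on (\<lambda>i. m - i) (set x)" "inj_on (\<lambda>i. m - i) (set y)"
      by (rule inj_on_subset[OF inj], blast)+
    hence "distinct (iw x)" "distinct (iw y)" unfolding iw_def using dn by (simp_all add: distinct_map)
    moreover have "set (iw x) \<inter> set (iw y) = {}" unfolding iw_def using dn(3) inj by (fastforce simp: inj_on_def)
    ultimately show "distinct word" unfolding word_def using iwx by fastforce
    have "(\<lambda>i. m - i) ` ({..<m} - {0}) = {..<m} - {0}"
    proof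
      show "{..<m} - {0} \<subseteq> (\<lambda>i. m - i) ` ({..<m} - {0})"
      proof
        fix s assume "s \<in> {..<m} - {0}"
        hence "m - s \<in> {..<m} - {0}" "s = m - (m - s)" by auto
        thus "s \<in> (\<lambda>i. m - i) ` ({..<m} - {0})" by blast
      qed
    qed auto
    hence "set (iw x) \<union> set (iw y) = {..<m} - {0}" unfolding iw_def un[symmetric] by auto
    thus "set word = {..<m}" unfolding word_def using m0 by auto
  qed
  have step1: "?Xi * K * ?Yi = gen n m 0 0 (rc (A m)) - \<mu> \<cdot>\<^sub>m wprod ?N ?G word"
  proof -
    have "?Xi * K * ?Yi = ?Xi * rc (z.W nw) * ?Yi - ?Xi * (\<mu> \<cdot>\<^sub>m Mh) * ?Yi"
    proof -
      have mm: "\<mu> \<cdot>\<^sub>m Mh \<in> carrier_mat ?N ?N" using Mh by simp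
      show ?thesis unfolding K_def mult_minus_distrib_mat[OF c(6) c(5) mm]
        by (rule minus_mult_distrib_mat[OF mc[OF c(6) c(5)] mc[OF c(6) mm] c(6)])
    qed
    also have "?Xi * rc (z.W nw) * ?Yi = gen n m 0 0 (rc (A m))"
    proof -
      note asN = assoc_mult_mat[of _ "?N" "?N" _ "?N" _ "?N"]
      have "?Xi * rc (z.W nw) * ?Yi = rc (w.W (iw x) * z.W nw * w.W (iw y))"
        by (simp only: rcm[of _ ?N ?N _ ?N] w.W_carrier z.W_carrier w.mult_N(1))
      also have "w.W (iw x) * z.W nw * w.W (iw y) = (w.W (iw x) * z.W x) * z.M 0 * (z.W y * w.W (iw y))"
        unfolding xy z.W_append wprod_simps by (simp only: asN w.W_carrier z.W_carrier z.M_carrier w.mult_N(1))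
      also have "\<dots> = z.M 0" unfolding inv(2)[OF Un_upper1] inv(1)[OF Un_upper2] by simp
      also have "rc (z.M 0) = gen n m 0 0 (rc (A m))" unfolding z.M_def using rcg[of "A m" 0 0] A[of m] by simp
      finally show ?thesis .
    qed
    also have "?Xi * (\<mu> \<cdot>\<^sub>m Mh) * ?Yi = \<mu> \<cdot>\<^sub>m wprod ?N ?G word"
    proof -
      have wt: "rc (w.W t) = wprod ?N ?G t" if t: "set t \<subseteq> set (iw x) \<union> set (iw y)" for t
      proof -
        have "rc (w.W t) = wprod ?N (\<lambda>i. rc (w.M i)) t" by (rule rcw) auto
        also have "\<dots> = wprod ?N ?G t"
        proof (rule wprod_cong)
          fix i assume "i \<in> set t"
          hence i: "i \<noteq> 0" "i < m" using t iwx by fastforce+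
          thus "rc (w.M i) = ?G i" unfolding w.M_def wpos_def using rcg[of "- A i"] A[of i] by (simp add: C'_def)
        qed
        finally show ?thesis .
      qed
      have "?Xi * (\<mu> \<cdot>\<^sub>m Mh) * ?Yi = \<mu> \<cdot>\<^sub>m (?Xi * Mh) * ?Yi"
        using mult_smult_distrib[OF c(6) Mh, of "iw x" \<mu>] by simp
      also have "\<dots> = \<mu> \<cdot>\<^sub>m (?Xi * Mh * ?Yi)" by (rule mult_smult_assoc_mat[OF mc[OF c(6) Mh] c(6)])
      also have "?Xi * Mh * ?Yi = wprod ?N ?G (iw x) * (?G 0 * wprod ?N ?G (iw y))"
        unfolding wt[OF Un_upper1, symmetric] wt[OF Un_upper2, symmetric] using as[OF c(6) Mh c(6)] by (simp add: Mh_def)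
      also have "\<dots> = wprod ?N ?G word" unfolding word_def by (subst wprod_append) auto
      finally show ?thesis .
    qed
    finally show ?thesis .
  qed
  let ?F = "flip n m :: complex poly fract mat"
  have Wc: "wprod ?N ?G word \<in> carrier_mat ?N ?N" "wprod ?N ?H word \<in> carrier_mat ?N ?N" by (auto intro!: wprod_carrier)
  have rcAm: "rc (A m) \<in> carrier_mat n n" using A[of m] by (simp add: rcc)
  have step2: "?F * (gen n m 0 0 (rc (A m)) - \<mu> \<cdot>\<^sub>m wprod ?N ?G word) * ?F =
    gen n m (m - 1) (m - 1) (rc (A m)) - \<mu> \<cdot>\<^sub>m wprod ?N ?H word"
  proof -
    let ?g = "gen n m 0 0 (rc (A m))" and ?g' = "gen n m (m - 1) (m - 1) (rc (A m))"
    have FF: "?F * ?F = 1\<^sub>m ?N" by (rule flip_flip)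
    have sW: "\<mu> \<cdot>\<^sub>m wprod ?N ?G word \<in> carrier_mat ?N ?N" using Wc by simp
    have fc: "?F \<in> carrier_mat ?N ?N" "?g \<in> carrier_mat ?N ?N" "?g' \<in> carrier_mat ?N ?N" by auto
    have 1: "?F * ?g * ?F = ?g'"
    proof -
      have "?F * ?g = ?g' * ?F" using flip_gen[OF rcAm m0 m0] by simp
      hence "?F * ?g * ?F = ?g' * (?F * ?F)" using as[OF fc(3) fc(1) fc(1)] by simp
      thus ?thesis unfolding FF right_mult_one_mat[OF fc(3)] .
    qed
    have 2: "?F * wprod ?N ?G word * ?F = wprod ?N ?H word"
    proof -
      have "?F * wprod ?N ?G word = wprod ?N ?H word * ?F" by (rule flip_wprod) (use wd(2) C' in auto)
      hence "?F * wprod ?N ?G word * ?F = wprod ?N ?H word * (?F * ?F)" using as[OF Wc(2) fc(1) fc(1)] by simp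
      thus ?thesis unfolding FF right_mult_one_mat[OF Wc(2)] .
    qed
    have "?F * (?g - \<mu> \<cdot>\<^sub>m wprod ?N ?G word) * ?F = ?F * ?g * ?F - ?F * (\<mu> \<cdot>\<^sub>m wprod ?N ?G word) * ?F"
      unfolding mult_minus_distrib_mat[OF fc(1) fc(2) sW]
      by (rule minus_mult_distrib_mat[OF mc[OF fc(1) fc(2)] mc[OF fc(1) sW] fc(1)])
    also have "?F * (\<mu> \<cdot>\<^sub>m wprod ?N ?G word) * ?F = \<mu> \<cdot>\<^sub>m (?F * wprod ?N ?G word * ?F)"
      unfolding mult_smult_distrib[OF fc(1) Wc(1)] by (rule mult_smult_assoc_mat[OF mc[OF fc(1) Wc(1)] fc(1)])
    finally show ?thesis unfolding 1 2 .
  qed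
  let ?LE = "leading_eval n \<mu> m C' (- rc (A m))"
  have mAm: "- rc (A m) \<in> carrier_mat n n" using rcAm by simp
  obtain U V where UV: "U \<in> carrier_mat ?N ?N" "V \<in> carrier_mat ?N ?N" "mat_over proper U" "mat_over proper V"
    "det U \<in> {1, -1}" "det V \<in> {1, -1}"
    "U * (\<mu> \<cdot>\<^sub>m wprod ?N ?H word - gen n m (m - 1) (m - 1) (- (- rc (A m)))) * V = bdiag ((m - 1) * n) n (1\<^sub>m ((m - 1) * n)) ?LE"
    using fiedler_elimination[OF n subring_proper mu mAm mat_over_uminus[OF subring_proper rco] m0 _ wd, of C'] C' by blast
  let ?K2 = "gen n m (m - 1) (m - 1) (rc (A m)) - \<mu> \<cdot>\<^sub>m wprod ?N ?H word"
  have K2c: "?K2 \<in> carrier_mat ?N ?N" using Wc by auto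
  \<comment> \<open>The elimination produces \<open>diag(-I, \<mu>\<^sup>m G)\<close>; \<open>J\<close> repairs the sign of the first blocks.\<close>
  define J where "J = bdiag ((m - 1) * n) n (- (1\<^sub>m ((m - 1) * n))) (1\<^sub>m n :: complex poly fract mat)"
  have mn: "(m - 1) * n + n = ?N" using m by (metis add.commute add_mult_distrib2 mult.commute mult_eq_if nat_mult_1 not_one_le_zero)
  have Jc: "J \<in> carrier_mat ?N ?N" unfolding J_def mn[symmetric] by (rule four_block_carrier_mat) auto
  have UK2: "U * ?K2 * V = - (bdiag ((m - 1) * n) n (1\<^sub>m ((m - 1) * n)) ?LE)"
  proof -
    let ?K1 = "\<mu> \<cdot>\<^sub>m wprod ?N ?H word - gen n m (m - 1) (m - 1) (- (- rc (A m)))"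
    have K1: "?K1 \<in> carrier_mat ?N ?N" by auto
    have e: "?K2 = - ?K1" unfolding uminus_uminus_mat using carrier_matD[OF Wc(2)] by (intro eq_matI) auto
    have "U * ?K2 * V = - (U * ?K1) * V" unfolding e using uminus_mult_right_mat[of U ?K1] carrier_matD[OF UV(1)] by simp
    also have "\<dots> = - (U * ?K1 * V)" by (rule uminus_mult_left_mat) (use carrier_matD[OF UV(2)] K1 in simp)
    finally show ?thesis unfolding UV(7) .
  qed
  have LEc: "?LE \<in> carrier_mat n n" by (simp add: leading_eval_def)
  have LE: "- ?LE = \<mu> ^ m \<cdot>\<^sub>m G"
  proof (rule eq_matI)
    have Gd: "G = rm (matrix_polynomial n m A) + \<Phi>" unfolding G \<Phi>_def rc_def Mi_def ..
    have Pd: "dim_row (matrix_polynomial n m A) = n" "dim_col (matrix_polynomial n m A) = n" by (auto simp: matrix_polynomial_def)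
    have Gdim: "dim_row G = n" "dim_col G = n" unfolding Gd using Phi by auto
    fix a d assume "a < dim_row (\<mu> ^ m \<cdot>\<^sub>m G)" "d < dim_col (\<mu> ^ m \<cdot>\<^sub>m G)"
    hence ad: "a < n" "d < n" using Gdim by auto
    define f where "f = (\<lambda>i. to_fract [:A i $$ (a, d):])"
    have rcA: "rc (A i) $$ (a, d) = f i" if "i \<le> m" for i using A[OF that] ad by (simp add: rc_def f_def)
    have C'e: "C' i $$ (a, d) = - f i - (if i = 0 then \<Phi> $$ (a, d) else 0)" if "i < m" for i
      using rcA[of 0] A[of i] that ad Phi rcAm A[of 0] by (auto simp: C'_def rc_def f_def to_fract_pconst)
    have mon: "to_fract (monom x i) = to_fract [:x:] * to_fract lam ^ i" for x i
    proof -
      have "monom x i = [:x:] * lam ^ i" by (simp add: monom_altdef)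
      moreover have "to_fract (p ^ i) = to_fract p ^ i" for p :: "complex poly" by (induction i) auto
      ultimately show ?thesis by (metis to_fract_mult)
    qed
    have sumf: "to_fract (\<Sum>i\<in>I. g i) = (\<Sum>i\<in>I. to_fract (g i))" for I and g :: "nat \<Rightarrow> complex poly"
      by (induction I rule: infinite_finite_induct) auto
    have pw: "\<mu> ^ m * (f i * to_fract lam ^ i) = \<mu> ^ (m - i) * f i" if "i \<le> m" for i
    proof -
      have 1: "\<mu> ^ m = \<mu> ^ (m - i) * \<mu> ^ i" unfolding power_add[symmetric] using that by simp
      have 2: "\<mu> ^ i * to_fract lam ^ i = 1" unfolding power_mult_distrib[symmetric] mul by simp
      have "\<mu> ^ m * (f i * to_fract lam ^ i) = \<mu> ^ (m - i) * f i * (\<mu> ^ i * to_fract lam ^ i)"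
        unfolding 1 by (simp only: mult_ac)
      thus ?thesis unfolding 2 by (simp only: mult_1_right)
    qed
    have "rm (matrix_polynomial n m A) $$ (a, d) = to_fract (\<Sum>i\<le>m. monom (A i $$ (a, d)) i)"
      using ad by (simp add: matrix_polynomial_def rm_def)
    also have "\<dots> = (\<Sum>i\<le>m. f i * to_fract lam ^ i)" unfolding sumf f_def by (rule sum.cong[OF refl]) (rule mon)
    finally have r: "rm (matrix_polynomial n m A) $$ (a, d) = (\<Sum>i\<le>m. f i * to_fract lam ^ i)" .
    have "G $$ (a, d) = rm (matrix_polynomial n m A) $$ (a, d) + \<Phi> $$ (a, d)"
      unfolding Gd by (rule index_add_mat(1)) (simp_all add: carrier_matD[OF Phi] ad)
    moreover have "(\<mu> ^ m \<cdot>\<^sub>m G) $$ (a, d) = \<mu> ^ m * G $$ (a, d)"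
      by (rule index_smult_mat(1)) (simp_all only: Gdim ad)
    ultimately have "(\<mu> ^ m \<cdot>\<^sub>m G) $$ (a, d) = \<mu> ^ m * ((\<Sum>i\<le>m. f i * to_fract lam ^ i) + \<Phi> $$ (a, d))"
      unfolding r by (simp only:)
    also have "\<dots> = (\<Sum>i\<le>m. \<mu> ^ (m - i) * f i) + \<mu> ^ m * \<Phi> $$ (a, d)"
    proof -
      have "(\<Sum>i\<le>m. \<mu> ^ m * (f i * to_fract lam ^ i)) = (\<Sum>i\<le>m. \<mu> ^ (m - i) * f i)"
        by (rule sum.cong[OF refl]) (rule pw, simp only: atMost_iff)
      thus ?thesis unfolding distrib_left sum_distrib_left by (rule arg_cong)
    qed
    finally have 1: "(\<mu> ^ m \<cdot>\<^sub>m G) $$ (a, d) = (\<Sum>i\<le>m. \<mu> ^ (m - i) * f i) + \<mu> ^ m * \<Phi> $$ (a, d)" .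
    have "(\<Sum>i<m. \<mu> ^ (m - i) * C' i $$ (a, d)) = (\<Sum>i<m. - (\<mu> ^ (m - i) * f i) - (if i = 0 then \<mu> ^ m * \<Phi> $$ (a, d) else 0))"
      by (rule sum.cong) (auto simp: C'e right_diff_distrib)
    also have "\<dots> = - (\<Sum>i<m. \<mu> ^ (m - i) * f i) - \<mu> ^ m * \<Phi> $$ (a, d)"
      using m0 by (simp add: sum_subtractf sum_negf)
    finally have 2: "?LE $$ (a, d) = - (\<Sum>i<m. \<mu> ^ (m - i) * f i) - \<mu> ^ m * \<Phi> $$ (a, d) - f m"
      using ad rcA[of m] carrier_matD[OF rcAm] by (simp add: leading_eval_def)
    have "(- ?LE) $$ (a, d) = - ?LE $$ (a, d)" using ad carrier_matD[OF LEc] by simp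
    also have "\<dots> = (\<Sum>i<m. \<mu> ^ (m - i) * f i) + \<mu> ^ (m - m) * f m + \<mu> ^ m * \<Phi> $$ (a, d)" unfolding 2 by simp
    also have "(\<Sum>i<m. \<mu> ^ (m - i) * f i) + \<mu> ^ (m - m) * f m = (\<Sum>i\<le>m. \<mu> ^ (m - i) * f i)"
      by (simp add: lessThan_Suc_atMost[symmetric])
    finally show "(- ?LE) $$ (a, d) = (\<mu> ^ m \<cdot>\<^sub>m G) $$ (a, d)" unfolding 1 .
  next
    have "dim_row G = n" "dim_col G = n" unfolding G by (simp_all add: carrier_matD[OF B])
    thus "dim_row (- ?LE) = dim_row (\<mu> ^ m \<cdot>\<^sub>m G)" "dim_col (- ?LE) = dim_col (\<mu> ^ m \<cdot>\<^sub>m G)" using LEc by auto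
  qed
  have JB: "J * (- (bdiag ((m - 1) * n) n (1\<^sub>m ((m - 1) * n)) ?LE)) = bdiag ((m - 1) * n) n (1\<^sub>m ((m - 1) * n)) (\<mu> ^ m \<cdot>\<^sub>m G)"
  proof -
    have o: "- (1\<^sub>m q) * - (1\<^sub>m q) = (1\<^sub>m q :: complex poly fract mat)" for q by (intro eq_matI) auto
    have "- (bdiag ((m - 1) * n) n (1\<^sub>m ((m - 1) * n)) ?LE) = bdiag ((m - 1) * n) n (- (1\<^sub>m ((m - 1) * n))) (- ?LE)"
      using carrier_matD[OF LEc] by (intro eq_matI) auto
    moreover have "J * bdiag ((m - 1) * n) n (- (1\<^sub>m ((m - 1) * n))) (- ?LE) =
      bdiag ((m - 1) * n) n (- (1\<^sub>m ((m - 1) * n)) * - (1\<^sub>m ((m - 1) * n))) (1\<^sub>m n * - ?LE)"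
      unfolding J_def by (rule bdiag_mult) (use LEc in auto)
    moreover have "1\<^sub>m n * - ?LE = - ?LE" using LEc by (intro left_mult_one_mat[of _ n n]) auto
    ultimately show ?thesis unfolding o LE by simp
  qed
  define Ol where "Ol = J * U * ?F * ?Xi * rc (minv P1)"
  define Or where "Or = rc (minv Rm) * ?Yi * ?F * V"
  have Fc: "?F \<in> carrier_mat ?N ?N" by auto
  have one: "rc (minv P1) * rc P1 = 1\<^sub>m ?N" "rc Rm * rc (minv Rm) = 1\<^sub>m ?N"
    unfolding rcm[OF i1(1) P1(1), symmetric] rcm[OF L_carrier(4) i2(1), symmetric] i1(3) i2(2) by (rule rc1)+
  have "Ol * (rc P1 * K * rc Rm) * Or = J * (U * (?F * (?Xi * ((rc (minv P1) * rc P1) * K * (rc Rm * rc (minv Rm))) * ?Yi) * ?F) * V)"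
    unfolding Ol_def Or_def by (simp only: as mc Jc UV(1,2) Fc c K)
  also have "(rc (minv P1) * rc P1) * K * (rc Rm * rc (minv Rm)) = K"
    unfolding one left_mult_one_mat[OF K] right_mult_one_mat[OF K] ..
  also have "J * (U * (?F * (?Xi * K * ?Yi) * ?F) * V) = bdiag ((m - 1) * n) n (1\<^sub>m ((m - 1) * n)) (\<mu> ^ m \<cdot>\<^sub>m G)"
    unfolding step1 step2 UK2 JB ..
  finally have fin: "Ol * (rc P1 * K * rc Rm) * Or = bdiag ((m - 1) * n) n (1\<^sub>m ((m - 1) * n)) (\<mu> ^ m \<cdot>\<^sub>m G)" .
  have Oc: "Ol \<in> carrier_mat ?N ?N" "Or \<in> carrier_mat ?N ?N" unfolding Ol_def Or_def by (intro mc Jc UV Fc c)+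
  have bJ: "biproper J"
  proof (rule involution_biproper[OF Jc])
    have o: "- (1\<^sub>m q) * - (1\<^sub>m q) = (1\<^sub>m q :: complex poly fract mat)" for q by (intro eq_matI) auto
    have "J * J = bdiag ((m - 1) * n) n (- (1\<^sub>m ((m - 1) * n)) * - (1\<^sub>m ((m - 1) * n))) (1\<^sub>m n * 1\<^sub>m n)"
      unfolding J_def by (rule bdiag_mult) auto
    also have "\<dots> = 1\<^sub>m ?N" unfolding o mn[symmetric] by (intro eq_matI) auto
    finally show "J * J = 1\<^sub>m ?N" .
    show "mat_over proper J" unfolding J_def
      by (rule mat_over_four_block) (auto intro!: mat_over_uminus mat_over_one mat_over_zero subring_proper)
  qed
  have bF: "biproper ?F"
    by (rule involution_biproper[OF Fc _ flip_flip]) (auto simp: mat_over_def flip_def subringD[OF subring_proper])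
  have bc: "biproper (rc X)" if "X \<in> carrier_mat ?N ?N" "det X \<noteq> 0" for X
    unfolding rc_def by (rule biproper_const[OF that(1)]) (use that in \<open>simp add: nonsingular_def\<close>)
  have di: "det (minv P1) \<noteq> 0" "det (minv Rm) \<noteq> 0"
    using det_mult[OF P1(1) i1(1)] det_mult[OF L_carrier(4) i2(1)] i1(2) i2(2) by auto
  have dw: "det (w.W (iw x)) \<noteq> 0" "det (w.W (iw y)) \<noteq> 0"
    by (rule w_det; use iwx in fastforce)+
  have "biproper Ol" unfolding Ol_def
    by (intro biproper_mult[of _ ?N] mc bJ bF bc biproperI[OF UV(1) UV(3) UV(5)] di dw Jc UV(1) Fc c i1(1) w.W_carrier)
  moreover have "biproper Or" unfolding Or_def
    by (intro biproper_mult[of _ ?N] mc bF bc biproperI[OF UV(2) UV(4) UV(6)] di dw UV(2) Fc c i2(1) w.W_carrier)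
  ultimately show ?thesis by (intro that[OF Oc]) (simp_all only: Mi_def[symmetric] GG fin)
qed

end

lemma last_block_assembly:
  fixes P :: "'a :: comm_ring_1 mat"
  assumes n: "n > 0" and m: "m > 0" and P: "P \<in> carrier_mat n n" and X: "X \<in> carrier_mat n r" and Y: "Y \<in> carrier_mat r n" and R: "R \<in> carrier_mat r r"
  defines "e \<equiv> bcol n m (m - 1)"
  shows "four_block_mat (bdiag ((m - 1) * n) n (1\<^sub>m ((m - 1) * n)) P) (- (e * X)) (Y * transpose_mat e) R =
    bdiag ((m - 1) * n) (n + r) (1\<^sub>m ((m - 1) * n)) (four_block_mat P (- X) Y R)" (is "?L = ?R")
proof (rule eq_matI)
  define a where "a = (m - 1) * n"
  obtain m' where m': "m = Suc m'" using m by (cases m) auto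
  have N: "m * n = a + n" unfolding a_def m' by simp
  have dv: "i div n = m - 1 \<longleftrightarrow> \<not> i < a" "\<not> i < a \<Longrightarrow> i mod n = i - a" if "i < a + n" for i
  proof -
    show "i div n = m - 1 \<longleftrightarrow> \<not> i < a"
    proof
      assume "i div n = m - 1"
      hence "(m - 1) * n \<le> i" by (metis div_times_less_eq_dividend)
      thus "\<not> i < a" unfolding a_def by simp
    next
      assume "\<not> i < a"
      hence "(m - 1) * n \<le> i" unfolding a_def by simp
      moreover have "i < (m - 1) * n + n" using that unfolding a_def .
      ultimately show "i div n = m - 1" using n by (intro div_nat_eqI) (auto simp: mult.commute)
    qed
    assume "\<not> i < a"
    hence "i = (i - a) + (m - 1) * n" "i - a < n" using that unfolding a_def by auto
    thus "i mod n = i - a" by (metis mod_less mod_mult_self1)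
  qed
  have tY: "transpose_mat Y \<in> carrier_mat n r" using Y by simp
  have eX: "(e * X) $$ (i, j) = (if i < a then 0 else X $$ (i - a, j))" if "i < a + n" "j < r" for i j
    unfolding e_def using bcol_mult_index[OF X, of i m j "m - 1"] dv[OF that(1)] that N by simp
  have Ye: "(Y * transpose_mat e) $$ (i, j) = (if j < a then 0 else Y $$ (i, j - a))" if "i < r" "j < a + n" for i j
  proof -
    have "Y * transpose_mat e = transpose_mat (e * transpose_mat Y)"
      unfolding e_def using transpose_mult[OF bcol_carrier tY, of m "m - 1"] by (simp only: transpose_transpose)
    moreover have "transpose_mat (e * transpose_mat Y) $$ (i, j) = (e * transpose_mat Y) $$ (j, i)"
      by (rule index_transpose_mat(1)) (use that N Y in \<open>simp_all add: e_def\<close>)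
    moreover have "(e * transpose_mat Y) $$ (j, i) = (if j < a then 0 else transpose_mat Y $$ (j - a, i))"
      unfolding e_def using bcol_mult_index[OF tY, of j m i "m - 1"] dv[OF that(2)] that N by simp
    ultimately show ?thesis using that carrier_matD[OF Y] by simp
  qed
  have dims: "dim_row (e * X) = a + n" "dim_col (e * X) = r" "dim_row (Y * transpose_mat e) = r" "dim_col (Y * transpose_mat e) = a + n"
    using N carrier_matD[OF X] carrier_matD[OF Y] by (simp_all add: e_def)
  note cs = carrier_matD[OF P] carrier_matD[OF X] carrier_matD[OF Y] carrier_matD[OF R]
  show "dim_row ?L = dim_row ?R" "dim_col ?L = dim_col ?R" using cs by simp_all
  fix i j assume "i < dim_row ?R" "j < dim_col ?R"
  hence i: "i < a + n + r" and j: "j < a + n + r" using cs by (simp_all add: a_def)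
  show "?L $$ (i, j) = ?R $$ (i, j)"
    unfolding a_def[symmetric] using i j
    by (cases "i < a"; cases "i < a + n"; cases "j < a"; cases "j < a + n")
      (simp_all add: cs dims eX Ye less_diff_conv2 not_less diff_diff_left add.commute add.left_commute del: index_mult_mat)
qed

lemma pencil_neg:
  assumes "X \<in> carrier_mat a c" "Y \<in> carrier_mat a c"
  shows "lam \<cdot>\<^sub>m pm X - pm Y = pm (- Y) - lam \<cdot>\<^sub>m pm (- X)"
  using carrier_matD[OF assms(1)] carrier_matD[OF assms(2)] by (intro eq_matI) auto

lemma pm_bdiag:
  assumes "X \<in> carrier_mat a a" "Y \<in> carrier_mat c c"
  shows "pm (bdiag a c X Y) = bdiag a c (pm X) (pm Y)"
  using carrier_matD[OF assms(1)] carrier_matD[OF assms(2)] by (intro eq_matI) auto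

lemma skew_four_block:
  fixes X :: "'a :: comm_ring_1 mat"
  assumes X: "X \<in> carrier_mat a a" and Y: "Y \<in> carrier_mat a c" and R: "R \<in> carrier_mat c c"
    and sk: "transpose_mat X = - X" "transpose_mat R = - R"
  shows "skew_symmetric (four_block_mat X (- Y) (transpose_mat Y) R)"
proof -
  have c: "- Y \<in> carrier_mat a c" "transpose_mat Y \<in> carrier_mat c a" using Y by auto
  have "transpose_mat (four_block_mat X (- Y) (transpose_mat Y) R) = four_block_mat (- X) Y (- transpose_mat Y) (- R)"
    unfolding transpose_four_block_mat[OF X c R] sk transpose_uminus_mat transpose_transpose ..
  also have "\<dots> = - four_block_mat X (- Y) (transpose_mat Y) R"
    using carrier_matD[OF X] carrier_matD[OF Y] carrier_matD[OF R] by (intro eq_matI) auto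
  finally show ?thesis unfolding skew_symmetric_def .
qed

lemma skew_polynomial:
  assumes A: "\<And>i. i \<le> m \<Longrightarrow> A i \<in> carrier_mat n n" and sk: "skew_symmetric (matrix_polynomial n m A)" and i: "i \<le> m"
  shows "transpose_mat (A i) = - A i"
  unfolding skew_entries[OF A[OF i]]
proof (intro allI impI)
  fix a c assume ac: "a < n" "c < n"
  have P: "matrix_polynomial n m A \<in> carrier_mat n n" by (simp add: matrix_polynomial_def)
  have co: "coeff (matrix_polynomial n m A $$ (x, y)) i = A i $$ (x, y)" if "x < n" "y < n" for x y
  proof -
    have "coeff (matrix_polynomial n m A $$ (x, y)) i = (\<Sum>j\<le>m. if j = i then A i $$ (x, y) else 0)"
      using that by (simp add: matrix_polynomial_def coeff_sum)
    thus ?thesis using i by simp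
  qed
  have "matrix_polynomial n m A $$ (c, a) = - matrix_polynomial n m A $$ (a, c)"
    using sk ac unfolding skew_symmetric_def skew_entries[OF P] by blast
  hence "coeff (matrix_polynomial n m A $$ (c, a)) i = - coeff (matrix_polynomial n m A $$ (a, c)) i" by simp
  thus "A i $$ (c, a) = - A i $$ (a, c)" using co ac by simp
qed

context gfpr_system
begin

abbreviation "Lp \<equiv> lam \<cdot>\<^sub>m pm L1 - pm L0"
abbreviation "sQ d \<equiv> d (wpos m \<alpha>) \<cdot>\<^sub>m sgnm n m d"

lemma sQ_props:
  fixes d :: "nat \<Rightarrow> complex"
  assumes d: "\<And>a. d a \<in> {1, -1}"
  shows "sQ d \<in> carrier_mat (m * n) (m * n)" "det (sQ d) \<noteq> 0" "sQ d * b = b"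
proof -
  have dd: "d a * d a = 1" for a using d[of a] by auto
  show c: "sQ d \<in> carrier_mat (m * n) (m * n)" by simp
  have e: "sQ d = sgnm n m (\<lambda>a. d (wpos m \<alpha>) * d a)" by (intro eq_matI) (auto simp: sgnm_def)
  have "(d (wpos m \<alpha>) * d a) * (d (wpos m \<alpha>) * d a) = (d (wpos m \<alpha>) * d (wpos m \<alpha>)) * (d a * d a)" for a by (simp only: mult_ac)
  hence "(d (wpos m \<alpha>) * d a) * (d (wpos m \<alpha>) * d a) = 1" for a unfolding dd by simp
  hence sq: "sQ d * sQ d = 1\<^sub>m (m * n)" unfolding e sgnm_mult_sgnm by (simp only: sgnm_one)
  have "det (sQ d) * det (sQ d) = 1" unfolding det_mult[OF c c, symmetric] sq by (rule det_one)
  thus "det (sQ d) \<noteq> 0" by (metis mult_zero_left zero_neq_one)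
  have "wpos m \<alpha> < m" using m by (simp add: wpos_def)
  thus "sQ d * b = b" unfolding e b_def by (simp add: sgnm_mult_bcol dd)
qed

text \<open>The scaling of \<open>Q\<close> by its own parameter at \<open>m - \<alpha>\<close> makes \<open>sQ d\<close> fix \<open>b\<close>, so that the sign matrix does
  not disturb the coupling blocks.\<close>

lemma rosenbrock:
  fixes d :: "nat \<Rightarrow> complex"
  assumes d: "\<And>a. d a \<in> {1, -1}"
    and Am: "det (A m) = 0 \<Longrightarrow> pz = 0 \<and> 0 \<notin> set tz" and A0: "det (A 0) = 0 \<Longrightarrow> 0 \<notin> set tw"
    and real: "is_realization n r (matrix_polynomial n m A) As E B (transpose_mat B) G"
    and minimal: "\<And>r' P' A' E' B' C'. is_realization n r' P' A' E' B' C' G \<Longrightarrow> r \<le> r'"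
    and sk: "transpose_mat E = - E" "transpose_mat As = - As"
  shows "rosenbrock_strong_linearization n m r (system_matrix (matrix_polynomial n m A) As E B) G
    (four_block_mat (pm (sQ d) * Lp) (- pm bB) (pm Bb) (lam \<cdot>\<^sub>m pm E - pm As))"
proof -
  let ?N = "m * n" and ?P = "matrix_polynomial n m A" and ?R = "lam \<cdot>\<^sub>m pm E - pm As"
  have nE: "det E \<noteq> 0" and G: "G = rm ?P + rm (pm (transpose_mat B)) * minv (rm ?R) * rm (pm B)" and Pc: "?P \<in> carrier_mat n n"
    using real by (auto simp: is_realization_def nonsingular_def)
  define Q where "Q = sQ d"
  note Q = sQ_props[of d, OF d, folded Q_def]
  define P1 where "P1 = Q * Lm * w.W w1"
  have P1c: "P1 \<in> carrier_mat ?N ?N" unfolding P1_def by (intro w.mult_N(1) Q L_carrier w.W_carrier)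
  have evw0: "0 \<notin> set (evw (2 * j))" for j using w.evw_odd[of 0 "2 * j"] by auto
  have P1d: "det P1 \<noteq> 0"
  proof -
    have "det (z.W (rev tz)) \<noteq> 0" by (rule z_det) (use words_less Am in auto)
    moreover have "det (w.W (rev tw)) \<noteq> 0" by (rule w_det) (use words_less A0 in auto)
    moreover have "det (w.W w1) \<noteq> 0" by (rule w_det) (use w1_set mhk in auto)
    ultimately show ?thesis unfolding P1_def Lm_def
      using Q by (simp only: det_mult[of _ ?N] w.mult_N(1) w.W_carrier z.W_carrier mult_eq_0_iff simp_thms)
  qed
  have P1e: "P1 * e0 = b"
  proof -
    have "P1 * e0 = Q * (Lm * w.W w1) * e0" unfolding P1_def by (subst assoc_mult_mat[OF Q(1) L_carrier(3) w.W_carrier]) (rule refl)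
    also have "\<dots> = Q * (Lm * w.W w1 * e0)" by (rule w.assoc3[OF Q(1)]) (auto intro!: w.mult_N)
    finally show ?thesis unfolding left_column b_def[symmetric] Q(3) .
  qed
  have dR: "det Rm \<noteq> 0"
  proof -
    have "det (w.W sw) \<noteq> 0" by (rule w_det) (use words_less evw0[of "h div 2"] hh in \<open>auto simp: sw_evw\<close>)
    moreover have "det (w.W tw) \<noteq> 0" by (rule w_det) (use words_less A0 in auto)
    moreover have "det (z.W tz) \<noteq> 0" by (rule z_det) (use words_less Am in auto)
    moreover have "det (z.W sz) \<noteq> 0"
    proof (rule z_det)
      assume "0 \<in> set sz"
      hence "pz \<noteq> 0" using evw0 unfolding sz_def by (cases "pz = 0") (auto simp: csym_zero)
      thus "det (A m) \<noteq> 0" using Am by blast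
    qed (rule words_less)
    ultimately show ?thesis unfolding Rm_def
      by (simp only: det_mult[of _ ?N] w.mult_N(1) w.W_carrier z.W_carrier mult_eq_0_iff simp_thms)
  qed
  have QLc: "Q * L1 \<in> carrier_mat ?N ?N" "Q * L0 \<in> carrier_mat ?N ?N" by (intro w.mult_N(1) Q L_carrier)+
  have QL: "Q * L1 = P1 * z.W nw * Rm" "Q * L0 = P1 * w.M 0 * Rm" unfolding P1_def by (rule L_factor[OF Q(1)])+
  have T11: "pm Q * Lp = lam \<cdot>\<^sub>m pm (Q * L1) - pm (Q * L0)" by (rule pencil_mult_left[OF Q(1) L_carrier(2,1)])
  let ?T = "four_block_mat (pm Q * Lp) (- pm bB) (pm Bb) ?R"
  have T11c: "pm Q * Lp \<in> carrier_mat ?N ?N" unfolding T11 by (rule minus_carrier_mat) (use QLc in simp)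
  have Tc: "- pm bB \<in> carrier_mat ?N r" "pm Bb \<in> carrier_mat r ?N" "?R \<in> carrier_mat r r" "pm bB \<in> carrier_mat ?N r"
    using bB_carrier pencil_carrier[OF As E nE] by auto
  have Tform: "?T = four_block_mat (pm (- (Q * L0)) - lam \<cdot>\<^sub>m pm (- (Q * L1))) (pm (- bB)) (pm Bb) (pm (- As) - lam \<cdot>\<^sub>m pm (- E))"
    unfolding T11 pencil_neg[OF QLc] pencil_neg[OF E As] pm_uminus ..
  obtain U V where UV: "U \<in> carrier_mat ?N ?N" "V \<in> carrier_mat ?N ?N" "unimodular U" "unimodular V"
    "U * (lam \<cdot>\<^sub>m pm (P1 * z.W nw * Rm) - pm (P1 * w.M 0 * Rm)) * V = bdiag ((m - 1) * n) n (1\<^sub>m ((m - 1) * n)) ?P"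
    "U * pm b = bcol n m (m - 1)" "pm (transpose_mat b) * V = transpose_mat (bcol n m (m - 1))"
    by (rule unimodular_part[OF P1c P1d P1e dR])
  let ?e = "bcol n m (m - 1) :: complex poly mat"
  have tB: "pm (transpose_mat B) \<in> carrier_mat n r" "transpose_mat B \<in> carrier_mat n r" and pB: "pm B \<in> carrier_mat r n" using B by auto
  have m0: "m > 0" using m by simp
  have uni: "diag_block_mat [U, pm (1\<^sub>m r)] * ?T * diag_block_mat [V, pm (1\<^sub>m r)] = diag_block_mat [1\<^sub>m ((m - 1) * n), system_matrix ?P As E B]"
  proof -
    have o: "1\<^sub>m r \<in> carrier_mat r r" by simp
    have "bdiag ?N r U (1\<^sub>m r) * ?T = four_block_mat (U * (pm Q * Lp)) (U * - pm bB) (1\<^sub>m r * pm Bb) (1\<^sub>m r * ?R)"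
      by (rule bdiag_mult_four_block[OF UV(1) o T11c Tc(1-3)])
    also have "U * - pm bB = - (?e * pm (transpose_mat B))"
    proof -
      have 1: "U * - pm bB = - (U * pm bB)" by (rule uminus_mult_right_mat) (simp only: carrier_matD[OF UV(1)] carrier_matD[OF Tc(4)])
      have 2: "pm bB = pm b * pm (transpose_mat B)" by (rule pm_mult[OF b_carrier tB(2)])
      have pb: "pm b \<in> carrier_mat ?N n" using b_carrier by simp
      show ?thesis unfolding 1 unfolding 2 assoc_mult_mat[symmetric, OF UV(1) pb tB(1)] UV(6) ..
    qed
    also have "1\<^sub>m r * pm Bb = pm Bb" by (rule left_mult_one_mat[OF Tc(2)])
    also have "1\<^sub>m r * ?R = ?R" by (rule left_mult_one_mat[OF Tc(3)])
    finally have 1: "bdiag ?N r U (1\<^sub>m r) * ?T = four_block_mat (U * (pm Q * Lp)) (- (?e * pm (transpose_mat B))) (pm Bb) ?R" .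
    have ec: "- (?e * pm (transpose_mat B)) \<in> carrier_mat ?N r" using mult_carrier_mat[OF bcol_carrier tB(1)] by simp
    have "four_block_mat (U * (pm Q * Lp)) (- (?e * pm (transpose_mat B))) (pm Bb) ?R * bdiag ?N r V (1\<^sub>m r) =
      four_block_mat (U * (pm Q * Lp) * V) (- (?e * pm (transpose_mat B)) * 1\<^sub>m r) (pm Bb * V) (?R * 1\<^sub>m r)"
      by (rule four_block_mult_bdiag[OF UV(2) o mult_carrier_mat[OF UV(1) T11c] ec Tc(2,3)])
    also have "pm Bb * V = pm B * transpose_mat ?e"
    proof -
      have tb: "transpose_mat b \<in> carrier_mat n ?N" "pm (transpose_mat b) \<in> carrier_mat n ?N" using b_carrier by auto
      have "pm Bb = pm B * pm (transpose_mat b)" by (rule pm_mult[OF B tb(1)])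
      hence "pm Bb * V = pm B * (pm (transpose_mat b) * V)" using assoc_mult_mat[OF pB tb(2) UV(2)] by (simp only:)
      thus ?thesis unfolding UV(7) .
    qed
    also have "- (?e * pm (transpose_mat B)) * 1\<^sub>m r = - (?e * pm (transpose_mat B))" by (rule right_mult_one_mat[OF ec])
    also have "?R * 1\<^sub>m r = ?R" by (rule right_mult_one_mat[OF Tc(3)])
    also have "U * (pm Q * Lp) * V = bdiag ((m - 1) * n) n (1\<^sub>m ((m - 1) * n)) ?P" unfolding T11 QL by (rule UV(5))
    also have "four_block_mat (bdiag ((m - 1) * n) n (1\<^sub>m ((m - 1) * n)) ?P) (- (?e * pm (transpose_mat B))) (pm B * transpose_mat ?e) ?R =
      bdiag ((m - 1) * n) (n + r) (1\<^sub>m ((m - 1) * n)) (four_block_mat ?P (- pm (transpose_mat B)) (pm B) ?R)"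
      by (rule last_block_assembly[OF n m0 Pc tB(1) pB Tc(3)])
    finally have 2: "bdiag ?N r U (1\<^sub>m r) * ?T * bdiag ?N r V (1\<^sub>m r) =
      bdiag ((m - 1) * n) (n + r) (1\<^sub>m ((m - 1) * n)) (system_matrix ?P As E B)" unfolding 1 system_matrix_def .
    have Sc: "system_matrix ?P As E B \<in> carrier_mat (n + r) (n + r)"
      unfolding system_matrix_def by (rule four_block_carrier_mat[OF Pc Tc(3)])
    show ?thesis unfolding pm_one diag_block_two[OF UV(1) o] diag_block_two[OF UV(2) o] 2 by (rule diag_block_two[symmetric, OF one_carrier_mat Sc])
  qed
  have rc: "rm ?R \<in> carrier_mat r r" using Tc(3) by simp
  have tf: "transfer_function ?N ?T = rm (pm Q * Lp) + rm (pm bB) * minv (rm ?R) * rm (pm Bb)"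
    by (rule transfer_function_four_block[OF T11c Tc(4,2,3) det_pencil(2)[OF As E nE]])
  obtain Ol Or where O: "Ol \<in> carrier_mat ?N ?N" "Or \<in> carrier_mat ?N ?N" "biproper Ol" "biproper Or"
    "Ol * (inverse (to_fract lam) \<cdot>\<^sub>m (rm (lam \<cdot>\<^sub>m pm (P1 * z.W nw * Rm) - pm (P1 * w.M 0 * Rm)) +
      rm (pm bB) * minv (rm ?R) * rm (pm Bb))) * Or = bdiag ((m - 1) * n) n (1\<^sub>m ((m - 1) * n)) (inverse (to_fract lam) ^ m \<cdot>\<^sub>m G)"
    by (rule infinity_part[OF P1c P1d P1e dR nE G])
  have Gc: "inverse (to_fract lam) ^ m \<cdot>\<^sub>m G \<in> carrier_mat n n"
  proof -
    have "dim_row G = n" "dim_col G = n" unfolding G by (simp_all add: carrier_matD[OF B])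
    thus ?thesis by auto
  qed
  have inf: "Ol * (inverse (to_fract lam) \<cdot>\<^sub>m transfer_function ?N ?T) * Or = diag_block_mat [1\<^sub>m ((m - 1) * n), inverse (to_fract lam) ^ m \<cdot>\<^sub>m G]"
    unfolding tf unfolding T11 QL O(5) by (rule diag_block_two[symmetric, OF one_carrier_mat Gc])
  have nK: "nonsingular (- E)" using det_uminus_zero[OF E] nE by (simp add: nonsingular_def)
  have n1: "nonsingular (1\<^sub>m r :: complex mat)" by (simp add: nonsingular_def)
  have cc: "- (Q * L0) \<in> carrier_mat ?N ?N" "- (Q * L1) \<in> carrier_mat ?N ?N" "- bB \<in> carrier_mat ?N r" "- As \<in> carrier_mat r r" "- E \<in> carrier_mat r r"
    using QLc bB_carrier(1) As E by simp_all
  have R1: "\<forall>x. vec_space.rank r (four_block_mat Bb (- As - x \<cdot>\<^sub>m - E) (0\<^sub>m 0 ?N) (0\<^sub>m 0 r)) = r"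
    by (intro allI irreducible(1)[OF real _ sk]) (rule minimal)
  have R2: "\<forall>x. vec_space.rank (?N + r) (- bB @\<^sub>r (- As - x \<cdot>\<^sub>m - E)) = r"
    by (intro allI irreducible(2)[OF real _ sk]) (rule minimal)
  have EU: "\<exists>U \<in> carrier_mat ?N ?N. \<exists>V \<in> carrier_mat ?N ?N. \<exists>U0 \<in> carrier_mat r r. \<exists>V0 \<in> carrier_mat r r.
    unimodular U \<and> unimodular V \<and> nonsingular U0 \<and> nonsingular V0 \<and>
    diag_block_mat [U, pm U0] * ?T * diag_block_mat [V, pm V0] = diag_block_mat [1\<^sub>m ((m - 1) * n), system_matrix ?P As E B]"
    by (rule bexI[OF _ UV(1)], rule bexI[OF _ UV(2)], rule bexI[OF _ one_carrier_mat], rule bexI[OF _ one_carrier_mat])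
      (intro conjI UV(3,4) n1 uni)
  have EO: "\<exists>Ol \<in> carrier_mat ?N ?N. \<exists>Or \<in> carrier_mat ?N ?N. biproper Ol \<and> biproper Or \<and>
    Ol * (inverse (to_fract lam) \<cdot>\<^sub>m transfer_function ?N ?T) * Or = diag_block_mat [1\<^sub>m ((m - 1) * n), inverse (to_fract lam) ^ m \<cdot>\<^sub>m G]"
    by (rule bexI[OF _ O(1)], rule bexI[OF _ O(2)]) (intro conjI O(3,4) inf)
  show ?thesis
    unfolding rosenbrock_strong_linearization_def Q_def[symmetric]
    by (rule bexI[OF _ cc(1)], rule bexI[OF _ cc(2)], rule bexI[OF _ cc(3)], rule bexI[OF _ bB_carrier(2)],
        rule bexI[OF _ cc(4)], rule bexI[OF _ cc(5)])
      (intro conjI Tform nK R1 R2 EU EO)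
qed

lemma sQ_skew:
  fixes d :: "nat \<Rightarrow> complex"
  assumes sk: "transpose_mat (sgnm n m d * L0) = - (sgnm n m d * L0)" "transpose_mat (sgnm n m d * L1) = - (sgnm n m d * L1)"
  shows "transpose_mat (pm (sQ d) * Lp) = - (pm (sQ d) * Lp)"
proof -
  have t: "transpose_mat (sQ d * X) = - (sQ d * X)" "sQ d * X \<in> carrier_mat (m * n) (m * n)"
    if X: "X \<in> carrier_mat (m * n) (m * n)" and s: "transpose_mat (sgnm n m d * X) = - (sgnm n m d * X)" for X
  proof -
    have c: "sgnm n m d * X \<in> carrier_mat (m * n) (m * n)" by (rule mult_carrier_mat[OF sgnm_carrier X])
    have e: "sQ d * X = d (wpos m \<alpha>) \<cdot>\<^sub>m (sgnm n m d * X)" by (rule mult_smult_assoc_mat[OF sgnm_carrier X])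
    show "sQ d * X \<in> carrier_mat (m * n) (m * n)" unfolding e using c by simp
    show "transpose_mat (sQ d * X) = - (sQ d * X)"
    proof -
      have "transpose_mat (d (wpos m \<alpha>) \<cdot>\<^sub>m (sgnm n m d * X)) = d (wpos m \<alpha>) \<cdot>\<^sub>m transpose_mat (sgnm n m d * X)"
        by (intro eq_matI) (auto simp del: index_mult_mat(1))
      also have "\<dots> = - (d (wpos m \<alpha>) \<cdot>\<^sub>m (sgnm n m d * X))" unfolding s by (intro eq_matI) (auto simp del: index_mult_mat(1))
      finally show ?thesis unfolding e .
    qed
  qed
  have Q: "sQ d \<in> carrier_mat (m * n) (m * n)" by simp
  show ?thesis
    unfolding pencil_mult_left[OF Q L_carrier(2,1)]
    using pencil_skew_iff[OF t(2)[OF L_carrier(2) sk(2)] t(2)[OF L_carrier(1) sk(1)]] t(1)[OF L_carrier(2) sk(2)] t(1)[OF L_carrier(1) sk(1)]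
    unfolding skew_symmetric_def by blast
qed

lemma block_form:
  fixes d :: "nat \<Rightarrow> complex"
  assumes d: "\<And>a. d a \<in> {1, -1}"
  shows "pm (diag_block_mat [sQ d, 1\<^sub>m r]) * four_block_mat Lp (- pm bB) (pm Bb) (lam \<cdot>\<^sub>m pm E - pm As) =
    four_block_mat (pm (sQ d) * Lp) (- pm bB) (pm Bb) (lam \<cdot>\<^sub>m pm E - pm As)"
proof -
  note Q = sQ_props[of d, OF d]
  have Rc: "lam \<cdot>\<^sub>m pm E - pm As \<in> carrier_mat r r" using As E by auto
  have Lc: "Lp \<in> carrier_mat (m * n) (m * n)" by (rule minus_carrier_mat) simp
  have o: "1\<^sub>m r \<in> carrier_mat r r" by simp
  have bc: "- pm bB \<in> carrier_mat (m * n) r" "pm bB \<in> carrier_mat (m * n) r" "pm Bb \<in> carrier_mat r (m * n)" using bB_carrier by auto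
  have pQ: "pm (sQ d) \<in> carrier_mat (m * n) (m * n)" using Q(1) by simp
  have tB: "transpose_mat B \<in> carrier_mat n r" using B by simp
  have 0: "pm (sQ d) * - pm bB = - (pm (sQ d) * pm bB)" by (rule uminus_mult_right_mat) (simp only: carrier_matD[OF pQ] carrier_matD[OF bc(2)])
  have 1: "pm (sQ d) * - pm bB = - pm bB"
    unfolding 0 pm_mult[symmetric, OF Q(1) bB_carrier(1)] assoc_mult_mat[symmetric, OF Q(1) b_carrier tB] Q(3) ..
  show ?thesis
    unfolding diag_block_two[OF Q(1) o] pm_bdiag[OF Q(1) o] pm_one bdiag_mult_four_block[OF pQ o Lc bc(1,3) Rc] 1
      left_mult_one_mat[OF bc(3)] left_mult_one_mat[OF Rc] ..
qed

end

theorem theorem4p34: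
  fixes n m r h pw pz \<alpha> :: nat
    and A :: "nat \<Rightarrow> complex mat"
    and P S L LL :: "complex poly mat"
    and As E B :: "complex mat"
    and G :: "complex poly fract mat"
    and w z cw cz tw tz :: "int list"
  assumes m: "m \<ge> 1"
    and A: "\<And>i. i \<le> m \<Longrightarrow> A i \<in> carrier_mat n n"
    and Am: "A m \<noteq> 0\<^sub>m n n"
    and P: "P = matrix_polynomial n m A"
    and G: "G \<in> carrier_mat n n" "skew_symmetric G"
    and realization: "minimal_skew_realization n r P As E B G"
    and S: "S = system_matrix P As E B"
    and h: "h \<le> m - 1" "even h"
    and w: "simple_admissible_tuple h pw w"
    and cw: "cw = symmetric_complement h pw"
    and z: "admissible_tuple (m - h - 1) pz (map (\<lambda>i. i + int m) z)"
    and cz: "map (\<lambda>i. i + int m) cz = symmetric_complement (m - h - 1) pz"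
    and tw: "set tw \<subseteq> {0..int h - 1}" "right_index_tuple_type1 h (rev w) tw"
    and tz: "set (map (\<lambda>i. i + int m) tz) \<subseteq> {0..int m - int h - 2}"
      "right_index_tuple_type1 (m - h - 1) (rev (map (\<lambda>i. i + int m) z)) (map (\<lambda>i. i + int m) tz)"
    and LL: "LL = gfpr (m * n + r) (fiedler_ext n m r A) (fiedler_sys n m r A As E B) w z cw tw cz tz"
    and L: "L = gfpr (m * n) (fiedler n m A) (fiedler n m A) w z cw tw cz tz"
    and \<alpha>: "\<alpha> = c0 (w @ cw @ tw)"
  shows
    "let qskew = (\<lambda>\<epsilon> Q. quasi_identity n m \<epsilon> Q \<and> skew_symmetric (pm Q * L));
         unique_up_to_sign = (\<forall>\<epsilon> Q \<epsilon>' Q'. qskew \<epsilon> Q \<and> qskew \<epsilon>' Q' \<longrightarrow> Q' = Q \<or> Q' = - Q);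
         QQ = (\<lambda>\<epsilon> Q. diag_block_mat [\<epsilon> (m - \<alpha>) \<cdot>\<^sub>m Q, 1\<^sub>m r]);
         b = ecol m (m - \<alpha>) \<otimes>\<^sub>K transpose_mat B;
         c = transpose_mat (ecol m (m - \<alpha>)) \<otimes>\<^sub>K B;
         block_form = (\<lambda>\<epsilon> Q. four_block_mat (pm (\<epsilon> (m - \<alpha>) \<cdot>\<^sub>m Q) * L) (- pm b)
                                              (pm c) (lam \<cdot>\<^sub>m pm E - pm As))
     in
       (\<exists>\<epsilon> Q. qskew \<epsilon> Q) \<and>
       (A 0 \<noteq> 0\<^sub>m n n \<or> 0 \<notin> set tw \<longrightarrow> unique_up_to_sign) \<and>
       (unique_up_to_sign \<longrightarrow>
         (\<exists>!X. (\<exists>\<epsilon> Q. qskew \<epsilon> Q \<and> X = QQ \<epsilon> Q \<and> pm X * LL = block_form \<epsilon> Q) \<and>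
               skew_symmetric (pm X * LL))) \<and>
       (\<forall>\<epsilon> Q. qskew \<epsilon> Q \<longrightarrow>
         pm (QQ \<epsilon> Q) * LL = block_form \<epsilon> Q \<and>
         skew_symmetric (pm (QQ \<epsilon> Q) * LL) \<and>
         ((\<not> nonsingular (A m) \<longrightarrow> pz = 0) \<and>
          (\<not> nonsingular (A 0) \<longrightarrow> 0 \<notin> set tw) \<and>
          (\<not> nonsingular (A m) \<longrightarrow> - int m \<notin> set tz) \<longrightarrow>
            rosenbrock_strong_linearization n m r S G (pm (QQ \<epsilon> Q) * LL)) \<and>
         transfer_function (m * n) (pm (QQ \<epsilon> Q) * LL) =
           rm (pm (\<epsilon> (m - \<alpha>) \<cdot>\<^sub>m Q) * L) + rm (pm b) * minv (rm (lam \<cdot>\<^sub>m pm E - pm As)) * rm (pm c) \<and>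
         skew_symmetric (transfer_function (m * n) (pm (QQ \<epsilon> Q) * LL)))"
proof -
  have n: "n > 0"
  proof (rule ccontr)
    assume "\<not> n > 0"
    hence "A m = 0\<^sub>m n n" using A[of m] by (intro eq_matI) auto
    thus False using Am by simp
  qed
  have real: "is_realization n r P As E B (transpose_mat B) G" and skP: "skew_symmetric P"
    and skR: "skew_symmetric (lam \<cdot>\<^sub>m pm E - pm As)"
    and minimal: "\<And>r' P' A' E' B' C'. is_realization n r' P' A' E' B' C' G \<Longrightarrow> r \<le> r'"
    using realization unfolding minimal_skew_realization_def skew_realization_def by blast+
  have c: "As \<in> carrier_mat r r" "E \<in> carrier_mat r r" "B \<in> carrier_mat r n" and nE: "det E \<noteq> 0"
    using real by (auto simp: is_realization_def nonsingular_def)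
  have skE: "transpose_mat E = - E" "transpose_mat As = - As" using skR pencil_skew_iff[OF c(2,1)] by auto
  have skA: "transpose_mat (A i) = - A i" if "i \<le> m" for i
    by (rule skew_polynomial[of m A n, OF A _ that]) (use skP P in auto)
  define kz where "kz = m - h - 1"
  have km: "m - 1 - h = kz" by (simp add: kz_def)
  have pw: "pw = 0" using w h(2) unfolding simple_admissible_tuple_def admissible_tuple_def by auto
  have wa: "w = map int (adm 0 (h div 2))"
    using admissible_tuple_adm(3)[of h pw w] w unfolding simple_admissible_tuple_def pw by simp
  have cwa: "cw = map int (csym 0 (h div 2))" using symmetric_complement_csym[of 0 h] cw h(2) unfolding pw by simp
  note za = admissible_tuple_adm[OF z, folded kz_def]
  have shift_back: "t = map (\<lambda>i. int i - int m) u" if "map (\<lambda>i. i + int m) t = map int u" for t u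
  proof -
    have "t = map (\<lambda>i. i - int m) (map (\<lambda>i. i + int m) t)" by (simp add: o_def)
    thus ?thesis unfolding that by (simp add: o_def)
  qed
  have ze: "z = map (\<lambda>i. int i - int m) (adm pz ((kz - pz) div 2))" by (rule shift_back[OF za(3)])
  have cze: "cz = map (\<lambda>i. int i - int m) (csym pz ((kz - pz) div 2))"
    by (rule shift_back) (use cz symmetric_complement_csym[OF za(1,2)] in \<open>simp add: kz_def\<close>)
  define twn where "twn = map nat tw"
  define tzn where "tzn = map (\<lambda>i. nat (i + int m)) tz"
  have twn: "tw = map int twn" unfolding twn_def using tw(1) by (auto intro!: map_idI[symmetric])
  have tzs: "map (\<lambda>i. i + int m) tz = map int tzn" unfolding tzn_def using tz(1) by auto
  have tzn: "tz = map (\<lambda>i. int i - int m) tzn" by (rule shift_back[OF tzs])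
  have mvw: "mv (simple_state 0 h) twn"
    using right_tuple_adm_mv[of 0 "h div 2" twn] tw(2) h(2) unfolding wa twn by simp
  have kk: "pz + 2 * ((kz - pz) div 2) = kz" using za(1,2) by simp
  have mvz: "mv (simple_state pz kz) tzn"
    using right_tuple_adm_mv[of pz "(kz - pz) div 2" tzn] tz(2) unfolding tzs za(3) kk kz_def[symmetric] by simp
  interpret g: gfpr_system n m A h pz twn tzn r As E B
    by unfold_locales (use n m A skA h za(1,2) mvw mvz c in \<open>simp_all add: km[simplified]\<close>)
  have gk: "g.k = kz" by (simp add: g.k_def kz_def)
  note words = g.aw_def g.sw_def g.az_def g.sz_def gk
  have Lf: "L = lam \<cdot>\<^sub>m pm g.L1 - pm g.L0"
    unfolding L wa cwa ze cze twn tzn by (rule g.L_form[unfolded words])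
  have LLf: "LL = four_block_mat (lam \<cdot>\<^sub>m pm g.L1 - pm g.L0) (- pm (g.b * transpose_mat B)) (pm (B * transpose_mat g.b)) (lam \<cdot>\<^sub>m pm E - pm As)"
    unfolding LL wa cwa ze cze twn tzn by (rule g.LL_form[unfolded words])
  have al: "\<alpha> = g.\<alpha>" unfolding \<alpha> wa cwa twn using g.c0_alpha[unfolded words] by simp
  have am: "1 \<le> m - \<alpha>" "m - \<alpha> \<le> m" "m - \<alpha> - 1 = wpos m g.\<alpha>" "wpos m g.\<alpha> < m" "Suc (wpos m g.\<alpha>) = m - \<alpha>"
    using g.alpha_le h(1) m unfolding al wpos_def by auto
  have tB: "transpose_mat B \<in> carrier_mat n r" using c(3) by simp
  have bk: "ecol m (m - \<alpha>) \<otimes>\<^sub>K transpose_mat B = g.b * transpose_mat B"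
    unfolding kronecker_ecol[OF tB am(1,2)] am(3) g.b_def ..
  have ck: "transpose_mat (ecol m (m - \<alpha>)) \<otimes>\<^sub>K B = B * transpose_mat g.b"
    unfolding kronecker_transpose bk using transpose_mult[OF g.b_carrier tB] by simp
  let ?R = "lam \<cdot>\<^sub>m pm E - pm As"
  let ?bB = "g.b * transpose_mat B" and ?Bb = "B * transpose_mat g.b"
  let ?qs = "\<lambda>\<epsilon> Q. quasi_identity n m \<epsilon> Q \<and> skew_symmetric (pm Q * L)"
  let ?QQ = "\<lambda>\<epsilon> Q. diag_block_mat [\<epsilon> (m - \<alpha>) \<cdot>\<^sub>m Q, 1\<^sub>m r]"
  let ?bf = "\<lambda>\<epsilon> Q. four_block_mat (pm (\<epsilon> (m - \<alpha>) \<cdot>\<^sub>m Q) * L) (- pm ?bB) (pm ?Bb) ?R"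
  have skew_iff: "skew_symmetric (pm (sgnm n m d) * L) \<longleftrightarrow>
    transpose_mat (sgnm n m d * g.L1) = - (sgnm n m d * g.L1) \<and> transpose_mat (sgnm n m d * g.L0) = - (sgnm n m d * g.L0)" for d
    unfolding Lf pencil_mult_left[OF sgnm_carrier g.L_carrier(2,1)]
    by (rule pencil_skew_iff[of _ "m * n"]) (intro mult_carrier_mat[OF sgnm_carrier] g.L_carrier)+
  have signs: "\<exists>d. (\<forall>a. d a \<in> {1, -1 :: complex}) \<and> Q = sgnm n m d \<and> d (wpos m g.\<alpha>) = \<epsilon> (m - \<alpha>) \<and>
    transpose_mat (sgnm n m d * g.L0) = - (sgnm n m d * g.L0) \<and> transpose_mat (sgnm n m d * g.L1) = - (sgnm n m d * g.L1)"
    if qs: "?qs \<epsilon> Q" for \<epsilon> Q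
  proof -
    define d where "d = (\<lambda>a. if a < m then \<epsilon> (Suc a) else 1)"
    have d: "\<forall>a. d a \<in> {1, -1}"
    proof
      fix a
      show "d a \<in> {1, -1}" using qs unfolding d_def quasi_identity_def by (cases "a < m") auto
    qed
    have Q: "Q = sgnm n m d"
      unfolding quasi_identity_signs[OF n conjunct1[OF qs]] by (rule sgnm_cong) (simp add: d_def)
    have "d (wpos m g.\<alpha>) = \<epsilon> (m - \<alpha>)" unfolding d_def using am(4,5) by simp
    thus ?thesis using d Q conjunct2[OF qs] unfolding Q skew_iff by blast
  qed
  have ex: "\<exists>\<epsilon> Q. ?qs \<epsilon> Q"
  proof -
    obtain d where d: "\<forall>a. d a \<in> {1, -1 :: complex}"
      "transpose_mat (sgnm n m d * g.L0) = - (sgnm n m d * g.L0)" "transpose_mat (sgnm n m d * g.L1) = - (sgnm n m d * g.L1)"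
      by (rule g.skew_signs_exist, blast)
    have "quasi_identity n m (\<lambda>j. d (j - 1)) (sgnm n m d)"
      by (rule signs_quasi_identity[OF n]) (use d(1) in blast)
    hence "?qs (\<lambda>j. d (j - 1)) (sgnm n m d)" using skew_iff[of d] d(2,3) by blast
    thus ?thesis by blast
  qed
  have unique: "Q' = Q \<or> Q' = - Q" if A0: "A 0 \<noteq> 0\<^sub>m n n \<or> 0 \<notin> set tw" and qs: "?qs \<epsilon> Q" "?qs \<epsilon>' Q'" for \<epsilon> Q \<epsilon>' Q'
  proof -
    obtain d where d: "\<forall>a. d a \<in> {1, -1 :: complex}" "Q = sgnm n m d"
      "transpose_mat (sgnm n m d * g.L0) = - (sgnm n m d * g.L0)" "transpose_mat (sgnm n m d * g.L1) = - (sgnm n m d * g.L1)"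
      using signs[OF qs(1)] by blast
    obtain d' where d': "\<forall>a. d' a \<in> {1, -1 :: complex}" "Q' = sgnm n m d'"
      "transpose_mat (sgnm n m d' * g.L0) = - (sgnm n m d' * g.L0)" "transpose_mat (sgnm n m d' * g.L1) = - (sgnm n m d' * g.L1)"
      using signs[OF qs(2)] by blast
    have sq: "d a * d a = 1" "d' a * d' a = 1" for a
    proof -
      have "d a = 1 \<or> d a = -1" "d' a = 1 \<or> d' a = -1" using d(1) d'(1) by auto
      thus "d a * d a = 1" "d' a * d' a = 1" by auto
    qed
    define s where "s = d' g.k * d g.k"
    have s: "s = 1 \<or> s = -1"
    proof -
      have "d g.k = 1 \<or> d g.k = -1" "d' g.k = 1 \<or> d' g.k = -1" using d(1) d'(1) by auto
      thus ?thesis unfolding s_def by auto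
    qed
    have A0': "A 0 \<noteq> 0\<^sub>m n n" if "0 \<in> set twn" using A0 that unfolding twn by force
    have "d' a = s * d a" if "a < m" for a
    proof -
      have eq: "d' a * d a = s" unfolding s_def
        by (rule g.skew_signs_unique[of d d', OF sq d(3,4) d'(3,4) A0' Am that])
      have "s * d a = d' a * (d a * d a)" unfolding eq[symmetric] by (rule mult.assoc)
      thus ?thesis unfolding sq by simp
    qed
    hence "Q' = sgnm n m (\<lambda>a. s * d a)" unfolding d'(2) by (rule sgnm_cong)
    thus ?thesis using s sgnm_uminus[of n m d] d(2) by auto
  qed
  have block: "pm (?QQ \<epsilon> Q) * LL = ?bf \<epsilon> Q" "skew_symmetric (?bf \<epsilon> Q)"
    "transfer_function (m * n) (?bf \<epsilon> Q) = rm (pm (\<epsilon> (m - \<alpha>) \<cdot>\<^sub>m Q) * L) + rm (pm ?bB) * minv (rm ?R) * rm (pm ?Bb)"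
    "skew_symmetric (rm (pm (\<epsilon> (m - \<alpha>) \<cdot>\<^sub>m Q) * L) + rm (pm ?bB) * minv (rm ?R) * rm (pm ?Bb))"
    "(\<not> nonsingular (A m) \<longrightarrow> pz = 0) \<and> (\<not> nonsingular (A 0) \<longrightarrow> 0 \<notin> set tw) \<and> (\<not> nonsingular (A m) \<longrightarrow> - int m \<notin> set tz) \<longrightarrow>
      rosenbrock_strong_linearization n m r S G (?bf \<epsilon> Q)"
    if qs: "?qs \<epsilon> Q" for \<epsilon> Q
  proof -
    obtain d where d: "\<forall>a. d a \<in> {1, -1 :: complex}" "Q = sgnm n m d" "d (wpos m g.\<alpha>) = \<epsilon> (m - \<alpha>)"
      "transpose_mat (sgnm n m d * g.L0) = - (sgnm n m d * g.L0)" "transpose_mat (sgnm n m d * g.L1) = - (sgnm n m d * g.L1)"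
      using signs[OF qs] by blast
    have d1: "d a \<in> {1, -1}" for a using d(1) by blast
    have sQ: "\<epsilon> (m - \<alpha>) \<cdot>\<^sub>m Q = g.sQ d" unfolding d(2,3) ..
    have Qc: "pm (g.sQ d) * L \<in> carrier_mat (m * n) (m * n)"
      unfolding Lf pencil_mult_left[OF g.sQ_props(1)[of d, OF d1] g.L_carrier(2,1)]
      by (rule minus_carrier_mat) (use mult_carrier_mat[OF g.sQ_props(1)[of d, OF d1] g.L_carrier(1)] in simp)
    have skL: "transpose_mat (pm (g.sQ d) * L) = - (pm (g.sQ d) * L)" unfolding Lf by (rule g.sQ_skew[OF d(4,5)])
    have Rc: "?R \<in> carrier_mat r r" by (rule pencil_carrier[OF c(1,2) nE])
    have bc: "pm ?bB \<in> carrier_mat (m * n) r" "pm ?Bb \<in> carrier_mat r (m * n)" using g.bB_carrier by auto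
    have Bb: "pm ?Bb = transpose_mat (pm ?bB)"
      unfolding pm_transpose[symmetric] transpose_mult[OF g.b_carrier tB] by simp
    show "pm (?QQ \<epsilon> Q) * LL = ?bf \<epsilon> Q" unfolding sQ LLf unfolding Lf by (rule g.block_form[of d, OF d1])
    have tR: "transpose_mat ?R = - ?R" using skR unfolding skew_symmetric_def .
    show "skew_symmetric (?bf \<epsilon> Q)" unfolding sQ Bb by (rule skew_four_block[OF Qc bc(1) Rc skL tR])
    have dR: "det (rm ?R) \<noteq> 0" by (rule det_pencil(2)[OF c(1,2) nE])
    show "transfer_function (m * n) (?bf \<epsilon> Q) = rm (pm (\<epsilon> (m - \<alpha>) \<cdot>\<^sub>m Q) * L) + rm (pm ?bB) * minv (rm ?R) * rm (pm ?Bb)"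
      unfolding sQ by (rule transfer_function_four_block[OF Qc bc Rc dR])
    show "skew_symmetric (rm (pm (\<epsilon> (m - \<alpha>) \<cdot>\<^sub>m Q) * L) + rm (pm ?bB) * minv (rm ?R) * rm (pm ?Bb))"
    proof -
      have rR: "rm ?R \<in> carrier_mat r r" using Rc by simp
      note mi = minv_props[OF rR dR]
      let ?M = "minv (rm ?R)" and ?b = "rm (pm ?bB)"
      have tM: "transpose_mat ?M = - ?M"
        unfolding minv_transpose[OF rR dR, symmetric] minv_uminus[OF rR dR, symmetric] rm_transpose[symmetric] tR rm_uminus ..
      have bcc: "?b \<in> carrier_mat (m * n) r" "transpose_mat ?b \<in> carrier_mat r (m * n)" using bc by auto
      have e: "rm (pm ?Bb) = transpose_mat ?b" unfolding Bb rm_transpose ..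
      have bM: "?b * ?M \<in> carrier_mat (m * n) r" by (rule mult_carrier_mat[OF bcc(1) mi(1)])
      have bMb: "?b * ?M * transpose_mat ?b \<in> carrier_mat (m * n) (m * n)" by (rule mult_carrier_mat[OF bM bcc(2)])
      have t: "transpose_mat (?b * ?M * transpose_mat ?b) = - (?b * ?M * transpose_mat ?b)"
      proof -
        have 1: "transpose_mat (?b * ?M * transpose_mat ?b) = ?b * (transpose_mat ?M * transpose_mat ?b)"
          unfolding transpose_mult[OF bM bcc(2)] transpose_mult[OF bcc(1) mi(1)] transpose_transpose ..
        have 2: "- ?M * transpose_mat ?b = - (?M * transpose_mat ?b)"
          by (rule uminus_mult_left_mat) (simp only: carrier_matD[OF mi(1)] carrier_matD[OF bcc(2)])
        have Mb: "?M * transpose_mat ?b \<in> carrier_mat r (m * n)" by (rule mult_carrier_mat[OF mi(1) bcc(2)])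
        have 3: "?b * - (?M * transpose_mat ?b) = - (?b * (?M * transpose_mat ?b))"
          by (rule uminus_mult_right_mat) (simp only: carrier_matD[OF bcc(1)] carrier_matD[OF Mb])
        show ?thesis using 1 unfolding tM 2 3 assoc_mult_mat[OF bcc(1) mi(1) bcc(2), symmetric] .
      qed
      have rQ: "rm (pm (g.sQ d) * L) \<in> carrier_mat (m * n) (m * n)" using Qc by simp
      have tQ: "transpose_mat (rm (pm (g.sQ d) * L)) = - rm (pm (g.sQ d) * L)"
        unfolding rm_transpose[symmetric] skL rm_uminus ..
      show ?thesis
        unfolding skew_symmetric_def sQ e transpose_add[OF rQ bMb] t tQ
        using carrier_matD[OF rQ] carrier_matD[OF bMb] by (intro eq_matI) (simp_all del: index_mult_mat)
    qed
    show "(\<not> nonsingular (A m) \<longrightarrow> pz = 0) \<and> (\<not> nonsingular (A 0) \<longrightarrow> 0 \<notin> set tw) \<and> (\<not> nonsingular (A m) \<longrightarrow> - int m \<notin> set tz) \<longrightarrow>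
      rosenbrock_strong_linearization n m r S G (?bf \<epsilon> Q)"
    proof
      assume cond: "(\<not> nonsingular (A m) \<longrightarrow> pz = 0) \<and> (\<not> nonsingular (A 0) \<longrightarrow> 0 \<notin> set tw) \<and> (\<not> nonsingular (A m) \<longrightarrow> - int m \<notin> set tz)"
      have "pz = 0 \<and> 0 \<notin> set tzn" if "det (A m) = 0"
        using cond that unfolding tzn nonsingular_def by force
      moreover have "0 \<notin> set twn" if "det (A 0) = 0"
        using cond that unfolding twn nonsingular_def by force
      ultimately show "rosenbrock_strong_linearization n m r S G (?bf \<epsilon> Q)"
        unfolding sQ S P unfolding Lf by (intro g.rosenbrock[of d, OF d1 _ _ real[unfolded P] minimal skE])
    qed
  qed
  have uniqueX: "?QQ \<epsilon>' Q' = ?QQ \<epsilon> Q" if qs: "?qs \<epsilon> Q" "?qs \<epsilon>' Q'" and pmQ: "Q' = Q \<or> Q' = - Q" for \<epsilon> Q \<epsilon>' Q'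
  proof -
    let ?p = "wpos m g.\<alpha>"
    have ix: "?p * n < m * n" using am(4) n by simp
    have ent: "Q $$ (?p * n, ?p * n) = \<epsilon> (m - \<alpha>) \<and> dim_row Q = m * n \<and> dim_col Q = m * n" if q: "?qs \<epsilon> Q" for \<epsilon> Q
    proof -
      obtain d where d: "Q = sgnm n m d" "d ?p = \<epsilon> (m - \<alpha>)" using signs[OF q] by blast
      show ?thesis unfolding d(1) d(2)[symmetric] using ix n by (simp add: sgnm_def)
    qed
    note e = ent[OF qs(1)] ent[OF qs(2)]
    from pmQ have "\<epsilon>' (m - \<alpha>) \<cdot>\<^sub>m Q' = \<epsilon> (m - \<alpha>) \<cdot>\<^sub>m Q"
    proof
      assume "Q' = Q" thus ?thesis using e by simp
    next
      assume Q': "Q' = - Q"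
      have "\<epsilon>' (m - \<alpha>) = - \<epsilon> (m - \<alpha>)" using e ix unfolding Q' by simp
      thus ?thesis unfolding Q' by (intro eq_matI) auto
    qed
    thus ?thesis by simp
  qed
  have exX: "\<exists>!X. (\<exists>\<epsilon> Q. ?qs \<epsilon> Q \<and> X = ?QQ \<epsilon> Q \<and> pm X * LL = ?bf \<epsilon> Q) \<and> skew_symmetric (pm X * LL)"
    if un: "\<forall>\<epsilon> Q \<epsilon>' Q'. ?qs \<epsilon> Q \<and> ?qs \<epsilon>' Q' \<longrightarrow> Q' = Q \<or> Q' = - Q"
  proof -
    obtain \<epsilon> Q where qs: "?qs \<epsilon> Q" using ex by blast
    show ?thesis
    proof (rule ex1I[of _ "?QQ \<epsilon> Q"], rule conjI)
      show "\<exists>\<epsilon>' Q'. ?qs \<epsilon>' Q' \<and> ?QQ \<epsilon> Q = ?QQ \<epsilon>' Q' \<and> pm (?QQ \<epsilon> Q) * LL = ?bf \<epsilon>' Q'"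
        by (rule exI[of _ \<epsilon>], rule exI[of _ Q]) (intro conjI conjunct1[OF qs] conjunct2[OF qs] refl block(1)[OF qs])
      show "skew_symmetric (pm (?QQ \<epsilon> Q) * LL)" unfolding block(1)[OF qs] by (rule block(2)[OF qs])
    next
      fix X assume "(\<exists>\<epsilon> Q. ?qs \<epsilon> Q \<and> X = ?QQ \<epsilon> Q \<and> pm X * LL = ?bf \<epsilon> Q) \<and> skew_symmetric (pm X * LL)"
      then obtain \<epsilon>' Q' where q': "?qs \<epsilon>' Q'" "X = ?QQ \<epsilon>' Q'" by blast
      have "Q' = Q \<or> Q' = - Q" using un qs q'(1) by blast
      thus "X = ?QQ \<epsilon> Q" unfolding q'(2) by (rule uniqueX[OF qs q'(1)])
    qed
  qed
  show ?thesis
    unfolding Let_def bk ck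
  proof (intro conjI impI allI)
    show "\<exists>\<epsilon> Q. ?qs \<epsilon> Q" by (rule ex)
  next
    fix \<epsilon> Q \<epsilon>' Q' assume "A 0 \<noteq> 0\<^sub>m n n \<or> 0 \<notin> set tw" "?qs \<epsilon> Q \<and> ?qs \<epsilon>' Q'"
    thus "Q' = Q \<or> Q' = - Q" using unique by blast
  next
    assume "\<forall>\<epsilon> Q \<epsilon>' Q'. ?qs \<epsilon> Q \<and> ?qs \<epsilon>' Q' \<longrightarrow> Q' = Q \<or> Q' = - Q"
    thus "\<exists>!X. (\<exists>\<epsilon> Q. ?qs \<epsilon> Q \<and> X = ?QQ \<epsilon> Q \<and> pm X * LL = ?bf \<epsilon> Q) \<and> skew_symmetric (pm X * LL)" by (rule exX)
  next
    fix \<epsilon> Q assume qs: "?qs \<epsilon> Q"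
    note B = block[OF qs]
    show "pm (?QQ \<epsilon> Q) * LL = ?bf \<epsilon> Q" by (rule B(1))
    show "skew_symmetric (pm (?QQ \<epsilon> Q) * LL)" unfolding B(1) by (rule B(2))
    show "transfer_function (m * n) (pm (?QQ \<epsilon> Q) * LL) = rm (pm (\<epsilon> (m - \<alpha>) \<cdot>\<^sub>m Q) * L) + rm (pm ?bB) * minv (rm ?R) * rm (pm ?Bb)"
      unfolding B(1) by (rule B(3))
    show "skew_symmetric (transfer_function (m * n) (pm (?QQ \<epsilon> Q) * LL))" unfolding B(1) B(3) by (rule B(4))
    assume "(\<not> nonsingular (A m) \<longrightarrow> pz = 0) \<and> (\<not> nonsingular (A 0) \<longrightarrow> 0 \<notin> set tw) \<and> (\<not> nonsingular (A m) \<longrightarrow> - int m \<notin> set tz)"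
    thus "rosenbrock_strong_linearization n m r S G (pm (?QQ \<epsilon> Q) * LL)" unfolding B(1) using B(5) by blast
  qed
qed

end
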